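(* Let $\omega$ be a non-quasianalytic weight function. Then the multiplication operator $M\colon\mathcal{O}_{M,\omega}(\mathbb{R}^N)\times\mathcal{O}'_{M,\omega}(\mathbb{R}^N)\to\mathcal{O}'_{M,\omega}(\mathbb{R}^N)$, $(f,T)\mapsto fT$, is separately continuous and hence a hypocontinuous bilinear mapping.
   Context: Weights. A non-quasianalytic weight function is a continuous increasing function $\omega:[0,\infty)\to[0,\infty)$ such that: ($\alpha$) there is $K\ge 1$ with $\omega(2t)\le K(1+\omega(t))$ for all $t\ge 0$; ($\beta$) $\int_1^\infty \frac{\omega(t)}{1+t^2}\,dt<\infty$; ($\gamma$) there are $a\in\mathbb{R}$, $b>0$ with $\omega(t)\ge a+b\log(1+t)$ for all $t\ge 0$; ($\delta$) $\varphi_\omega(t)=\omega(e^t)$ is convex. It is assumed (normalization) that $\omega$ vanishes on $[0,1]$. For $x\in\mathbb{R}^N$, $\omega(x):=\omega(|x|)$. The Young conjugate is $\varphi^*_\omega(s):=\sup_{t\ge 0}\{st-\varphi_\omega(t)\}$, $s\ge 0$ (the value $+\infty$ is allowed, with $\exp(-\infty)=0$). Spaces. For $m,n\in\mathbb{N}$ let $\mathcal{O}^m_{n,\omega}(\mathbb{R}^N)$ be the space of all $f\in C^\infty(\mathbb{R}^N)$ with $r_{m,n}(f):=\sup_{\alpha\in\mathbb{N}_0^N}\sup_{x\in\mathbb{R}^N}|\partial^\alpha f(x)|\exp\left(-n\omega(x)-m\varphi^*_\omega\left(\frac{|\alpha|}{m}\right)\right)<\infty$, with norm $r_{m,n}$.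 Set $\mathcal{O}_{M,\omega}(\mathbb{R}^N):=\bigcap_{m}\bigcup_{n}\mathcal{O}^m_{n,\omega}(\mathbb{R}^N)$ with the topology of the projective limit over $m$ of the locally convex inductive limits $\mathrm{ind}_{n}\,\mathcal{O}^m_{n,\omega}(\mathbb{R}^N)$. $\mathcal{O}'_{M,\omega}(\mathbb{R}^N)$ is its strong dual. For $f\in\mathcal{O}_{M,\omega}(\mathbb{R}^N)$ and $T\in\mathcal{O}'_{M,\omega}(\mathbb{R}^N)$, $fT$ is defined by $\langle fT,g\rangle:=\langle T,fg\rangle$, $g\in\mathcal{O}_{M,\omega}(\mathbb{R}^N)$ (the space $\mathcal{O}_{M,\omega}(\mathbb{R}^N)$ is closed under pointwise multiplication). Hypocontinuity. A bilinear map $b\colon E\times F\to G$ between topological vector spaces is hypocontinuous if for every bounded $A\subset E$ the set $\{b(x,\cdot):x\in A\}$ is equicontinuous in $\mathcal{L}(F,G)$, and for every bounded $B\subset F$ the set $\{b(\cdot,y):y\in B\}$ is equicontinuous in $\mathcal{L}(E,G)$. *)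

theory Defs
  imports "HOL-Analysis.Analysis" "HOL-Library.Function_Algebras"
begin

section \<open>Locally convex spaces of complex-valued functions\<close>

text \<open>
  Every space below is a complex vector space of functions \<open>'a \<Rightarrow> complex\<close> with pointwise
  operations; this covers both spaces of functions on \<open>\<real>\<^sup>N\<close> and spaces of linear functionals.
  A topological vector space is given by a topology whose \<^const>\<open>topspace\<close> is the carrier.
\<close>

definition fscale :: "complex \<Rightarrow> ('a \<Rightarrow> complex) \<Rightarrow> 'a \<Rightarrow> complex"
  where "fscale c f = (\<lambda>x. c * f x)"

interpretation fun_space: vector_space "fscale :: complex \<Rightarrow> ('a \<Rightarrow> complex) \<Rightarrow> 'a \<Rightarrow> complex"
  by unfold_locales (auto simp: fscale_def algebra_simps fun_eq_iff)

definition tvs :: "('a \<Rightarrow> complex) topology \<Rightarrow> bool"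
  where "tvs X \<longleftrightarrow>
    fun_space.subspace (topspace X) \<and>
    continuous_map (prod_topology X X) X (\<lambda>(f, g). f + g) \<and>
    continuous_map (prod_topology euclidean X) X (\<lambda>(c, f). fscale c f)"

definition convex_funs :: "('a \<Rightarrow> complex) set \<Rightarrow> bool"
  where "convex_funs W \<longleftrightarrow>
    (\<forall>f\<in>W. \<forall>g\<in>W. \<forall>t\<in>{0..1::real}. fscale (of_real (1 - t)) f + fscale (of_real t) g \<in> W)"

definition locally_convex :: "('a \<Rightarrow> complex) topology \<Rightarrow> bool"
  where "locally_convex X \<longleftrightarrow> tvs X \<and>
    (\<forall>U. openin X U \<and> 0 \<in> U \<longrightarrow> (\<exists>W. openin X W \<and> 0 \<in> W \<and> convex_funs W \<and> W \<subseteq> U))"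

definition bounded_in :: "('a \<Rightarrow> complex) topology \<Rightarrow> ('a \<Rightarrow> complex) set \<Rightarrow> bool"
  where "bounded_in X B \<longleftrightarrow> B \<subseteq> topspace X \<and>
    (\<forall>U. openin X U \<and> 0 \<in> U \<longrightarrow> (\<exists>s>0. \<forall>t>s. B \<subseteq> fscale (of_real t) ` U))"

text \<open>
  The translation-invariant topology on \<open>E\<close> for which the traces on \<open>E\<close> of the members of \<open>N\<close>
  form a base of neighbourhoods of \<open>0\<close>.
\<close>

definition translation_topology ::
    "('a \<Rightarrow> complex) set \<Rightarrow> ('a \<Rightarrow> complex) set set \<Rightarrow> ('a \<Rightarrow> complex) topology"
  where "translation_topology E N =
    topology (\<lambda>U. U \<subseteq> E \<and> (\<forall>f\<in>U. \<exists>W\<in>N. {g \<in> E. g - f \<in> W} \<subseteq> U))"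

lemma openin_translation_topology:
  assumes "N \<noteq> {}" and "\<And>V W. V \<in> N \<Longrightarrow> W \<in> N \<Longrightarrow> \<exists>S\<in>N. S \<subseteq> V \<inter> W"
  shows "openin (translation_topology E N) U \<longleftrightarrow>
    U \<subseteq> E \<and> (\<forall>f\<in>U. \<exists>W\<in>N. {g \<in> E. g - f \<in> W} \<subseteq> U)"
proof -
  have "istopology (\<lambda>U. U \<subseteq> E \<and> (\<forall>f\<in>U. \<exists>W\<in>N. {g \<in> E. g - f \<in> W} \<subseteq> U))"
    unfolding istopology_def
  proof (intro conjI allI impI ballI)
    fix S T f
    assume S: "S \<subseteq> E \<and> (\<forall>f\<in>S. \<exists>W\<in>N. {g \<in> E. g - f \<in> W} \<subseteq> S)"
      and T: "T \<subseteq> E \<and> (\<forall>f\<in>T. \<exists>W\<in>N. {g \<in> E. g - f \<in> W} \<subseteq> T)" and f: "f \<in> S \<inter> T"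
    from S f obtain V where V: "V \<in> N" "{g \<in> E. g - f \<in> V} \<subseteq> S" by (meson IntD1)
    from T f obtain W where W: "W \<in> N" "{g \<in> E. g - f \<in> W} \<subseteq> T" by (meson IntD2)
    from assms(2)[OF V(1) W(1)] obtain R where R: "R \<in> N" "R \<subseteq> V \<inter> W" ..
    have "{g \<in> E. g - f \<in> R} \<subseteq> S \<inter> T" using V(2) W(2) R(2) by fast
    with R(1) show "\<exists>W\<in>N. {g \<in> E. g - f \<in> W} \<subseteq> S \<inter> T" ..
  next
    fix \<K> f
    assume K: "\<forall>K\<in>\<K>. K \<subseteq> E \<and> (\<forall>f\<in>K. \<exists>W\<in>N. {g \<in> E. g - f \<in> W} \<subseteq> K)"
      and "f \<in> \<Union>\<K>"
    then obtain K where K': "K \<in> \<K>" "f \<in> K" by blast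
    with K obtain W where W: "W \<in> N" "{g \<in> E. g - f \<in> W} \<subseteq> K" by meson
    from W(2) K'(1) have "{g \<in> E. g - f \<in> W} \<subseteq> \<Union>\<K>" by (meson Union_upper subset_trans)
    with W(1) show "\<exists>W\<in>N. {g \<in> E. g - f \<in> W} \<subseteq> \<Union>\<K>" ..
  qed (fast, fast)
  then show ?thesis
    by (simp add: translation_topology_def topology_inverse')
qed

text \<open>The finest locally convex topology on the union making all inclusions continuous.\<close>

definition lc_inductive_limit ::
    "'i set \<Rightarrow> ('i \<Rightarrow> ('a \<Rightarrow> complex) topology) \<Rightarrow> ('a \<Rightarrow> complex) topology"
  where "lc_inductive_limit I E = topology_generated_by
    {U. \<exists>X. locally_convex X \<and> topspace X = (\<Union>i\<in>I. topspace (E i)) \<and>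
            (\<forall>i\<in>I. continuous_map (E i) X id) \<and> openin X U}"

text \<open>The coarsest topology on the intersection making all inclusions continuous.\<close>

definition projective_limit ::
    "'i set \<Rightarrow> ('i \<Rightarrow> ('a \<Rightarrow> complex) topology) \<Rightarrow> ('a \<Rightarrow> complex) topology"
  where "projective_limit I E = topology_generated_by
    {(\<Inter>j\<in>I. topspace (E j)) \<inter> U | i U. i \<in> I \<and> openin (E i) U}"

text \<open>
  Functionals are total functions in HOL; those in the dual are made unique by being \<open>0\<close>
  outside the carrier, so that pointwise operations agree with those of the dual.
\<close>

definition dual_space :: "('a \<Rightarrow> complex) topology \<Rightarrow> (('a \<Rightarrow> complex) \<Rightarrow> complex) set"
  where "dual_space X = {T.
    (\<forall>f. f \<notin> topspace X \<longrightarrow> T f = 0) \<and>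
    (\<forall>f\<in>topspace X. \<forall>g\<in>topspace X. T (f + g) = T f + T g) \<and>
    (\<forall>c. \<forall>f\<in>topspace X. T (fscale c f) = c * T f) \<and>
    continuous_map X euclidean T}"

definition strong_dual :: "('a \<Rightarrow> complex) topology \<Rightarrow> (('a \<Rightarrow> complex) \<Rightarrow> complex) topology"
  where "strong_dual X = translation_topology (dual_space X)
    {{T. \<forall>f\<in>B. cmod (T f) \<le> e} | B e. bounded_in X B \<and> e > 0}"

lemma bounded_in_empty: "bounded_in X {}"
  by (auto simp: bounded_in_def intro: exI[of _ 1])

lemma bounded_in_Un:
  assumes "bounded_in X A" and "bounded_in X B"
  shows "bounded_in X (A \<union> B)"
  unfolding bounded_in_def
proof (intro conjI allI impI)
  show "A \<union> B \<subseteq> topspace X" using assms by (auto simp: bounded_in_def)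
  fix U assume U: "openin X U \<and> 0 \<in> U"
  obtain r :: real where r: "r > 0" "\<And>t. t > r \<Longrightarrow> A \<subseteq> fscale (of_real t) ` U"
    using assms(1) U unfolding bounded_in_def by meson
  obtain s :: real where s: "s > 0" "\<And>t. t > s \<Longrightarrow> B \<subseteq> fscale (of_real t) ` U"
    using assms(2) U unfolding bounded_in_def by meson
  show "\<exists>s>0. \<forall>t>s. A \<union> B \<subseteq> fscale (of_real t) ` U"
  proof (intro exI[of _ "max r s"] conjI allI impI Un_least)
    show "0 < max r s" using r(1) by simp
  qed (use r(2) s(2) in auto)
qed

lemma openin_strong_dual:
  "openin (strong_dual X) U \<longleftrightarrow> U \<subseteq> dual_space X \<and>
    (\<forall>T\<in>U. \<exists>B e. bounded_in X B \<and> e > 0 \<and>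
       {S \<in> dual_space X. \<forall>f\<in>B. cmod (S f - T f) \<le> e} \<subseteq> U)"
proof -
  let ?N = "{{T. \<forall>f\<in>B. cmod (T f) \<le> e} | B e. bounded_in X B \<and> e > 0}"
  have ne: "?N \<noteq> {}" using bounded_in_empty[of X] zero_less_one by blast
  have dir: "\<exists>S\<in>?N. S \<subseteq> V \<inter> W" if "V \<in> ?N" "W \<in> ?N" for V W
  proof -
    obtain A d where V: "V = {T. \<forall>f\<in>A. cmod (T f) \<le> d}" "bounded_in X A" "d > 0"
      using \<open>V \<in> ?N\<close> by blast
    obtain B e where W: "W = {T. \<forall>f\<in>B. cmod (T f) \<le> e}" "bounded_in X B" "e > 0"
      using \<open>W \<in> ?N\<close> by blast
    have "bounded_in X (A \<union> B)" "min d e > 0" using V W bounded_in_Un by auto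
    then have "{T. \<forall>f\<in>A \<union> B. cmod (T f) \<le> min d e} \<in> ?N" by blast
    moreover have "{T. \<forall>f\<in>A \<union> B. cmod (T f) \<le> min d e} \<subseteq> V \<inter> W" using V W by auto
    ultimately show ?thesis by blast
  qed
  have "openin (strong_dual X) U \<longleftrightarrow> U \<subseteq> dual_space X \<and>
      (\<forall>T\<in>U. \<exists>W\<in>?N. {S \<in> dual_space X. S - T \<in> W} \<subseteq> U)"
    unfolding strong_dual_def by (rule openin_translation_topology[OF ne dir])
  moreover have "(\<exists>W\<in>?N. {S \<in> dual_space X. S - T \<in> W} \<subseteq> U) \<longleftrightarrow>
      (\<exists>B e. bounded_in X B \<and> e > 0 \<and>
         {S \<in> dual_space X. \<forall>f\<in>B. cmod (S f - T f) \<le> e} \<subseteq> U)" for T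
    unfolding Bex_def mem_Collect_eq fun_diff_def by blast
  ultimately show ?thesis by simp
qed

section \<open>Bilinear maps and hypocontinuity\<close>

definition continuous_linear_maps ::
    "('a \<Rightarrow> complex) topology \<Rightarrow> ('b \<Rightarrow> complex) topology \<Rightarrow> (('a \<Rightarrow> complex) \<Rightarrow> 'b \<Rightarrow> complex) set"
  where "continuous_linear_maps X Y = {h. continuous_map X Y h \<and>
    (\<forall>f\<in>topspace X. \<forall>g\<in>topspace X. h (f + g) = h f + h g) \<and>
    (\<forall>c. \<forall>f\<in>topspace X. h (fscale c f) = fscale c (h f))}"

definition equicontinuous_in ::
    "('a \<Rightarrow> complex) topology \<Rightarrow> ('b \<Rightarrow> complex) topology \<Rightarrow> (('a \<Rightarrow> complex) \<Rightarrow> 'b \<Rightarrow> complex) set \<Rightarrow> bool"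
  where "equicontinuous_in X Y H \<longleftrightarrow> H \<subseteq> continuous_linear_maps X Y \<and>
    (\<forall>f\<in>topspace X. \<forall>V. openin Y V \<and> 0 \<in> V \<longrightarrow>
      (\<exists>U. openin X U \<and> f \<in> U \<and> (\<forall>h\<in>H. \<forall>g\<in>U. h g - h f \<in> V)))"

definition bilinear_map ::
    "('a \<Rightarrow> complex) topology \<Rightarrow> ('b \<Rightarrow> complex) topology \<Rightarrow> ('c \<Rightarrow> complex) topology \<Rightarrow>
     (('a \<Rightarrow> complex) \<Rightarrow> ('b \<Rightarrow> complex) \<Rightarrow> 'c \<Rightarrow> complex) \<Rightarrow> bool"
  where "bilinear_map X Y Z b \<longleftrightarrow>
    (\<forall>x\<in>topspace X. \<forall>y\<in>topspace Y. b x y \<in> topspace Z) \<and>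
    (\<forall>x\<in>topspace X. \<forall>x'\<in>topspace X. \<forall>y\<in>topspace Y. b (x + x') y = b x y + b x' y) \<and>
    (\<forall>x\<in>topspace X. \<forall>y\<in>topspace Y. \<forall>y'\<in>topspace Y. b x (y + y') = b x y + b x y') \<and>
    (\<forall>c. \<forall>x\<in>topspace X. \<forall>y\<in>topspace Y.
       b (fscale c x) y = fscale c (b x y) \<and> b x (fscale c y) = fscale c (b x y))"

definition separately_continuous ::
    "('a \<Rightarrow> complex) topology \<Rightarrow> ('b \<Rightarrow> complex) topology \<Rightarrow> ('c \<Rightarrow> complex) topology \<Rightarrow>
     (('a \<Rightarrow> complex) \<Rightarrow> ('b \<Rightarrow> complex) \<Rightarrow> 'c \<Rightarrow> complex) \<Rightarrow> bool"
  where "separately_continuous X Y Z b \<longleftrightarrow>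
    (\<forall>x\<in>topspace X. continuous_map Y Z (\<lambda>y. b x y)) \<and>
    (\<forall>y\<in>topspace Y. continuous_map X Z (\<lambda>x. b x y))"

definition hypocontinuous ::
    "('a \<Rightarrow> complex) topology \<Rightarrow> ('b \<Rightarrow> complex) topology \<Rightarrow> ('c \<Rightarrow> complex) topology \<Rightarrow>
     (('a \<Rightarrow> complex) \<Rightarrow> ('b \<Rightarrow> complex) \<Rightarrow> 'c \<Rightarrow> complex) \<Rightarrow> bool"
  where "hypocontinuous X Y Z b \<longleftrightarrow>
    (\<forall>A. bounded_in X A \<longrightarrow> equicontinuous_in Y Z {(\<lambda>y. b x y) | x. x \<in> A}) \<and>
    (\<forall>B. bounded_in Y B \<longrightarrow> equicontinuous_in X Z {(\<lambda>x. b x y) | y. y \<in> B})"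

section \<open>Smooth functions and partial derivatives\<close>

definition partial_deriv :: "'n::finite \<Rightarrow> (real^'n \<Rightarrow> complex) \<Rightarrow> real^'n \<Rightarrow> complex"
  where "partial_deriv i f = (\<lambda>x. vector_derivative (\<lambda>t. f (x + t *\<^sub>R axis i 1)) (at 0))"

definition smooth :: "(real^'n::finite \<Rightarrow> complex) \<Rightarrow> bool"
  where "smooth f \<longleftrightarrow> (\<forall>is. let g = foldr partial_deriv is f in
    continuous_on UNIV g \<and> (\<forall>i x. (\<lambda>t. g (x + t *\<^sub>R axis i 1)) differentiable (at (0::real))))"

text \<open>
  An arbitrary enumeration of the coordinates, fixing the order of differentiation in
  \<open>\<partial>\<^sup>\<alpha>\<close>; for smooth functions the order is irrelevant.
\<close>

definition coordinates :: "'n::finite list"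
  where "coordinates = (SOME xs. distinct xs \<and> set xs = UNIV)"

definition multi_deriv :: "('n::finite \<Rightarrow> nat) \<Rightarrow> (real^'n \<Rightarrow> complex) \<Rightarrow> real^'n \<Rightarrow> complex"
  where "multi_deriv \<alpha> f = foldr (\<lambda>i. partial_deriv i ^^ \<alpha> i) coordinates f"

section \<open>Weight functions\<close>

definition nonquasianalytic_weight :: "(real \<Rightarrow> real) \<Rightarrow> bool"
  where "nonquasianalytic_weight \<omega> \<longleftrightarrow>
    continuous_on {0..} \<omega> \<and> mono_on {0..} \<omega> \<and> (\<forall>t\<ge>0. \<omega> t \<ge> 0) \<and>
    (\<exists>K\<ge>1. \<forall>t\<ge>0. \<omega> (2 * t) \<le> K * (1 + \<omega> t)) \<and>
    set_integrable lborel {1..} (\<lambda>t. \<omega> t / (1 + t\<^sup>2)) \<and>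
    (\<exists>a b. b > 0 \<and> (\<forall>t\<ge>0. \<omega> t \<ge> a + b * ln (1 + t))) \<and>
    convex_on UNIV (\<lambda>t. \<omega> (exp t)) \<and>
    (\<forall>t\<in>{0..1}. \<omega> t = 0)"

definition young_conjugate :: "(real \<Rightarrow> real) \<Rightarrow> real \<Rightarrow> ereal"
  where "young_conjugate \<omega> s = (SUP t\<in>{0..}. ereal (s * t - \<omega> (exp t)))"

definition exp_ereal :: "ereal \<Rightarrow> ereal"
  where "exp_ereal u = (if u = -\<infinity> then 0 else if u = \<infinity> then \<infinity> else ereal (exp (real_of_ereal u)))"

section \<open>The spaces of multipliers\<close>

definition seminorm_r :: "(real \<Rightarrow> real) \<Rightarrow> nat \<Rightarrow> nat \<Rightarrow> (real^'n::finite \<Rightarrow> complex) \<Rightarrow> ereal"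
  where "seminorm_r \<omega> m n f = (SUP \<alpha>. SUP x.
    ereal (cmod (multi_deriv \<alpha> f x)) *
    exp_ereal (- ereal (real n * \<omega> (norm x))
               - ereal (real m) * young_conjugate \<omega> (real (\<Sum>i\<in>UNIV. \<alpha> i) / real m)))"

definition O_step :: "(real \<Rightarrow> real) \<Rightarrow> nat \<Rightarrow> nat \<Rightarrow> (real^'n::finite \<Rightarrow> complex) topology"
  where "O_step \<omega> m n = translation_topology
    {f. smooth f \<and> seminorm_r \<omega> m n f < \<infinity>} {{f. seminorm_r \<omega> m n f < ereal e} | e. e > 0}"

definition O_M :: "(real \<Rightarrow> real) \<Rightarrow> (real^'n::finite \<Rightarrow> complex) topology"
  where "O_M \<omega> = projective_limit {1..} (\<lambda>m. lc_inductive_limit {1..} (\<lambda>n. O_step \<omega> m n))"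

definition O_M_dual :: "(real \<Rightarrow> real) \<Rightarrow> ((real^'n::finite \<Rightarrow> complex) \<Rightarrow> complex) topology"
  where "O_M_dual \<omega> = strong_dual (O_M \<omega>)"

text \<open>In \<open>f * g\<close> the product is the pointwise one.\<close>

definition multiplication :: "(real \<Rightarrow> real) \<Rightarrow> (real^'n::finite \<Rightarrow> complex) \<Rightarrow>
    ((real^'n \<Rightarrow> complex) \<Rightarrow> complex) \<Rightarrow> (real^'n \<Rightarrow> complex) \<Rightarrow> complex"
  where "multiplication \<omega> f T = (\<lambda>g. if g \<in> topspace (O_M \<omega>) then T (f * g) else 0)"

end

theory Submission
  imports Defs "HOL-Probability.Characteristic_Functions" "HOL-Probability.Sinc_Integral"
begin

text \<open>
  Let \<open>E\<close> be the multiplier space and \<open>E'\<close> its strong dual. The product \<open>E \<times> E \<rightarrow> E\<close> is hypocontinuous, and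
  transposing it yields equicontinuity of \<open>T \<mapsto> f T\<close> for \<open>f\<close> in a bounded set. For \<open>f \<mapsto> f T\<close> with \<open>T\<close> in a
  bounded set \<open>B\<close> it suffices that bounded subsets of \<open>E'\<close> are equicontinuous. To see this, test \<open>B\<close> on
  the Gaussian atoms \<open>t \<mapsto> e\<^sup>i\<^sup>\<xi>\<^sup>t exp (- |t - x|\<^sup>2 / 2)\<close>. First, \<open>T(atom(x, \<xi>))\<close> is at most
  \<open>C exp (m\<^sub>0 \<omega>(\<xi>))\<close>, since otherwise suitable multiples of atoms would form a bounded set on which \<open>B\<close> is
  unbounded. Then, with \<open>m\<^sub>0\<close> fixed and any \<open>n\<close>, it is at most \<open>C\<^sub>n exp (m\<^sub>0 \<omega>(\<xi>) - n \<omega>(x))\<close>, up to enlarging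
  \<open>m\<^sub>0\<close> once: where \<open>\<omega>(\<xi>) \<le> n \<omega>(x)\<close> the multiples \<open>exp (n \<omega>(x)) atom(x, \<xi>)\<close> form a bounded set, and elsewhere
  the first bound suffices. Since \<open>f\<close> is an integral of atoms weighted by its short-time Fourier
  transform \<open>V f\<close>, the seminorm \<open>f \<mapsto> sup {|\<integral> V f \<cdot> T(atom)| : T \<in> B}\<close> is continuous on \<open>E\<close> and dominates \<open>B\<close>.
\<close>

section \<open>Seminorms\<close>

text \<open>The delicate point is the inductive limit over n: a bounded subset of it is not assumed
  to lie in a single step, so boundedness is exploited only by testing against continuous seminorms.
  Every continuity question is therefore reduced to one description: q is continuous at level m if
  for every n there is a C with \<open>q f \<le> C * A\<close> whenever
  \<open>bound m n A f\<close>. The order of quantifiers matters: m is chosen once, for a functional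
  or for a whole bounded set of functionals, and n comes afterwards. This is why the atoms must be
  estimated with one fixed \<open>m0\<close> and arbitrary n. The Gaussian window suits every
  weight: condition (\<beta>) gives \<omega>(t) = O(1 + t), so its derivatives meet all the bounds
  of the space and its decay beats every exp (n \<omega>). The Leibniz factor 2^k and the lack of
  subadditivity of \<omega> are both paid for by condition (\<alpha>), which multiplies an index by
  \<open>doubling\<close>; this loss is harmless because all indices m and n are available. Separate
  continuity comes out as the special case of one-point bounded sets.\<close>

definition seminorm_on :: "('a \<Rightarrow> complex) set \<Rightarrow> (('a \<Rightarrow> complex) \<Rightarrow> real) \<Rightarrow> bool"
  where "seminorm_on F q \<longleftrightarrow> (\<forall>f\<in>F. 0 \<le> q f) \<and>
    (\<forall>f\<in>F. \<forall>g\<in>F. q (f + g) \<le> q f + q g) \<and> (\<forall>c. \<forall>f\<in>F. q (fscale c f) = cmod c * q f)"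

lemma seminorm_onI:
  assumes "\<And>f g. f \<in> F \<Longrightarrow> g \<in> F \<Longrightarrow> q (f + g) \<le> q f + q g"
    and "\<And>c f. f \<in> F \<Longrightarrow> q (fscale c f) = cmod c * q f"
    and "\<And>f. f \<in> F \<Longrightarrow> 0 \<le> q f"
  shows "seminorm_on F q"
  using assms by (simp add: seminorm_on_def)

lemma seminorm_on_nonneg: "seminorm_on F q \<Longrightarrow> f \<in> F \<Longrightarrow> 0 \<le> q f"
  and seminorm_on_triangle: "seminorm_on F q \<Longrightarrow> f \<in> F \<Longrightarrow> g \<in> F \<Longrightarrow> q (f + g) \<le> q f + q g"
  and seminorm_on_scale: "seminorm_on F q \<Longrightarrow> f \<in> F \<Longrightarrow> q (fscale c f) = cmod c * q f"
  by (simp_all add: seminorm_on_def)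

lemma seminorm_on_mono: "seminorm_on F q \<Longrightarrow> G \<subseteq> F \<Longrightarrow> seminorm_on G q"
  unfolding seminorm_on_def by blast

lemma seminorm_on_zero:
  assumes "seminorm_on F q" "0 \<in> F"
  shows "q 0 = 0"
proof -
  have "q (fscale 0 0) = 0" using seminorm_on_scale[OF assms, of 0] by simp
  moreover have "fscale 0 0 = (0 :: 'a \<Rightarrow> complex)" by (simp add: fscale_def fun_eq_iff)
  ultimately show ?thesis by simp
qed

lemma fscale_minus_one: "fscale (-1) f = - f"
  by (simp add: fscale_def fun_eq_iff)

lemma fscale_inverse_cancel: "c \<noteq> 0 \<Longrightarrow> fscale c (fscale (inverse c) f) = f"
  "c \<noteq> 0 \<Longrightarrow> fscale (inverse c) (fscale c f) = f"
  by (simp_all add: fscale_def fun_eq_iff)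

lemma subspace_rules:
  assumes "fun_space.subspace F"
  shows "0 \<in> F" "f \<in> F \<Longrightarrow> g \<in> F \<Longrightarrow> f + g \<in> F" "f \<in> F \<Longrightarrow> fscale c f \<in> F"
    "f \<in> F \<Longrightarrow> g \<in> F \<Longrightarrow> f - g \<in> F"
  using fun_space.subspace_0[OF assms] fun_space.subspace_add[OF assms]
    fun_space.subspace_scale[OF assms] fun_space.subspace_diff[OF assms] by auto

lemma seminorm_on_diff_triangle:
  assumes "fun_space.subspace F" "seminorm_on F q" "f \<in> F" "g \<in> F" "h \<in> F"
  shows "q (f - h) \<le> q (f - g) + q (g - h)"
  using seminorm_on_triangle[OF assms(2), of "f - g" "g - h"] subspace_rules[OF assms(1)] assms(3-5)
  by simp

section \<open>The topology of a single seminorm\<close>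

definition seminorm_topology ::
    "('a \<Rightarrow> complex) set \<Rightarrow> (('a \<Rightarrow> complex) \<Rightarrow> real) \<Rightarrow> ('a \<Rightarrow> complex) topology"
  where "seminorm_topology F q = translation_topology F {{f. q f < e} | e. e > 0}"

text \<open>The monotone radius map \<open>r\<close> lets one lemma serve two systems of balls: real
  seminorms with \<open>r\<close> the identity, and the extended-real \<open>seminorm_r\<close> with
  \<open>r = ereal\<close>.\<close>

lemma openin_translation_balls:
  fixes q :: "('a \<Rightarrow> complex) \<Rightarrow> 'b::linorder" and r :: "real \<Rightarrow> 'b"
  assumes "\<And>d e. d \<le> e \<Longrightarrow> r d \<le> r e"
  shows "openin (translation_topology F {{f. q f < r e} | e. e > 0}) U \<longleftrightarrow>
    U \<subseteq> F \<and> (\<forall>f\<in>U. \<exists>e>0. {g \<in> F. q (g - f) < r e} \<subseteq> U)"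
proof -
  have dir: "\<exists>S\<in>{{f. q f < r e} | e. e > 0}. S \<subseteq> V \<inter> W"
    if V: "V \<in> {{f. q f < r e} | e. e > 0}" and W: "W \<in> {{f. q f < r e} | e. e > 0}" for V W
  proof -
    obtain d where d: "V = {f. q f < r d}" "d > 0" using V by auto
    obtain e where e: "W = {f. q f < r e}" "e > 0" using W by auto
    note * = d e
    have "{f. q f < r (min d e)} \<subseteq> V \<inter> W"
      using * assms[of "min d e" d] assms[of "min d e" e] by (auto intro: less_le_trans)
    then show ?thesis using *(2,4) by (intro bexI[of _ "{f. q f < r (min d e)}"]) auto
  qed
  have ne: "{{f. q f < r e} | e. e > 0} \<noteq> {}" using zero_less_one by blast
  have "(\<exists>W\<in>{{f. q f < r e} | e. e > 0}. {g \<in> F. g - f \<in> W} \<subseteq> U) \<longleftrightarrow>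
      (\<exists>e>0. {g \<in> F. q (g - f) < r e} \<subseteq> U)" for f
    by (simp only: Bex_def mem_Collect_eq) blast
  then show ?thesis by (subst openin_translation_topology[OF ne dir]) simp_all
qed

lemma openin_seminorm_topology:
  "openin (seminorm_topology F q) U \<longleftrightarrow>
    U \<subseteq> F \<and> (\<forall>f\<in>U. \<exists>e>0. {g \<in> F. q (g - f) < e} \<subseteq> U)"
  unfolding seminorm_topology_def by (rule openin_translation_balls[where r="\<lambda>e. e"])

lemma topspace_seminorm_topology [simp]: "topspace (seminorm_topology F q) = F"
proof
  show "topspace (seminorm_topology F q) \<subseteq> F"
    using openin_topspace[of "seminorm_topology F q"] unfolding openin_seminorm_topology by simp
  have "openin (seminorm_topology F q) F"
    unfolding openin_seminorm_topology by (auto intro: exI[of _ "1::real"])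
  then show "F \<subseteq> topspace (seminorm_topology F q)" by (rule openin_subset)
qed

context
  fixes F :: "('a \<Rightarrow> complex) set" and q
  assumes F: "fun_space.subspace F" and q: "seminorm_on F q"
begin

private lemmas Fr = subspace_rules[OF F]

lemma openin_seminorm_ball:
  assumes "f \<in> F"
  shows "openin (seminorm_topology F q) {g \<in> F. q (g - f) < e}"
  unfolding openin_seminorm_topology
proof (intro conjI ballI)
  fix g assume g: "g \<in> {g \<in> F. q (g - f) < e}"
  have "{h \<in> F. q (h - g) < e - q (g - f)} \<subseteq> {g \<in> F. q (g - f) < e}"
    using seminorm_on_diff_triangle[OF F q _ _ assms] g by fastforce
  then show "\<exists>d>0. {h \<in> F. q (h - g) < d} \<subseteq> {g \<in> F. q (g - f) < e}"
    using g by (intro exI[of _ "e - q (g - f)"]) simp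
qed auto

lemma tvs_seminorm_topology: "tvs (seminorm_topology F q)"
  unfolding tvs_def
proof (intro conjI)
  let ?X = "seminorm_topology F q"
  show "fun_space.subspace (topspace ?X)" using F by simp
  show "continuous_map (prod_topology ?X ?X) ?X (\<lambda>(f, g). f + g)"
    unfolding continuous_map_def
  proof (intro conjI allI impI)
    fix U assume U: "openin ?X U"
    show "openin (prod_topology ?X ?X) {x \<in> topspace (prod_topology ?X ?X). (case x of (f, g) \<Rightarrow> f + g) \<in> U}"
      unfolding openin_prod_topology_alt
    proof (intro allI impI)
      fix f g assume "(f, g) \<in> {x \<in> topspace (prod_topology ?X ?X). (case x of (f, g) \<Rightarrow> f + g) \<in> U}"
      then have fg: "f \<in> F" "g \<in> F" "f + g \<in> U" by auto
      then obtain e where e: "e > 0" "{h \<in> F. q (h - (f + g)) < e} \<subseteq> U"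
        using U unfolding openin_seminorm_topology by blast
      let ?B = "\<lambda>f. {h \<in> F. q (h - f) < e / 2}"
      have "h + k \<in> U" if "h \<in> ?B f" "k \<in> ?B g" for h k
      proof -
        have "q ((h - f) + (k - g)) \<le> q (h - f) + q (k - g)"
          using that fg Fr by (intro seminorm_on_triangle[OF q]) auto
        then have "q (h + k - (f + g)) < e" using that by (simp add: algebra_simps)
        then show ?thesis using e that Fr by blast
      qed
      then have "?B f \<times> ?B g \<subseteq> {x \<in> topspace (prod_topology ?X ?X). (case x of (f, g) \<Rightarrow> f + g) \<in> U}"
        by auto
      moreover have "f \<in> ?B f" "g \<in> ?B g" using fg e seminorm_on_zero[OF q Fr(1)] by simp_all
      ultimately show "\<exists>V W. openin ?X V \<and> openin ?X W \<and> f \<in> V \<and> g \<in> W \<and>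
          V \<times> W \<subseteq> {x \<in> topspace (prod_topology ?X ?X). (case x of (f, g) \<Rightarrow> f + g) \<in> U}"
        using openin_seminorm_ball fg by blast
    qed
  qed (use Fr in auto)
  show "continuous_map (prod_topology euclidean ?X) ?X (\<lambda>(c, f). fscale c f)"
    unfolding continuous_map_def
  proof (intro conjI allI impI)
    fix U assume U: "openin ?X U"
    let ?S = "{x \<in> topspace (prod_topology euclidean ?X). (case x of (c, f) \<Rightarrow> fscale c f) \<in> U}"
    show "openin (prod_topology euclidean ?X) ?S"
      unfolding openin_prod_topology_alt
    proof (intro allI impI)
      fix c f assume "(c, f) \<in> ?S"
      then have f: "f \<in> F" "fscale c f \<in> U" by auto
      then obtain e where e: "e > 0" "{h \<in> F. q (h - fscale c f) < e} \<subseteq> U"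
        using U unfolding openin_seminorm_topology by blast
      have qf: "0 \<le> q f" using seminorm_on_nonneg[OF q f(1)] .
      \<comment> \<open>The difference is split as \<open>d (h - f) + (d - c) f\<close>. The radius
        \<open>r\<close> keeps the second term below \<open>e / 2\<close> (\<open>q f + 1\<close>
        avoids a division by zero) and forces \<open>cmod d \<le> cmod c + 1\<close>; then
        \<open>s\<close> bounds the first term by \<open>e / 2\<close>.\<close>
      define r where "r = min 1 (e / (2 * (q f + 1)))"
      define s where "s = e / (2 * (cmod c + 1))"
      have r: "r > 0" "r \<le> 1" "r * q f < e / 2"
      proof -
        show "r > 0" "r \<le> 1" using e qf by (auto simp: r_def)
        have "r * q f \<le> e / (2 * (q f + 1)) * q f" using qf by (intro mult_right_mono) (auto simp: r_def)
        also have "\<dots> < e / 2" using e qf by (simp add: field_simps)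
        finally show "r * q f < e / 2" .
      qed
      have "cmod c + 1 > 0" using norm_ge_zero[of c] by linarith
      then have s: "s > 0" "(cmod c + 1) * s = e / 2" using e by (simp_all add: s_def field_simps)
      have "fscale d h \<in> U" if d: "d \<in> ball c r" and h: "h \<in> F" "q (h - f) < s" for d h
      proof -
        have dc: "cmod (d - c) < r" using d by (simp add: dist_norm norm_minus_commute)
        have "cmod d \<le> cmod (d - c) + cmod c" using norm_triangle_ineq[of "d - c" c] by simp
        then have "cmod d \<le> cmod c + 1" using dc r by simp
        moreover have "0 \<le> q (h - f)" using seminorm_on_nonneg[OF q] Fr h f by simp
        ultimately have *: "cmod d * q (h - f) \<le> (cmod c + 1) * s" using h by (intro mult_mono) auto
        have **: "cmod (d - c) * q f \<le> r * q f" using dc qf by (intro mult_right_mono) auto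
        have "fscale d h - fscale c f = fscale d (h - f) + fscale (d - c) f"
          by (simp add: fscale_def fun_eq_iff algebra_simps)
        then have "q (fscale d h - fscale c f) \<le> q (fscale d (h - f)) + q (fscale (d - c) f)"
          using seminorm_on_triangle[OF q] Fr h f by simp
        also have "\<dots> = cmod d * q (h - f) + cmod (d - c) * q f"
          using seminorm_on_scale[OF q] Fr h f by simp
        also have "\<dots> < e" using * ** r s by linarith
        finally show ?thesis using e(2) Fr h by blast
      qed
      then have "ball c r \<times> {h \<in> F. q (h - f) < s} \<subseteq> ?S" by auto
      moreover have "openin euclidean (ball c r)" "c \<in> ball c r" using r by auto
      moreover have "f \<in> {h \<in> F. q (h - f) < s}" using f s seminorm_on_zero[OF q Fr(1)] by simp
      ultimately show "\<exists>V W. openin euclidean V \<and> openin ?X W \<and> c \<in> V \<and> f \<in> W \<and> V \<times> W \<subseteq> ?S"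
        using openin_seminorm_ball[OF f(1)] by blast
    qed
  qed (use Fr in auto)
qed

lemma locally_convex_seminorm_topology: "locally_convex (seminorm_topology F q)"
  unfolding locally_convex_def
proof (intro conjI allI impI tvs_seminorm_topology)
  fix U assume U: "openin (seminorm_topology F q) U \<and> 0 \<in> U"
  then obtain e where e: "e > 0" "{g \<in> F. q (g - 0) < e} \<subseteq> U"
    unfolding openin_seminorm_topology by blast
  have "convex_funs {g \<in> F. q (g - 0) < e}"
    unfolding convex_funs_def
  proof (intro ballI)
    fix f g and t :: real
    assume fg: "f \<in> {g \<in> F. q (g - 0) < e}" "g \<in> {g \<in> F. q (g - 0) < e}" and t: "t \<in> {0..1}"
    let ?h = "fscale (of_real (1 - t)) f + fscale (of_real t) g"
    have "q ?h \<le> q (fscale (of_real (1 - t)) f) + q (fscale (of_real t) g)"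
      using fg Fr by (intro seminorm_on_triangle[OF q]) auto
    also have "\<dots> = (1 - t) * q f + t * q g"
      using fg t by (auto simp: seminorm_on_scale[OF q] simp del: of_real_diff)
    also have "\<dots> < e"
      using fg t by (intro convex_bound_lt) auto
    finally show "?h \<in> {g \<in> F. q (g - 0) < e}" using fg Fr by simp
  qed
  then show "\<exists>W. openin (seminorm_topology F q) W \<and> 0 \<in> W \<and> convex_funs W \<and> W \<subseteq> U"
    using openin_seminorm_ball[OF Fr(1), of e] e seminorm_on_zero[OF q Fr(1)] Fr(1)
    by (intro exI[of _ "{g \<in> F. q (g - 0) < e}"]) simp
qed

end

section \<open>Topologies given by families of seminorms\<close>

text \<open>Directedness carries an arbitrary factor \<open>c\<close>, so multiples of a seminorm
  are dominated within \<open>Q\<close> and balls of radius 1 already give all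
  neighbourhoods.\<close>

definition seminorm_base :: "('a \<Rightarrow> complex) topology \<Rightarrow> (('a \<Rightarrow> complex) \<Rightarrow> real) set \<Rightarrow> bool"
  where "seminorm_base X Q \<longleftrightarrow> fun_space.subspace (topspace X) \<and> Q \<noteq> {} \<and>
    (\<forall>q\<in>Q. seminorm_on (topspace X) q) \<and>
    (\<forall>p\<in>Q. \<forall>q\<in>Q. \<forall>c. \<exists>r\<in>Q. \<forall>f\<in>topspace X. p f \<le> r f \<and> c * q f \<le> r f) \<and>
    (\<forall>U. openin X U \<longleftrightarrow> U \<subseteq> topspace X \<and> (\<forall>f\<in>U. \<exists>q\<in>Q. {g \<in> topspace X. q (g - f) < 1} \<subseteq> U))"

context
  fixes X :: "('a \<Rightarrow> complex) topology" and Q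
  assumes base: "seminorm_base X Q"
begin

lemma seminorm_base_subspace: "fun_space.subspace (topspace X)"
  and seminorm_base_nonempty: "Q \<noteq> {}"
  and seminorm_base_seminorm: "q \<in> Q \<Longrightarrow> seminorm_on (topspace X) q"
  and seminorm_base_openin: "openin X U \<longleftrightarrow>
    U \<subseteq> topspace X \<and> (\<forall>f\<in>U. \<exists>q\<in>Q. {g \<in> topspace X. q (g - f) < 1} \<subseteq> U)"
  using base by (simp_all add: seminorm_base_def)

lemma seminorm_base_directed:
  "p \<in> Q \<Longrightarrow> q \<in> Q \<Longrightarrow> \<exists>r\<in>Q. \<forall>f\<in>topspace X. p f \<le> r f \<and> c * q f \<le> r f"
  using base by (simp add: seminorm_base_def)

private lemmas Xr = subspace_rules[OF seminorm_base_subspace]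

lemma openin_seminorm_base_ball:
  assumes "q \<in> Q" "f \<in> topspace X"
  shows "openin X {g \<in> topspace X. q (g - f) < e}"
  unfolding seminorm_base_openin
proof (intro conjI ballI)
  note q = seminorm_base_seminorm[OF assms(1)]
  fix g assume g: "g \<in> {g \<in> topspace X. q (g - f) < e}"
  define d where "d = e - q (g - f)"
  have d: "d > 0" using g by (simp add: d_def)
  \<comment> \<open>A seminorm dominating \<open>q / d\<close> has its unit ball inside the d-ball
    of \<open>q\<close>.\<close>
  obtain r where r: "r \<in> Q" "\<And>h. h \<in> topspace X \<Longrightarrow> inverse d * q h \<le> r h"
    using seminorm_base_directed[OF assms(1,1)] by blast
  have "{h \<in> topspace X. r (h - g) < 1} \<subseteq> {g \<in> topspace X. q (g - f) < e}"
  proof safe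
    fix h assume h: "h \<in> topspace X" "r (h - g) < 1"
    have "inverse d * q (h - g) < 1" using r(2)[of "h - g"] h g Xr by force
    then have "q (h - g) < d" using d by (simp add: field_simps)
    then show "q (h - f) < e"
      using seminorm_on_diff_triangle[OF seminorm_base_subspace q h(1) _ assms(2), of g] g
      by (simp add: d_def)
  qed
  then show "\<exists>r\<in>Q. {h \<in> topspace X. r (h - g) < 1} \<subseteq> {g \<in> topspace X. q (g - f) < e}"
    using r by blast
qed auto

lemma bounded_in_seminorm_base:
  "bounded_in X B \<longleftrightarrow> B \<subseteq> topspace X \<and> (\<forall>q\<in>Q. \<exists>c. \<forall>f\<in>B. q f \<le> c)"
proof (intro iffI conjI ballI)
  assume B: "bounded_in X B"
  then show BX: "B \<subseteq> topspace X" by (simp add: bounded_in_def)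
  fix q assume q: "q \<in> Q"
  let ?U = "{g \<in> topspace X. q (g - 0) < 1}"
  have "openin X ?U" using openin_seminorm_base_ball[OF q Xr(1)] .
  moreover have "0 \<in> ?U" using seminorm_on_zero[OF seminorm_base_seminorm[OF q]] Xr(1) by simp
  ultimately obtain s where s: "s > 0" "\<And>t. t > s \<Longrightarrow> B \<subseteq> fscale (of_real t) ` ?U"
    using B unfolding bounded_in_def by meson
  have "q f \<le> s + 1" if "f \<in> B" for f
  proof -
    have "f \<in> fscale (of_real (s + 1)) ` ?U" using s(2)[of "s + 1"] that by auto
    then obtain g where g: "f = fscale (of_real (s + 1)) g" "g \<in> topspace X" "q g < 1" by auto
    have "q f = cmod (of_real (s + 1)) * q g" unfolding g(1)
      by (rule seminorm_on_scale[OF seminorm_base_seminorm[OF q] g(2)])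
    also have "cmod (of_real (s + 1)) = s + 1" using s(1) unfolding norm_of_real by simp
    finally have "q f = (s + 1) * q g" .
    also have "\<dots> \<le> (s + 1) * 1" using g(3) s(1) by (intro mult_left_mono) auto
    finally show ?thesis by simp
  qed
  then show "\<exists>c. \<forall>f\<in>B. q f \<le> c" by blast
next
  assume B: "B \<subseteq> topspace X \<and> (\<forall>q\<in>Q. \<exists>c. \<forall>f\<in>B. q f \<le> c)"
  show "bounded_in X B" unfolding bounded_in_def
  proof (intro conjI allI impI)
    show "B \<subseteq> topspace X" using B by simp
    fix U assume U: "openin X U \<and> 0 \<in> U"
    then obtain q where q: "q \<in> Q" "{g \<in> topspace X. q (g - 0) < 1} \<subseteq> U"
      unfolding seminorm_base_openin by blast
    obtain c where c: "\<And>f. f \<in> B \<Longrightarrow> q f \<le> c" using B q(1) by blast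
    show "\<exists>s>0. \<forall>t>s. B \<subseteq> fscale (of_real t) ` U"
    proof (intro exI[of _ "max c 1"] conjI allI impI subsetI)
      fix t f assume t: "t > max c 1" and f: "f \<in> B"
      have fX: "f \<in> topspace X" using B f by blast
      let ?g = "fscale (inverse (of_real t)) f"
      have "q ?g = inverse t * q f"
        using seminorm_on_scale[OF seminorm_base_seminorm[OF q(1)] fX, of "inverse (of_real t)"] t
        by (simp add: norm_inverse)
      also have "\<dots> < 1" using c[OF f] t by (simp add: field_simps)
      finally have "?g \<in> U" using q(2) Xr(3)[OF fX] by auto
      moreover have "f = fscale (of_real t) ?g" using t by (simp add: fscale_inverse_cancel)
      ultimately show "f \<in> fscale (of_real t) ` U" by blast
    qed auto
  qed
qed

text \<open>Continuity is tested on the preimage of the unit disc; homogeneity turns "q f < 1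
  implies |T f| < 1" into domination by \<open>q\<close> with constant 1.\<close>

lemma dual_space_seminorm_base:
  "T \<in> dual_space X \<longleftrightarrow> (\<forall>f. f \<notin> topspace X \<longrightarrow> T f = 0) \<and>
    (\<forall>f\<in>topspace X. \<forall>g\<in>topspace X. T (f + g) = T f + T g) \<and>
    (\<forall>c. \<forall>f\<in>topspace X. T (fscale c f) = c * T f) \<and>
    (\<exists>q\<in>Q. \<forall>f\<in>topspace X. cmod (T f) \<le> q f)"
  (is "_ \<longleftrightarrow> ?Z \<and> ?A \<and> ?S \<and> ?B")
proof
  assume T: "T \<in> dual_space X"
  then have lin: ?Z ?A ?S and cont: "continuous_map X euclidean T" by (simp_all add: dual_space_def)
  have T0: "T 0 = 0" using lin(3)[rule_format, OF Xr(1), of 0] by (simp add: fscale_def zero_fun_def)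
  have "openin X {f \<in> topspace X. T f \<in> ball 0 1}"
    by (rule openin_continuous_map_preimage[OF cont]) simp
  moreover have "0 \<in> {f \<in> topspace X. T f \<in> ball 0 1}" using Xr T0 by simp
  ultimately obtain q where q: "q \<in> Q" "{f \<in> topspace X. q (f - 0) < 1} \<subseteq> {f \<in> topspace X. T f \<in> ball 0 1}"
    unfolding seminorm_base_openin by blast
  note qs = seminorm_base_seminorm[OF q(1)]
  have "cmod (T f) \<le> q f" if f: "f \<in> topspace X" for f
  proof (rule field_le_epsilon)
    fix e :: real assume e: "e > 0"
    \<comment> \<open>Adding \<open>e\<close> keeps \<open>t\<close> positive when
      \<open>q f = 0\<close> and puts \<open>f / t\<close> strictly inside the unit ball.\<close>
    define t where "t = q f + e"
    have t: "t > 0" using seminorm_on_nonneg[OF qs f] e by (simp add: t_def)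
    let ?g = "fscale (inverse (of_real t)) f"
    have "q ?g = inverse t * q f"
      using seminorm_on_scale[OF qs f, of "inverse (of_real t)"] t by (simp add: norm_inverse)
    also have "\<dots> < 1" using e t by (simp add: field_simps t_def)
    finally have "T ?g \<in> ball 0 1" using q(2) Xr(3)[OF f] by auto
    then have "cmod (inverse (of_real t) * T f) < 1" using lin(3) f by simp
    then have "inverse t * cmod (T f) < 1" using t by (simp add: norm_mult norm_inverse)
    then show "cmod (T f) \<le> q f + e" using t by (simp add: field_simps t_def)
  qed
  then show "?Z \<and> ?A \<and> ?S \<and> ?B" using lin q(1) by blast
next
  assume R: "?Z \<and> ?A \<and> ?S \<and> ?B"
  then obtain q where q: "q \<in> Q" "\<And>f. f \<in> topspace X \<Longrightarrow> cmod (T f) \<le> q f" by blast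
  have diff: "T (f - g) = T f - T g" if "f \<in> topspace X" "g \<in> topspace X" for f g
  proof -
    have "T (f + fscale (-1) g) = T f + T (fscale (-1) g)" using R that Xr by blast
    also have "T (fscale (-1) g) = -1 * T g" using R that by blast
    finally have "T (f + - g) = T f + - 1 * T g" unfolding fscale_minus_one .
    then show ?thesis
      by (simp only: diff_conv_add_uminus[of f g] diff_conv_add_uminus[of "T f"] mult_minus1)
  qed
  have "continuous_map X euclidean T"
    unfolding continuous_map_def
  proof (intro conjI allI impI)
    fix U :: "complex set" assume "openin euclidean U"
    then have U: "open U" by simp
    show "openin X {f \<in> topspace X. T f \<in> U}"
      unfolding seminorm_base_openin
    proof (intro conjI ballI)
      fix f assume f: "f \<in> {f \<in> topspace X. T f \<in> U}"
      then obtain e where e: "e > 0" "ball (T f) e \<subseteq> U" using U openE by blast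
      obtain r where r: "r \<in> Q" "\<And>h. h \<in> topspace X \<Longrightarrow> inverse e * q h \<le> r h"
        using seminorm_base_directed[OF q(1,1)] by blast
      have "{h \<in> topspace X. r (h - f) < 1} \<subseteq> {f \<in> topspace X. T f \<in> U}"
      proof safe
        fix h assume h: "h \<in> topspace X" "r (h - f) < 1"
        have "inverse e * q (h - f) < 1" using r(2)[of "h - f"] h f Xr by force
        then have "q (h - f) < e" using e by (simp add: field_simps)
        then have "cmod (T h - T f) < e" using q(2)[of "h - f"] diff h f Xr by force
        then show "T h \<in> U" using e by (auto simp: dist_norm norm_minus_commute)
      qed
      then show "\<exists>r\<in>Q. {h \<in> topspace X. r (h - f) < 1} \<subseteq> {f \<in> topspace X. T f \<in> U}" using r by blast
    qed auto
  qed auto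
  then show "T \<in> dual_space X" using R by (simp add: dual_space_def)
qed

end

lemma continuous_map_pointwiseI:
  assumes "\<And>x. x \<in> topspace X \<Longrightarrow> h x \<in> topspace Y"
    and "\<And>x V. x \<in> topspace X \<Longrightarrow> openin Y V \<Longrightarrow> h x \<in> V \<Longrightarrow>
      \<exists>U. openin X U \<and> x \<in> U \<and> (\<forall>y\<in>U. h y \<in> V)"
  shows "continuous_map X Y h"
  unfolding continuous_map_def
proof (intro conjI allI impI)
  fix V assume V: "openin Y V"
  show "openin X {x \<in> topspace X. h x \<in> V}"
  proof (subst openin_subopen, intro ballI)
    fix x assume "x \<in> {x \<in> topspace X. h x \<in> V}"
    then obtain U where U: "openin X U" "x \<in> U" "\<forall>y\<in>U. h y \<in> V"
      using assms(2)[of x V] V by auto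
    moreover have "U \<subseteq> {x \<in> topspace X. h x \<in> V}" using U openin_subset by blast
    ultimately show "\<exists>U. openin X U \<and> x \<in> U \<and> U \<subseteq> {x \<in> topspace X. h x \<in> V}" by blast
  qed
qed (use assms(1) in auto)

section \<open>Minkowski functionals of convex, balanced, absorbing sets\<close>

definition gauge_functional :: "('a \<Rightarrow> complex) set \<Rightarrow> ('a \<Rightarrow> complex) \<Rightarrow> real"
  where "gauge_functional W f = Inf {t. t > 0 \<and> fscale (of_real (inverse t)) f \<in> W}"

context
  fixes F W :: "('a \<Rightarrow> complex) set"
  assumes F: "fun_space.subspace F"
    and conv: "convex_funs W"
    and balanced: "\<And>c f. f \<in> W \<Longrightarrow> cmod c \<le> 1 \<Longrightarrow> fscale c f \<in> W"
    and absorbing: "\<And>f. f \<in> F \<Longrightarrow> \<exists>t>0. fscale (of_real (inverse t)) f \<in> W"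
begin

lemma gauge_functional_le: "t > 0 \<Longrightarrow> fscale (of_real (inverse t)) f \<in> W \<Longrightarrow> gauge_functional W f \<le> t"
  unfolding gauge_functional_def by (intro cInf_lower) (auto intro: bdd_belowI[of _ 0])

lemma gauge_functional_ge:
  assumes "f \<in> F" "\<And>t. t > 0 \<Longrightarrow> fscale (of_real (inverse t)) f \<in> W \<Longrightarrow> s \<le> t"
  shows "s \<le> gauge_functional W f"
  unfolding gauge_functional_def using absorbing[OF assms(1)] assms(2) by (intro cInf_greatest) auto

lemma gauge_functional_scale_le:
  assumes "f \<in> F"
  shows "gauge_functional W (fscale c f) \<le> cmod c * gauge_functional W f"
proof (cases "c = 0")
  case True
  obtain s :: real where s: "s > 0" "fscale (of_real (inverse s)) f \<in> W" using absorbing[OF assms] by blast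
  have "fscale 0 (fscale (of_real (inverse s)) f) \<in> W" using s(2) by (rule balanced) simp
  moreover have "fscale 0 (fscale (of_real (inverse s)) f) = fscale (of_real (inverse t)) (fscale 0 f)" for t
    by (simp add: fscale_def)
  ultimately have "gauge_functional W (fscale 0 f) \<le> t" if "t > 0" for t
    using gauge_functional_le[OF that] by metis
  then have "gauge_functional W (fscale 0 f) \<le> 0" by (meson field_le_epsilon add_0 add.left_neutral dense not_le)
  then show ?thesis using True by simp
next
  case False
  have "gauge_functional W (fscale c f) / cmod c \<le> gauge_functional W f"
  proof (rule gauge_functional_ge[OF assms])
    fix t :: real assume t: "t > 0" "fscale (of_real (inverse t)) f \<in> W"
    \<comment> \<open>Balancedness absorbs the phase \<open>c / cmod c\<close>, so only the modulus
      rescales \<open>t\<close>.\<close>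
    have "fscale (c / of_real (cmod c)) (fscale (of_real (inverse t)) f) \<in> W"
      using t(2) by (rule balanced) (use False in \<open>simp add: norm_divide\<close>)
    also have "fscale (c / of_real (cmod c)) (fscale (of_real (inverse t)) f) =
        fscale (of_real (inverse (cmod c * t))) (fscale c f)"
      using False t by (simp add: fscale_def fun_eq_iff field_simps)
    finally have "gauge_functional W (fscale c f) \<le> cmod c * t"
      using t False by (intro gauge_functional_le) auto
    then show "gauge_functional W (fscale c f) / cmod c \<le> t" using False by (simp add: field_simps)
  qed
  then show ?thesis using False by (simp add: field_simps)
qed

lemma seminorm_on_gauge_functional: "seminorm_on F (gauge_functional W)"
proof (rule seminorm_onI)
  fix f g assume f: "f \<in> F" and g: "g \<in> F"
  have *: "gauge_functional W (f + g) \<le> s + t"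
    if s: "s > 0" "fscale (of_real (inverse s)) f \<in> W" and t: "t > 0" "fscale (of_real (inverse t)) g \<in> W"
    for s t :: real
  proof (rule gauge_functional_le)
    \<comment> \<open>With this weight the convex combination of \<open>f / s\<close> and
      \<open>g / t\<close> is exactly \<open>(f + g) / (s + t)\<close>.\<close>
    have "t / (s + t) \<in> {0..1}" using s t by simp
    then have "fscale (of_real (1 - t / (s + t))) (fscale (of_real (inverse s)) f) +
        fscale (of_real (t / (s + t))) (fscale (of_real (inverse t)) g) \<in> W"
      using conv s t unfolding convex_funs_def by blast
    also have "1 - t / (s + t) = s / (s + t)" using s t by (simp add: field_simps)
    also have "fscale (of_real (s / (s + t))) (fscale (of_real (inverse s)) f) +
        fscale (of_real (t / (s + t))) (fscale (of_real (inverse t)) g) = fscale (of_real (inverse (s + t))) (f + g)"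
      using s t by (simp add: fscale_def fun_eq_iff field_simps flip: of_real_add)
    finally show "fscale (of_real (inverse (s + t))) (f + g) \<in> W" .
  qed (use s t in simp)
  have "gauge_functional W (f + g) - t \<le> gauge_functional W f"
    if t: "t > 0" "fscale (of_real (inverse t)) g \<in> W" for t
    by (rule gauge_functional_ge[OF f]) (use *[OF _ _ t] in fastforce)
  then have "gauge_functional W (f + g) - gauge_functional W f \<le> gauge_functional W g"
    by (intro gauge_functional_ge[OF g]) fastforce
  then show "gauge_functional W (f + g) \<le> gauge_functional W f + gauge_functional W g" by simp
next
  fix c f assume f: "f \<in> F"
  show "gauge_functional W (fscale c f) = cmod c * gauge_functional W f"
  proof (rule antisym[OF gauge_functional_scale_le[OF f]])
    show "cmod c * gauge_functional W f \<le> gauge_functional W (fscale c f)"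
    proof (cases "c = 0")
      case True
      have "0 \<le> gauge_functional W (fscale c f)"
        using subspace_rules(3)[OF F f] by (rule gauge_functional_ge) simp
      then show ?thesis using True by simp
    next
      case False
      have "gauge_functional W (fscale (inverse c) (fscale c f)) \<le> cmod (inverse c) * gauge_functional W (fscale c f)"
        using subspace_rules(3)[OF F f] by (rule gauge_functional_scale_le)
      then show ?thesis using False by (simp add: fscale_inverse_cancel norm_divide field_simps)
    qed
  qed
next
  show "0 \<le> gauge_functional W f" if "f \<in> F" for f
    using that by (rule gauge_functional_ge) simp
qed

lemma gauge_functional_less_one:
  assumes "f \<in> F" "gauge_functional W f < 1"
  shows "f \<in> W"
proof -
  obtain t where t: "t > 0" "fscale (of_real (inverse t)) f \<in> W" "t < 1"
    using gauge_functional_ge[OF assms(1), of 1] assms(2) by fastforce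
  have "fscale (of_real t) (fscale (of_real (inverse t)) f) \<in> W" using t(2) by (rule balanced) (use t in simp)
  then show ?thesis using t(1) by (simp add: fscale_inverse_cancel)
qed

end

section \<open>Locally convex inductive limits\<close>

definition inductive_seminorms ::
    "'i set \<Rightarrow> ('i \<Rightarrow> ('a \<Rightarrow> complex) set) \<Rightarrow> ('i \<Rightarrow> ('a \<Rightarrow> complex) \<Rightarrow> real) \<Rightarrow> (('a \<Rightarrow> complex) \<Rightarrow> real) set"
  where "inductive_seminorms I S r =
    {q. seminorm_on (\<Union>i\<in>I. S i) q \<and> (\<forall>i\<in>I. \<exists>C. \<forall>f\<in>S i. q f \<le> C * r i f)}"

lemma tvs_openin_translate:
  assumes "tvs X" "openin X U" "f \<in> topspace X"
  shows "openin X {g \<in> topspace X. g + f \<in> U}"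
proof -
  have "continuous_map X X ((\<lambda>(g, h). g + h) \<circ> (\<lambda>g. (g, f)))"
  proof (rule continuous_map_compose)
    show "continuous_map X (prod_topology X X) (\<lambda>g. (g, f))"
      using assms(3) by (intro continuous_map_pairedI) auto
    show "continuous_map (prod_topology X X) X (\<lambda>(g, h). g + h)" using assms(1) by (simp add: tvs_def)
  qed
  from openin_continuous_map_preimage[OF this assms(2)] show ?thesis by simp
qed

context
  fixes I :: "'i set" and S :: "'i \<Rightarrow> ('a \<Rightarrow> complex) set" and r
  assumes S: "\<And>i. i \<in> I \<Longrightarrow> fun_space.subspace (S i)"
    and r: "\<And>i. i \<in> I \<Longrightarrow> seminorm_on (S i) (r i)"
    and F: "fun_space.subspace (\<Union>i\<in>I. S i)"
begin

private abbreviation "F \<equiv> \<Union>i\<in>I. S i"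
private abbreviation "Q \<equiv> inductive_seminorms I S r"

lemma inductive_seminorms_combine:
  assumes p: "p \<in> Q" and q: "q \<in> Q" and c: "c \<ge> 0"
  shows "(\<lambda>f. p f + c * q f) \<in> Q"
proof -
  have ps: "seminorm_on F p" and qs: "seminorm_on F q" using p q by (simp_all add: inductive_seminorms_def)
  have "seminorm_on F (\<lambda>f. p f + c * q f)"
  proof (rule seminorm_onI)
    fix f g assume f: "f \<in> F" and g: "g \<in> F"
    have "c * q (f + g) \<le> c * (q f + q g)" using seminorm_on_triangle[OF qs f g] c by (rule mult_left_mono)
    then show "p (f + g) + c * q (f + g) \<le> p f + c * q f + (p g + c * q g)"
      using seminorm_on_triangle[OF ps f g] by (simp add: algebra_simps)
  next
    show "0 \<le> p f + c * q f" if "f \<in> F" for f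
      using seminorm_on_nonneg[OF ps that] seminorm_on_nonneg[OF qs that] c by simp
  qed (simp add: seminorm_on_scale[OF ps] seminorm_on_scale[OF qs] algebra_simps)
  moreover have "\<exists>C. \<forall>f\<in>S i. p f + c * q f \<le> C * r i f" if i: "i \<in> I" for i
  proof -
    obtain A B where A: "\<And>f. f \<in> S i \<Longrightarrow> p f \<le> A * r i f" and B: "\<And>f. f \<in> S i \<Longrightarrow> q f \<le> B * r i f"
      using p q i unfolding inductive_seminorms_def by blast
    have "p f + c * q f \<le> (A + c * B) * r i f" if "f \<in> S i" for f
      using A[OF that] mult_left_mono[OF B[OF that] c] by (simp add: algebra_simps)
    then show ?thesis by blast
  qed
  ultimately show ?thesis by (simp add: inductive_seminorms_def)
qed

lemma zero_in_inductive_seminorms: "(\<lambda>_. 0) \<in> Q"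
  using seminorm_on_nonneg[OF r] by (auto simp: inductive_seminorms_def seminorm_on_def intro!: exI[of _ 1])

lemma continuous_map_into_seminorm_topology:
  assumes q: "q \<in> Q" and i: "i \<in> I"
  shows "continuous_map (seminorm_topology (S i) (r i)) (seminorm_topology F q) id"
proof (rule continuous_map_pointwiseI)
  fix f V assume f: "f \<in> topspace (seminorm_topology (S i) (r i))"
    and V: "openin (seminorm_topology F q) V" "id f \<in> V"
  then obtain e where e: "e > 0" "{g \<in> F. q (g - f) < e} \<subseteq> V" unfolding openin_seminorm_topology by auto
  obtain C where C: "\<And>f. f \<in> S i \<Longrightarrow> q f \<le> C * r i f" using q i unfolding inductive_seminorms_def by blast
  let ?C = "max C 1"
  let ?U = "{g \<in> S i. r i (g - f) < e / ?C}"
  have "g \<in> V" if g: "g \<in> ?U" for g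
  proof -
    have *: "g - f \<in> S i" using subspace_rules(4)[OF S[OF i]] f g by simp
    have "q (g - f) \<le> C * r i (g - f)" using C[OF *] .
    also have "\<dots> \<le> ?C * r i (g - f)" using seminorm_on_nonneg[OF r[OF i] *] by (intro mult_right_mono) auto
    also have "\<dots> < e" using g by (simp add: field_simps)
    finally show ?thesis using e(2) g i by blast
  qed
  moreover have "openin (seminorm_topology (S i) (r i)) ?U"
    using openin_seminorm_ball[OF S[OF i] r[OF i]] f by simp
  moreover have "f \<in> ?U"
    using f e subspace_rules(1)[OF S[OF i]] seminorm_on_zero[OF r[OF i]] by (simp add: less_max_iff_disj)
  ultimately show "\<exists>U. openin (seminorm_topology (S i) (r i)) U \<and> f \<in> U \<and> (\<forall>g\<in>U. id g \<in> V)"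
    by auto
qed (use i in auto)

text \<open>After translation to 0, a convex neighbourhood contains its balanced core, which still
  contains a ball of every step. The core is therefore absorbing, and its Minkowski functional
  belongs to \<open>inductive_seminorms\<close>.\<close>

lemma seminorm_below_neighbourhood:
  assumes X: "locally_convex X" "topspace X = F"
    and cont: "\<And>i. i \<in> I \<Longrightarrow> continuous_map (seminorm_topology (S i) (r i)) X id"
    and U: "openin X U" "f \<in> U"
  shows "\<exists>q\<in>Q. {g \<in> F. q (g - f) < 1} \<subseteq> U"
proof -
  note Fr = subspace_rules[OF F]
  have tvs: "tvs X" using X by (simp add: locally_convex_def)
  have f: "f \<in> F" using openin_subset[OF U(1)] U(2) X(2) by blast
  have "openin X {g \<in> F. g + f \<in> U}" using tvs_openin_translate[OF tvs U(1)] f X(2) by simp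
  moreover have "0 \<in> {g \<in> F. g + f \<in> U}" using Fr U by simp
  ultimately obtain W where W: "openin X W" "0 \<in> W" "convex_funs W" "W \<subseteq> {g \<in> F. g + f \<in> U}"
    using X(1) unfolding locally_convex_def by meson
  \<comment> \<open>The largest balanced subset of \<open>W\<close> in the carrier; it stays convex
    because each condition \<open>fscale c g \<in> W\<close> is convex in \<open>g\<close>.\<close>
  define V where "V = {g \<in> F. \<forall>c. cmod c \<le> 1 \<longrightarrow> fscale c g \<in> W}"
  have VW: "V \<subseteq> W"
  proof
    fix g assume "g \<in> V"
    then have "fscale 1 g \<in> W" unfolding V_def by (auto simp del: fun_space.scale_one)
    then show "g \<in> W" by simp
  qed
  have balanced: "fscale c g \<in> V" if "g \<in> V" "cmod c \<le> 1" for c g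
    using that Fr unfolding V_def by (auto simp: norm_mult mult_le_one)
  have conv: "convex_funs V"
    unfolding convex_funs_def
  proof (intro ballI)
    fix g h and t :: real assume gh: "g \<in> V" "h \<in> V" and t: "t \<in> {0..1}"
    let ?k = "fscale (of_real (1 - t)) g + fscale (of_real t) h"
    have "fscale c ?k \<in> W" if "cmod c \<le> 1" for c
    proof -
      have "fscale c ?k = fscale (of_real (1 - t)) (fscale c g) + fscale (of_real t) (fscale c h)"
        by (simp add: fscale_def fun_eq_iff algebra_simps)
      also have "\<dots> \<in> W"
        using W(3) gh t that unfolding V_def convex_funs_def by blast
      finally show ?thesis .
    qed
    moreover have "?k \<in> F" using gh Fr by (auto simp: V_def simp del: UN_iff)
    ultimately show "?k \<in> V" by (simp add: V_def)
  qed
  \<comment> \<open>The ball comes from continuity of the inclusion into \<open>X\<close>. Being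
    balanced itself, it lies in the core \<open>V\<close> and not only in \<open>W\<close>.\<close>
  have ball: "\<exists>e>0. \<forall>g\<in>S i. r i g < e \<longrightarrow> g \<in> V" if i: "i \<in> I" for i
  proof -
    have "openin (seminorm_topology (S i) (r i)) {g \<in> S i. g \<in> W}"
      using openin_continuous_map_preimage[OF cont[OF i] W(1)] by simp
    moreover have "0 \<in> {g \<in> S i. g \<in> W}" using W subspace_rules(1)[OF S[OF i]] by simp
    ultimately obtain e where e: "e > 0" "{g \<in> S i. r i (g - 0) < e} \<subseteq> {g \<in> S i. g \<in> W}"
      unfolding openin_seminorm_topology by blast
    have "g \<in> V" if g: "g \<in> S i" "r i g < e" for g
    proof -
      have "fscale c g \<in> W" if c: "cmod c \<le> 1" for c
      proof -
        have "r i (fscale c g) = cmod c * r i g" by (rule seminorm_on_scale[OF r[OF i] g(1)])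
        also have "\<dots> \<le> 1 * r i g" using c seminorm_on_nonneg[OF r[OF i] g(1)] by (intro mult_right_mono) auto
        finally have "r i (fscale c g) < e" using g by simp
        then show ?thesis using e(2) subspace_rules(3)[OF S[OF i] g(1)] by auto
      qed
      then show ?thesis using g i by (auto simp: V_def)
    qed
    then show ?thesis using e(1) by blast
  qed
  have ball': "fscale (of_real (inverse t)) g \<in> V"
    if "i \<in> I" "e > 0" "\<forall>g\<in>S i. r i g < e \<longrightarrow> g \<in> V" "g \<in> S i" "r i g < e * t" "t > 0" for i e g t
  proof -
    have "r i (fscale (of_real (inverse t)) g) = inverse t * r i g"
      using seminorm_on_scale[OF r[OF that(1)] that(4), of "of_real (inverse t)"] that(6)
      by (simp add: norm_inverse)
    also have "\<dots> < e" using that by (simp add: field_simps)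
    finally show ?thesis using that(3) subspace_rules(3)[OF S[OF that(1)] that(4)] by blast
  qed
  have absorbing: "\<exists>t>0. fscale (of_real (inverse t)) g \<in> V" if gF: "g \<in> F" for g
  proof -
    obtain i where i: "i \<in> I" "g \<in> S i" using gF by blast
    obtain e where e: "e > 0" "\<forall>g\<in>S i. r i g < e \<longrightarrow> g \<in> V" using ball[OF i(1)] by blast
    \<comment> \<open>The added 1 makes the inequality strict, and the scaling positive, even when
      \<open>r i g = 0\<close>.\<close>
    have "r i g < e * (r i g / e + 1)" "r i g / e + 1 > 0"
      using e(1) divide_nonneg_pos[OF seminorm_on_nonneg[OF r[OF i(1)] i(2)] e(1)]
      by (simp_all add: field_simps)
    then show ?thesis using ball'[OF i(1) e i(2)] by blast
  qed
  note gauge = F conv balanced absorbing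
  let ?q = "gauge_functional V"
  have "?q \<in> Q"
    unfolding inductive_seminorms_def
  proof (intro CollectI conjI ballI)
    show "seminorm_on F ?q" by (rule seminorm_on_gauge_functional[OF gauge])
    fix i assume i: "i \<in> I"
    obtain e where e: "e > 0" "\<forall>g\<in>S i. r i g < e \<longrightarrow> g \<in> V" using ball[OF i] by blast
    \<comment> \<open>\<open>V\<close> contains the e-ball of step \<open>i\<close>, so the gauge is
      at most \<open>r i / e\<close> there.\<close>
    have "?q g \<le> (1 / e) * r i g" if g: "g \<in> S i" for g
    proof (rule field_le_epsilon)
      fix d :: real assume d: "d > 0"
      have t: "r i g < e * (1 / e * r i g + d)" "1 / e * r i g + d > 0"
        using e(1) d seminorm_on_nonneg[OF r[OF i] g] by (simp_all add: field_simps add_pos_nonneg)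
      show "?q g \<le> 1 / e * r i g + d"
        by (rule gauge_functional_le[OF gauge t(2) ball'[OF i e g t]])
    qed
    then show "\<exists>C. \<forall>g\<in>S i. ?q g \<le> C * r i g" by blast
  qed
  moreover have "{g \<in> F. ?q (g - f) < 1} \<subseteq> U"
  proof safe
    fix g i assume g: "i \<in> I" "g \<in> S i" "?q (g - f) < 1"
    then have "g - f \<in> F" using Fr(4) f by blast
    then have "g - f \<in> V" using gauge_functional_less_one[OF gauge] g(3) by simp
    then have "g - f \<in> {g \<in> F. g + f \<in> U}" using VW W(4) by blast
    then show "g \<in> U" by simp
  qed
  ultimately show ?thesis by blast
qed

text \<open>The subbase collects all admissible locally convex topologies. A single seminorm of the
  family defines such a topology, so its balls are open in the limit; conversely
  \<open>seminorm_below_neighbourhood\<close> puts one of these balls into every admissible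
  neighbourhood.\<close>

lemma seminorm_base_inductive_limit:
  "seminorm_base (lc_inductive_limit I (\<lambda>i. seminorm_topology (S i) (r i))) Q"
    (is "seminorm_base ?L Q")
  and topspace_inductive_limit:
  "topspace (lc_inductive_limit I (\<lambda>i. seminorm_topology (S i) (r i))) = F"
proof -
  let ?G = "{U. \<exists>X. locally_convex X \<and> topspace X = F \<and>
    (\<forall>i\<in>I. continuous_map (seminorm_topology (S i) (r i)) X id) \<and> openin X U}"
  have L: "?L = topology_generated_by ?G" by (simp add: lc_inductive_limit_def)
  have seminorm_open: "U \<in> ?G" if "q \<in> Q" "openin (seminorm_topology F q) U" for q U
    using that continuous_map_into_seminorm_topology locally_convex_seminorm_topology[OF F, of q]
    by (auto simp: inductive_seminorms_def intro!: exI[of _ "seminorm_topology F q"])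
  have "F \<in> ?G" using seminorm_open[OF zero_in_inductive_seminorms] openin_topspace[of "seminorm_topology F (\<lambda>_. 0)"]
    unfolding topspace_seminorm_topology by blast
  have *: "U \<subseteq> F" if "U \<in> ?G" for U using that openin_subset by blast
  show top: "topspace ?L = F" unfolding L topology_generated_by_topspace
    by (rule equalityI, rule Union_least, erule *, rule Union_upper, rule \<open>F \<in> ?G\<close>)
  have qs: "seminorm_on F q" if "q \<in> Q" for q using that by (simp add: inductive_seminorms_def)
  have dir: "\<exists>r\<in>Q. \<forall>f\<in>F. p f \<le> r f \<and> c * q f \<le> r f" if p: "p \<in> Q" and q: "q \<in> Q" for p q c
  proof (intro bexI[of _ "\<lambda>f. p f + \<bar>c\<bar> * q f"] ballI)
    fix f assume f: "f \<in> F"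
    have "c * q f \<le> \<bar>c\<bar> * q f" using seminorm_on_nonneg[OF qs[OF q] f] by (intro mult_right_mono) auto
    moreover have "0 \<le> \<bar>c\<bar> * q f" using seminorm_on_nonneg[OF qs[OF q] f] by simp
    ultimately show "p f \<le> p f + \<bar>c\<bar> * q f \<and> c * q f \<le> p f + \<bar>c\<bar> * q f"
      using seminorm_on_nonneg[OF qs[OF p] f] by linarith
  qed (use inductive_seminorms_combine[OF p q] in auto)
  have openin: "openin ?L U \<longleftrightarrow> U \<subseteq> F \<and> (\<forall>f\<in>U. \<exists>q\<in>Q. {g \<in> F. q (g - f) < 1} \<subseteq> U)" for U
  proof
    assume "openin ?L U"
    then have "generate_topology_on ?G U" unfolding L openin_topology_generated_by_iff .
    then show "U \<subseteq> F \<and> (\<forall>f\<in>U. \<exists>q\<in>Q. {g \<in> F. q (g - f) < 1} \<subseteq> U)"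
    proof induction
      case (Int U V)
      have "\<exists>q\<in>Q. {g \<in> F. q (g - f) < 1} \<subseteq> U \<inter> V" if f: "f \<in> U \<inter> V" for f
      proof -
        obtain p where p: "p \<in> Q" "{g \<in> F. p (g - f) < 1} \<subseteq> U" using Int.IH(1) f by blast
        obtain q where q: "q \<in> Q" "{g \<in> F. q (g - f) < 1} \<subseteq> V" using Int.IH(2) f by blast
        obtain s where s: "s \<in> Q" "\<And>f. f \<in> F \<Longrightarrow> p f \<le> s f \<and> 1 * q f \<le> s f"
          using dir[OF p(1) q(1), of 1] by blast
        have "{g \<in> F. s (g - f) < 1} \<subseteq> U \<inter> V"
        proof
          fix g assume g: "g \<in> {g \<in> F. s (g - f) < 1}"
          have "f \<in> F" using f Int.IH(1) by blast
          then have "g - f \<in> F" using subspace_rules(4)[OF F] g by blast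
          then have "p (g - f) < 1" "q (g - f) < 1" using s(2) g by fastforce+
          then show "g \<in> U \<inter> V" using p q g by blast
        qed
        then show ?thesis using s(1) by blast
      qed
      then show ?case using Int.IH by blast
    next
      case (UN K)
      have *: "\<exists>q\<in>Q. {g \<in> F. q (g - f) < 1} \<subseteq> \<Union>K" if f: "f \<in> \<Union>K" for f
      proof -
        obtain V where V: "V \<in> K" "f \<in> V" using f by blast
        obtain q where q: "q \<in> Q" "{g \<in> F. q (g - f) < 1} \<subseteq> V" using UN.IH[OF V(1)] V(2) by blast
        then show ?thesis using Union_upper[OF V(1)] by (meson subset_trans)
      qed
      have "\<Union>K \<subseteq> F" using UN.IH by (intro Union_least) blast
      then show ?case using * by (intro conjI ballI)
    next
      case (Basis U)
      then obtain X where X: "locally_convex X" "topspace X = F"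
        "\<And>i. i \<in> I \<Longrightarrow> continuous_map (seminorm_topology (S i) (r i)) X id" "openin X U" by blast
      have "U \<subseteq> F" using openin_subset[OF X(4)] X(2) by simp
      then show ?case using seminorm_below_neighbourhood[OF X] by (intro conjI ballI)
    qed simp
  next
    assume U: "U \<subseteq> F \<and> (\<forall>f\<in>U. \<exists>q\<in>Q. {g \<in> F. q (g - f) < 1} \<subseteq> U)"
    show "openin ?L U"
    proof (subst openin_subopen, intro ballI)
      fix f assume f: "f \<in> U"
      then obtain q where q: "q \<in> Q" "{g \<in> F. q (g - f) < 1} \<subseteq> U" using U by blast
      have fF: "f \<in> F" using f U by blast
      have "openin (seminorm_topology F q) {g \<in> F. q (g - f) < 1}"
        by (rule openin_seminorm_ball[OF F qs[OF q(1)] fF])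
      then have "openin ?L {g \<in> F. q (g - f) < 1}"
        unfolding L using seminorm_open[OF q(1)] by (intro topology_generated_by_Basis) blast
      moreover have "f \<in> {g \<in> F. q (g - f) < 1}"
        using fF seminorm_on_zero[OF qs[OF q(1)]] subspace_rules(1)[OF F] by simp
      ultimately show "\<exists>V. openin ?L V \<and> f \<in> V \<and> V \<subseteq> U" using q(2) by blast
    qed
  qed
  show "seminorm_base ?L Q"
    unfolding seminorm_base_def top using F zero_in_inductive_seminorms qs dir openin by blast
qed

end

section \<open>Projective limits of topologies given by seminorms\<close>

lemma seminorm_base_projective_limit:
  assumes I: "I \<noteq> {}" and base: "\<And>i. i \<in> I \<Longrightarrow> seminorm_base (X i) (Q i)"
    and dir: "\<And>i j p q c. i \<in> I \<Longrightarrow> j \<in> I \<Longrightarrow> p \<in> Q i \<Longrightarrow> q \<in> Q j \<Longrightarrow>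
      \<exists>k\<in>I. \<exists>r\<in>Q k. \<forall>f\<in>(\<Inter>i\<in>I. topspace (X i)). p f \<le> r f \<and> c * q f \<le> r f"
  shows "topspace (projective_limit I X) = (\<Inter>i\<in>I. topspace (X i))"
    and "seminorm_base (projective_limit I X) (\<Union>i\<in>I. Q i)"
proof -
  let ?L = "projective_limit I X"
  define FF where "FF = (\<Inter>i\<in>I. topspace (X i))"
  define QQ where "QQ = (\<Union>i\<in>I. Q i)"
  have FFD: "FF \<subseteq> topspace (X i)" if "i \<in> I" for i using that by (auto simp: FF_def)
  have QQI: "q \<in> QQ" if "i \<in> I" "q \<in> Q i" for i q using that by (auto simp: QQ_def)
  have QQE: "\<exists>i. i \<in> I \<and> q \<in> Q i" if "q \<in> QQ" for q using that by (auto simp: QQ_def)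
  let ?G = "{FF \<inter> U | i U. i \<in> I \<and> openin (X i) U}"
  have L: "?L = topology_generated_by ?G" by (simp add: projective_limit_def FF_def)
  have "FF \<in> ?G"
  proof -
    obtain i where i: "i \<in> I" using I by blast
    have "FF = FF \<inter> topspace (X i)" using FFD[OF i] by blast
    then show ?thesis using i openin_topspace[of "X i"] by blast
  qed
  then have FG: "FF \<subseteq> \<Union>?G" by (rule Union_upper)
  have *: "\<Union>?G \<subseteq> FF"
  proof (rule Union_least)
    fix U assume "U \<in> ?G"
    then obtain i V where "U = FF \<inter> V" by blast
    then show "U \<subseteq> FF" by simp
  qed
  have top: "topspace ?L = FF" unfolding L topology_generated_by_topspace
    by (rule equalityI[OF * FG])
  have F: "fun_space.subspace FF"
    using seminorm_base_subspace[OF base] unfolding FF_def by (intro fun_space.subspace_Inter) auto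
  have qs: "seminorm_on FF q" if "q \<in> QQ" for q
    using QQE[OF that] seminorm_base_seminorm[OF base] seminorm_on_mono FFD by blast
  have ne: "QQ \<noteq> {}" using I seminorm_base_nonempty[OF base] by (auto simp: QQ_def)
  \<comment> \<open>Intersecting open sets that come from different components needs a common
    dominating seminorm. \<open>dir\<close> supplies it; for the levels it will hold because they
    form a decreasing chain.\<close>
  have dirQ: "\<exists>r\<in>QQ. \<forall>f\<in>FF. p f \<le> r f \<and> c * q f \<le> r f" if p: "p \<in> QQ" and q: "q \<in> QQ" for p q c
  proof -
    obtain i where i: "i \<in> I" "p \<in> Q i" using QQE[OF p] by blast
    obtain j where j: "j \<in> I" "q \<in> Q j" using QQE[OF q] by blast
    obtain k r where "k \<in> I" "r \<in> Q k" "\<forall>f\<in>FF. p f \<le> r f \<and> c * q f \<le> r f"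
      using dir[OF i(1) j(1) i(2) j(2), of c] unfolding FF_def by blast
    then show ?thesis using QQI by blast
  qed
  have openin: "openin ?L U \<longleftrightarrow> U \<subseteq> FF \<and> (\<forall>f\<in>U. \<exists>q\<in>QQ. {g \<in> FF. q (g - f) < 1} \<subseteq> U)" for U
  proof
    assume "openin ?L U"
    then have "generate_topology_on ?G U" unfolding L openin_topology_generated_by_iff .
    then show "U \<subseteq> FF \<and> (\<forall>f\<in>U. \<exists>q\<in>QQ. {g \<in> FF. q (g - f) < 1} \<subseteq> U)"
    proof induction
      case Empty
      show ?case by simp
    next
      case (Int U V)
      have "\<exists>q\<in>QQ. {g \<in> FF. q (g - f) < 1} \<subseteq> U \<inter> V" if f: "f \<in> U \<inter> V" for f
      proof -
        obtain p where p: "p \<in> QQ" "{g \<in> FF. p (g - f) < 1} \<subseteq> U" using Int.IH(1) f by blast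
        obtain q where q: "q \<in> QQ" "{g \<in> FF. q (g - f) < 1} \<subseteq> V" using Int.IH(2) f by blast
        obtain s where s: "s \<in> QQ" "\<And>f. f \<in> FF \<Longrightarrow> p f \<le> s f \<and> 1 * q f \<le> s f"
          using dirQ[OF p(1) q(1), of 1] by blast
        have "{g \<in> FF. s (g - f) < 1} \<subseteq> U \<inter> V"
        proof
          fix g assume g: "g \<in> {g \<in> FF. s (g - f) < 1}"
          have "f \<in> FF" using f Int.IH(1) by blast
          then have "g - f \<in> FF" using subspace_rules(4)[OF F] g by blast
          then have "p (g - f) < 1" "q (g - f) < 1" using s(2) g by fastforce+
          then show "g \<in> U \<inter> V" using p q g by blast
        qed
        then show ?thesis using s(1) by blast
      qed
      then show ?case using Int.IH by blast
    next
      case (UN K)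
      have *: "\<exists>q\<in>QQ. {g \<in> FF. q (g - f) < 1} \<subseteq> \<Union>K" if f: "f \<in> \<Union>K" for f
      proof -
        obtain V where V: "V \<in> K" "f \<in> V" using f by blast
        obtain q where q: "q \<in> QQ" "{g \<in> FF. q (g - f) < 1} \<subseteq> V" using UN.IH[OF V(1)] V(2) by blast
        then show ?thesis using Union_upper[OF V(1)] by (meson subset_trans)
      qed
      have "\<Union>K \<subseteq> FF" using UN.IH by (intro Union_least) blast
      then show ?case using * by (intro conjI ballI)
    next
      case (Basis U)
      then obtain i V where V: "i \<in> I" "openin (X i) V" "U = FF \<inter> V" by blast
      have "\<exists>q\<in>QQ. {g \<in> FF. q (g - f) < 1} \<subseteq> U" if "f \<in> U" for f
      proof -
        have "f \<in> V" using that V(3) by simp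
        then obtain q where q: "q \<in> Q i" "{g \<in> topspace (X i). q (g - f) < 1} \<subseteq> V"
          using seminorm_base_openin[OF base[OF V(1)], of V] V(2) by blast
        have "{g \<in> FF. q (g - f) < 1} \<subseteq> U" using q(2) FFD[OF V(1)] V(3) by blast
        then show ?thesis using QQI[OF V(1) q(1)] by (intro bexI[of _ q])
      qed
      then show ?case using V by blast
    qed
  next
    assume U: "U \<subseteq> FF \<and> (\<forall>f\<in>U. \<exists>q\<in>QQ. {g \<in> FF. q (g - f) < 1} \<subseteq> U)"
    show "openin ?L U"
    proof (subst openin_subopen, intro ballI)
      fix f assume f: "f \<in> U"
      then obtain q where q: "q \<in> QQ" "{g \<in> FF. q (g - f) < 1} \<subseteq> U" using U by blast
      obtain i where i: "i \<in> I" "q \<in> Q i" using QQE[OF q(1)] by blast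
      have fF: "f \<in> FF" using f U by blast
      have "openin (X i) {g \<in> topspace (X i). q (g - f) < 1}"
        using openin_seminorm_base_ball[OF base[OF i(1)] i(2)] fF FFD[OF i(1)] by blast
      moreover have "FF \<inter> {g \<in> topspace (X i). q (g - f) < 1} = {g \<in> FF. q (g - f) < 1}"
        using FFD[OF i(1)] by blast
      ultimately have "{g \<in> FF. q (g - f) < 1} \<in> ?G" using i(1) by blast
      then have "openin ?L {g \<in> FF. q (g - f) < 1}"
        unfolding L by (rule topology_generated_by_Basis)
      moreover have "f \<in> {g \<in> FF. q (g - f) < 1}"
        using fF seminorm_on_zero[OF qs[OF q(1)]] subspace_rules(1)[OF F] by simp
      ultimately show "\<exists>V. openin ?L V \<and> f \<in> V \<and> V \<subseteq> U" using q(2) by blast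
    qed
  qed
  have "seminorm_base ?L QQ"
    unfolding seminorm_base_def top using F ne qs dirQ openin by blast
  then show "seminorm_base ?L (\<Union>i\<in>I. Q i)" by (simp add: QQ_def)
  show "topspace ?L = (\<Inter>i\<in>I. topspace (X i))" using top by (simp add: FF_def)
qed

section \<open>Iterated partial derivatives\<close>

text \<open>Lists rather than multi-indices allow induction on one derivative at a time, either the
  outermost (head) or the innermost (last entry).\<close>

definition deriv_list :: "'n::finite list \<Rightarrow> (real^'n \<Rightarrow> complex) \<Rightarrow> real^'n \<Rightarrow> complex"
  where "deriv_list js f = foldr partial_deriv js f"

lemma deriv_list_simps [simp]:
  "deriv_list [] f = f" "deriv_list (j # js) f = partial_deriv j (deriv_list js f)"
  "deriv_list (ls @ js) f = deriv_list ls (deriv_list js f)"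
  by (simp_all add: deriv_list_def)

lemma smooth_iff:
  "smooth f \<longleftrightarrow> (\<forall>js. continuous_on UNIV (deriv_list js f) \<and>
    (\<forall>i x. (\<lambda>t. deriv_list js f (x + t *\<^sub>R axis i 1)) differentiable (at (0::real))))"
  by (simp add: smooth_def Let_def deriv_list_def)

lemma smooth_deriv_list:
  assumes "smooth f"
  shows "smooth (deriv_list js f)"
  unfolding smooth_iff
proof
  fix ls
  show "continuous_on UNIV (deriv_list ls (deriv_list js f)) \<and>
    (\<forall>i x. (\<lambda>t. deriv_list ls (deriv_list js f) (x + t *\<^sub>R axis i 1)) differentiable (at (0::real)))"
    using assms[unfolded smooth_iff, rule_format, of "ls @ js"] by simp
qed

lemma smooth_partial_deriv: "smooth f \<Longrightarrow> smooth (partial_deriv i f)"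
  using smooth_deriv_list[of f "[i]"] by simp

lemma smooth_continuous: "smooth f \<Longrightarrow> continuous_on UNIV f"
  unfolding smooth_iff by (metis deriv_list_simps(1))

lemma smooth_has_partial_deriv:
  assumes "smooth f"
  shows "((\<lambda>t. f (x + t *\<^sub>R axis i 1)) has_vector_derivative partial_deriv i f x) (at 0)"
  using assms[unfolded smooth_iff, rule_format, of "[]"]
  by (simp add: partial_deriv_def vector_derivative_works)

lemma smooth_has_partial_deriv_at:
  assumes "smooth f"
  shows "((\<lambda>t. f (x + t *\<^sub>R axis i 1)) has_vector_derivative partial_deriv i f (x + s *\<^sub>R axis i 1)) (at s)"
proof -
  have "((\<lambda>t. t - s) has_vector_derivative 1) (at s)"
    by (auto intro!: derivative_eq_intros)
  moreover have "((\<lambda>t. f (x + s *\<^sub>R axis i 1 + t *\<^sub>R axis i 1)) has_vector_derivative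
      partial_deriv i f (x + s *\<^sub>R axis i 1)) (at (s - s))"
    using smooth_has_partial_deriv[OF assms] by simp
  ultimately show ?thesis
    using vector_diff_chain_at[of "\<lambda>t. t - s" 1 s] by (fastforce simp: o_def algebra_simps)
qed

lemma partial_deriv_eqI:
  "((\<lambda>t. f (x + t *\<^sub>R axis i 1)) has_vector_derivative d) (at 0) \<Longrightarrow> partial_deriv i f x = d"
  by (simp add: partial_deriv_def vector_derivative_at)

text \<open>Smoothness is the largest class of continuous, partially differentiable functions closed
  under \<open>partial_deriv\<close>. Closure properties follow by exhibiting a class with these
  features.\<close>

lemma smooth_coinduct:
  assumes "P f" and step: "\<And>g. P g \<Longrightarrow> continuous_on UNIV g \<and>
    (\<forall>i x. \<exists>d. ((\<lambda>t. g (x + t *\<^sub>R axis i 1)) has_vector_derivative d) (at 0)) \<and> (\<forall>i. P (partial_deriv i g))"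
  shows "smooth f"
proof -
  have "P (deriv_list js f)" for js
    by (induction js) (use assms in auto)
  then show ?thesis unfolding smooth_iff using step by (meson differentiableI_vector)
qed

lemma partial_deriv_add:
  assumes "smooth f" "smooth g"
  shows "partial_deriv i (f + g) = partial_deriv i f + partial_deriv i g"
proof
  fix x
  show "partial_deriv i (f + g) x = (partial_deriv i f + partial_deriv i g) x"
    using has_vector_derivative_add[OF assms[THEN smooth_has_partial_deriv, of x i]]
    by (intro partial_deriv_eqI) simp
qed

lemma partial_deriv_fscale:
  assumes "smooth f"
  shows "partial_deriv i (fscale c f) = fscale c (partial_deriv i f)"
proof
  fix x
  show "partial_deriv i (fscale c f) x = fscale c (partial_deriv i f) x"
    using has_vector_derivative_mult_right[OF smooth_has_partial_deriv[OF assms], of c x i]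
    by (intro partial_deriv_eqI) (simp add: fscale_def)
qed

lemma partial_deriv_mult:
  assumes "smooth f" "smooth g"
  shows "partial_deriv i (f * g) = partial_deriv i f * g + f * partial_deriv i g"
proof
  fix x
  show "partial_deriv i (f * g) x = (partial_deriv i f * g + f * partial_deriv i g) x"
    using has_vector_derivative_mult[OF assms[THEN smooth_has_partial_deriv, of x i]]
    by (intro partial_deriv_eqI) (simp add: algebra_simps)
qed

lemma smooth_add:
  assumes "smooth f" "smooth g"
  shows "smooth (f + g)"
proof (rule smooth_coinduct[where P="\<lambda>h. \<exists>u v. smooth u \<and> smooth v \<and> h = u + v"])
  show "\<exists>u v. smooth u \<and> smooth v \<and> f + g = u + v" using assms by blast
  fix h :: "real^'a \<Rightarrow> complex" assume "\<exists>u v. smooth u \<and> smooth v \<and> h = u + v"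
  then obtain u v where h: "smooth u" "smooth v" "h = u + v" by blast
  have "continuous_on UNIV h"
    unfolding h(3) plus_fun_def using h by (intro continuous_on_add smooth_continuous)
  moreover have "((\<lambda>t. h (x + t *\<^sub>R axis i 1)) has_vector_derivative partial_deriv i u x + partial_deriv i v x) (at 0)" for i x
    unfolding h(3) plus_fun_def using h by (intro has_vector_derivative_add smooth_has_partial_deriv)
  ultimately show "continuous_on UNIV h \<and>
    (\<forall>i x. \<exists>d. ((\<lambda>t. h (x + t *\<^sub>R axis i 1)) has_vector_derivative d) (at 0)) \<and>
    (\<forall>i. \<exists>u v. smooth u \<and> smooth v \<and> partial_deriv i h = u + v)"
    using h by (metis partial_deriv_add smooth_partial_deriv)
qed

lemma smooth_fscale:
  assumes "smooth f"
  shows "smooth (fscale c f)"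
proof (rule smooth_coinduct[where P="\<lambda>h. \<exists>u. smooth u \<and> h = fscale c u"])
  show "\<exists>u. smooth u \<and> fscale c f = fscale c u" using assms by blast
  fix h :: "real^'a \<Rightarrow> complex" assume "\<exists>u. smooth u \<and> h = fscale c u"
  then obtain u where h: "smooth u" "h = fscale c u" by blast
  have "continuous_on UNIV h"
    unfolding h(2) fscale_def using h by (intro continuous_intros smooth_continuous)
  moreover have "((\<lambda>t. h (x + t *\<^sub>R axis i 1)) has_vector_derivative c * partial_deriv i u x) (at 0)" for i x
    unfolding h(2) fscale_def using h by (intro has_vector_derivative_mult_right smooth_has_partial_deriv)
  ultimately show "continuous_on UNIV h \<and>
    (\<forall>i x. \<exists>d. ((\<lambda>t. h (x + t *\<^sub>R axis i 1)) has_vector_derivative d) (at 0)) \<and>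
    (\<forall>i. \<exists>u. smooth u \<and> partial_deriv i h = fscale c u)"
    using h by (metis partial_deriv_fscale smooth_partial_deriv)
qed

text \<open>The derivative of a product is a sum of two products, so a class suitable for
  \<open>smooth_coinduct\<close> has to be closed under sums.\<close>

inductive sum_of_smooth_products :: "(real^'n::finite \<Rightarrow> complex) \<Rightarrow> bool" where
  product: "smooth u \<Longrightarrow> smooth v \<Longrightarrow> sum_of_smooth_products (u * v)"
| add: "sum_of_smooth_products f \<Longrightarrow> sum_of_smooth_products g \<Longrightarrow> sum_of_smooth_products (f + g)"

lemma smooth_mult:
  assumes "smooth f" "smooth g"
  shows "smooth (f * g)"
proof (rule smooth_coinduct[where P=sum_of_smooth_products])
  show "sum_of_smooth_products (f * g)" using assms by (rule product)
  fix h :: "real^'a \<Rightarrow> complex" assume "sum_of_smooth_products h"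
  then show "continuous_on UNIV h \<and>
    (\<forall>i x. \<exists>d. ((\<lambda>t. h (x + t *\<^sub>R axis i 1)) has_vector_derivative d) (at 0)) \<and>
    (\<forall>i. sum_of_smooth_products (partial_deriv i h))"
  proof induction
    case (product u v)
    have "continuous_on UNIV (u * v)"
      unfolding times_fun_def using product by (intro continuous_on_mult smooth_continuous)
    moreover have "((\<lambda>t. (u * v) (x + t *\<^sub>R axis i 1)) has_vector_derivative
        u (x + 0 *\<^sub>R axis i 1) * partial_deriv i v x + partial_deriv i u x * v (x + 0 *\<^sub>R axis i 1)) (at 0)" for i x
      unfolding times_fun_def using product by (intro has_vector_derivative_mult smooth_has_partial_deriv)
    moreover have "sum_of_smooth_products (partial_deriv i (u * v))" for i
      unfolding partial_deriv_mult[OF product]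
      using product by (intro sum_of_smooth_products.intros smooth_partial_deriv)
    ultimately show ?case by blast
  next
    case (add u v)
    have d: "\<exists>d. ((\<lambda>t. (u + v) (x + t *\<^sub>R axis i 1)) has_vector_derivative d) (at 0) \<and>
        partial_deriv i (u + v) x = partial_deriv i u x + partial_deriv i v x" for i x
    proof -
      obtain a b where a: "((\<lambda>t. u (x + t *\<^sub>R axis i 1)) has_vector_derivative a) (at 0)"
        and b: "((\<lambda>t. v (x + t *\<^sub>R axis i 1)) has_vector_derivative b) (at 0)" using add by meson
      from a b have ab: "((\<lambda>t. (u + v) (x + t *\<^sub>R axis i 1)) has_vector_derivative a + b) (at 0)"
        unfolding plus_fun_def by (rule has_vector_derivative_add)
      then show ?thesis
        unfolding partial_deriv_eqI[OF a] partial_deriv_eqI[OF b] partial_deriv_eqI[OF ab] by blast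
    qed
    have "continuous_on UNIV (u + v)" unfolding plus_fun_def using add by (intro continuous_on_add) auto
    moreover have "partial_deriv i (u + v) = partial_deriv i u + partial_deriv i v" for i
      using d by (auto simp: fun_eq_iff simp del: plus_fun_apply simp: plus_fun_def)
    ultimately show ?case using d add sum_of_smooth_products.add by metis
  qed
qed

lemma deriv_list_add:
  assumes "smooth f" "smooth g"
  shows "deriv_list js (f + g) = deriv_list js f + deriv_list js g"
  using assms by (induction js) (simp_all add: partial_deriv_add smooth_deriv_list)

lemma deriv_list_fscale: "smooth f \<Longrightarrow> deriv_list js (fscale c f) = fscale c (deriv_list js f)"
  by (induction js) (simp_all add: partial_deriv_fscale smooth_deriv_list)

lemma deriv_list_diff:
  assumes "smooth f" "smooth g"
  shows "smooth (f - g)" "deriv_list js (f - g) = deriv_list js f - deriv_list js g"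
proof -
  have *: "u - v = u + fscale (-1) v" for u v :: "real^'a \<Rightarrow> complex" by (simp add: fscale_minus_one)
  show "smooth (f - g)" unfolding * using assms by (intro smooth_add smooth_fscale)
  show "deriv_list js (f - g) = deriv_list js f - deriv_list js g"
    unfolding * using assms by (simp only: deriv_list_add deriv_list_fscale smooth_fscale)
qed

lemma smooth_zero: "smooth (0 :: real^'n::finite \<Rightarrow> complex)"
  and deriv_list_zero: "deriv_list js (0 :: real^'n::finite \<Rightarrow> complex) = 0"
proof -
  have *: "partial_deriv i (0 :: real^'n \<Rightarrow> complex) = 0" for i
  proof
    show "partial_deriv i (0 :: real^'n \<Rightarrow> complex) x = 0 x" for x
      by (rule partial_deriv_eqI) simp
  qed
  show "smooth (0 :: real^'n \<Rightarrow> complex)"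
  proof (rule smooth_coinduct[where P="\<lambda>h. h = 0"])
    fix h :: "real^'n \<Rightarrow> complex" assume h: "h = 0"
    have "continuous_on UNIV h" unfolding h zero_fun_def by simp
    moreover have "((\<lambda>t. h (x + t *\<^sub>R axis i 1)) has_vector_derivative 0) (at 0)" for i x
      unfolding h by simp
    ultimately show "continuous_on UNIV h \<and>
      (\<forall>i x. \<exists>d. ((\<lambda>t. h (x + t *\<^sub>R axis i 1)) has_vector_derivative d) (at 0)) \<and>
      (\<forall>i. partial_deriv i h = 0)" using * h by blast
  qed simp
  show "deriv_list js (0 :: real^'n \<Rightarrow> complex) = 0" by (induction js) (simp_all add: * del: zero_fun_apply)
qed

text \<open>
  Restricting to a class \<open>P\<close> of derivatives that is closed under deleting entries allows one to
  keep the fixed order of differentiation, so that no symmetry of mixed derivatives is needed.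
\<close>

lemma deriv_list_mult_bound:
  fixes f g :: "real^'n::finite \<Rightarrow> complex" and v :: "nat \<Rightarrow> real"
  assumes smooth: "smooth f" "smooth g"
    and P: "\<And>ls j js. P (ls @ j # js) \<Longrightarrow> P (ls @ js)"
    and v: "\<And>k. 0 \<le> v k" "\<And>k l. v (k + l) \<le> v k * v l"
    and f: "\<And>js. P js \<Longrightarrow> cmod (deriv_list js f x) * v (length js) \<le> A"
    and g: "\<And>js. P js \<Longrightarrow> cmod (deriv_list js g x) * v (length js) \<le> B"
    and "P ls"
  shows "cmod (deriv_list ls (f * g) x) * v (length ls) \<le> 2 ^ length ls * (A * B)"
proof -
  \<comment> \<open>Generalized so that derivatives already moved onto the factors are recorded in
    \<open>js\<close> and \<open>ks\<close>. Each remaining derivative in \<open>ls\<close> splits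
    into two terms, and \<open>v\<close> counts the total order.\<close>
  have "cmod (deriv_list ls (deriv_list js f * deriv_list ks g) x) * v (length ls + length js + length ks)
      \<le> 2 ^ length ls * (A * B)" if "P (ls @ js)" "P (ls @ ks)" for js ks
    using that
  proof (induction "ls" arbitrary: js ks rule: rev_induct)
    case Nil
    have "cmod ((deriv_list js f * deriv_list ks g) x) * v (length js + length ks) \<le>
        cmod (deriv_list js f x) * cmod (deriv_list ks g x) * (v (length js) * v (length ks))"
      using v by (auto simp: norm_mult intro!: mult_left_mono)
    also have "\<dots> = (cmod (deriv_list js f x) * v (length js)) * (cmod (deriv_list ks g x) * v (length ks))"
      by simp
    also have "\<dots> \<le> A * B"
      using Nil f[of js] g[of ks] v by (intro mult_mono) (auto intro: order_trans[rotated])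
    finally show ?case by simp
  next
    case (snoc i "ls")
    let ?u = "deriv_list js f" and ?w = "deriv_list ks g"
    have sm: "smooth ?u" "smooth ?w" using smooth by (simp_all add: smooth_deriv_list)
    have 1: "cmod (deriv_list ls (partial_deriv i ?u * ?w) x) * v (Suc (length ls + length js + length ks))
        \<le> 2 ^ length ls * (A * B)"
      using snoc.IH[of "i # js" ks] snoc.prems P[of "ls" i ks] by (simp del: times_fun_apply)
    have 2: "cmod (deriv_list ls (?u * partial_deriv i ?w) x) * v (Suc (length ls + length js + length ks))
        \<le> 2 ^ length ls * (A * B)"
      using snoc.IH[of js "i # ks"] snoc.prems P[of "ls" i js] by (simp del: times_fun_apply)
    have "deriv_list (ls @ [i]) (?u * ?w) x =
        deriv_list ls (partial_deriv i ?u * ?w) x + deriv_list ls (?u * partial_deriv i ?w) x"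
      using sm by (simp add: partial_deriv_mult deriv_list_add smooth_mult smooth_partial_deriv)
    then have "cmod (deriv_list (ls @ [i]) (?u * ?w) x) * v (Suc (length ls + length js + length ks)) \<le>
        (cmod (deriv_list ls (partial_deriv i ?u * ?w) x) + cmod (deriv_list ls (?u * partial_deriv i ?w) x)) *
        v (Suc (length ls + length js + length ks))"
      using v(1) by (simp add: mult_right_mono norm_triangle_ineq)
    also have "\<dots> \<le> 2 ^ length (ls @ [i]) * (A * B)"
      using 1 2 by (simp add: algebra_simps)
    finally show ?case by (simp del: times_fun_apply)
  qed
  from this[of "[]" "[]"] show ?thesis using \<open>P ls\<close> by simp
qed

text \<open>\<open>H i k\<close> stands for the k-th derivative of the i-th factor. A derivative in
  direction i raises one index, so the class of such products is closed under
  \<open>partial_deriv\<close>.\<close>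

lemma smooth_product_of_coordinates:
  fixes H :: "'n::finite \<Rightarrow> nat \<Rightarrow> real \<Rightarrow> complex"
  assumes H: "\<And>i k t. (H i k has_vector_derivative H i (Suc k) t) (at t)"
  shows "smooth (\<lambda>x. \<Prod>i\<in>UNIV. H i 0 (x $ i))"
    and "deriv_list js (\<lambda>x. \<Prod>i\<in>UNIV. H i 0 (x $ i)) = (\<lambda>x. \<Prod>i\<in>UNIV. H i (count_list js i) (x $ i))"
proof -
  let ?G = "\<lambda>a x. \<Prod>i\<in>UNIV. H i (a i) (x $ i)"
  have d: "((\<lambda>t. ?G a (x + t *\<^sub>R axis j 1)) has_vector_derivative ?G (a(j := Suc (a j))) x) (at 0)" for a j x
  proof -
    define c where "c = (\<Prod>i\<in>UNIV - {j}. H i (a i) (x $ i))"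
    have 1: "?G a (x + t *\<^sub>R axis j 1) = H j (a j) (x $ j + t) * c" for t
      unfolding c_def by (subst prod.remove[of _ j]) (auto simp: axis_def intro!: prod.cong)
    have 2: "?G (a(j := Suc (a j))) x = H j (Suc (a j)) (x $ j) * c"
      unfolding c_def by (subst prod.remove[of _ j]) (auto intro!: prod.cong)
    have "((\<lambda>t. x $ j + t) has_vector_derivative 1) (at 0)" by (auto intro!: derivative_eq_intros)
    from vector_diff_chain_at[OF this, of "H j (a j)" "H j (Suc (a j)) (x $ j)"] H[of j "a j" "x $ j"]
    have "((\<lambda>t. H j (a j) (x $ j + t)) has_vector_derivative H j (Suc (a j)) (x $ j)) (at 0)"
      by (simp add: o_def)
    then show ?thesis unfolding 1 2 by (rule has_vector_derivative_mult_left)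
  qed
  have pd: "partial_deriv j (?G a) = ?G (a(j := Suc (a j)))" for a j
    by (rule ext, rule partial_deriv_eqI, rule d)
  have cont: "continuous_on UNIV (?G a)" for a
  proof (intro continuous_on_prod)
    fix i
    have "continuous_on UNIV (H i (a i))"
      using H by (meson continuous_at_imp_continuous_on has_vector_derivative_continuous)
    then show "continuous_on UNIV (\<lambda>x. H i (a i) (x $ i))"
      by (rule continuous_on_compose2) (auto intro!: continuous_intros)
  qed
  show "smooth (\<lambda>x. \<Prod>i\<in>UNIV. H i 0 (x $ i))"
  proof (rule smooth_coinduct[where P="\<lambda>h. \<exists>a. h = ?G a"])
    show "\<exists>a. (\<lambda>x. \<Prod>i\<in>UNIV. H i 0 (x $ i)) = ?G a" by (intro exI[of _ "\<lambda>_. 0"]) simp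
    fix h assume "\<exists>a. h = ?G a"
    then obtain a where "h = ?G a" by blast
    then show "continuous_on UNIV h \<and>
      (\<forall>i x. \<exists>d. ((\<lambda>t. h (x + t *\<^sub>R axis i 1)) has_vector_derivative d) (at 0)) \<and>
      (\<forall>i. \<exists>a. partial_deriv i h = ?G a)"
      using cont d pd by blast
  qed
  have "deriv_list js (?G (\<lambda>_. 0)) = ?G (count_list js)"
  proof (induction js)
    case (Cons j js)
    have "count_list (j # js) = (count_list js)(j := Suc (count_list js j))" by (auto simp: fun_eq_iff)
    then show ?case unfolding deriv_list_simps(2) Cons.IH pd by (rule ssubst) (rule refl)
  qed simp
  then show "deriv_list js (\<lambda>x. \<Prod>i\<in>UNIV. H i 0 (x $ i)) = (\<lambda>x. \<Prod>i\<in>UNIV. H i (count_list js i) (x $ i))"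
    by simp
qed

subsection \<open>Multi-indices as ordered lists of coordinates\<close>

definition coordinate_index :: "'n::finite \<Rightarrow> nat"
  where "coordinate_index i = (SOME k. k < length (coordinates :: 'n list) \<and> coordinates ! k = i)"

text \<open>Sorted in the order in which \<open>multi_deriv\<close> differentiates: exactly the
  lists that come from multi-indices. The class is closed under deleting entries, as the Leibniz
  estimate requires.\<close>

definition ordered_list :: "'n::finite list \<Rightarrow> bool"
  where "ordered_list js \<longleftrightarrow> sorted (map coordinate_index js)"

definition list_of_index :: "('n::finite \<Rightarrow> nat) \<Rightarrow> 'n list"
  where "list_of_index \<alpha> = concat (map (\<lambda>i. replicate (\<alpha> i) i) coordinates)"

lemma coordinates: "distinct (coordinates :: 'n::finite list)" "set (coordinates :: 'n list) = UNIV"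
proof -
  have "\<exists>xs :: 'n list. distinct xs \<and> set xs = UNIV"
    using finite_distinct_list[of "UNIV :: 'n set"] by auto
  from someI_ex[OF this] show "distinct (coordinates :: 'n list)" "set (coordinates :: 'n list) = UNIV"
    unfolding coordinates_def by auto
qed

lemma coordinate_index:
  fixes i :: "'n::finite"
  shows "coordinate_index i < length (coordinates :: 'n list)" "coordinates ! coordinate_index i = i"
proof -
  have "\<exists>k. k < length (coordinates :: 'n list) \<and> coordinates ! k = i"
    using coordinates(2) by (metis UNIV_I in_set_conv_nth)
  from someI_ex[OF this] show "coordinate_index i < length (coordinates :: 'n list)"
    "coordinates ! coordinate_index i = i" unfolding coordinate_index_def by auto
qed

lemma inj_coordinate_index: "inj_on coordinate_index A"
  by (metis coordinate_index(2) inj_onI)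

lemma map_coordinate_index: "map coordinate_index (coordinates :: 'n::finite list) = [0..<length (coordinates :: 'n list)]"
  by (rule nth_equalityI) (simp, simp, metis coordinate_index coordinates(1) nth_eq_iff_index_eq)

lemma ordered_list_of_index: "ordered_list (list_of_index \<alpha>)"
proof -
  have "sorted (map f (concat (map (\<lambda>i. replicate (\<alpha> i) i) xs)))" if "sorted (map f xs)" for f :: "'a \<Rightarrow> nat" and xs
    using that by (induction xs) (auto simp: sorted_append map_concat)
  then show ?thesis unfolding ordered_list_def list_of_index_def
    using map_coordinate_index by (metis sorted_upt)
qed

lemma count_list_of_index: "count_list (list_of_index \<alpha>) i = \<alpha> i"
proof -
  have *: "count_list (concat (map (\<lambda>i. replicate (\<alpha> i) i) xs)) i = (if i \<in> set xs then \<alpha> i else 0)"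
    if "distinct xs" for xs
  proof -
    have r: "count_list (replicate n j) i = (if i = j then n else 0)" for n j by (induction n) auto
    show ?thesis using that by (induction xs) (auto simp: r)
  qed
  then show ?thesis unfolding list_of_index_def *[OF coordinates(1)] by (simp add: coordinates(2))
qed

lemma list_of_index_count:
  assumes "ordered_list js"
  shows "list_of_index (count_list js) = js"
proof -
  \<comment> \<open>Two sorted lists with the same multiset agree, because the sorting key is
    injective.\<close>
  have "mset js = mset (list_of_index (count_list js))"
    by (rule multiset_eqI) (metis count_list_of_index count_mset)
  from sort_key_inj_key_eq[OF this inj_coordinate_index ordered_list_of_index[unfolded ordered_list_def]]
  have "sort_key coordinate_index js = list_of_index (count_list js)" .
  moreover have "sort_key coordinate_index js = js"
    using assms by (intro sort_key_inj_key_eq inj_coordinate_index) (auto simp: ordered_list_def)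
  ultimately show ?thesis by simp
qed

lemma length_list_of_index: "length (list_of_index \<alpha>) = (\<Sum>i\<in>UNIV. \<alpha> i)"
  by (simp add: list_of_index_def length_concat o_def sum_list_distinct_conv_sum_set coordinates)

lemma multi_deriv_eq: "multi_deriv \<alpha> f = deriv_list (list_of_index \<alpha>) f"
proof -
  have "foldr (\<lambda>i. partial_deriv i ^^ \<alpha> i) xs f = foldr partial_deriv (concat (map (\<lambda>i. replicate (\<alpha> i) i) xs)) f" for xs
  proof (induction xs)
    case (Cons j xs)
    have "(partial_deriv j ^^ n) g = foldr partial_deriv (replicate n j) g" for n g
      by (induction n) auto
    then show ?case using Cons by simp
  qed simp
  then show ?thesis by (simp add: multi_deriv_def deriv_list_def list_of_index_def)
qed

text \<open>Multi-indices and ordered lists are in bijection, with the order of the derivative as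
  length; all later estimates run over ordered lists.\<close>

lemma all_multi_deriv_iff:
  "(\<forall>\<alpha>. R (multi_deriv \<alpha> f) (\<Sum>i\<in>UNIV. \<alpha> i)) \<longleftrightarrow> (\<forall>js. ordered_list js \<longrightarrow> R (deriv_list js f) (length js))"
  by (metis length_list_of_index list_of_index_count multi_deriv_eq ordered_list_of_index)

lemma ordered_list_delete: "ordered_list (ls @ j # js) \<Longrightarrow> ordered_list (ls @ js)"
  by (auto simp: ordered_list_def sorted_append)

lemma ordered_list_suffix: "ordered_list (ls @ js) \<Longrightarrow> ordered_list js"
  by (auto simp: ordered_list_def sorted_append)

lemma ordered_list_Nil: "ordered_list []" and ordered_list_replicate: "ordered_list (replicate k i)"
  by (simp_all add: ordered_list_def)

section \<open>Weight functions\<close>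

text \<open>This is \<open>exp (- m \<phi>\<^sup>*(k / m))\<close>, written as an infimum over \<open>r = e\<^sup>t\<close> to avoid infinite values.\<close>

definition weight_coeff :: "(real \<Rightarrow> real) \<Rightarrow> nat \<Rightarrow> nat \<Rightarrow> real"
  where "weight_coeff \<omega> m k = (INF r\<in>{1..}. exp (real m * \<omega> r) / r ^ k)"

text \<open>For m \<ge> 1 this is \<open>seminorm_r \<omega> m n f \<le> ereal A\<close> freed of
  extended reals, see \<open>seminorm_r_le_iff\<close>.\<close>

definition deriv_bound :: "(real \<Rightarrow> real) \<Rightarrow> nat \<Rightarrow> nat \<Rightarrow> real \<Rightarrow> (real^'n::finite \<Rightarrow> complex) \<Rightarrow> bool"
  where "deriv_bound \<omega> m n A f \<longleftrightarrow> (\<forall>js x. ordered_list js \<longrightarrow>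
    cmod (deriv_list js f x) * weight_coeff \<omega> m (length js) \<le> A * exp (real n * \<omega> (norm x)))"

locale weight_function =
  fixes \<omega> :: "real \<Rightarrow> real"
  assumes weight: "nonquasianalytic_weight \<omega>"
begin

lemma weight_mono: "0 \<le> s \<Longrightarrow> s \<le> t \<Longrightarrow> \<omega> s \<le> \<omega> t"
  using weight by (auto simp: nonquasianalytic_weight_def mono_on_def)

lemma weight_nonneg: "0 \<le> t \<Longrightarrow> 0 \<le> \<omega> t"
  using weight by (auto simp: nonquasianalytic_weight_def)

lemma weight_zero: "0 \<le> t \<Longrightarrow> t \<le> 1 \<Longrightarrow> \<omega> t = 0"
  using weight by (auto simp: nonquasianalytic_weight_def)

lemma weight_log_growth: "\<exists>a b. b > 0 \<and> (\<forall>t\<ge>0. \<omega> t \<ge> a + b * ln (1 + t))"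
  using weight by (auto simp: nonquasianalytic_weight_def)

text \<open>An integer constant for condition (\<alpha>), so that it can multiply the indices m and
  n.\<close>

definition doubling :: nat
  where "doubling = (SOME K. K \<ge> 1 \<and> (\<forall>t\<ge>0. \<omega> (2 * t) \<le> real K * (1 + \<omega> t)))"

lemma doubling_ge_one: "doubling \<ge> 1"
  and weight_double: "0 \<le> t \<Longrightarrow> \<omega> (2 * t) \<le> real doubling * (1 + \<omega> t)"
proof -
  obtain K :: real where K: "K \<ge> 1" "\<And>t. t \<ge> 0 \<Longrightarrow> \<omega> (2 * t) \<le> K * (1 + \<omega> t)"
    using weight by (auto simp: nonquasianalytic_weight_def)
  have "\<omega> (2 * t) \<le> real (nat \<lceil>K\<rceil>) * (1 + \<omega> t)" if t: "t \<ge> 0" for t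
  proof -
    have "\<omega> (2 * t) \<le> K * (1 + \<omega> t)" using K t by simp
    also have "\<dots> \<le> real (nat \<lceil>K\<rceil>) * (1 + \<omega> t)" using weight_nonneg[OF t] by (intro mult_right_mono real_nat_ceiling_ge) auto
    finally show ?thesis .
  qed
  moreover have "nat \<lceil>K\<rceil> \<ge> 1" using K by linarith
  ultimately have "\<exists>K::nat. K \<ge> 1 \<and> (\<forall>t\<ge>0. \<omega> (2 * t) \<le> real K * (1 + \<omega> t))" by blast
  from someI_ex[OF this]
  show "doubling \<ge> 1" "0 \<le> t \<Longrightarrow> \<omega> (2 * t) \<le> real doubling * (1 + \<omega> t)"
    unfolding doubling_def by auto
qed

lemma weight_add_le:
  assumes "0 \<le> s" "0 \<le> t"
  shows "\<omega> (s + t) \<le> real doubling * (1 + \<omega> s + \<omega> t)"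
proof -
  have "\<omega> (s + t) \<le> \<omega> (2 * max s t)" using assms by (intro weight_mono) auto
  also have "\<dots> \<le> real doubling * (1 + \<omega> (max s t))" using assms by (intro weight_double) auto
  also have "\<dots> \<le> real doubling * (1 + \<omega> s + \<omega> t)"
    using weight_nonneg assms by (intro mult_left_mono) (auto simp: max_def)
  finally show ?thesis .
qed

lemma weight_norm_add_le:
  "\<omega> (norm (x + y)) \<le> real doubling * (1 + \<omega> (norm x) + \<omega> (norm y))"
  using weight_mono[OF norm_ge_zero norm_triangle_ineq] weight_add_le[OF norm_ge_zero norm_ge_zero]
  by (rule order_trans)

text \<open>By monotonicity the integrand of (\<beta>) is at least \<omega>(t) / (5 t^2) on [t, 2t],
  because 1 + s^2 \<le> 5 t^2 there when t \<ge> 1. The interval has length t, so the finite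
  integral bounds \<omega>(t) / t.\<close>

lemma weight_linear_bound: "\<exists>H\<ge>0. \<forall>t\<ge>0. \<omega> t \<le> H * (1 + t)"
proof -
  let ?f = "\<lambda>t. \<omega> t / (1 + t\<^sup>2)"
  have int: "set_integrable lborel {1..} ?f"
    using weight by (simp add: nonquasianalytic_weight_def)
  define J where "J = set_lebesgue_integral lborel {1..} ?f"
  have J0: "J \<ge> 0"
    unfolding J_def set_lebesgue_integral_def
    by (rule Bochner_Integration.integral_nonneg) (auto simp: indicator_def intro!: divide_nonneg_nonneg weight_nonneg)
  have bound: "\<omega> t \<le> 5 * J * t" if t: "t \<ge> 1" for t
  proof -
    have sub: "set_integrable lborel {t..2*t} ?f"
      using int by (rule set_integrable_subset) (use t in auto)
    have c: "set_integrable lborel {t..2*t} (\<lambda>_. \<omega> t / (5 * t\<^sup>2))"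
      unfolding set_integrable_def by (intro integrable_scaleR_left integrable_real_indicator) (auto simp: emeasure_lborel_Icc_eq)
    have "t * (\<omega> t / (5 * t\<^sup>2)) = set_lebesgue_integral lborel {t..2*t} (\<lambda>_. \<omega> t / (5 * t\<^sup>2))"
      using t by (simp add: set_lebesgue_integral_def)
    also have "\<dots> \<le> set_lebesgue_integral lborel {t..2*t} ?f"
    proof (rule set_integral_mono[OF c sub])
      fix s assume s: "s \<in> {t..2*t}"
      have "s\<^sup>2 \<le> (2 * t)\<^sup>2" using s t by (intro power_mono) auto
      moreover have "1 \<le> t\<^sup>2" using t by simp
      ultimately have "1 + s\<^sup>2 \<le> 5 * t\<^sup>2" by (simp add: power_mult_distrib)
      then show "\<omega> t / (5 * t\<^sup>2) \<le> ?f s"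
        using s t by (intro frac_le weight_mono weight_nonneg) (auto simp: add_pos_nonneg)
    qed
    also have "\<dots> \<le> J"
      unfolding J_def set_lebesgue_integral_def
      using sub int t by (intro integral_mono)
        (auto simp: set_integrable_def indicator_def intro!: divide_nonneg_nonneg weight_nonneg)
    finally show ?thesis using t by (simp add: field_simps power2_eq_square)
  qed
  have "\<omega> t \<le> 5 * J * (1 + t)" if t: "t \<ge> 0" for t
  proof (cases "t \<ge> 1")
    case True
    then show ?thesis using bound[OF True] J0 by (simp add: algebra_simps)
  next
    case False
    then show ?thesis using weight_zero[OF t] J0 t by simp
  qed
  then show ?thesis using J0 by (intro exI[of _ "5 * J"]) auto
qed

section \<open>Calculus of the coefficients \<open>v m k\<close>\<close>

abbreviation "v \<equiv> weight_coeff \<omega>"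

lemma weight_coeff_le: "1 \<le> r \<Longrightarrow> v m k \<le> exp (real m * \<omega> r) / r ^ k"
  unfolding weight_coeff_def by (rule cINF_lower) (auto intro!: bdd_belowI2[of _ 0])

lemma weight_coeff_ge: "(\<And>r. 1 \<le> r \<Longrightarrow> c \<le> exp (real m * \<omega> r) / r ^ k) \<Longrightarrow> c \<le> v m k"
  unfolding weight_coeff_def by (rule cINF_greatest) auto

lemma weight_coeff_nonneg: "0 \<le> v m k"
  by (rule weight_coeff_ge) simp

lemma weight_coeff_le_one: "v m k \<le> 1"
  using weight_coeff_le[of 1 m k] weight_zero[of 1] by simp

lemma weight_coeff_0: "v m 0 = 1"
  by (intro antisym weight_coeff_le_one weight_coeff_ge) (simp add: weight_nonneg)

lemma weight_coeff_mono: "m \<le> m' \<Longrightarrow> v m k \<le> v m' k"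
proof (rule weight_coeff_ge)
  fix r :: real assume m: "m \<le> m'" and r: "1 \<le> r"
  have "real m * \<omega> r \<le> real m' * \<omega> r" using m r weight_nonneg[of r] by (intro mult_right_mono) auto
  then have *: "exp (real m * \<omega> r) \<le> exp (real m' * \<omega> r)" by simp
  have "v m k \<le> exp (real m * \<omega> r) / r ^ k" using r by (rule weight_coeff_le)
  also have "\<dots> \<le> exp (real m' * \<omega> r) / r ^ k"
    using * r by (intro divide_right_mono) auto
  finally show "v m k \<le> exp (real m' * \<omega> r) / r ^ k" .
qed

text \<open>Given radii r and s for the two factors, the infimum for k + l is tested at the larger
  one: its exponent is at most the sum of both since \<omega> \<ge> 0, and r^k s^l is at most its
  power of order k + l.\<close>

lemma weight_coeff_submult: "v m (k + l) \<le> v m k * v m l"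
proof -
  have *: "v m (k + l) \<le> (exp (real m * \<omega> r) / r ^ k) * (exp (real m * \<omega> s) / s ^ l)"
    if r: "1 \<le> r" and s: "1 \<le> s" for r s
  proof -
    define t where "t = max r s"
    have t: "1 \<le> t" "r \<le> t" "s \<le> t" "t = r \<or> t = s" using r by (auto simp: t_def)
    have "v m (k + l) \<le> exp (real m * \<omega> t) / t ^ (k + l)" using t by (intro weight_coeff_le)
    also have "\<dots> \<le> exp (real m * \<omega> r + real m * \<omega> s) / (r ^ k * s ^ l)"
    proof (rule frac_le)
      show "exp (real m * \<omega> t) \<le> exp (real m * \<omega> r + real m * \<omega> s)"
      proof -
        have "0 \<le> real m * \<omega> r" "0 \<le> real m * \<omega> s" using r s weight_nonneg by simp_all
        then show ?thesis using t(4) by (elim disjE) simp_all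
      qed
      show "r ^ k * s ^ l \<le> t ^ (k + l)" unfolding power_add
        using r s t by (intro mult_mono power_mono) auto
    qed (use r s in auto)
    finally show ?thesis by (simp add: exp_add)
  qed
  \<comment> \<open>The infima are taken one after the other: first over r with s fixed, then over
    s. The second division is by \<open>v m k\<close>, hence the separate case of a zero
    coefficient.\<close>
  have "v m (k + l) / (exp (real m * \<omega> s) / s ^ l) \<le> v m k" if s: "1 \<le> s" for s
    by (rule weight_coeff_ge) (use *[OF _ s] s in \<open>simp add: field_simps\<close>)
  then have **: "v m (k + l) \<le> v m k * (exp (real m * \<omega> s) / s ^ l)" if s: "1 \<le> s" for s
    using s by (simp add: field_simps)
  show ?thesis
  proof (cases "v m k = 0")
    case True
    then show ?thesis using **[of 1] weight_zero[of 1] by simp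
  next
    case False
    then have pos: "v m k > 0" using weight_coeff_nonneg[of m k] by simp
    have "v m (k + l) / v m k \<le> v m l"
      by (rule weight_coeff_ge) (use ** pos in \<open>simp add: field_simps\<close>)
    then show ?thesis using pos by (simp add: field_simps)
  qed
qed

lemma weight_coeff_pos_mono: "0 < v m k \<Longrightarrow> j \<le> k \<Longrightarrow> 0 < v m j"
  using weight_coeff_submult[of m j "k - j"] weight_coeff_nonneg[of m j]
  by (cases "v m j = 0") auto

text \<open>Testing the infimum at 2r instead of r gains 2^k and replaces \<omega>(r) by
  \<omega>(2r). This absorbs the Leibniz factor 2^k whenever functions are multiplied.\<close>

lemma weight_coeff_doubling: "2 ^ k * v m k \<le> exp (real (doubling * m)) * v (doubling * m) k"
proof -
  have "2 ^ k * v m k / exp (real (doubling * m)) \<le> v (doubling * m) k"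
  proof (rule weight_coeff_ge)
    fix r :: real assume r: "1 \<le> r"
    have "2 ^ k * v m k \<le> 2 ^ k * (exp (real m * \<omega> (2 * r)) / (2 * r) ^ k)"
      using r by (intro mult_left_mono weight_coeff_le) auto
    also have "\<dots> = exp (real m * \<omega> (2 * r)) / r ^ k" by (simp add: power_mult_distrib)
    also have "\<dots> \<le> exp (real m * (real doubling * (1 + \<omega> r))) / r ^ k"
      using r weight_double[of r] by (intro divide_right_mono) (auto intro!: mult_left_mono)
    also have "\<dots> = exp (real (doubling * m)) * (exp (real (doubling * m) * \<omega> r) / r ^ k)"
      by (simp add: algebra_simps exp_add)
    finally show "2 ^ k * v m k / exp (real (doubling * m)) \<le> exp (real (doubling * m) * \<omega> r) / r ^ k"
      by (simp add: field_simps)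
  qed
  then show ?thesis by (simp add: field_simps)
qed

text \<open>Testing the infimum at r = k compares k! with k^k and leaves exp (m \<omega>(k)), which
  linear growth of \<omega> bounds geometrically. This is what admits the Gaussian, whose
  derivatives are controlled by k!.\<close>

lemma weight_coeff_fact: "\<exists>\<rho>\<ge>1. \<exists>C. \<forall>k. fact k * v m k \<le> C * \<rho> ^ k"
proof -
  obtain H where H: "H \<ge> 0" "\<And>t. t \<ge> 0 \<Longrightarrow> \<omega> t \<le> H * (1 + t)" using weight_linear_bound by blast
  define \<rho> where "\<rho> = exp (real m * H)"
  have "fact k * v m k \<le> \<rho> * \<rho> ^ k" for k
  proof (cases "k = 0")
    case True
    then show ?thesis using H by (simp add: weight_coeff_0 \<rho>_def)
  next
    case False
    have "fact k * v m k \<le> real k ^ k * (exp (real m * \<omega> (real k)) / real k ^ k)"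
      using False fact_le_power[of k]
      by (intro mult_mono weight_coeff_le weight_coeff_nonneg) auto
    also have "\<dots> = exp (real m * \<omega> (real k))" using False by simp
    also have "\<dots> \<le> exp (real m * (H * (1 + real k)))" using H by (simp add: mult_left_mono)
    also have "\<dots> = \<rho> * \<rho> ^ k" by (simp add: \<rho>_def algebra_simps exp_add flip: exp_of_nat_mult)
    finally show ?thesis .
  qed
  moreover have "\<rho> \<ge> 1" using H by (simp add: \<rho>_def)
  ultimately show ?thesis by blast
qed

lemma weight_coeff_power:
  assumes "0 \<le> r"
  shows "r ^ k * v m k \<le> exp (real m * \<omega> r)"
proof (cases "1 \<le> r")
  case True
  then show ?thesis using weight_coeff_le[OF True, of m k] by (simp add: field_simps)
next
  case False
  have "r ^ k * v m k \<le> 1 * 1"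
    using assms False by (intro mult_mono power_le_one weight_coeff_le_one weight_coeff_nonneg) auto
  also have "\<dots> \<le> exp (real m * \<omega> r)" using weight_nonneg[OF assms] by simp
  finally show ?thesis .
qed

text \<open>Biduality \<open>\<phi>\<^sup>*\<^sup>* = \<phi>\<close> restricted to integral slopes, which costs one factor \<open>R\<close>.\<close>

lemma weight_coeff_attained:
  assumes R: "1 \<le> R"
  shows "\<exists>k. exp (real m * \<omega> R) \<le> v m k * R ^ Suc k"
proof -
  define t0 where "t0 = ln R"
  have t0: "t0 \<ge> 0" "exp t0 = R" using R by (simp_all add: t0_def)
  have conv: "convex_on UNIV (\<lambda>t. \<omega> (exp t))" using weight by (simp add: nonquasianalytic_weight_def)
  \<comment> \<open>The right derivative of \<phi> at \<open>t0\<close>, used as the slope of a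
    supporting line.\<close>
  define s where "s = Inf ((\<lambda>t. (\<omega> (exp t0) - \<omega> (exp t)) / (t0 - t)) ` ({t0<..} \<inter> UNIV))"
  have sub: "\<omega> (exp t) \<ge> \<omega> (exp t0) + s * (t - t0)" for t
    unfolding s_def using convex_le_Inf_differential[OF conv, of t0 t] by simp
  have "\<omega> (exp (t0 - 1)) \<le> \<omega> (exp t0)" by (intro weight_mono) auto
  then have s0: "s \<ge> 0" using sub[of "t0 - 1"] by simp
  \<comment> \<open>Rounding the slope m s down preserves the estimate for t \<ge> 0; the missing
    part of the slope, at most 1, is paid by one extra factor R.\<close>
  define k where "k = nat \<lfloor>real m * s\<rfloor>"
  have k: "real k \<le> real m * s" "real m * s \<le> real k + 1" using s0 by (auto simp: k_def)
  have "exp (real m * \<omega> R) / R ^ Suc k \<le> v m k"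
  proof (rule weight_coeff_ge)
    fix r :: real assume r: "1 \<le> r"
    define t where "t = ln r"
    have t: "t \<ge> 0" "exp t = r" using r by (simp_all add: t_def)
    have "real m * \<omega> r \<ge> real m * (\<omega> R + s * (t - t0))"
      using sub[of t] unfolding t t0 by (intro mult_left_mono) auto
    moreover have "(real m * s - real k) * t \<ge> 0" "(real k + 1 - real m * s) * t0 \<ge> 0"
      using k t t0 by simp_all
    ultimately have *: "real m * \<omega> R - real (Suc k) * t0 \<le> real m * \<omega> r - real k * t"
      by (simp add: algebra_simps)
    have "exp (real m * \<omega> R) / R ^ Suc k = exp (real m * \<omega> R - real (Suc k) * t0)"
      unfolding exp_diff t0(2)[symmetric] exp_of_nat_mult ..
    also have "\<dots> \<le> exp (real m * \<omega> r - real k * t)" using * by simp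
    also have "\<dots> = exp (real m * \<omega> r) / r ^ k"
      unfolding exp_diff t(2)[symmetric] exp_of_nat_mult ..
    finally show "exp (real m * \<omega> R) / R ^ Suc k \<le> exp (real m * \<omega> r) / r ^ k" .
  qed
  then show ?thesis using R by (intro exI[of _ k]) (simp add: field_simps del: power_Suc)
qed

lemma young_conjugate_nonneg: "0 \<le> young_conjugate \<omega> s"
  unfolding young_conjugate_def using weight_zero[of 1]
  by (intro SUP_upper2[of 0]) auto

text \<open>The decreasing map c \<mapsto> exp (- m c) turns the supremum over t \<ge> 0 into an
  infimum over r = e^t \<ge> 1. An infinite conjugate corresponds to a vanishing
  coefficient.\<close>

lemma exp_ereal_young_conjugate:
  assumes m: "m \<ge> 1"
  shows "exp_ereal (- ereal a - ereal (real m) * young_conjugate \<omega> (real k / real m)) = ereal (exp (- a) * v m k)"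
proof -
  let ?y = "young_conjugate \<omega> (real k / real m)"
  have m0: "real m > 0" using m by simp
  have elem: "exp (real m * \<omega> (exp t)) / exp t ^ k = exp (- (real m * (real k / real m * t - \<omega> (exp t))))" for t
    using m0 by (simp add: right_diff_distrib exp_diff flip: exp_of_nat_mult)
  have le: "exp (- (real m * c)) \<le> v m k" if c: "?y \<le> ereal c" for c
  proof (rule weight_coeff_ge)
    fix r :: real assume r: "1 \<le> r"
    have "ereal (real k / real m * ln r - \<omega> (exp (ln r))) \<le> ?y"
      unfolding young_conjugate_def using r by (intro SUP_upper) auto
    then have "real k / real m * ln r - \<omega> (exp (ln r)) \<le> c" using c by (metis ereal_less_eq(3) order_trans)
    then have "exp (- (real m * c)) \<le> exp (real m * \<omega> (exp (ln r))) / exp (ln r) ^ k"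
      unfolding elem using m0 by simp
    then show "exp (- (real m * c)) \<le> exp (real m * \<omega> r) / r ^ k" using r by simp
  qed
  have ge: "v m k \<le> exp (- (real m * c))" if c: "ereal c < ?y" for c
  proof -
    obtain t where t: "t \<ge> 0" "c < real k / real m * t - \<omega> (exp t)"
      using c unfolding young_conjugate_def less_SUP_iff by auto
    have "v m k \<le> exp (real m * \<omega> (exp t)) / exp t ^ k" using t by (intro weight_coeff_le) auto
    also have "\<dots> \<le> exp (- (real m * c))" unfolding elem using t m0 by simp
    finally show ?thesis .
  qed
  show ?thesis
  proof (cases ?y)
    case (real y)
    have "v m k \<le> exp (- (real m * y))"
    proof (rule ccontr)
      assume "\<not> ?thesis"
      then have less: "exp (- (real m * y)) < v m k" by simp
      \<comment> \<open>The number with exp (- m c) = v m k; any point strictly between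
        \<open>c\<close> and \<open>y\<close> contradicts \<open>ge\<close>.\<close>
      define c where "c = - ln (v m k) / real m"
      have pos: "v m k > 0" using less exp_gt_zero less_trans by blast
      have vc: "v m k = exp (- (real m * c))" using pos m0 by (simp add: c_def)
      have "c < y" using less unfolding vc using m0 by simp
      then obtain d where d: "c < d" "d < y" using dense by blast
      have "v m k \<le> exp (- (real m * d))" using d by (intro ge) (simp add: real)
      then show False unfolding vc using d m0 by simp
    qed
    moreover have "exp (- (real m * y)) \<le> v m k" by (rule le) (simp add: real)
    ultimately have "v m k = exp (- (real m * y))" by simp
    then show ?thesis unfolding real exp_ereal_def by (simp add: exp_diff exp_minus field_simps)
  next
    case PInf
    have "v m k = 0"
    proof (rule ccontr)
      assume "v m k \<noteq> 0"
      then have pos: "v m k > 0" using weight_coeff_nonneg[of m k] by simp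
      \<comment> \<open>Chosen so that exp (- m c) = v m k exp (- m), which is strictly below
        \<open>v m k\<close>.\<close>
      define c where "c = 1 - ln (v m k) / real m"
      have "real m * c = real m - ln (v m k)" using m0 by (simp add: c_def field_simps)
      then have "- (real m * c) = ln (v m k) + - real m" by simp
      then have "exp (- (real m * c)) = v m k * exp (- real m)" using pos by (simp only: exp_add exp_ln)
      then have "v m k \<le> v m k * exp (- real m)" using ge[of c] PInf by simp
      moreover have "exp (- real m) < 1" using m0 by simp
      ultimately show False using pos by simp
    qed
    then show ?thesis unfolding PInf exp_ereal_def using m0 by simp
  next
    case MInf
    then show ?thesis using young_conjugate_nonneg[of "real k / real m"] by simp
  qed
qed

section \<open>The step spaces\<close>

abbreviation "bound \<equiv> deriv_bound \<omega>"

lemma seminorm_r_le_iff: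
  assumes "m \<ge> 1"
  shows "seminorm_r \<omega> m n f \<le> ereal A \<longleftrightarrow> bound m n A f"
proof -
  have "seminorm_r \<omega> m n f \<le> ereal A \<longleftrightarrow> (\<forall>\<alpha>. \<forall>x. cmod (multi_deriv \<alpha> f x) *
      (exp (- (real n * \<omega> (norm x))) * v m (\<Sum>i\<in>UNIV. \<alpha> i)) \<le> A)"
    unfolding seminorm_r_def exp_ereal_young_conjugate[OF assms] SUP_le_iff by simp
  also have "\<dots> \<longleftrightarrow> (\<forall>\<alpha>. \<forall>x. cmod (multi_deriv \<alpha> f x) * v m (\<Sum>i\<in>UNIV. \<alpha> i) \<le> A * exp (real n * \<omega> (norm x)))"
    by (simp add: exp_minus field_simps)
  also have "\<dots> \<longleftrightarrow> bound m n A f"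
    unfolding deriv_bound_def
    using all_multi_deriv_iff[of "\<lambda>g k. \<forall>x. cmod (g x) * v m k \<le> A * exp (real n * \<omega> (norm x))" f] by auto
  finally show ?thesis .
qed

lemma deriv_boundD: "bound m n A f \<Longrightarrow> ordered_list js \<Longrightarrow>
    cmod (deriv_list js f x) * v m (length js) \<le> A * exp (real n * \<omega> (norm x))"
  by (simp add: deriv_bound_def)

lemma deriv_bound_value: "bound m n A f \<Longrightarrow> cmod (f x) \<le> A * exp (real n * \<omega> (norm x))"
  using deriv_boundD[of m n A f "[]" x] by (simp add: ordered_list_Nil weight_coeff_0)

lemma deriv_bound_nonneg: "bound m n A f \<Longrightarrow> 0 \<le> A"
  using deriv_bound_value[of m n A f 0] norm_ge_zero[of "f 0"] weight_zero[of 0]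
  by (auto intro: order_trans[OF norm_ge_zero])

lemma deriv_bound_mono:
  assumes "bound m n A f" "m' \<le> m" "n \<le> n'" "A \<le> A'"
  shows "bound m' n' A' f"
  unfolding deriv_bound_def
proof (intro allI impI)
  fix js :: "'a list" and x :: "real^'a" assume js: "ordered_list js"
  have "cmod (deriv_list js f x) * v m' (length js) \<le> cmod (deriv_list js f x) * v m (length js)"
    using assms by (intro mult_left_mono weight_coeff_mono) auto
  also have "\<dots> \<le> A * exp (real n * \<omega> (norm x))" using deriv_boundD[OF assms(1) js] .
  also have "\<dots> \<le> A' * exp (real n' * \<omega> (norm x))"
    using assms deriv_bound_nonneg[OF assms(1)] weight_nonneg[of "norm x"]
    by (intro mult_mono) (auto intro!: mult_right_mono)
  finally show "cmod (deriv_list js f x) * v m' (length js) \<le> A' * exp (real n' * \<omega> (norm x))" .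
qed

lemma deriv_bound_add:
  assumes "smooth f" "smooth g" "bound m n A f" "bound m n B g"
  shows "bound m n (A + B) (f + g)"
  unfolding deriv_bound_def
proof (intro allI impI)
  fix js :: "'a list" and x :: "real^'a" assume js: "ordered_list js"
  have "cmod (deriv_list js (f + g) x) * v m (length js) \<le>
      (cmod (deriv_list js f x) + cmod (deriv_list js g x)) * v m (length js)"
    unfolding deriv_list_add[OF assms(1,2)] plus_fun_apply
    by (intro mult_right_mono norm_triangle_ineq weight_coeff_nonneg)
  also have "\<dots> \<le> (A + B) * exp (real n * \<omega> (norm x))"
    using deriv_boundD[OF assms(3) js, of x] deriv_boundD[OF assms(4) js, of x] by (simp add: algebra_simps)
  finally show "cmod (deriv_list js (f + g) x) * v m (length js) \<le> (A + B) * exp (real n * \<omega> (norm x))" .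
qed

lemma deriv_bound_fscale:
  assumes "smooth f" "bound m n A f"
  shows "bound m n (cmod c * A) (fscale c f)"
  unfolding deriv_bound_def
proof (intro allI impI)
  fix js :: "'a list" and x :: "real^'a" assume js: "ordered_list js"
  have "cmod c * (cmod (deriv_list js f x) * v m (length js)) \<le> cmod c * (A * exp (real n * \<omega> (norm x)))"
    using deriv_boundD[OF assms(2) js] by (intro mult_left_mono) auto
  then show "cmod (deriv_list js (fscale c f) x) * v m (length js) \<le> cmod c * A * exp (real n * \<omega> (norm x))"
    unfolding deriv_list_fscale[OF assms(1)] by (simp add: fscale_def norm_mult mult.assoc)
qed

definition step_space :: "nat \<Rightarrow> nat \<Rightarrow> (real^'n::finite \<Rightarrow> complex) set"
  where "step_space m n = {f. smooth f \<and> (\<exists>A. bound m n A f)}"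

text \<open>\<open>real_of_ereal\<close> sends infinity to 0, so this behaves as a seminorm only on
  \<open>step_space m n\<close>. For this reason \<open>seminorm_on\<close> is relative to a
  carrier.\<close>

definition step_norm :: "nat \<Rightarrow> nat \<Rightarrow> (real^'n::finite \<Rightarrow> complex) \<Rightarrow> real"
  where "step_norm m n f = real_of_ereal (seminorm_r \<omega> m n f)"

lemma step_norm:
  assumes m: "m \<ge> 1" and f: "f \<in> step_space m n"
  shows "seminorm_r \<omega> m n f = ereal (step_norm m n f)"
    and "bound m n (step_norm m n f) f"
    and "bound m n A f \<longleftrightarrow> step_norm m n f \<le> A"
proof -
  obtain A where "bound m n A f" using f by (auto simp: step_space_def)
  then have 1: "seminorm_r \<omega> m n f \<le> ereal A" using seminorm_r_le_iff[OF m] by blast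
  have 2: "0 \<le> seminorm_r \<omega> m n f"
    unfolding seminorm_r_def exp_ereal_young_conjugate[OF m] using weight_coeff_nonneg
    by (intro SUP_upper2[of "\<lambda>_. 0"] SUP_upper2[of 0]) auto
  show eq: "seminorm_r \<omega> m n f = ereal (step_norm m n f)"
    unfolding step_norm_def using 1 2 by (cases "seminorm_r \<omega> m n f") auto
  show "bound m n (step_norm m n f) f" "bound m n A f \<longleftrightarrow> step_norm m n f \<le> A" for A
    using seminorm_r_le_iff[OF m, of n f] unfolding eq by auto
qed

lemma subspace_step_space: "fun_space.subspace (step_space m n)"
proof (rule fun_space.subspaceI)
  have "bound m n 0 0" unfolding deriv_bound_def deriv_list_zero by simp
  then show "0 \<in> step_space m n" unfolding step_space_def using smooth_zero by blast
qed (auto simp only: step_space_def mem_Collect_eq intro: smooth_add smooth_fscale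
    dest: deriv_bound_add deriv_bound_fscale)

lemma seminorm_on_step_norm:
  assumes m: "m \<ge> 1"
  shows "seminorm_on (step_space m n :: (real^'n::finite \<Rightarrow> complex) set) (step_norm m n)"
proof (rule seminorm_onI)
  fix f :: "real^'n \<Rightarrow> complex" assume f: "f \<in> step_space m n"
  show "0 \<le> step_norm m n f" using step_norm(2)[OF m f] by (rule deriv_bound_nonneg)
  have sm: "smooth h" if "h \<in> step_space m n" for h :: "real^'n \<Rightarrow> complex" using that by (simp add: step_space_def)
  show "step_norm m n (f + g) \<le> step_norm m n f + step_norm m n g" if g: "g \<in> step_space m n" for g
    using deriv_bound_add[OF sm[OF f] sm[OF g] step_norm(2)[OF m f] step_norm(2)[OF m g]]
      step_norm(3)[OF m fun_space.subspace_add[OF subspace_step_space f g]] by blast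
  have le: "step_norm m n (fscale c h) \<le> cmod c * step_norm m n h" if h: "h \<in> step_space m n"
    for c and h :: "real^'n \<Rightarrow> complex"
    using deriv_bound_fscale[OF sm[OF h] step_norm(2)[OF m h]]
      step_norm(3)[OF m fun_space.subspace_scale[OF subspace_step_space h]] by blast
  fix c
  show "step_norm m n (fscale c f) = cmod c * step_norm m n f"
  proof (cases "c = 0")
    case True
    have "bound m n 0 (0 :: real^'n \<Rightarrow> complex)" unfolding deriv_bound_def deriv_list_zero by simp
    then have "step_norm m n (0 :: real^'n \<Rightarrow> complex) \<le> 0"
      using step_norm(3)[OF m fun_space.subspace_0[OF subspace_step_space]] by blast
    moreover have "0 \<le> step_norm m n (0 :: real^'n \<Rightarrow> complex)"
      by (rule deriv_bound_nonneg, rule step_norm(2)[OF m fun_space.subspace_0[OF subspace_step_space]])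
    ultimately show ?thesis using True by simp
  next
    case False
    have "step_norm m n (fscale (inverse c) (fscale c f)) \<le> cmod (inverse c) * step_norm m n (fscale c f)"
      by (rule le[OF fun_space.subspace_scale[OF subspace_step_space f]])
    then have "cmod c * step_norm m n f \<le> step_norm m n (fscale c f)"
      unfolding fscale_inverse_cancel(2)[OF False] using False by (simp add: norm_divide field_simps)
    then show ?thesis using le[OF f, of c] by simp
  qed
qed

lemma O_step_eq:
  assumes m: "m \<ge> 1"
  shows "(O_step \<omega> m n :: (real^'n::finite \<Rightarrow> complex) topology) = seminorm_topology (step_space m n) (step_norm m n)"
proof -
  have S: "{f. smooth f \<and> seminorm_r \<omega> m n f < \<infinity>} = (step_space m n :: (real^'n \<Rightarrow> complex) set)"
  proof (rule set_eqI)
    fix f :: "real^'n \<Rightarrow> complex"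
    have "seminorm_r \<omega> m n f < \<infinity> \<longleftrightarrow> (\<exists>A. seminorm_r \<omega> m n f \<le> ereal A)"
      by (cases "seminorm_r \<omega> m n f") auto
    then show "f \<in> {f. smooth f \<and> seminorm_r \<omega> m n f < \<infinity>} \<longleftrightarrow> f \<in> step_space m n"
      unfolding seminorm_r_le_iff[OF m] by (simp add: step_space_def)
  qed
  show ?thesis
  proof (rule topology_eq[THEN iffD2], rule allI)
    fix U :: "(real^'n \<Rightarrow> complex) set"
    have "openin (O_step \<omega> m n) U \<longleftrightarrow> U \<subseteq> step_space m n \<and>
        (\<forall>f\<in>U. \<exists>e>0. {g \<in> step_space m n. seminorm_r \<omega> m n (g - f) < ereal e} \<subseteq> U)"
      unfolding O_step_def S by (rule openin_translation_balls[where r=ereal]) simp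
    also have "\<dots> \<longleftrightarrow> U \<subseteq> step_space m n \<and>
        (\<forall>f\<in>U. \<exists>e>0. {g \<in> step_space m n. step_norm m n (g - f) < e} \<subseteq> U)"
    proof (intro conj_cong refl ball_cong)
      fix f assume U: "U \<subseteq> step_space m n" "f \<in> U"
      have "{g \<in> step_space m n. seminorm_r \<omega> m n (g - f) < ereal e} =
          {g \<in> step_space m n. step_norm m n (g - f) < e}" for e
      proof (intro Collect_cong conj_cong refl)
        fix g :: "real^'n \<Rightarrow> complex" assume "g \<in> step_space m n"
        then have "g - f \<in> step_space m n" using U fun_space.subspace_diff[OF subspace_step_space] by blast
        from step_norm(1)[OF m this]
        show "seminorm_r \<omega> m n (g - f) < ereal e \<longleftrightarrow> step_norm m n (g - f) < e" by simp
      qed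
      then show "(\<exists>e>0. {g \<in> step_space m n. seminorm_r \<omega> m n (g - f) < ereal e} \<subseteq> U) \<longleftrightarrow>
        (\<exists>e>0. {g \<in> step_space m n. step_norm m n (g - f) < e} \<subseteq> U)" by simp
    qed
    finally show "openin (O_step \<omega> m n) U \<longleftrightarrow> openin (seminorm_topology (step_space m n) (step_norm m n)) U"
      unfolding openin_seminorm_topology .
  qed
qed

end

text \<open>Serves for suprema over the unit ball of a step, over a bounded set of functions and
  over a set of functionals. Nonemptiness and boundedness keep the real suprema meaningful.\<close>

lemma seminorm_on_SUP:
  assumes I: "I \<noteq> {}" and q: "\<And>i. i \<in> I \<Longrightarrow> seminorm_on F (q i)"
    and F: "fun_space.subspace F"
    and bdd: "\<And>f. f \<in> F \<Longrightarrow> bdd_above ((\<lambda>i. q i f) ` I)"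
  shows "seminorm_on F (\<lambda>f. SUP i\<in>I. q i f)"
proof (rule seminorm_onI)
  fix f assume f: "f \<in> F"
  obtain i where i: "i \<in> I" using I by blast
  show "0 \<le> (SUP i\<in>I. q i f)"
    using cSUP_upper2[OF bdd[OF f] i seminorm_on_nonneg[OF q[OF i] f]] .
  show "(SUP i\<in>I. q i (f + g)) \<le> (SUP i\<in>I. q i f) + (SUP i\<in>I. q i g)" if g: "g \<in> F" for g
  proof (rule cSUP_least[OF I])
    fix i assume i: "i \<in> I"
    show "q i (f + g) \<le> (SUP i\<in>I. q i f) + (SUP i\<in>I. q i g)"
      using seminorm_on_triangle[OF q[OF i] f g] cSUP_upper[OF i bdd[OF f]] cSUP_upper[OF i bdd[OF g]]
      by linarith
  qed
  have le: "(SUP i\<in>I. q i (fscale c h)) \<le> cmod c * (SUP i\<in>I. q i h)" if h: "h \<in> F" for c h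
  proof (rule cSUP_least[OF I])
    fix i assume i: "i \<in> I"
    show "q i (fscale c h) \<le> cmod c * (SUP i\<in>I. q i h)"
      unfolding seminorm_on_scale[OF q[OF i] h] by (intro mult_left_mono cSUP_upper[OF i bdd[OF h]]) simp
  qed
  fix c
  show "(SUP i\<in>I. q i (fscale c f)) = cmod c * (SUP i\<in>I. q i f)"
  proof (cases "c = 0")
    case True
    have "q i (fscale c f) = 0" if "i \<in> I" for i unfolding seminorm_on_scale[OF q[OF that] f] True by simp
    then have "(SUP i\<in>I. q i (fscale c f)) = (SUP i\<in>I. 0::real)" by (intro SUP_cong) auto
    then show ?thesis using I True by simp
  next
    case False
    have "(SUP i\<in>I. q i f) \<le> cmod (inverse c) * (SUP i\<in>I. q i (fscale c f))"
      using le[OF subspace_rules(3)[OF F f], of "inverse c" c] unfolding fscale_inverse_cancel(2)[OF False] .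
    then have "cmod c * (SUP i\<in>I. q i f) \<le> (SUP i\<in>I. q i (fscale c f))"
      using False by (simp add: norm_divide field_simps)
    then show ?thesis using le[OF f, of c] by simp
  qed
qed

text \<open>A step norm may be 0, whereas \<open>level_seminormsI\<close> assumes its estimate for
  positive \<open>A\<close> only; approaching the norm from above closes the gap.\<close>

lemma le_mult_of_less:
  fixes x D A :: real
  assumes "\<And>t. A < t \<Longrightarrow> x \<le> D * t" "0 \<le> D"
  shows "x \<le> D * A"
proof (rule field_le_epsilon)
  fix e :: real assume e: "e > 0"
  have "x \<le> D * (A + e / (D + 1))" using assms e by simp
  also have "\<dots> = D * A + e * (D / (D + 1))" by (simp add: algebra_simps)
  also have "\<dots> \<le> D * A + e * 1" using assms(2) e by (intro add_left_mono mult_left_mono) auto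
  finally show "x \<le> D * A + e" by simp
qed

context weight_function
begin

section \<open>The levels m, their continuous seminorms, and the projective limit\<close>

definition level :: "nat \<Rightarrow> (real^'n::finite \<Rightarrow> complex) set"
  where "level m = (\<Union>n\<in>{1..}. step_space m n)"

definition level_seminorms :: "nat \<Rightarrow> ((real^'n::finite \<Rightarrow> complex) \<Rightarrow> real) set"
  where "level_seminorms m = inductive_seminorms {1..} (step_space m) (step_norm m)"

lemma step_space_mono: "m' \<le> m \<Longrightarrow> n \<le> n' \<Longrightarrow> step_space m n \<subseteq> step_space m' n'"
  by (auto simp: step_space_def intro: deriv_bound_mono)

lemma step_spaceI: "smooth f \<Longrightarrow> bound m n A f \<Longrightarrow> f \<in> step_space m n"
  by (auto simp: step_space_def)

lemma levelI: "smooth f \<Longrightarrow> bound m n A f \<Longrightarrow> f \<in> level m"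
proof -
  assume "smooth f" "bound m n A f"
  \<comment> \<open>Steps are indexed from 1, while estimates may come with n = 0.\<close>
  then have "f \<in> step_space m (max n 1)"
    by (intro step_spaceI[where A=A]) (auto intro: deriv_bound_mono)
  then show "f \<in> level m" unfolding level_def by (intro UN_I[of "max n 1"]) auto
qed

lemma levelE:
  assumes "f \<in> level m"
  obtains n A where "n \<ge> 1" "smooth f" "bound m n A f" "f \<in> step_space m n"
  using assms by (auto simp: level_def step_space_def)

lemma level_antimono: "m' \<le> m \<Longrightarrow> level m \<subseteq> level m'"
  unfolding level_def using step_space_mono[OF _ order_refl] by blast

lemma subspace_level: "fun_space.subspace (level m)"
proof (rule fun_space.subspaceI)
  show "0 \<in> level m"
    using subspace_rules(1)[OF subspace_step_space, of m 1] by (auto simp: level_def)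
  fix f g :: "real^'a \<Rightarrow> complex" assume f: "f \<in> level m" and g: "g \<in> level m"
  obtain n A where n: "smooth f" "bound m n A f" using f by (rule levelE)
  obtain n' B where n': "smooth g" "bound m n' B g" using g by (rule levelE)
  have "bound m (max n n') (A + B) (f + g)"
    using n n' by (intro deriv_bound_add) (auto intro: deriv_bound_mono)
  then show "f + g \<in> level m" by (intro levelI smooth_add n n')
  show "fscale c f \<in> level m" for c
    by (rule levelI[OF smooth_fscale[OF n(1)] deriv_bound_fscale[OF n]])
qed

text \<open>The working criterion for continuity at level m: one constant for each n, and positive
  \<open>A\<close> only, so that f may be scaled to the unit ball of its step.\<close>

lemma level_seminormsI:
  assumes m: "m \<ge> 1" and q: "seminorm_on (level m) q"
    and bnd: "\<And>n. n \<ge> 1 \<Longrightarrow> \<exists>C\<ge>0. \<forall>f A. smooth f \<longrightarrow> bound m n A f \<longrightarrow> 0 < A \<longrightarrow> q f \<le> C * A"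
  shows "q \<in> level_seminorms m"
  unfolding level_seminorms_def inductive_seminorms_def
proof (intro CollectI conjI ballI)
  show "seminorm_on (\<Union> (step_space m ` {1..})) q" using q by (simp add: level_def)
  fix n :: nat assume "n \<in> {1..}"
  then obtain C where C: "C \<ge> 0" "\<And>f A. smooth f \<Longrightarrow> bound m n A f \<Longrightarrow> 0 < A \<Longrightarrow> q f \<le> C * A"
    using bnd by fastforce
  have "q f \<le> C * step_norm m n f" if f: "f \<in> step_space m n" for f
  proof (rule le_mult_of_less)
    fix t assume t: "step_norm m n f < t"
    have "bound m n t f" using t step_norm(3)[OF m f] by simp
    moreover have "0 < t" using t seminorm_on_nonneg[OF seminorm_on_step_norm[OF m] f] by simp
    ultimately show "q f \<le> C * t" using C(2) f by (simp add: step_space_def)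
  qed fact
  then show "\<exists>C. \<forall>f\<in>step_space m n. q f \<le> C * step_norm m n f" by blast
qed

lemma level_seminorms_bound:
  assumes m: "m \<ge> 1" and q: "q \<in> level_seminorms m"
  shows "\<exists>C\<ge>0. \<forall>f A. smooth f \<longrightarrow> bound m n A f \<longrightarrow> q f \<le> C * A"
proof -
  have "max n 1 \<in> {1..}" by simp
  then obtain C where C: "\<And>f. f \<in> step_space m (max n 1) \<Longrightarrow> q f \<le> C * step_norm m (max n 1) f"
    using q unfolding level_seminorms_def inductive_seminorms_def by blast
  have "q f \<le> max C 0 * A" if f: "smooth f" "bound m n A f" for f A
  proof -
    have b: "bound m (max n 1) A f" using f(2) by (rule deriv_bound_mono) auto
    note fs = step_spaceI[OF f(1) b]
    have "q f \<le> C * step_norm m (max n 1) f" using C[OF fs] .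
    also have "\<dots> \<le> max C 0 * step_norm m (max n 1) f"
      using seminorm_on_nonneg[OF seminorm_on_step_norm[OF m] fs] by (intro mult_right_mono) auto
    also have "\<dots> \<le> max C 0 * A" using step_norm(3)[OF m fs] b by (intro mult_left_mono) auto
    finally show ?thesis .
  qed
  then show ?thesis by (intro exI[of _ "max C 0"]) auto
qed

lemma level_seminorms_seminorm: "q \<in> level_seminorms m \<Longrightarrow> seminorm_on (level m) q"
  by (simp add: level_seminorms_def inductive_seminorms_def level_def)

text \<open>Coefficients increase with m, so a bound at the higher level implies one at the lower
  level with the same constants. This makes the levels a chain and their seminorms directed.\<close>

lemma level_seminorms_mono:
  assumes m: "m \<ge> 1" and le: "m \<le> m'" and q: "q \<in> level_seminorms m"
  shows "q \<in> level_seminorms m'"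
proof (rule level_seminormsI)
  show "m' \<ge> 1" using m le by simp
  show "seminorm_on (level m') q"
    using level_seminorms_seminorm[OF q] level_antimono[OF le] by (rule seminorm_on_mono)
  show "\<exists>C\<ge>0. \<forall>f A. smooth f \<longrightarrow> bound m' n A f \<longrightarrow> 0 < A \<longrightarrow> q f \<le> C * A" for n
    using level_seminorms_bound[OF m q, of n] deriv_bound_mono[OF _ le order_refl order_refl] by meson
qed

lemma seminorm_base_level:
  assumes m: "m \<ge> 1"
  shows "topspace (lc_inductive_limit {1..} (\<lambda>n. O_step \<omega> m n)) = (level m :: (real^'n::finite \<Rightarrow> complex) set)"
    and "seminorm_base (lc_inductive_limit {1..} (\<lambda>n. O_step \<omega> m n) :: (real^'n \<Rightarrow> complex) topology) (level_seminorms m)"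
  unfolding O_step_eq[OF m] level_seminorms_def unfolding level_def
  by (rule topspace_inductive_limit[OF subspace_step_space seminorm_on_step_norm[OF m]]
      seminorm_base_inductive_limit[OF subspace_step_space seminorm_on_step_norm[OF m]],
      rule subspace_level[unfolded level_def])+

lemma seminorm_base_O_M:
  shows topspace_O_M: "topspace (O_M \<omega>) = (\<Inter>m\<in>{1..}. level m :: (real^'n::finite \<Rightarrow> complex) set)"
    and "seminorm_base (O_M \<omega> :: (real^'n \<Rightarrow> complex) topology) (\<Union>m\<in>{1..}. level_seminorms m)"
proof -
  let ?X = "\<lambda>m. lc_inductive_limit {1..} (\<lambda>n. O_step \<omega> m n) :: (real^'n \<Rightarrow> complex) topology"
  have base: "seminorm_base (?X m) (level_seminorms m)" if "m \<in> {1..}" for m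
    using that seminorm_base_level(2) by simp
  have dir: "\<exists>k\<in>{1..}. \<exists>r\<in>level_seminorms k. \<forall>f\<in>(\<Inter>m\<in>{1..}. topspace (?X m)). p f \<le> r f \<and> c * q f \<le> r f"
    if i: "i \<in> {1..}" and j: "j \<in> {1..}" and p: "p \<in> level_seminorms i" and q: "q \<in> level_seminorms j" for i j p q c
  proof -
    define k where "k = max i j"
    have k: "k \<in> {1..}" "p \<in> level_seminorms k" "q \<in> level_seminorms k"
      using i j p q level_seminorms_mono[of i k p] level_seminorms_mono[of j k q] by (auto simp: k_def)
    obtain r where "r \<in> level_seminorms k" "\<forall>f\<in>topspace (?X k). p f \<le> r f \<and> c * q f \<le> r f"
      using seminorm_base_directed[OF base[OF k(1)] k(2,3), of c] by blast
    then show ?thesis using k(1) by (intro bexI[of _ k] bexI[of _ r]) auto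
  qed
  have ne: "{1::nat..} \<noteq> {}" by auto
  have lim: "topspace (projective_limit {1..} ?X) = (\<Inter>m\<in>{1..}. topspace (?X m))"
    "seminorm_base (projective_limit {1..} ?X) (\<Union>m\<in>{1..}. level_seminorms m)"
    by (rule seminorm_base_projective_limit[where Q=level_seminorms, OF ne], erule base, rule dir, assumption+)+
  show "topspace (O_M \<omega>) = (\<Inter>m\<in>{1..}. level m :: (real^'n::finite \<Rightarrow> complex) set)"
    unfolding O_M_def lim(1) using seminorm_base_level(1) by (intro INF_cong) auto
  show "seminorm_base (O_M \<omega> :: (real^'n \<Rightarrow> complex) topology) (\<Union>m\<in>{1..}. level_seminorms m)"
    unfolding O_M_def by (rule lim(2))
qed

lemma topspace_O_M_iff: "f \<in> topspace (O_M \<omega>) \<longleftrightarrow> smooth f \<and> (\<forall>m\<ge>1. \<exists>n A. bound m n A f)"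
proof
  assume "f \<in> topspace (O_M \<omega>)"
  then have f: "f \<in> level m" if "m \<ge> 1" for m using that unfolding topspace_O_M by auto
  show "smooth f \<and> (\<forall>m\<ge>1. \<exists>n A. bound m n A f)"
    using f[of 1] f by (meson levelE order_refl)
qed (auto simp: topspace_O_M intro: levelI)

lemma subspace_O_M: "fun_space.subspace (topspace (O_M \<omega>))"
  by (rule seminorm_base_subspace[OF seminorm_base_O_M(2)])

text \<open>A sufficient criterion: for each m, one pair n, A serves the whole set. The sets of
  atoms on which functionals are tested have this form.\<close>

lemma bounded_in_O_M_I:
  assumes "\<And>f. f \<in> B \<Longrightarrow> smooth f" "\<And>m. m \<ge> 1 \<Longrightarrow> \<exists>n A. \<forall>f\<in>B. bound m n A f"
  shows "bounded_in (O_M \<omega>) B"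
  unfolding bounded_in_seminorm_base[OF seminorm_base_O_M(2)]
proof (intro conjI ballI)
  show "B \<subseteq> topspace (O_M \<omega>)" using assms unfolding subset_iff topspace_O_M_iff by meson
  fix q :: "(real^'a \<Rightarrow> complex) \<Rightarrow> real" assume "q \<in> (\<Union>m\<in>{1..}. level_seminorms m)"
  then obtain m where m: "m \<ge> 1" "q \<in> level_seminorms m" by auto
  obtain n A where A: "\<forall>f\<in>B. bound m n A f" using assms(2)[OF m(1)] by blast
  obtain C where "C \<ge> 0" "\<And>f A. smooth f \<Longrightarrow> bound m n A f \<Longrightarrow> q f \<le> C * A"
    using level_seminorms_bound[OF m] by blast
  then show "\<exists>c. \<forall>f\<in>B. q f \<le> c" using assms(1) A by blast
qed

text \<open>A continuous functional is dominated by a seminorm of a single level, so m is fixed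
  before n and only the constant depends on n.\<close>

lemma dual_O_M_bound:
  fixes T :: "(real^'n::finite \<Rightarrow> complex) \<Rightarrow> complex"
  assumes "T \<in> dual_space (O_M \<omega>)"
  shows "\<exists>m\<ge>1. \<forall>n. \<exists>C\<ge>0. \<forall>f A. f \<in> topspace (O_M \<omega>) \<longrightarrow> bound m n A f \<longrightarrow> cmod (T f) \<le> C * A"
proof -
  obtain q where q: "q \<in> (\<Union>m\<in>{1..}. level_seminorms m)" "\<And>f. f \<in> topspace (O_M \<omega>) \<Longrightarrow> cmod (T f) \<le> q f"
    using assms unfolding dual_space_seminorm_base[OF seminorm_base_O_M(2)] by blast
  then obtain m where m: "m \<ge> 1" "q \<in> level_seminorms m" by auto
  have "\<exists>C\<ge>0. \<forall>f A. f \<in> topspace (O_M \<omega>) \<longrightarrow> bound m n A f \<longrightarrow> cmod (T f) \<le> C * A" for n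
  proof -
    obtain C where C: "C \<ge> 0" "\<And>f A. smooth f \<Longrightarrow> bound m n A f \<Longrightarrow> q f \<le> C * A"
      using level_seminorms_bound[OF m] by blast
    have "cmod (T f) \<le> C * A" if "f \<in> topspace (O_M \<omega>)" "bound m n A f" for f A
      using q(2)[OF that(1)] C(2)[of f A] that topspace_O_M_iff by (meson order_trans)
    then show ?thesis using C(1) by blast
  qed
  then show ?thesis using m(1) by blast
qed

section \<open>Multiplication in the multiplier space\<close>

text \<open>The Leibniz factor 2^k is absorbed by \<open>weight_coeff_doubling\<close>, at the price
  of the index \<open>doubling * m\<close> for both factors. Working at one point \<open>x\<close>
  allows different growth or decay of the factors to be inserted afterwards.\<close>

lemma deriv_list_mult_weight:
  fixes f g :: "real^'n::finite \<Rightarrow> complex"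
  assumes "smooth f" "smooth g"
    and f: "\<And>js. ordered_list js \<Longrightarrow> cmod (deriv_list js f x) * v (doubling * m) (length js) \<le> A"
    and g: "\<And>js. ordered_list js \<Longrightarrow> cmod (deriv_list js g x) * v (doubling * m) (length js) \<le> B"
    and ls: "ordered_list ls"
  shows "cmod (deriv_list ls (f * g) x) * v m (length ls) \<le> exp (real (doubling * m)) * (A * B)"
proof -
  let ?c = "cmod (deriv_list ls (f * g) x)" and ?k = "length ls"
  have *: "?c * v (doubling * m) ?k \<le> 2 ^ ?k * (A * B)"
    using assms by (intro deriv_list_mult_bound[where P=ordered_list])
      (auto intro: ordered_list_delete weight_coeff_nonneg weight_coeff_submult)
  have "2 ^ ?k * (?c * v m ?k) = ?c * (2 ^ ?k * v m ?k)" by simp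
  also have "\<dots> \<le> ?c * (exp (real (doubling * m)) * v (doubling * m) ?k)"
    by (intro mult_left_mono weight_coeff_doubling) simp
  also have "\<dots> = exp (real (doubling * m)) * (?c * v (doubling * m) ?k)" by simp
  also have "\<dots> \<le> exp (real (doubling * m)) * (2 ^ ?k * (A * B))" using * by (intro mult_left_mono) auto
  finally have "2 ^ ?k * (?c * v m ?k) \<le> 2 ^ ?k * (exp (real (doubling * m)) * (A * B))" by (simp add: mult_ac)
  then show ?thesis by simp
qed

lemma deriv_bound_mult:
  assumes "smooth f" "smooth g" "bound (doubling * m) n A f" "bound (doubling * m) n' B g"
  shows "bound m (n + n') (exp (real (doubling * m)) * (A * B)) (f * g)"
  unfolding deriv_bound_def
proof (intro allI impI)
  fix js :: "'a list" and x :: "real^'a" assume js: "ordered_list js"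
  have "cmod (deriv_list js (f * g) x) * v m (length js) \<le> exp (real (doubling * m)) *
      ((A * exp (real n * \<omega> (norm x))) * (B * exp (real n' * \<omega> (norm x))))"
    using assms deriv_boundD[OF assms(3)] deriv_boundD[OF assms(4)] js
    by (intro deriv_list_mult_weight) auto
  then show "cmod (deriv_list js (f * g) x) * v m (length js) \<le>
      exp (real (doubling * m)) * (A * B) * exp (real (n + n') * \<omega> (norm x))"
    by (simp add: algebra_simps exp_add)
qed

lemma level_mult: "f \<in> level (doubling * m) \<Longrightarrow> g \<in> level (doubling * m) \<Longrightarrow> f * g \<in> level m"
  by (elim levelE) (blast intro: levelI smooth_mult deriv_bound_mult)

lemma doubling_mult_ge: "m \<ge> 1 \<Longrightarrow> doubling * m \<ge> 1"
  using doubling_ge_one by simp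

lemma topspace_O_M_mult:
  "f \<in> topspace (O_M \<omega>) \<Longrightarrow> g \<in> topspace (O_M \<omega>) \<Longrightarrow> f * g \<in> topspace (O_M \<omega>)"
  unfolding topspace_O_M using doubling_mult_ge by (auto intro!: level_mult)

text \<open>
  For a fixed step \<open>n\<close>, the supremum of \<open>q (f * g)\<close> over the unit ball of that step is a continuous
  seminorm in \<open>g\<close>, hence bounded on \<open>C\<close>.
\<close>

lemma mult_bounded_equicontinuous:
  fixes C :: "(real^'n::finite \<Rightarrow> complex) set"
  assumes m: "m \<ge> 1" and q: "q \<in> level_seminorms m" and C: "bounded_in (O_M \<omega>) C"
  shows "\<exists>p\<in>level_seminorms (doubling * m). \<forall>f\<in>level (doubling * m). \<forall>g\<in>C. q (f * g) \<le> p f"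
proof -
  define M where "M = doubling * m"
  have M: "M \<ge> 1" using m doubling_mult_ge by (simp add: M_def)
  have CM: "C \<subseteq> level M" using C M unfolding bounded_in_def topspace_O_M by auto
  note qs = level_seminorms_seminorm[OF q]
  have mult: "f * g \<in> level m" if "f \<in> level M" "g \<in> level M" for f g :: "real^'n \<Rightarrow> complex"
    using that level_mult unfolding M_def by blast
  have q1: "seminorm_on (level M) (\<lambda>g. q (f * g))" if f: "f \<in> level M" for f
  proof (rule seminorm_onI)
    fix g h :: "real^'n \<Rightarrow> complex" and c assume g: "g \<in> level M"
    show "0 \<le> q (f * g)" using seminorm_on_nonneg[OF qs mult[OF f g]] .
    have "f * fscale c g = fscale c (f * g)" by (simp add: fscale_def fun_eq_iff)
    then show "q (f * fscale c g) = cmod c * q (f * g)" using seminorm_on_scale[OF qs mult[OF f g]] by simp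
    assume h: "h \<in> level M"
    show "q (f * (g + h)) \<le> q (f * g) + q (f * h)"
      unfolding distrib_left by (rule seminorm_on_triangle[OF qs mult[OF f g] mult[OF f h]])
  qed
  have comm: "q (f * g) = q (g * f)" for f g by (simp only: mult.commute)
  define U where "U n = {f :: real^'n \<Rightarrow> complex. smooth f \<and> bound M n 1 f}" for n
  have UM: "f \<in> level M" if "f \<in> U n" for f n using that by (auto simp: U_def intro: levelI)
  have U0: "U n \<noteq> {}" for n
  proof -
    have "bound M n 1 (0 :: real^'n \<Rightarrow> complex)" unfolding deriv_bound_def deriv_list_zero by simp
    then show ?thesis using smooth_zero by (auto simp: U_def)
  qed
  have step: "\<exists>c\<ge>0. \<forall>f\<in>U n. \<forall>g A. smooth g \<longrightarrow> bound M n' A g \<longrightarrow> q (f * g) \<le> c * A" for n n'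
  proof -
    obtain c where c: "c \<ge> 0" "\<And>h A. smooth h \<Longrightarrow> bound m (n + n') A h \<Longrightarrow> q h \<le> c * A"
      using level_seminorms_bound[OF m q] by blast
    have "q (f * g) \<le> c * exp (real M) * A" if "f \<in> U n" "smooth g" "bound M n' A g" for f g A
    proof -
      have "bound m (n + n') (exp (real M) * (1 * A)) (f * g)"
        unfolding M_def using that by (intro deriv_bound_mult) (auto simp: U_def M_def)
      moreover have "smooth (f * g)" using that by (intro smooth_mult) (auto simp: U_def)
      ultimately show ?thesis using c(2)[of "f * g" "exp (real M) * (1 * A)"] by (simp add: mult.assoc)
    qed
    then show ?thesis using c(1) by (intro exI[of _ "c * exp (real M)"]) auto
  qed
  have bdd: "bdd_above ((\<lambda>f. q (f * g)) ` U n)" if g: "g \<in> level M" for g n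
  proof -
    obtain n' A where "smooth g" "bound M n' A g" using g by (rule levelE)
    then show ?thesis using step[of n n'] unfolding bdd_above_def by blast
  qed
  have sup: "(\<lambda>g. SUP f\<in>U n. q (f * g)) \<in> level_seminorms M" for n
  proof (rule level_seminormsI[OF M])
    show "seminorm_on (level M) (\<lambda>g. SUP f\<in>U n. q (f * g))"
      using U0 q1[OF UM] subspace_level bdd by (rule seminorm_on_SUP)
    show "\<exists>c\<ge>0. \<forall>g A. smooth g \<longrightarrow> bound M n' A g \<longrightarrow> 0 < A \<longrightarrow> (SUP f\<in>U n. q (f * g)) \<le> c * A" for n'
      using step[of n n'] U0[of n] by (meson cSUP_least)
  qed
  \<comment> \<open>Boundedness of \<open>C\<close> enters by testing it against one seminorm for
    each n; no step containing \<open>C\<close> is involved. The resulting \<open>d n\<close> is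
    uniform over \<open>C\<close>.\<close>
  have "\<exists>d. \<forall>g\<in>C. p g \<le> d" if "p \<in> level_seminorms M" for p
    using C M that unfolding bounded_in_seminorm_base[OF seminorm_base_O_M(2)] by auto
  from this[OF sup] have "\<forall>n. \<exists>d. \<forall>g\<in>C. (SUP f\<in>U n. q (f * g)) \<le> d" ..
  then have "\<exists>d. \<forall>n. \<forall>g\<in>C. (SUP f\<in>U n. q (f * g)) \<le> d n" by (rule choice)
  then obtain d where d: "\<And>n g. g \<in> C \<Longrightarrow> (SUP f\<in>U n. q (f * g)) \<le> d n" by blast
  have ball: "q (f * g) \<le> d n" if "f \<in> U n" "g \<in> C" for f g n
    using cSUP_upper[OF that(1) bdd] d[OF that(2)] CM that(2) by (meson order_trans subsetD)
  have scaled: "q (f * g) \<le> d n * A" if f: "smooth f" "bound M n A f" "0 < A" and g: "g \<in> C" for f g n A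
  proof -
    have "bound M n (cmod (of_real (inverse A)) * A) (fscale (of_real (inverse A)) f)"
      using f by (intro deriv_bound_fscale)
    moreover have "cmod (of_real (inverse A)) * A = 1" unfolding norm_of_real using f(3) by simp
    ultimately have "fscale (of_real (inverse A)) f \<in> U n"
      using f by (simp add: U_def smooth_fscale)
    from ball[OF this g] have "q (fscale (of_real (inverse A)) f * g) \<le> d n" .
    also have "fscale (of_real (inverse A)) f * g = fscale (of_real (inverse A)) (f * g)"
      by (simp add: fscale_def fun_eq_iff)
    also have "q \<dots> = cmod (of_real (inverse A)) * q (f * g)"
      using f g CM by (intro seminorm_on_scale[OF qs mult]) (auto intro: levelI)
    finally show ?thesis using f(3) by (simp add: norm_divide field_simps)
  qed
  show ?thesis
  \<comment> \<open>A supremum over an empty \<open>C\<close> would be an unspecified real, so an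
    arbitrary seminorm of the level is taken in that case.\<close>
  proof (cases "C = {}")
    case True
    then show ?thesis using seminorm_base_nonempty[OF seminorm_base_level(2)[OF M]] unfolding M_def by blast
  next
    case False
    define p where "p f = (SUP g\<in>C. q (f * g))" for f
    have bdd': "bdd_above ((\<lambda>g. q (f * g)) ` C)" if f: "f \<in> level M" for f
    proof -
      obtain n A where "smooth f" "bound M n A f" using f by (rule levelE)
      \<comment> \<open>The scaling argument divides by the bound, which must therefore be
        positive.\<close>
      moreover from this have "bound M n (max A 1) f" by (auto intro: deriv_bound_mono)
      ultimately have "q (f * g) \<le> d n * max A 1" if "g \<in> C" for g using scaled[of f n "max A 1" g] that by simp
      then show ?thesis by (rule bdd_aboveI2)
    qed
    have "p \<in> level_seminorms M"
    proof (rule level_seminormsI[OF M])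
      have "seminorm_on (level M) (\<lambda>f. q (f * g))" if "g \<in> C" for g
        unfolding comm[of _ g] using q1 CM that by blast
      then show "seminorm_on (level M) p"
        unfolding p_def using False bdd' by (intro seminorm_on_SUP subspace_level)
      fix n
      have "p f \<le> max (d n) 0 * A" if "smooth f" "bound M n A f" "0 < A" for f A
        unfolding p_def
      proof (rule cSUP_least[OF False])
        fix g assume "g \<in> C"
        from scaled[OF that this] have "q (f * g) \<le> d n * A" .
        also have "\<dots> \<le> max (d n) 0 * A" using that by (intro mult_right_mono) auto
        finally show "q (f * g) \<le> max (d n) 0 * A" .
      qed
      then show "\<exists>c\<ge>0. \<forall>f A. smooth f \<longrightarrow> bound M n A f \<longrightarrow> 0 < A \<longrightarrow> p f \<le> c * A"
        by (intro exI[of _ "max (d n) 0"]) auto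
    qed
    moreover have "q (f * g) \<le> p f" if "f \<in> level M" "g \<in> C" for f g
      unfolding p_def using that bdd' by (intro cSUP_upper)
    ultimately show ?thesis unfolding M_def by blast
  qed
qed

end

section \<open>Hypocontinuity of the transposed multiplication\<close>

lemma zero_in_dual_space: "0 \<in> dual_space X"
  unfolding dual_space_def zero_fun_def by (auto simp: zero_fun_def)

lemma topspace_strong_dual [simp]: "topspace (strong_dual X) = dual_space X"
proof
  show "topspace (strong_dual X) \<subseteq> dual_space X"
    using openin_topspace[of "strong_dual X"] unfolding openin_strong_dual by blast
  have "openin (strong_dual X) (dual_space X)"
    unfolding openin_strong_dual using bounded_in_empty[of X] zero_less_one by blast
  then show "dual_space X \<subseteq> topspace (strong_dual X)" by (rule openin_subset)
qed

lemma dual_spaceD: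
  assumes "T \<in> dual_space X"
  shows "f \<notin> topspace X \<Longrightarrow> T f = 0" "f \<in> topspace X \<Longrightarrow> g \<in> topspace X \<Longrightarrow> T (f + g) = T f + T g"
    "f \<in> topspace X \<Longrightarrow> T (fscale c f) = c * T f"
  using assms by (simp_all add: dual_space_def)

lemma dual_space_diff:
  assumes S: "S \<in> dual_space X" and T: "T \<in> dual_space X"
  shows "S - T \<in> dual_space X"
proof -
  have "continuous_map X euclidean (\<lambda>f. S f - T f)"
    using S T by (intro continuous_map_diff) (simp_all add: dual_space_def)
  then show ?thesis
    using dual_spaceD[OF S] dual_spaceD[OF T]
    unfolding dual_space_def fun_diff_def by (auto simp: algebra_simps)
qed

text \<open>The clause \<open>\<exists>d<e\<close> says that the supremum over \<open>D\<close> is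
  below \<open>e\<close> without forming a supremum; the strict gap leaves the room needed for
  openness.\<close>

lemma openin_strong_dual_ball:
  assumes D: "bounded_in X D"
  shows "openin (strong_dual X) {T \<in> dual_space X. \<exists>d<e. \<forall>h\<in>D. cmod (T h - T0 h) \<le> d}"
    (is "openin _ ?U")
  unfolding openin_strong_dual
proof (intro conjI ballI)
  fix T assume "T \<in> ?U"
  then obtain d where d: "d < e" "\<And>h. h \<in> D \<Longrightarrow> cmod (T h - T0 h) \<le> d" by blast
  \<comment> \<open>Half of the gap is spent, so the new bound (e + d) / 2 is still less than
    \<open>e\<close>.\<close>
  have "{S \<in> dual_space X. \<forall>h\<in>D. cmod (S h - T h) \<le> (e - d) / 2} \<subseteq> ?U"
  proof safe
    fix S assume S: "\<forall>h\<in>D. cmod (S h - T h) \<le> (e - d) / 2"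
    have "cmod (S h - T0 h) \<le> (e - d) / 2 + d" if h: "h \<in> D" for h
    proof -
      have "S h - T0 h = (S h - T h) + (T h - T0 h)" by simp
      then have "cmod (S h - T0 h) \<le> cmod (S h - T h) + cmod (T h - T0 h)"
        by (metis norm_triangle_ineq)
      then show ?thesis using bspec[OF S h] d(2)[OF h] by linarith
    qed
    moreover have "(e - d) / 2 + d < e" using d(1) by (simp add: field_simps)
    ultimately show "\<exists>d<e. \<forall>h\<in>D. cmod (S h - T0 h) \<le> d" by blast
  qed
  moreover have "(e - d) / 2 > 0" using d(1) by simp
  ultimately show "\<exists>B e. bounded_in X B \<and> e > 0 \<and>
      {S \<in> dual_space X. \<forall>h\<in>B. cmod (S h - T h) \<le> e} \<subseteq> ?U" using D by blast
qed auto

lemma bounded_in_strong_dualD: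
  assumes B: "bounded_in (strong_dual X) B" and D: "bounded_in X D"
  shows "\<exists>c. \<forall>T\<in>B. \<forall>h\<in>D. cmod (T h) \<le> c"
proof -
  let ?U = "{T \<in> dual_space X. \<exists>d<1. \<forall>h\<in>D. cmod (T h - 0 h) \<le> d}"
  have "openin (strong_dual X) ?U" by (rule openin_strong_dual_ball[OF D])
  moreover have "0 \<in> ?U" using zero_in_dual_space by (auto intro: exI[of _ 0])
  ultimately obtain s where s: "s > 0" "\<And>t. t > s \<Longrightarrow> B \<subseteq> fscale (of_real t) ` ?U"
    using B unfolding bounded_in_def by meson
  have "cmod (T h) \<le> s + 1" if T: "T \<in> B" and h: "h \<in> D" for T h
  proof -
    have "T \<in> fscale (of_real (s + 1)) ` ?U" using s(2)[of "s + 1"] T by auto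
    then obtain S d where S: "T = fscale (of_real (s + 1)) S" "d < 1" "\<forall>h\<in>D. cmod (S h) \<le> d" by auto
    have "cmod (T h) = (s + 1) * cmod (S h)"
      unfolding S(1) fscale_def norm_mult norm_of_real using s(1) by simp
    also have "\<dots> \<le> (s + 1) * 1" using S h s(1) by (intro mult_left_mono) force+
    finally show ?thesis by simp
  qed
  then show ?thesis by blast
qed

text \<open>Continuity of f \<mapsto> f T for a single T is the one-point case of
  \<open>transpose_equicontinuous_space\<close>, which asks for a strongly bounded set.\<close>

lemma bounded_in_strong_dual_singleton:
  assumes base: "seminorm_base X Q" and T: "T \<in> dual_space X"
  shows "bounded_in (strong_dual X) {T}"
  unfolding bounded_in_def
proof (intro conjI allI impI)
  fix U assume "openin (strong_dual X) U \<and> 0 \<in> U"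
  then obtain D e where D: "bounded_in X D" "e > 0" "{S \<in> dual_space X. \<forall>h\<in>D. cmod (S h - 0 h) \<le> e} \<subseteq> U"
    unfolding openin_strong_dual by blast
  obtain q where q: "q \<in> Q" "\<And>f. f \<in> topspace X \<Longrightarrow> cmod (T f) \<le> q f"
    using T unfolding dual_space_seminorm_base[OF base] by blast
  obtain c where c: "\<And>h. h \<in> D \<Longrightarrow> q h \<le> c"
    using D(1) q(1) unfolding bounded_in_seminorm_base[OF base] by blast
  have DX: "D \<subseteq> topspace X" using D(1) by (simp add: bounded_in_def)
  show "\<exists>s>0. \<forall>t>s. {T} \<subseteq> fscale (of_real t) ` U"
  proof (intro exI[of _ "max 1 (c / e)"] conjI allI impI)
    fix t assume t: "t > max 1 (c / e)"
    let ?S = "fscale (inverse (of_real t)) T"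
    have "?S \<in> dual_space X"
    proof -
      have "continuous_map X euclidean (\<lambda>f. inverse (of_real t) * T f)"
        using T continuous_map_compose[of X euclidean T euclidean "\<lambda>z. inverse (of_real t) * z"]
        by (simp add: dual_space_def o_def continuous_intros)
      then show ?thesis using dual_spaceD[OF T] unfolding dual_space_def fscale_def[of _ T] by (auto simp: algebra_simps)
    qed
    moreover have "cmod (?S h - 0 h) \<le> e" if h: "h \<in> D" for h
    proof -
      have "cmod (T h) \<le> c" using q(2)[of h] c[OF h] h DX by force
      also have "c < t * e" using t D(2) by (simp add: field_simps)
      finally show ?thesis using t by (simp add: fscale_def norm_mult norm_divide field_simps)
    qed
    ultimately have "?S \<in> U" using D(3) by blast
    then have *: "fscale (of_real t) ?S \<in> fscale (of_real t) ` U" by (rule imageI)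
    have "of_real t \<noteq> (0::complex)" using t by simp
    from * show "{T} \<subseteq> fscale (of_real t) ` U" unfolding fscale_inverse_cancel(1)[OF \<open>of_real t \<noteq> 0\<close>] by blast
  qed auto
qed (use T in simp)

lemma equicontinuous_in_subset_imp_continuous:
  "equicontinuous_in X Y H \<Longrightarrow> h \<in> H \<Longrightarrow> continuous_map X Y h"
  by (auto simp: equicontinuous_in_def continuous_linear_maps_def)

section \<open>Transposed multiplication on a space of functions closed under products, whose
  strongly bounded sets of functionals are equicontinuous\<close>

context
  fixes X :: "('a \<Rightarrow> complex) topology" and Q
    and b :: "('a \<Rightarrow> complex) \<Rightarrow> (('a \<Rightarrow> complex) \<Rightarrow> complex) \<Rightarrow> ('a \<Rightarrow> complex) \<Rightarrow> complex"
  assumes base: "seminorm_base X Q"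
    and mult: "\<And>f g. f \<in> topspace X \<Longrightarrow> g \<in> topspace X \<Longrightarrow> f * g \<in> topspace X"
    and mult_equicontinuous: "\<And>q C. q \<in> Q \<Longrightarrow> bounded_in X C \<Longrightarrow>
      \<exists>p\<in>Q. \<forall>f\<in>topspace X. \<forall>g\<in>C. q (f * g) \<le> p f"
    and quasibarrelled: "\<And>B. bounded_in (strong_dual X) B \<Longrightarrow>
      \<exists>q\<in>Q. \<forall>T\<in>B. \<forall>f\<in>topspace X. cmod (T f) \<le> q f"
  defines "b \<equiv> \<lambda>f T g. if g \<in> topspace X then T (f * g) else 0"
begin

lemma bounded_in_singleton: "f \<in> topspace X \<Longrightarrow> bounded_in X {f}"
  unfolding bounded_in_seminorm_base[OF base] by auto

text \<open>\<open>mult_equicontinuous\<close> gives q (f g) \<le> p f uniformly for g in C, and p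
  is bounded on A. The set of products is the test set in
  \<open>transpose_equicontinuous_dual\<close>.\<close>

lemma bounded_in_mult:
  assumes A: "bounded_in X A" and C: "bounded_in X C"
  shows "bounded_in X {f * g | f g. f \<in> A \<and> g \<in> C}"
  unfolding bounded_in_seminorm_base[OF base]
proof (intro conjI ballI)
  have AX: "A \<subseteq> topspace X" "C \<subseteq> topspace X" using A C by (simp_all add: bounded_in_def)
  then show "{f * g | f g. f \<in> A \<and> g \<in> C} \<subseteq> topspace X" using mult by blast
  fix q assume "q \<in> Q"
  then obtain p where p: "p \<in> Q" "\<And>f g. f \<in> topspace X \<Longrightarrow> g \<in> C \<Longrightarrow> q (f * g) \<le> p f"
    using mult_equicontinuous[OF _ C] by blast
  obtain c where "\<And>f. f \<in> A \<Longrightarrow> p f \<le> c" using A p(1) unfolding bounded_in_seminorm_base[OF base] by blast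
  then have "q (f * g) \<le> c" if "f \<in> A" "g \<in> C" for f g using p(2)[of f g] AX that by force
  then show "\<exists>c. \<forall>h\<in>{f * g | f g. f \<in> A \<and> g \<in> C}. q h \<le> c" by blast
qed

lemma transpose_in_dual:
  assumes f: "f \<in> topspace X" and T: "T \<in> dual_space X"
  shows "b f T \<in> dual_space X"
  unfolding dual_space_seminorm_base[OF base]
proof (intro conjI allI impI ballI)
  note Xr = subspace_rules[OF seminorm_base_subspace[OF base]]
  show "b f T g = 0" if "g \<notin> topspace X" for g using that by (simp add: b_def)
  show "b f T (g + h) = b f T g + b f T h" if "g \<in> topspace X" "h \<in> topspace X" for g h
    using that Xr mult[OF f] dual_spaceD(2)[OF T] by (simp add: b_def distrib_left)
  show "b f T (fscale c g) = c * b f T g" if g: "g \<in> topspace X" for c g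
  proof -
    have "f * fscale c g = fscale c (f * g)" by (simp add: fscale_def fun_eq_iff)
    then show ?thesis using g Xr mult[OF f] dual_spaceD(3)[OF T] by (simp add: b_def)
  qed
  obtain q where q: "q \<in> Q" "\<And>f. f \<in> topspace X \<Longrightarrow> cmod (T f) \<le> q f"
    using T unfolding dual_space_seminorm_base[OF base] by blast
  obtain p where p: "p \<in> Q" "\<And>g h. g \<in> topspace X \<Longrightarrow> h \<in> {f} \<Longrightarrow> q (g * h) \<le> p g"
    using mult_equicontinuous[OF q(1) bounded_in_singleton[OF f]] by blast
  have "cmod (b f T g) \<le> p g" if "g \<in> topspace X" for g
    using that q(2)[OF mult[OF that f]] p(2)[OF that, of f] by (simp add: b_def mult.commute[of f])
  then show "\<exists>q\<in>Q. \<forall>g\<in>topspace X. cmod (b f T g) \<le> q g" using p(1) by blast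
qed

lemma bilinear_transpose: "bilinear_map X (strong_dual X) (strong_dual X) b"
  unfolding bilinear_map_def topspace_strong_dual
proof (intro conjI ballI allI)
  fix f T assume f: "f \<in> topspace X" and T: "T \<in> dual_space X"
  show "b f T \<in> dual_space X" by (rule transpose_in_dual[OF f T])
  show "b (f + f') T = b f T + b f' T" if "f' \<in> topspace X" for f'
    using mult f that dual_spaceD(2)[OF T] by (auto simp: b_def fun_eq_iff distrib_right)
  show "b f (T + S) = b f T + b f S" for S
    by (auto simp: b_def fun_eq_iff)
  fix c
  show "b f (fscale c T) = fscale c (b f T)"
    by (auto simp: b_def fscale_def[of _ T] fscale_def[of _ "\<lambda>g. if g \<in> topspace X then T (f * g) else 0"] fun_eq_iff)
  have *: "fscale c f * g = fscale c (f * g)" for g by (simp add: fscale_def fun_eq_iff)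
  show "b (fscale c f) T = fscale c (b f T)"
  proof
    fix g
    show "b (fscale c f) T g = fscale c (b f T) g"
      unfolding b_def * fscale_def[of c "\<lambda>g. if g \<in> topspace X then T (f * g) else 0"]
      using mult[OF f] dual_spaceD(3)[OF T] by auto
  qed
qed

text \<open>Since (f T - f T0) g = (T - T0) (f g), testing on \<open>C\<close> uniformly for f in
  \<open>A\<close> amounts to testing T - T0 on the bounded set of products.\<close>

lemma transpose_equicontinuous_dual:
  assumes A: "bounded_in X A"
  shows "equicontinuous_in (strong_dual X) (strong_dual X) {(\<lambda>T. b f T) | f. f \<in> A}"
proof -
  have AX: "A \<subseteq> topspace X" using A by (simp add: bounded_in_def)
  have key: "\<exists>U. openin (strong_dual X) U \<and> T0 \<in> U \<and>
      (\<forall>f\<in>A. \<forall>T\<in>U. \<forall>g\<in>C. cmod (b f T g - b f T0 g) \<le> e)"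
    if C: "bounded_in X C" and e: "e > 0" and T0: "T0 \<in> dual_space X" for C T0 and e :: real
  proof (intro exI conjI)
    let ?D = "{f * g | f g. f \<in> A \<and> g \<in> C}"
    let ?U = "{T \<in> dual_space X. \<exists>d<e. \<forall>h\<in>?D. cmod (T h - T0 h) \<le> d}"
    show "openin (strong_dual X) ?U" by (rule openin_strong_dual_ball[OF bounded_in_mult[OF A C]])
    show "T0 \<in> ?U" using T0 e by (auto intro: exI[of _ 0])
    show "\<forall>f\<in>A. \<forall>T\<in>?U. \<forall>g\<in>C. cmod (b f T g - b f T0 g) \<le> e"
    proof (intro ballI)
      fix f T g assume "f \<in> A" "T \<in> ?U" "g \<in> C"
      then obtain d where "d < e" "cmod (T (f * g) - T0 (f * g)) \<le> d" by blast
      then show "cmod (b f T g - b f T0 g) \<le> e" using e by (simp add: b_def)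
    qed
  qed
  show ?thesis
    unfolding equicontinuous_in_def topspace_strong_dual
  proof (intro conjI ballI allI impI subsetI)
    fix h assume "h \<in> {(\<lambda>T. b f T) | f. f \<in> A}"
    then obtain f where f: "f \<in> A" "h = (\<lambda>T. b f T)" by blast
    have fX: "f \<in> topspace X" using f AX by blast
    have "continuous_map (strong_dual X) (strong_dual X) h"
    proof (rule continuous_map_pointwiseI)
      fix T0 V assume T0: "T0 \<in> topspace (strong_dual X)" and V: "openin (strong_dual X) V" "h T0 \<in> V"
      from V obtain C e where C: "bounded_in X C" "e > 0"
        "{S \<in> dual_space X. \<forall>g\<in>C. cmod (S g - h T0 g) \<le> e} \<subseteq> V"
        unfolding openin_strong_dual by blast
      obtain U where U: "openin (strong_dual X) U" "T0 \<in> U"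
        "\<forall>f\<in>A. \<forall>T\<in>U. \<forall>g\<in>C. cmod (b f T g - b f T0 g) \<le> e"
        using key[OF C(1,2), of T0] T0 unfolding topspace_strong_dual by blast
      have "h T \<in> V" if T: "T \<in> U" for T
      proof -
        have "T \<in> dual_space X" using openin_subset[OF U(1)] T by auto
        then have "h T \<in> dual_space X" unfolding f(2) by (rule transpose_in_dual[OF fX])
        moreover have "\<forall>g\<in>C. cmod (h T g - h T0 g) \<le> e" using U(3) f T by auto
        ultimately show ?thesis using C(3) by blast
      qed
      then show "\<exists>U. openin (strong_dual X) U \<and> T0 \<in> U \<and> (\<forall>T\<in>U. h T \<in> V)" using U by blast
    qed (use f transpose_in_dual[OF fX] in simp)
    then show "h \<in> continuous_linear_maps (strong_dual X) (strong_dual X)"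
      using bilinear_transpose fX unfolding continuous_linear_maps_def bilinear_map_def f(2) by simp
  next
    fix T0 V assume T0: "T0 \<in> dual_space X" and V: "openin (strong_dual X) V \<and> 0 \<in> V"
    then obtain C e where C: "bounded_in X C" "e > 0"
      "{S \<in> dual_space X. \<forall>g\<in>C. cmod (S g - 0 g) \<le> e} \<subseteq> V"
      unfolding openin_strong_dual by blast
    obtain U where U: "openin (strong_dual X) U" "T0 \<in> U"
      "\<forall>f\<in>A. \<forall>T\<in>U. \<forall>g\<in>C. cmod (b f T g - b f T0 g) \<le> e"
      using key[OF C(1,2) T0] by auto
    have "b f T - b f T0 \<in> V" if "f \<in> A" "T \<in> U" for f T
    proof -
      have "T \<in> dual_space X" using openin_subset[OF U(1)] that by auto
      then have "b f T - b f T0 \<in> dual_space X" using AX that T0 by (intro dual_space_diff transpose_in_dual) auto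
      then show ?thesis using C(3) U(3) that by auto
    qed
    then show "\<exists>U. openin (strong_dual X) U \<and> T0 \<in> U \<and>
        (\<forall>h\<in>{(\<lambda>T. b f T) | f. f \<in> A}. \<forall>T\<in>U. h T - h T0 \<in> V)" using U by blast
  qed
qed

text \<open>Since (f T - f0 T) g = T ((f - f0) g), \<open>quasibarrelled\<close> bounds all T in B
  by one q, and \<open>mult_equicontinuous\<close> bounds q ((f - f0) g) by p (f - f0) uniformly for
  g in C.\<close>

lemma transpose_equicontinuous_space:
  assumes B: "bounded_in (strong_dual X) B"
  shows "equicontinuous_in X (strong_dual X) {(\<lambda>f. b f T) | T. T \<in> B}"
proof -
  have BX: "B \<subseteq> dual_space X" using B by (simp add: bounded_in_def)
  note sub = seminorm_base_subspace[OF base]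
  note Xr = subspace_rules[OF sub]
  obtain q where q: "q \<in> Q" "\<And>T f. T \<in> B \<Longrightarrow> f \<in> topspace X \<Longrightarrow> cmod (T f) \<le> q f"
    using quasibarrelled[OF B] by blast
  have key: "\<exists>U. openin X U \<and> f0 \<in> U \<and> (\<forall>T\<in>B. \<forall>f\<in>U. \<forall>g\<in>C. cmod (b f T g - b f0 T g) \<le> e)"
    if C: "bounded_in X C" and e: "e > 0" and f0: "f0 \<in> topspace X" for C f0 and e :: real
  proof -
    obtain p where p: "p \<in> Q" "\<And>f g. f \<in> topspace X \<Longrightarrow> g \<in> C \<Longrightarrow> q (f * g) \<le> p f"
      using mult_equicontinuous[OF q(1) C] by blast
    have CX: "C \<subseteq> topspace X" using C by (simp add: bounded_in_def)
    let ?U = "{f \<in> topspace X. p (f - f0) < e}"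
    have "cmod (b f T g - b f0 T g) \<le> e" if "T \<in> B" "f \<in> ?U" "g \<in> C" for T f g
    proof -
      have T: "T \<in> dual_space X" and g: "g \<in> topspace X" and f: "f \<in> topspace X" using that BX CX by auto
      have ff: "f - f0 \<in> topspace X" using Xr(4)[OF f f0] .
      have "T (f * g) = T ((f - f0) * g + f0 * g)" by (simp only: left_diff_distrib diff_add_cancel)
      also have "\<dots> = T ((f - f0) * g) + T (f0 * g)"
        by (rule dual_spaceD(2)[OF T mult[OF ff g] mult[OF f0 g]])
      finally have "b f T g - b f0 T g = T ((f - f0) * g)" using g by (simp add: b_def)
      also have "cmod \<dots> \<le> q ((f - f0) * g)" using q(2)[OF that(1) mult[OF ff g]] .
      also have "\<dots> \<le> p (f - f0)" using p(2)[OF ff that(3)] .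
      finally show ?thesis using that(2) by simp
    qed
    moreover have "openin X ?U" by (rule openin_seminorm_base_ball[OF base p(1) f0])
    moreover have "f0 \<in> ?U" using f0 e seminorm_on_zero[OF seminorm_base_seminorm[OF base p(1)] Xr(1)] by simp
    ultimately show ?thesis by blast
  qed
  show ?thesis
    unfolding equicontinuous_in_def
  proof (intro conjI ballI allI impI subsetI)
    fix h assume "h \<in> {(\<lambda>f. b f T) | T. T \<in> B}"
    then obtain T where T: "T \<in> B" "h = (\<lambda>f. b f T)" by blast
    have TX: "T \<in> dual_space X" using T BX by blast
    have "continuous_map X (strong_dual X) h"
    proof (rule continuous_map_pointwiseI)
      fix f0 V assume f0: "f0 \<in> topspace X" and V: "openin (strong_dual X) V" "h f0 \<in> V"
      from V obtain C e where C: "bounded_in X C" "e > 0"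
        "{S \<in> dual_space X. \<forall>g\<in>C. cmod (S g - h f0 g) \<le> e} \<subseteq> V"
        unfolding openin_strong_dual by blast
      obtain U where U: "openin X U" "f0 \<in> U"
        "\<forall>T\<in>B. \<forall>f\<in>U. \<forall>g\<in>C. cmod (b f T g - b f0 T g) \<le> e"
        using key[OF C(1,2) f0] by auto
      have "h f \<in> V" if f: "f \<in> U" for f
      proof -
        have "f \<in> topspace X" using openin_subset[OF U(1)] f by auto
        then have "h f \<in> dual_space X" unfolding T(2) by (rule transpose_in_dual[OF _ TX])
        moreover have "\<forall>g\<in>C. cmod (h f g - h f0 g) \<le> e" using U(3) T f by auto
        ultimately show ?thesis using C(3) by blast
      qed
      then show "\<exists>U. openin X U \<and> f0 \<in> U \<and> (\<forall>f\<in>U. h f \<in> V)" using U by blast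
    qed (use T transpose_in_dual[OF _ TX] in simp)
    then show "h \<in> continuous_linear_maps X (strong_dual X)"
      using bilinear_transpose TX unfolding continuous_linear_maps_def bilinear_map_def T(2) by simp
  next
    fix f0 V assume f0: "f0 \<in> topspace X" and V: "openin (strong_dual X) V \<and> 0 \<in> V"
    then obtain C e where C: "bounded_in X C" "e > 0"
      "{S \<in> dual_space X. \<forall>g\<in>C. cmod (S g - 0 g) \<le> e} \<subseteq> V"
      unfolding openin_strong_dual by blast
    obtain U where U: "openin X U" "f0 \<in> U"
      "\<forall>T\<in>B. \<forall>f\<in>U. \<forall>g\<in>C. cmod (b f T g - b f0 T g) \<le> e"
      using key[OF C(1,2) f0] by auto
    have "b f T - b f0 T \<in> V" if "T \<in> B" "f \<in> U" for f T
    proof -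
      have "f \<in> topspace X" using openin_subset[OF U(1)] that by auto
      then have "b f T - b f0 T \<in> dual_space X" using BX that f0 by (intro dual_space_diff transpose_in_dual) auto
      then show ?thesis using C(3) U(3) that by auto
    qed
    then show "\<exists>U. openin X U \<and> f0 \<in> U \<and>
        (\<forall>h\<in>{(\<lambda>f. b f T) | T. T \<in> B}. \<forall>f\<in>U. h f - h f0 \<in> V)" using U by blast
  qed
qed

lemma hypocontinuous_transpose: "hypocontinuous X (strong_dual X) (strong_dual X) b"
  unfolding hypocontinuous_def
  using transpose_equicontinuous_dual transpose_equicontinuous_space by blast

lemma separately_continuous_transpose: "separately_continuous X (strong_dual X) (strong_dual X) b"
  unfolding separately_continuous_def
proof (intro conjI ballI)
  show "continuous_map (strong_dual X) (strong_dual X) (\<lambda>T. b f T)" if "f \<in> topspace X" for f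
    by (rule equicontinuous_in_subset_imp_continuous[OF
          transpose_equicontinuous_dual[OF bounded_in_singleton[OF that]]]) blast
  show "continuous_map X (strong_dual X) (\<lambda>f. b f T)" if "T \<in> topspace (strong_dual X)" for T
    using that by (intro equicontinuous_in_subset_imp_continuous[OF
          transpose_equicontinuous_space[OF bounded_in_strong_dual_singleton[OF base]]]) auto
qed

end

section \<open>Gaussian atoms\<close>

text \<open>Hermite polynomials with the sign (-1)^k built in, so that \<open>gauss_deriv k\<close>
  is the k-th derivative of exp (- u^2 / 2) itself.\<close>

fun hermite :: "nat \<Rightarrow> real \<Rightarrow> real" where
  "hermite 0 u = 1"
| "hermite (Suc 0) u = - u"
| "hermite (Suc (Suc k)) u = - u * hermite (Suc k) u - real (Suc k) * hermite k u"

definition gauss_deriv :: "nat \<Rightarrow> real \<Rightarrow> real"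
  where "gauss_deriv k u = hermite k u * exp (- u\<^sup>2 / 2)"

lemma hermite_deriv: "(hermite k has_real_derivative hermite (Suc k) u + u * hermite k u) (at u)"
proof -
  \<comment> \<open>The classical rule He_k' = k He_(k-1) in this sign convention. The claimed form,
    suited to the product rule with exp (- u^2 / 2), then follows from the recurrence.\<close>
  have "(hermite k has_real_derivative (case k of 0 \<Rightarrow> 0 | Suc l \<Rightarrow> - real k * hermite l u)) (at u)"
  proof (induction k rule: induct_nat_012)
    case (ge2 k)
    have "((\<lambda>u. - u * hermite (Suc k) u - real (Suc k) * hermite k u) has_real_derivative
        - 1 * hermite (Suc k) u + (- u) * (- real (Suc k) * hermite k u) -
        real (Suc k) * (case k of 0 \<Rightarrow> 0 | Suc l \<Rightarrow> - real k * hermite l u)) (at u)"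
      using ge2.IH by (auto intro!: derivative_eq_intros)
    moreover have "- 1 * hermite (Suc k) u + (- u) * (- real (Suc k) * hermite k u) -
        real (Suc k) * (case k of 0 \<Rightarrow> 0 | Suc l \<Rightarrow> - real k * hermite l u) = - real (Suc (Suc k)) * hermite (Suc k) u"
      by (cases k) (simp_all add: algebra_simps)
    ultimately show ?case by simp
  qed (auto intro!: derivative_eq_intros)
  moreover have "(case k of 0 \<Rightarrow> 0 | Suc l \<Rightarrow> - real k * hermite l u) = hermite (Suc k) u + u * hermite k u"
    by (cases k) (simp_all add: algebra_simps)
  ultimately show ?thesis by simp
qed

lemma gauss_deriv: "(gauss_deriv k has_real_derivative gauss_deriv (Suc k) u) (at u)"
  unfolding gauss_deriv_def
  by (auto intro!: derivative_eq_intros hermite_deriv simp: power2_eq_square algebra_simps)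

text \<open>The recurrence is compared with the partial sums S_k of exp L for L = \<rho> |u| +
  \<rho>^2: because L S_k \<le> (k + 1) S_(k+1), induction gives the bound k! S_k. The parameter
  \<rho> is free, to match \<open>weight_coeff_fact\<close>.\<close>

lemma hermite_le:
  fixes u \<rho> :: real
  assumes "\<rho> \<ge> 0"
  shows "\<bar>hermite k u\<bar> * \<rho> ^ k \<le> fact k * exp (\<rho> * \<bar>u\<bar> + \<rho>\<^sup>2)"
proof -
  define L where "L = \<rho> * \<bar>u\<bar> + \<rho>\<^sup>2"
  define S where "S k = (\<Sum>i\<le>k. L ^ i / fact i)" for k
  have L: "L \<ge> 0" using assms by (simp add: L_def)
  have S_mono: "S k \<le> S (Suc k)" for k using L by (simp add: S_def)
  have S_pos: "S k \<ge> 0" for k using L by (auto simp: S_def intro!: sum_nonneg)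
  have LS: "L * S k \<le> real (Suc k) * S (Suc k)" for k
  proof -
    have "L * S k = (\<Sum>i\<le>k. real (Suc i) * (L ^ Suc i / fact (Suc i)))"
      unfolding S_def sum_distrib_left by (intro sum.cong) (simp_all add: field_simps del: of_nat_Suc)
    also have "\<dots> \<le> (\<Sum>i\<le>k. real (Suc k) * (L ^ Suc i / fact (Suc i)))"
      using L by (intro sum_mono mult_right_mono) auto
    also have "\<dots> = real (Suc k) * (\<Sum>i\<le>k. L ^ Suc i / fact (Suc i))" by (simp add: sum_distrib_left)
    also have "\<dots> \<le> real (Suc k) * S (Suc k)"
      unfolding S_def sum.atMost_Suc_shift[of _ k] by (intro mult_left_mono) auto
    finally show ?thesis .
  qed
  have "\<bar>hermite k u\<bar> * \<rho> ^ k \<le> fact k * S k"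
  proof (induction k rule: induct_nat_012)
    case 1
    have "0 \<le> \<rho>\<^sup>2" by simp
    then show ?case by (simp add: S_def L_def mult.commute)
  next
    case (ge2 k)
    have "\<bar>hermite (Suc (Suc k)) u\<bar> * \<rho> ^ Suc (Suc k) \<le>
        (\<bar>u\<bar> * \<bar>hermite (Suc k) u\<bar> + real (Suc k) * \<bar>hermite k u\<bar>) * \<rho> ^ Suc (Suc k)"
      using assms by (intro mult_right_mono) (auto simp: abs_mult intro: order_trans[OF abs_triangle_ineq4])
    also have "\<dots> = (\<rho> * \<bar>u\<bar>) * (\<bar>hermite (Suc k) u\<bar> * \<rho> ^ Suc k) + \<rho>\<^sup>2 * real (Suc k) * (\<bar>hermite k u\<bar> * \<rho> ^ k)"
      by (simp add: algebra_simps power2_eq_square)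
    also have "\<dots> \<le> (\<rho> * \<bar>u\<bar>) * (fact (Suc k) * S (Suc k)) + \<rho>\<^sup>2 * real (Suc k) * (fact k * S k)"
      using assms ge2.IH by (intro add_mono mult_left_mono) auto
    also have "\<dots> \<le> (\<rho> * \<bar>u\<bar>) * (fact (Suc k) * S (Suc k)) + \<rho>\<^sup>2 * real (Suc k) * (fact k * S (Suc k))"
      using S_mono assms by (intro add_mono mult_left_mono) auto
    also have "\<dots> = fact (Suc k) * (L * S (Suc k))" by (simp add: L_def algebra_simps)
    also have "\<dots> \<le> fact (Suc k) * (real (Suc (Suc k)) * S (Suc (Suc k)))"
      using LS[of "Suc k"] by (intro mult_left_mono) simp_all
    also have "\<dots> = fact (Suc (Suc k)) * S (Suc (Suc k))" by (simp add: algebra_simps)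
    finally show ?case .
  qed (simp add: S_def)
  also have "\<dots> \<le> fact k * exp L"
  proof (rule mult_left_mono)
    have s: "(\<lambda>i. L ^ i / fact i) sums exp L" using exp_converges[of L] by (simp add: field_simps scaleR_conv_of_real)
    have "S k \<le> (\<Sum>i. L ^ i / fact i)"
      unfolding S_def using sums_summable[OF s] L by (intro sum_le_suminf) auto
    then show "S k \<le> exp L" using sums_unique[OF s] by simp
  qed simp
  finally show ?thesis by (simp add: L_def)
qed

text \<open>Written, like \<open>gaussian\<close>, as a product over coordinates, so that
  derivatives and integrals factor; \<open>modulation_eq\<close> and \<open>gaussian_eq\<close> give
  the closed forms.\<close>

definition modulation :: "real^'n::finite \<Rightarrow> real^'n \<Rightarrow> complex"
  where "modulation \<xi> = (\<lambda>t. \<Prod>i\<in>UNIV. exp (\<i> * of_real (\<xi> $ i * t $ i)))"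

definition gaussian :: "real^'n::finite \<Rightarrow> real^'n \<Rightarrow> complex"
  where "gaussian x = (\<lambda>t. \<Prod>i\<in>UNIV. of_real (gauss_deriv 0 (t $ i - x $ i)))"

definition atom :: "(real^'n::finite) \<times> (real^'n) \<Rightarrow> real^'n \<Rightarrow> complex"
  where "atom y = modulation (snd y) * gaussian (fst y)"

lemma smooth_modulation: "smooth (modulation \<xi>)"
  and deriv_list_modulation:
  "deriv_list js (modulation \<xi>) =
    (\<lambda>t. \<Prod>i\<in>UNIV. (\<i> * of_real (\<xi> $ i)) ^ count_list js i * exp (\<i> * of_real (\<xi> $ i * t $ i)))"
proof -
  let ?H = "\<lambda>i k t. (\<i> * of_real (\<xi> $ i)) ^ k * exp (\<i> * of_real (\<xi> $ i * t))"
  have "((\<lambda>t. exp (\<i> * of_real (\<xi> $ i * t))) has_vector_derivative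
      \<i> * of_real (\<xi> $ i) * exp (\<i> * of_real (\<xi> $ i * t))) (at t)" for i t
  proof -
    have "((\<lambda>z. exp (\<i> * of_real (\<xi> $ i) * z)) has_field_derivative
        \<i> * of_real (\<xi> $ i) * exp (\<i> * of_real (\<xi> $ i) * of_real t)) (at (of_real t))"
      by (auto intro!: derivative_eq_intros)
    from has_vector_derivative_real_field[OF this] show ?thesis by (simp add: mult.assoc)
  qed
  then have "(?H i k has_vector_derivative ?H i (Suc k) t) (at t)" for i k t
    unfolding power_Suc2 mult.assoc by (intro has_vector_derivative_mult_right) (simp only: mult.assoc)
  from smooth_product_of_coordinates[where H="?H", OF this]
  show "smooth (modulation \<xi>)" "deriv_list js (modulation \<xi>) =
    (\<lambda>t. \<Prod>i\<in>UNIV. (\<i> * of_real (\<xi> $ i)) ^ count_list js i * exp (\<i> * of_real (\<xi> $ i * t $ i)))"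
    by (simp_all add: modulation_def)
qed

lemma smooth_gaussian: "smooth (gaussian x)"
  and deriv_list_gaussian:
  "deriv_list js (gaussian x) = (\<lambda>t. \<Prod>i\<in>UNIV. of_real (gauss_deriv (count_list js i) (t $ i - x $ i)))"
proof -
  let ?H = "\<lambda>i k t. complex_of_real (gauss_deriv k (t - x $ i))"
  have "((\<lambda>t. gauss_deriv k (t - x $ i)) has_real_derivative gauss_deriv (Suc k) (t - x $ i)) (at t)" for i k t
    by (rule DERIV_cong[OF DERIV_chain2[OF gauss_deriv]]) (auto intro!: derivative_eq_intros)
  then have "(?H i k has_vector_derivative ?H i (Suc k) t) (at t)" for i k t
    using has_vector_derivative_of_real has_real_derivative_iff_has_vector_derivative by blast
  from smooth_product_of_coordinates[where H="?H", OF this]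
  show "smooth (gaussian x)"
    "deriv_list js (gaussian x) = (\<lambda>t. \<Prod>i\<in>UNIV. of_real (gauss_deriv (count_list js i) (t $ i - x $ i)))"
    by (simp_all add: gaussian_def)
qed

lemma smooth_atom: "smooth (atom y)"
  unfolding atom_def by (intro smooth_mult smooth_modulation smooth_gaussian)

lemma modulation_eq: "modulation \<xi> t = exp (\<i> * of_real (\<xi> \<bullet> t))"
  unfolding modulation_def inner_vec_def by (simp add: exp_sum sum_distrib_left)

lemma gaussian_eq: "gaussian x t = of_real (exp (- (norm (t - x))\<^sup>2 / 2))"
proof -
  have "gaussian x t = of_real (\<Prod>i\<in>UNIV. exp (- (t $ i - x $ i)\<^sup>2 / 2))"
    by (simp add: gaussian_def gauss_deriv_def)
  also have "(\<Prod>i\<in>UNIV. exp (- (t $ i - x $ i)\<^sup>2 / 2)) = exp (\<Sum>i\<in>UNIV. - (t $ i - x $ i)\<^sup>2 / 2)"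
    by (simp add: exp_sum)
  also have "(\<Sum>i\<in>UNIV. - (t $ i - x $ i)\<^sup>2 / 2) = - (norm (t - x))\<^sup>2 / 2"
  proof -
    have "(norm (t - x))\<^sup>2 = (\<Sum>i\<in>UNIV. (t $ i - x $ i)\<^sup>2)"
      by (simp add: norm_vec_def L2_set_def sum_nonneg)
    then show ?thesis by (simp add: sum_negf sum_divide_distrib)
  qed
  finally show ?thesis .
qed

lemma norm_modulation [simp]: "cmod (modulation \<xi> t) = 1"
  by (simp add: modulation_eq)

lemma continuous_on_gauss_deriv [continuous_intros]:
  "continuous_on S f \<Longrightarrow> continuous_on S (\<lambda>x. gauss_deriv k (f x))"
  by (rule continuous_on_compose2[of UNIV "gauss_deriv k"])
    (auto intro!: continuous_at_imp_continuous_on DERIV_isCont[OF gauss_deriv])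

text \<open>The innermost derivative is moved onto one of the two factors by the product rule. The
  induction thus runs over products of explicitly known derivatives, which are jointly continuous in
  position, frequency and argument.\<close>

lemma continuous_on_deriv_list_atom:
  "continuous_on UNIV (\<lambda>z. deriv_list (js :: 'n::finite list) (atom (fst z)) (snd z))"
proof -
  have "continuous_on UNIV (\<lambda>z :: ((real^'n) \<times> (real^'n)) \<times> (real^'n).
    deriv_list js (deriv_list ks (modulation (snd (fst z))) * deriv_list ls (gaussian (fst (fst z)))) (snd z))" for ks ls
  proof (induction js arbitrary: ks ls rule: rev_induct)
    case Nil
    show ?case
      unfolding deriv_list_simps times_fun_apply deriv_list_modulation deriv_list_gaussian
      by (intro continuous_intros)
  next
    case (snoc i js)
    have "deriv_list (js @ [i]) (deriv_list ks (modulation \<xi>) * deriv_list ls (gaussian x)) =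
      deriv_list js (deriv_list (i # ks) (modulation \<xi>) * deriv_list ls (gaussian x)) +
      deriv_list js (deriv_list ks (modulation \<xi>) * deriv_list (i # ls) (gaussian x))" for \<xi> x :: "real^'n"
      by (simp add: partial_deriv_mult deriv_list_add smooth_mult smooth_partial_deriv smooth_deriv_list
          smooth_modulation smooth_gaussian del: times_fun_apply plus_fun_apply)
    then show ?case using snoc.IH[of "i # ks" ls] snoc.IH[of ks "i # ls"]
      by (simp only: plus_fun_apply) (rule continuous_on_add)
  qed
  from this[of "[]" "[]"] show ?thesis by (simp only: deriv_list_simps atom_def)
qed

context weight_function
begin

text \<open>\<open>hermite_le\<close> is used with the \<rho> of \<open>weight_coeff_fact\<close>,
  so that \<rho>^k cancels and only a factor in u remains; the Gaussian turns this into decay of any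
  exponential rate \<kappa>.\<close>

lemma gauss_deriv_weight_bound:
  "\<exists>C. \<forall>k u. \<bar>gauss_deriv k u\<bar> * v m k \<le> C * exp (- \<kappa> * \<bar>u\<bar>)"
proof -
  obtain \<rho> C where \<rho>: "\<rho> \<ge> 1" and C: "\<And>k. fact k * v m k \<le> C * \<rho> ^ k" using weight_coeff_fact by blast
  have "\<bar>gauss_deriv k u\<bar> * v m k \<le> C * exp (\<rho>\<^sup>2 + (\<rho> + \<kappa>)\<^sup>2 / 2) * exp (- \<kappa> * \<bar>u\<bar>)" for k u
  proof -
    have C0: "C \<ge> 0" using C[of 0] weight_coeff_0 by simp
    have "\<rho> ^ k * (\<bar>gauss_deriv k u\<bar> * v m k) = (\<bar>hermite k u\<bar> * \<rho> ^ k) * (exp (- u\<^sup>2 / 2) * v m k)"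
      by (simp add: gauss_deriv_def abs_mult)
    also have "\<dots> \<le> (fact k * exp (\<rho> * \<bar>u\<bar> + \<rho>\<^sup>2)) * (exp (- u\<^sup>2 / 2) * v m k)"
      using hermite_le[of \<rho> k u] \<rho> weight_coeff_nonneg by (intro mult_right_mono) auto
    also have "\<dots> = exp (\<rho> * \<bar>u\<bar> + \<rho>\<^sup>2 - u\<^sup>2 / 2) * (fact k * v m k)"
    proof -
      have "exp (\<rho> * \<bar>u\<bar> + \<rho>\<^sup>2 - u\<^sup>2 / 2) = exp (\<rho> * \<bar>u\<bar> + \<rho>\<^sup>2) * exp (- u\<^sup>2 / 2)"
        by (simp flip: exp_add)
      then show ?thesis by simp
    qed
    also have "\<dots> \<le> exp (\<rho> * \<bar>u\<bar> + \<rho>\<^sup>2 - u\<^sup>2 / 2) * (C * \<rho> ^ k)" using C[of k] by (intro mult_left_mono) auto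
    finally have "\<rho> ^ k * (\<bar>gauss_deriv k u\<bar> * v m k) \<le> \<rho> ^ k * (C * exp (\<rho> * \<bar>u\<bar> + \<rho>\<^sup>2 - u\<^sup>2 / 2))"
      by (simp add: mult_ac)
    then have "\<bar>gauss_deriv k u\<bar> * v m k \<le> C * exp (\<rho> * \<bar>u\<bar> + \<rho>\<^sup>2 - u\<^sup>2 / 2)" using \<rho> by simp
    also have "\<dots> \<le> C * exp (\<rho>\<^sup>2 + (\<rho> + \<kappa>)\<^sup>2 / 2 + - \<kappa> * \<bar>u\<bar>)"
    proof -
      \<comment> \<open>Completing the square at |u| = \<rho> + \<kappa> trades u^2 / 2 for linear
        decay of rate \<kappa>.\<close>
      have "0 \<le> (\<bar>u\<bar> - (\<rho> + \<kappa>))\<^sup>2" by simp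
      also have "\<dots> = u\<^sup>2 - 2 * (\<rho> * \<bar>u\<bar> + \<kappa> * \<bar>u\<bar>) + (\<rho> + \<kappa>)\<^sup>2"
        unfolding power2_diff by (simp add: algebra_simps)
      finally have "\<rho> * \<bar>u\<bar> + \<rho>\<^sup>2 - u\<^sup>2 / 2 \<le> \<rho>\<^sup>2 + (\<rho> + \<kappa>)\<^sup>2 / 2 + - \<kappa> * \<bar>u\<bar>"
        by simp
      then show ?thesis using C0 by (intro mult_left_mono) auto
    qed
    finally show ?thesis by (simp only: exp_add mult.assoc)
  qed
  then show ?thesis by blast
qed

lemma weight_coeff_sum_le: "finite I \<Longrightarrow> v m (\<Sum>i\<in>I. c i) \<le> (\<Prod>i\<in>I. v m (c i))"
proof (induction I rule: finite_induct)
  case (insert i I)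
  have "v m (\<Sum>i\<in>insert i I. c i) \<le> v m (c i) * v m (\<Sum>i\<in>I. c i)"
    using insert weight_coeff_submult by simp
  also have "\<dots> \<le> v m (c i) * (\<Prod>i\<in>I. v m (c i))"
    using insert weight_coeff_nonneg by (intro mult_left_mono)
  finally show ?case using insert by simp
qed (simp add: weight_coeff_0)

text \<open>The coordinatewise bounds multiply, and the sum of the |t_i - x_i| dominates the
  Euclidean norm. The rate \<kappa> is later chosen to beat the growth in
  \<open>weight_shift_bound\<close>.\<close>

lemma gaussian_weight_bound:
  assumes "\<kappa> \<ge> 0"
  shows "\<exists>C. \<forall>js (x :: real^'n::finite) t.
    cmod (deriv_list js (gaussian x) t) * v m (length js) \<le> C * exp (- \<kappa> * norm (t - x))"
proof -
  obtain C where C: "\<And>k u. \<bar>gauss_deriv k u\<bar> * v m k \<le> C * exp (- \<kappa> * \<bar>u\<bar>)"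
    using gauss_deriv_weight_bound by blast
  have C0: "C \<ge> 0" using C[of 0 0] by (simp add: gauss_deriv_def weight_coeff_0)
  have "cmod (deriv_list js (gaussian x) t) * v m (length js) \<le> C ^ CARD('n) * exp (- \<kappa> * norm (t - x))"
    for js and x t :: "real^'n"
  proof -
    have len: "length js = (\<Sum>i\<in>UNIV. count_list js i)" by (simp add: sum_count_set)
    have "cmod (deriv_list js (gaussian x) t) * v m (length js) \<le>
        (\<Prod>i\<in>UNIV. \<bar>gauss_deriv (count_list js i) (t $ i - x $ i)\<bar>) * (\<Prod>i\<in>UNIV. v m (count_list js i))"
      unfolding deriv_list_gaussian len
      by (intro mult_mono weight_coeff_sum_le) (auto simp: prod_norm[symmetric] weight_coeff_nonneg intro!: prod_nonneg)
    also have "\<dots> = (\<Prod>i\<in>UNIV. \<bar>gauss_deriv (count_list js i) (t $ i - x $ i)\<bar> * v m (count_list js i))"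
      by (simp add: prod.distrib)
    also have "\<dots> \<le> (\<Prod>i\<in>(UNIV :: 'n set). C * exp (- \<kappa> * \<bar>t $ i - x $ i\<bar>))"
      using C weight_coeff_nonneg by (intro prod_mono) auto
    also have "\<dots> = C ^ CARD('n) * exp (- \<kappa> * (\<Sum>i\<in>UNIV. \<bar>(t - x) $ i\<bar>))"
      by (simp add: prod.distrib exp_sum[symmetric] sum_distrib_left sum_negf)
    also have "\<dots> \<le> C ^ CARD('n) * exp (- \<kappa> * norm (t - x))"
      using assms C0 norm_le_l1_cart[of "t - x"] by (intro mult_left_mono) (auto intro: mult_left_mono)
    finally show ?thesis .
  qed
  then show ?thesis by blast
qed

text \<open>Each derivative multiplies by a coordinate of \<xi>, so the largest coordinate is the
  natural size of the frequency. \<open>infnorm\<close> returns in \<open>stft_bound\<close>, where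
  it is attained by one coordinate.\<close>

lemma modulation_weight_bound:
  "cmod (deriv_list js (modulation \<xi>) t) * v m (length js) \<le> exp (real m * \<omega> (infnorm \<xi>))"
proof -
  have "cmod (deriv_list js (modulation \<xi>) t) = (\<Prod>i\<in>UNIV. \<bar>\<xi> $ i\<bar> ^ count_list js i)"
    unfolding deriv_list_modulation by (simp add: prod_norm[symmetric] norm_mult norm_power)
  also have "\<dots> \<le> (\<Prod>i\<in>UNIV. infnorm \<xi> ^ count_list js i)"
    by (intro prod_mono conjI power_mono component_le_infnorm_cart) auto
  also have "\<dots> = infnorm \<xi> ^ length js" by (simp add: power_sum[symmetric] sum_count_set)
  finally have "cmod (deriv_list js (modulation \<xi>) t) * v m (length js) \<le> infnorm \<xi> ^ length js * v m (length js)"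
    by (intro mult_right_mono weight_coeff_nonneg)
  also have "\<dots> \<le> exp (real m * \<omega> (infnorm \<xi>))" by (rule weight_coeff_power[OF infnorm_pos_le])
  finally show ?thesis .
qed

lemma atom_weight_bound:
  assumes "\<kappa> \<ge> 0"
  shows "\<exists>C\<ge>0. \<forall>js (x :: real^'n::finite) \<xi> t. ordered_list js \<longrightarrow>
    cmod (deriv_list js (atom (x, \<xi>)) t) * v m (length js) \<le>
    C * exp (real (doubling * m) * \<omega> (infnorm \<xi>)) * exp (- \<kappa> * norm (t - x))"
proof -
  obtain C where C: "\<And>js (x :: real^'n) t.
      cmod (deriv_list js (gaussian x) t) * v (doubling * m) (length js) \<le> C * exp (- \<kappa> * norm (t - x))"
    using gaussian_weight_bound[OF assms] by blast
  have "0 \<le> C * exp (- \<kappa> * norm (0 :: real^'n))"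
    using C[of "[]" 0 0] by (auto simp: weight_coeff_0 intro: order_trans[OF norm_ge_zero])
  then have C0: "C \<ge> 0" by simp
  have "cmod (deriv_list js (atom (x, \<xi>)) t) * v m (length js) \<le>
      exp (real (doubling * m)) * (exp (real (doubling * m) * \<omega> (infnorm \<xi>)) * (C * exp (- \<kappa> * norm (t - x))))"
    if "ordered_list js" for js and x \<xi> t :: "real^'n"
    unfolding atom_def fst_conv snd_conv
    by (rule deriv_list_mult_weight[OF smooth_modulation smooth_gaussian modulation_weight_bound C that])
  then show ?thesis using C0
    by (intro exI[of _ "exp (real (doubling * m)) * C"]) (auto simp: mult_ac)
qed

text \<open>The substitute for subadditivity: moving the argument from x to t multiplies n by
  \<open>doubling\<close>, and the difference t - x enters only linearly, because \<omega> grows at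
  most linearly.\<close>

lemma weight_shift_bound:
  "\<exists>H\<ge>0. \<forall>x t :: real^'n::finite. real n * \<omega> (norm x) \<le>
    real (n * doubling) * \<omega> (norm t) + H * (1 + norm (t - x))"
proof -
  obtain H where H: "H \<ge> 0" "\<And>t. t \<ge> 0 \<Longrightarrow> \<omega> t \<le> H * (1 + t)" using weight_linear_bound by blast
  let ?D = "real (n * doubling)"
  have "real n * \<omega> (norm x) \<le> ?D * \<omega> (norm t) + ?D * (1 + H) * (1 + norm (t - x))" for x t :: "real^'n"
  proof -
    have "\<omega> (norm x) \<le> real doubling * (1 + \<omega> (norm t) + \<omega> (norm (x - t)))"
      using weight_norm_add_le[of t "x - t"] by simp
    also have "\<dots> \<le> real doubling * (1 + \<omega> (norm t) + H * (1 + norm (t - x)))"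
      using H(2)[of "norm (x - t)"] by (intro mult_left_mono) (auto simp: norm_minus_commute)
    finally have "real n * \<omega> (norm x) \<le> real n * (real doubling * (1 + \<omega> (norm t) + H * (1 + norm (t - x))))"
      by (intro mult_left_mono) auto
    also have "\<dots> = ?D * \<omega> (norm t) + ?D * (1 + H * (1 + norm (t - x)))" by (simp add: algebra_simps)
    also have "\<dots> \<le> ?D * \<omega> (norm t) + ?D * ((1 + H) * (1 + norm (t - x)))"
      using H(1) by (intro add_left_mono mult_left_mono) (auto simp: algebra_simps)
    finally show ?thesis by (simp only: mult.assoc)
  qed
  then show ?thesis using H(1) by (intro exI[of _ "?D * (1 + H)"]) auto
qed

lemma atom_bound:
  "\<exists>C\<ge>0. \<forall>x \<xi> :: real^'n::finite. bound m (n * doubling)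
    (C * exp (real (doubling * m) * \<omega> (infnorm \<xi>) - real n * \<omega> (norm x))) (atom (x, \<xi>))"
proof -
  obtain H where H: "H \<ge> 0" "\<And>x t :: real^'n. real n * \<omega> (norm x) \<le>
    real (n * doubling) * \<omega> (norm t) + H * (1 + norm (t - x))" using weight_shift_bound[of n] by blast
  obtain C where C: "C \<ge> 0" "\<And>js (x :: real^'n) \<xi> t. ordered_list js \<Longrightarrow>
    cmod (deriv_list js (atom (x, \<xi>)) t) * v m (length js) \<le>
    C * exp (real (doubling * m) * \<omega> (infnorm \<xi>)) * exp (- H * norm (t - x))"
    using atom_weight_bound[OF H(1)] by blast
  have "bound m (n * doubling) (C * exp H * exp (real (doubling * m) * \<omega> (infnorm \<xi>) - real n * \<omega> (norm x)))
      (atom (x, \<xi>))" for x \<xi> :: "real^'n"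
    unfolding deriv_bound_def
  proof (intro allI impI)
    fix js :: "'n list" and t :: "real^'n" assume "ordered_list js"
    from C(2)[OF this] have "cmod (deriv_list js (atom (x, \<xi>)) t) * v m (length js) \<le>
      C * exp (real (doubling * m) * \<omega> (infnorm \<xi>) - H * norm (t - x))" by (simp add: exp_diff exp_minus field_simps)
    also have "\<dots> \<le> C * exp (H + (real (doubling * m) * \<omega> (infnorm \<xi>) - real n * \<omega> (norm x)) +
        real (n * doubling) * \<omega> (norm t))"
      using H(2)[of x t] C(1) by (intro mult_left_mono) (auto simp: algebra_simps)
    finally show "cmod (deriv_list js (atom (x, \<xi>)) t) * v m (length js) \<le>
      C * exp H * exp (real (doubling * m) * \<omega> (infnorm \<xi>) - real n * \<omega> (norm x)) *
      exp (real (n * doubling) * \<omega> (norm t))" by (simp only: exp_add mult.assoc)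
  qed
  then show ?thesis using C(1) by (intro exI[of _ "C * exp H"]) auto
qed

lemma windowed_bound:
  "\<exists>C\<ge>0. \<forall>f A x s js. smooth f \<longrightarrow> bound (doubling * m) n A f \<longrightarrow> ordered_list js \<longrightarrow>
    cmod (deriv_list js (f * gaussian (x :: real^'n::finite)) s) * v m (length js) \<le>
    C * A * exp (real (n * doubling) * \<omega> (norm x)) * exp (- norm (s - x))"
proof -
  obtain H where H: "H \<ge> 0" "\<And>x t :: real^'n. real n * \<omega> (norm x) \<le>
    real (n * doubling) * \<omega> (norm t) + H * (1 + norm (t - x))" using weight_shift_bound[of n] by blast
  \<comment> \<open>The rate \<open>H\<close> compensates the growth of f and the additional 1
    leaves the integrable factor exp (- |s - x|).\<close>
  have "H + 1 \<ge> 0" using H(1) by simp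
  then obtain C where C: "\<And>js (x :: real^'n) t.
      cmod (deriv_list js (gaussian x) t) * v (doubling * m) (length js) \<le> C * exp (- (H + 1) * norm (t - x))"
    using gaussian_weight_bound by blast
  have "0 \<le> C * exp (- (H + 1) * norm (0 :: real^'n))"
    using C[of "[]" 0 0] by (auto simp: weight_coeff_0 intro: order_trans[OF norm_ge_zero])
  then have C0: "C \<ge> 0" by simp
  let ?E = "exp (real (doubling * m))"
  have "cmod (deriv_list js (f * gaussian x) s) * v m (length js) \<le>
    ?E * C * exp H * A * exp (real (n * doubling) * \<omega> (norm x)) * exp (- norm (s - x))"
    if f: "smooth f" "bound (doubling * m) n A f" and js: "ordered_list js" for f A js and x s :: "real^'n"
  proof -
    have A: "A \<ge> 0" using f(2) by (rule deriv_bound_nonneg)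
    have "cmod (deriv_list js (f * gaussian x) s) * v m (length js) \<le>
      ?E * ((A * exp (real n * \<omega> (norm s))) * (C * exp (- (H + 1) * norm (s - x))))"
      using f js by (intro deriv_list_mult_weight C smooth_gaussian) (auto intro: deriv_boundD)
    also have "\<dots> = ?E * C * A * exp (real n * \<omega> (norm s) - (H + 1) * norm (s - x))"
    proof -
      have e: "exp (real n * \<omega> (norm s) - (H + 1) * norm (s - x)) =
          exp (real n * \<omega> (norm s)) * exp (- (H + 1) * norm (s - x))" by (simp add: algebra_simps flip: exp_add)
      show ?thesis unfolding e by (simp only: mult_ac)
    qed
    also have "\<dots> \<le> ?E * C * A * exp (H + real (n * doubling) * \<omega> (norm x) + - norm (s - x))"
      using H(2)[of s x] A C0 by (intro mult_left_mono) (auto simp: algebra_simps norm_minus_commute)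
    also have "\<dots> = ?E * C * exp H * A * exp (real (n * doubling) * \<omega> (norm x)) * exp (- norm (s - x))"
      unfolding exp_add by (simp add: mult_ac)
    finally show ?thesis .
  qed
  then show ?thesis using C0 by (intro exI[of _ "?E * C * exp H"]) (auto simp: mult.assoc)
qed

end

section \<open>Integration on Euclidean space\<close>

lemma lborel_integral_affine:
  fixes f :: "'a::euclidean_space \<Rightarrow> complex"
  assumes [measurable]: "f \<in> borel_measurable borel" and c: "c > 0"
  shows "(\<integral>x. f x \<partial>lborel) = c ^ DIM('a) *\<^sub>R (\<integral>x. f (t + c *\<^sub>R x) \<partial>lborel)"
proof -
  have "(\<integral>x. f x \<partial>lborel) = (\<integral>x. f x \<partial>density (distr lborel borel (\<lambda>x. t + c *\<^sub>R x)) (\<lambda>_. ennreal (\<bar>c\<bar> ^ DIM('a))))"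
    using c by (subst lborel_affine[of c t]) (simp_all add: ennreal_power)
  also have "\<dots> = c ^ DIM('a) *\<^sub>R (\<integral>x. f (t + c *\<^sub>R x) \<partial>lborel)"
    using c by (simp add: integral_density integral_distr)
  finally show ?thesis .
qed

lemma lborel_integral_translate:
  fixes f :: "'a::euclidean_space \<Rightarrow> complex"
  assumes [measurable]: "f \<in> borel_measurable borel"
  shows "(\<integral>x. f (t + x) \<partial>lborel) = (\<integral>x. f x \<partial>lborel)"
  using lborel_integral_affine[OF assms, of 1 t] by simp

lemma lborel_integrable_translate:
  fixes f :: "'a::euclidean_space \<Rightarrow> 'b::{banach, second_countable_topology}"
  assumes "integrable lborel f"
  shows "integrable lborel (\<lambda>x. f (t + x))"
  using integrable_distr[of "(+) t" lborel borel f] assms by (simp add: lborel_distr_plus)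

text \<open>Lebesgue measure is the image of the product measure indexed by \<open>Basis\<close>;
  the bijection i \<mapsto> \<open>axis i 1\<close> moves the factors from coordinates to basis
  vectors.\<close>

lemma lborel_cart_product:
  fixes f :: "'n::finite \<Rightarrow> real \<Rightarrow> complex"
  assumes f: "\<And>i. integrable lborel (f i)"
  shows "integrable lborel (\<lambda>x::real^'n. \<Prod>i\<in>UNIV. f i (x $ i))"
    and "(\<integral>x. (\<Prod>i\<in>UNIV. f i ((x::real^'n) $ i)) \<partial>lborel) = (\<Prod>i\<in>UNIV. \<integral>t. f i t \<partial>lborel)"
proof -
  let ?e = "\<lambda>i. axis i 1 :: real^'n"
  have e: "bij_betw ?e UNIV Basis"
    by (auto simp: bij_betw_def inj_on_def axis_eq_axis Basis_vec_def)
  define g where "g b = f (inv_into UNIV ?e b)" for b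
  have ge: "g (?e i) = f i" for i
    unfolding g_def using bij_betw_inv_into_left[OF e, of i] by simp
  interpret product_sigma_finite "\<lambda>_ :: real^'n. lborel :: real measure" by unfold_locales
  let ?P = "Pi\<^sub>M (Basis :: (real^'n) set) (\<lambda>_. lborel :: real measure)"
  let ?T = "\<lambda>y. \<Sum>b\<in>(Basis :: (real^'n) set). y b *\<^sub>R b"
  have T: "?T y $ i = y (?e i)" for y i
  proof -
    have "?T y $ i = ?T y \<bullet> ?e i" by (simp add: inner_axis)
    also have "\<dots> = y (?e i)" by (rule inner_sum_left_Basis) (auto simp: Basis_vec_def)
    finally show ?thesis .
  qed
  have [measurable]: "f i \<in> borel_measurable borel" for i
    using borel_measurable_integrable[OF f[of i]] by simp
  have m: "(\<lambda>x::real^'n. \<Prod>i\<in>UNIV. f i (x $ i)) \<in> borel_measurable borel"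
    by (intro borel_measurable_prod measurable_compose[OF _ \<open>\<And>i. f i \<in> borel_measurable borel\<close>])
      (auto intro!: borel_measurable_continuous_onI continuous_intros)
  have Tm: "?T \<in> measurable ?P borel" by measurable
  have prod: "(\<Prod>i\<in>UNIV. f i (?T y $ i)) = (\<Prod>b\<in>Basis. g b (y b))" for y
    unfolding T using prod.reindex_bij_betw[OF e, of "\<lambda>b. g b (y b)"] by (simp add: ge)
  have gi: "integrable lborel (g b)" if "b \<in> Basis" for b unfolding g_def by (rule f)
  show "integrable lborel (\<lambda>x::real^'n. \<Prod>i\<in>UNIV. f i (x $ i))"
  proof -
    have "integrable (distr ?P borel ?T) (\<lambda>x. \<Prod>i\<in>UNIV. f i (x $ i))"
      unfolding integrable_distr_eq[OF Tm m] prod by (rule product_integrable_prod) (auto intro: gi)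
    then show ?thesis by (subst lborel_eq)
  qed
  have "(\<integral>x. (\<Prod>i\<in>UNIV. f i ((x::real^'n) $ i)) \<partial>lborel) = (\<integral>y. (\<Prod>b\<in>Basis. g b (y b)) \<partial>?P)"
  proof -
    have "(\<integral>x. (\<Prod>i\<in>UNIV. f i ((x::real^'n) $ i)) \<partial>distr ?P borel ?T) = (\<integral>y. (\<Prod>b\<in>Basis. g b (y b)) \<partial>?P)"
      unfolding integral_distr[OF Tm m] prod ..
    then show ?thesis by (subst lborel_eq)
  qed
  also have "\<dots> = (\<Prod>b\<in>Basis. \<integral>t. g b t \<partial>lborel)"
    by (rule product_integral_prod) (auto intro: gi)
  also have "\<dots> = (\<Prod>i\<in>UNIV. \<integral>t. f i t \<partial>lborel)"
    using prod.reindex_bij_betw[OF e, of "\<lambda>b. \<integral>t. g b t \<partial>lborel"] by (simp add: ge)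
  finally show "(\<integral>x. (\<Prod>i\<in>UNIV. f i ((x::real^'n) $ i)) \<partial>lborel) = (\<Prod>i\<in>UNIV. \<integral>t. f i t \<partial>lborel)" .
qed

text \<open>An integrable weight of polynomial decay, taken as a product so that integrability
  reduces to dimension one.\<close>

definition decay :: "real^'n::finite \<Rightarrow> real"
  where "decay x = (\<Prod>i\<in>UNIV. 1 / (1 + (x $ i)\<^sup>2))"

lemma decay_nonneg: "0 \<le> decay x"
  by (auto simp: decay_def intro!: prod_nonneg)

lemma integrable_decay: "integrable lborel decay"
proof -
  have "integrable lborel (\<lambda>x::real. inverse (1 + x\<^sup>2))"
    using integrable_inverse_1_plus_square by (simp add: set_integrable_def)
  then have "integrable lborel (\<lambda>x::real. complex_of_real (inverse (1 + x\<^sup>2)))"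
    by (rule integrable_of_real)
  from lborel_cart_product(1)[where f="\<lambda>_ x. complex_of_real (inverse (1 + x\<^sup>2))", OF this]
  have "integrable lborel (\<lambda>x::real^'a. \<Prod>i\<in>UNIV. complex_of_real (inverse (1 + (x $ i)\<^sup>2)))" .
  also have "(\<lambda>x::real^'a. \<Prod>i\<in>UNIV. complex_of_real (inverse (1 + (x $ i)\<^sup>2))) = (\<lambda>x. complex_of_real (decay x))"
    by (simp add: decay_def inverse_eq_divide)
  finally have "integrable lborel (\<lambda>x::real^'a. complex_of_real (decay x))" .
  from integrable_Re[OF this] show ?thesis by simp
qed

text \<open>Stated for any common bound of the coordinates, since it is applied with both
  \<open>norm\<close> and \<open>infnorm\<close>.\<close>

lemma decay_lower_bound:
  fixes x :: "real^'n::finite"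
  assumes "\<And>i. \<bar>x $ i\<bar> \<le> r"
  shows "1 / (1 + r) ^ (2 * CARD('n)) \<le> decay x"
proof -
  have r: "0 \<le> r" using assms[of undefined] by linarith
  have "(\<Prod>i\<in>UNIV. 1 + (x $ i)\<^sup>2) \<le> (\<Prod>i\<in>(UNIV::'n set). (1 + r)\<^sup>2)"
  proof (intro prod_mono conjI)
    fix i
    have "(x $ i)\<^sup>2 \<le> r\<^sup>2" using power_mono[OF assms[of i], of 2] by simp
    then show "1 + (x $ i)\<^sup>2 \<le> (1 + r)\<^sup>2" using r by (simp add: power2_sum)
  qed auto
  also have "\<dots> = (1 + r) ^ (2 * CARD('n))" by (simp add: power_mult)
  finally have "1 / (1 + r) ^ (2 * CARD('n)) \<le> 1 / (\<Prod>i\<in>UNIV. 1 + (x $ i)\<^sup>2)"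
    by (intro divide_left_mono mult_pos_pos prod_pos) (use r in \<open>auto simp: add_pos_nonneg\<close>)
  then show ?thesis by (simp add: decay_def prod_dividef)
qed

lemma exp_minus_le_power:
  fixes r :: real
  assumes "0 \<le> r"
  shows "exp (- r) \<le> fact k * exp 1 * (1 / (1 + r) ^ k)"
proof -
  have s: "(\<lambda>i. (1 + r) ^ i / fact i) sums exp (1 + r)"
    using exp_converges[of "1 + r"] by (simp add: field_simps scaleR_conv_of_real)
  have "(\<Sum>i\<in>{k}. (1 + r) ^ i / fact i) \<le> (\<Sum>i. (1 + r) ^ i / fact i)"
    using assms by (intro sum_le_suminf sums_summable[OF s]) auto
  then have "(1 + r) ^ k / fact k \<le> exp 1 * exp r" using sums_unique[OF s] by (simp add: exp_add)
  moreover have "0 < (1 + r) ^ k" using assms by simp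
  ultimately show ?thesis by (simp add: exp_minus field_simps)
qed

lemma integrable_exp_norm: "integrable lborel (\<lambda>x::real^'n::finite. exp (- norm (x - a)))"
proof -
  let ?C = "fact (2 * CARD('n)) * exp 1 :: real"
  have "integrable lborel (\<lambda>x::real^'n. exp (- norm x))"
  proof (rule Bochner_Integration.integrable_bound)
    show "integrable lborel (\<lambda>x::real^'n. ?C * decay x)" using integrable_decay by simp
    show "AE x in lborel. norm (exp (- norm x)) \<le> norm (?C * decay (x :: real^'n))"
    proof (rule AE_I2)
      fix x :: "real^'n"
      have "exp (- norm x) \<le> ?C * (1 / (1 + norm x) ^ (2 * CARD('n)))" by (rule exp_minus_le_power) simp
      also have "\<dots> \<le> ?C * decay x"
        by (intro mult_left_mono decay_lower_bound component_le_norm_cart) auto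
      finally show "norm (exp (- norm x)) \<le> norm (?C * decay x)" using decay_nonneg[of x] by simp
    qed
  qed (auto intro!: borel_measurable_continuous_onI continuous_intros)
  from lborel_integrable_translate[OF this, of "- a"] show ?thesis by (simp add: add.commute)
qed

lemma has_vector_derivative_iff_quotient:
  fixes f :: "real \<Rightarrow> 'a::real_normed_vector"
  shows "(f has_vector_derivative d) (at 0) \<longleftrightarrow> ((\<lambda>h. (f h - f 0) /\<^sub>R h) \<longlongrightarrow> d) (at 0)"
proof -
  have "(f has_vector_derivative d) (at 0) \<longleftrightarrow> ((\<lambda>h. norm (f (0 + h) - f 0 - h *\<^sub>R d) / norm h) \<longlongrightarrow> 0) (at 0)"
    unfolding has_vector_derivative_def has_derivative_at by (simp add: bounded_linear_scaleR_left)
  also have "\<dots> \<longleftrightarrow> ((\<lambda>h. norm ((f h - f 0) /\<^sub>R h - d)) \<longlongrightarrow> 0) (at 0)"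
  proof (rule filterlim_cong[OF refl refl])
    show "\<forall>\<^sub>F h in at 0. norm (f (0 + h) - f 0 - h *\<^sub>R d) / norm h = norm ((f h - f 0) /\<^sub>R h - d)"
      unfolding eventually_at_filter
    proof (rule always_eventually, intro allI impI)
      fix h :: real assume h: "h \<noteq> 0"
      have "(f h - f 0) /\<^sub>R h - d = (f h - f 0 - h *\<^sub>R d) /\<^sub>R h"
        using h by (simp add: scaleR_diff_right)
      then show "norm (f (0 + h) - f 0 - h *\<^sub>R d) / norm h = norm ((f h - f 0) /\<^sub>R h - d)"
        by (simp add: divide_inverse mult.commute)
    qed
  qed
  also have "\<dots> \<longleftrightarrow> ((\<lambda>h. (f h - f 0) /\<^sub>R h) \<longlongrightarrow> d) (at 0)"
    unfolding tendsto_norm_zero_iff LIM_zero_iff ..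
  finally show ?thesis .
qed

text \<open>By the mean value inequality \<open>G\<close> majorizes all difference quotients with
  |t| < 1, so dominated convergence applies along every null sequence in that range.\<close>

lemma has_vector_derivative_integral:
  fixes b b' :: "'y \<Rightarrow> real \<Rightarrow> complex"
  assumes int: "\<And>t. \<bar>t\<bar> < 1 \<Longrightarrow> integrable M (\<lambda>y. b y t)"
    and der: "\<And>y t. \<bar>t\<bar> < 1 \<Longrightarrow> (b y has_vector_derivative b' y t) (at t)"
    and dom: "\<And>y t. \<bar>t\<bar> < 1 \<Longrightarrow> cmod (b' y t) \<le> G y"
    and G: "integrable M G"
  shows "((\<lambda>t. \<integral>y. b y t \<partial>M) has_vector_derivative (\<integral>y. b' y 0 \<partial>M)) (at 0)"
    and "integrable M (\<lambda>y. b' y 0)"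
proof -
  have quot: "cmod ((b y t - b y 0) /\<^sub>R t) \<le> G y" if t: "\<bar>t\<bar> < 1" for y t
  proof -
    have "norm (b y t - b y 0) \<le> G y * norm (t - 0)"
    proof (rule differentiable_bound[where S="{-1<..<1}" and f'="\<lambda>s h. h *\<^sub>R b' y s"])
      fix s :: real assume s: "s \<in> {-1<..<1}"
      then show "(b y has_derivative (\<lambda>h. h *\<^sub>R b' y s)) (at s within {-1<..<1})"
        using der[of s y] unfolding has_vector_derivative_def by (auto intro: has_derivative_at_withinI)
      show "onorm (\<lambda>h. h *\<^sub>R b' y s) \<le> G y"
      proof (rule onorm_le)
        fix h :: real
        show "norm (h *\<^sub>R b' y s) \<le> G y * norm h"
          using mult_right_mono[OF dom[of s y], of "\<bar>h\<bar>"] s by (auto simp: mult.commute)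
      qed
    qed (use t in auto)
    moreover have eq: "cmod ((b y t - b y 0) /\<^sub>R t) = cmod (b y t - b y 0) / \<bar>t\<bar>"
      by (simp add: divide_inverse mult.commute)
    ultimately show ?thesis
      unfolding eq using order_trans[OF norm_ge_zero dom[of 0 y]] by (cases "t = 0") (auto simp: divide_le_eq)
  qed
  have lim: "(\<lambda>k. (b y (X k) - b y 0) /\<^sub>R X k) \<longlonglongrightarrow> b' y 0"
    if "\<And>k. X k \<noteq> 0" "X \<longlonglongrightarrow> 0" for X y
    using der[of 0 y, unfolded has_vector_derivative_iff_quotient tendsto_at_iff_sequentially] that
    by (auto simp: o_def)
  have meas: "(\<lambda>y. (b y t - b y 0) /\<^sub>R t) \<in> borel_measurable M" if "\<bar>t\<bar> < 1" for t
    using borel_measurable_integrable[OF int[OF that]] borel_measurable_integrable[OF int[of 0]] by simp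
  have dct: "integrable M (\<lambda>y. b' y 0) \<and>
      (\<lambda>k. \<integral>y. (b y (X k) - b y 0) /\<^sub>R X k \<partial>M) \<longlonglongrightarrow> (\<integral>y. b' y 0 \<partial>M)"
    if X: "\<And>k. X k \<noteq> 0" "X \<longlonglongrightarrow> 0" "\<And>k. \<bar>X k\<bar> < 1" for X
  proof -
    have m: "(\<lambda>y. b' y 0) \<in> borel_measurable M"
      by (rule borel_measurable_LIMSEQ_metric[OF meas[OF X(3)] lim[OF X(1,2)]])
    show ?thesis
      using integrable_dominated_convergence[OF m _ G, of "\<lambda>k y. (b y (X k) - b y 0) /\<^sub>R X k"]
        integral_dominated_convergence[OF m _ G, of "\<lambda>k y. (b y (X k) - b y 0) /\<^sub>R X k"]
        meas[OF X(3)] lim[OF X(1,2)] quot[OF X(3)] by blast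
  qed
  \<comment> \<open>Some null sequence inside (0, 1): integrability of the derivative at 0 is
    obtained as a limit of difference quotients, hence needs at least one.\<close>
  define X0 :: "nat \<Rightarrow> real" where "X0 k = 1 / real (Suc (Suc k))" for k
  have "X0 \<longlonglongrightarrow> 0" unfolding X0_def using LIMSEQ_inverse_real_of_nat[THEN LIMSEQ_Suc] by (simp add: inverse_eq_divide)
  then show "integrable M (\<lambda>y. b' y 0)" using dct[of X0] by (simp add: X0_def)
  show "((\<lambda>t. \<integral>y. b y t \<partial>M) has_vector_derivative (\<integral>y. b' y 0 \<partial>M)) (at 0)"
    unfolding has_vector_derivative_iff_quotient tendsto_at_iff_sequentially
  proof (intro allI impI)
    fix X :: "nat \<Rightarrow> real" assume X: "\<forall>i. X i \<in> UNIV - {0}" "X \<longlonglongrightarrow> 0"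
    then obtain N where N: "\<And>k. k \<ge> N \<Longrightarrow> \<bar>X k\<bar> < 1"
      using LIMSEQ_D[OF X(2), of 1] by auto
    let ?X = "\<lambda>k. X (k + N)"
    have "(\<lambda>k. \<integral>y. (b y (?X k) - b y 0) /\<^sub>R ?X k \<partial>M) \<longlonglongrightarrow> (\<integral>y. b' y 0 \<partial>M)"
      using dct[of ?X] X N LIMSEQ_ignore_initial_segment[OF X(2), of N] by auto
    also have "(\<lambda>k. \<integral>y. (b y (?X k) - b y 0) /\<^sub>R ?X k \<partial>M) =
        (\<lambda>k. ((\<integral>y. b y (?X k) \<partial>M) - (\<integral>y. b y 0 \<partial>M)) /\<^sub>R ?X k)"
      using N int by (intro ext) (simp add: Bochner_Integration.integral_diff)
    finally show "((\<lambda>h. ((\<integral>y. b y h \<partial>M) - (\<integral>y. b y 0 \<partial>M)) /\<^sub>R h) \<circ> X) \<longlonglongrightarrow> (\<integral>y. b' y 0 \<partial>M)"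
      using LIMSEQ_offset[of "(\<lambda>h. ((\<integral>y. b y h \<partial>M) - (\<integral>y. b y 0 \<partial>M)) /\<^sub>R h) \<circ> X" N] by (simp add: o_def)
  qed
qed

lemma integrable_pair_bound:
  fixes F :: "'a::euclidean_space \<times> 'b::euclidean_space \<Rightarrow> complex"
  assumes F: "F \<in> borel_measurable borel"
    and g: "integrable lborel g" "\<And>x. 0 \<le> g x" and h: "integrable lborel h" "\<And>y. 0 \<le> h y"
    and le: "\<And>x y. cmod (F (x, y)) \<le> g x * h y"
  shows "integrable lborel F"
proof (rule Bochner_Integration.integrable_bound)
  have [measurable]: "g \<in> borel_measurable borel" "h \<in> borel_measurable borel"
    using borel_measurable_integrable[OF g(1)] borel_measurable_integrable[OF h(1)] by simp_all
  have "integrable (lborel \<Otimes>\<^sub>M lborel) (\<lambda>z. g (fst z) * h (snd z))"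
    by (rule lborel_pair.Fubini_integrable) (use g h in auto)
  then show "integrable lborel (\<lambda>z. g (fst z) * h (snd z))" unfolding lborel_prod .
qed (use F le g h in \<open>auto simp: abs_mult\<close>)

lemma lborel_Fubini:
  fixes F :: "'a::euclidean_space \<times> 'b::euclidean_space \<Rightarrow> complex"
  assumes "integrable lborel F"
  shows "(\<integral>z. F z \<partial>lborel) = (\<integral>x. (\<integral>y. F (x, y) \<partial>lborel) \<partial>lborel)"
    and "(\<integral>y. (\<integral>x. F (x, y) \<partial>lborel) \<partial>lborel) = (\<integral>x. (\<integral>y. F (x, y) \<partial>lborel) \<partial>lborel)"
proof -
  have F: "integrable (lborel \<Otimes>\<^sub>M lborel) (case_prod (\<lambda>x y. F (x, y)))"
    using assms by (simp add: lborel_prod)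
  show "(\<integral>z. F z \<partial>lborel) = (\<integral>x. (\<integral>y. F (x, y) \<partial>lborel) \<partial>lborel)"
    using lborel_pair.integral_fst[OF F] by (simp add: lborel_prod)
  show "(\<integral>y. (\<integral>x. F (x, y) \<partial>lborel) \<partial>lborel) = (\<integral>x. (\<integral>y. F (x, y) \<partial>lborel) \<partial>lborel)"
    by (rule lborel_pair.Fubini_integral[OF F])
qed

lemma borel_measurable_parametric_integral:
  fixes F :: "'a::euclidean_space \<times> 'b::euclidean_space \<Rightarrow> complex"
  assumes "F \<in> borel_measurable borel"
  shows "(\<lambda>x. \<integral>y. F (x, y) \<partial>lborel) \<in> borel_measurable borel"
proof -
  have "case_prod (\<lambda>x y. F (x, y)) \<in> borel_measurable (borel \<Otimes>\<^sub>M lborel)"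
    using assms by (simp add: borel_prod[symmetric] cong: measurable_cong_sets)
  then show ?thesis by (rule lborel.borel_measurable_lebesgue_integral)
qed

section \<open>Fourier inversion\<close>

text \<open>The integral of \<open>gaussian 0\<close>. Its square (2 pi)^N is the factor in
  \<open>fourier_inversion\<close>, as \<open>fourier\<close> carries no normalization.\<close>

definition gauss_mass :: "'n::finite itself \<Rightarrow> real"
  where "gauss_mass _ = sqrt (2 * pi) ^ CARD('n)"

lemma gauss_mass_pos: "gauss_mass T > 0"
  by (simp add: gauss_mass_def)

text \<open>The integrand factors over the coordinates, and each factor is the characteristic
  function of the standard normal distribution up to its density constant.\<close>

lemma integral_modulation_gaussian:
  fixes u :: "real^'n::finite"
  shows "integrable lborel (\<lambda>\<xi>. modulation \<xi> u * gaussian 0 \<xi>)"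
    and "(\<integral>\<xi>. modulation \<xi> u * gaussian 0 \<xi> \<partial>lborel) = of_real (gauss_mass TYPE('n)) * gaussian 0 u"
proof -
  let ?f = "\<lambda>i t. exp (\<i> * of_real (t * u $ i)) * of_real (gauss_deriv 0 t)"
  have prod: "modulation \<xi> u * gaussian 0 \<xi> = (\<Prod>i\<in>UNIV. ?f i (\<xi> $ i))" for \<xi>
    by (simp add: modulation_def gaussian_def prod.distrib)
  have g: "gauss_deriv 0 t = sqrt (2 * pi) * std_normal_density t" for t
    by (simp add: gauss_deriv_def std_normal_density_def)
  have int: "integrable lborel (?f i)" for i
  proof (rule Bochner_Integration.integrable_bound)
    show "integrable lborel (\<lambda>t. sqrt (2 * pi) * std_normal_density t)" by simp
    show "?f i \<in> borel_measurable lborel"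
      by (auto intro!: borel_measurable_continuous_onI continuous_intros)
  qed (simp add: norm_mult g)
  have val: "(\<integral>t. ?f i t \<partial>lborel) = of_real (sqrt (2 * pi)) * of_real (gauss_deriv 0 (u $ i))" for i
  proof -
    have "complex_of_real (exp (- (u $ i)\<^sup>2 / 2)) = (\<integral>t. exp (\<i> * of_real (u $ i * t)) \<partial>std_normal_distribution)"
      using char_std_normal_distribution unfolding char_def by metis
    also have "\<dots> = (\<integral>t. std_normal_density t *\<^sub>R exp (\<i> * of_real (u $ i * t)) \<partial>lborel)"
      by (subst integral_density) (auto intro!: borel_measurable_continuous_onI continuous_intros)
    finally have *: "complex_of_real (exp (- (u $ i)\<^sup>2 / 2)) =
      (\<integral>t. std_normal_density t *\<^sub>R exp (\<i> * of_real (u $ i * t)) \<partial>lborel)" .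
    have "(\<integral>t. ?f i t \<partial>lborel) =
        (\<integral>t. of_real (sqrt (2 * pi)) * (std_normal_density t *\<^sub>R exp (\<i> * of_real (u $ i * t))) \<partial>lborel)"
      by (intro Bochner_Integration.integral_cong refl) (simp add: g scaleR_conv_of_real mult_ac)
    also have "\<dots> = of_real (sqrt (2 * pi)) * (\<integral>t. std_normal_density t *\<^sub>R exp (\<i> * of_real (u $ i * t)) \<partial>lborel)"
      by (rule Bochner_Integration.integral_mult_right_zero)
    finally show ?thesis unfolding *[symmetric] by (simp add: gauss_deriv_def)
  qed
  show "integrable lborel (\<lambda>\<xi>. modulation \<xi> u * gaussian 0 \<xi>)"
    unfolding prod by (rule lborel_cart_product(1)[OF int])
  show "(\<integral>\<xi>. modulation \<xi> u * gaussian 0 \<xi> \<partial>lborel) = of_real (gauss_mass TYPE('n)) * gaussian 0 u"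
    unfolding prod lborel_cart_product(2)[OF int] val
    by (simp add: prod.distrib gauss_mass_def gaussian_def)
qed

lemma integral_gaussian:
  shows "integrable lborel (gaussian (0 :: real^'n::finite))"
    and "(\<integral>u. gaussian (0 :: real^'n::finite) u \<partial>lborel) = of_real (gauss_mass TYPE('n))"
proof -
  have eq: "(\<lambda>\<xi>. modulation \<xi> 0 * gaussian 0 \<xi>) = gaussian (0 :: real^'n)"
    by (simp add: fun_eq_iff modulation_eq)
  have g0: "gaussian 0 (0 :: real^'n) = 1" by (simp add: gaussian_eq)
  show "integrable lborel (gaussian (0 :: real^'n))"
    "(\<integral>u. gaussian (0 :: real^'n) u \<partial>lborel) = of_real (gauss_mass TYPE('n))"
    using integral_modulation_gaussian[of "0 :: real^'n"] unfolding eq by (simp_all add: g0)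
qed

definition fourier :: "(real^'n::finite \<Rightarrow> complex) \<Rightarrow> real^'n \<Rightarrow> complex"
  where "fourier F \<xi> = (\<integral>s. F s * modulation (- \<xi>) s \<partial>lborel)"

lemma continuous_modulation [continuous_intros]:
  "continuous_on S f \<Longrightarrow> continuous_on S g \<Longrightarrow> continuous_on S (\<lambda>x. modulation (f x) (g x))"
  unfolding modulation_eq by (intro continuous_intros)

lemma continuous_gaussian [continuous_intros]:
  "continuous_on S f \<Longrightarrow> continuous_on S g \<Longrightarrow> continuous_on S (\<lambda>x. gaussian (f x) (g x))"
  unfolding gaussian_eq by (intro continuous_intros) auto

text \<open>The integral over \<xi> is regularized by \<open>gaussian 0 (e *\<^sub>R \<xi>)\<close>.
  Fubini and the transform of the Gaussian turn it into a Gaussian average of \<open>F\<close>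
  around t at scale e, and e tends to 0 on both sides by dominated convergence.\<close>

lemma fourier_inversion:
  fixes F :: "real^'n::finite \<Rightarrow> complex"
  assumes cont: "continuous_on UNIV F" and int: "integrable lborel F"
    and bdd: "\<And>s. cmod (F s) \<le> D" and int': "integrable lborel (fourier F)"
  shows "(\<integral>\<xi>. fourier F \<xi> * modulation \<xi> t \<partial>lborel) = of_real ((gauss_mass TYPE('n))\<^sup>2) * F t"
proof -
  let ?c = "of_real (gauss_mass TYPE('n)) :: complex"
  define \<epsilon> :: "nat \<Rightarrow> real" where "\<epsilon> k = 1 / real (Suc k)" for k
  have \<epsilon>: "\<epsilon> k > 0" "\<epsilon> k \<le> 1" for k by (simp_all add: \<epsilon>_def)
  have \<epsilon>0: "\<epsilon> \<longlonglongrightarrow> 0" unfolding \<epsilon>_def using LIMSEQ_inverse_real_of_nat by (simp add: inverse_eq_divide)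
  have mF: "F \<in> borel_measurable borel" using cont by (rule borel_measurable_continuous_onI)
  have D0: "D \<ge> 0" using order_trans[OF norm_ge_zero bdd] .
  have g0: "gaussian 0 0 = (1::complex)" by (simp add: gaussian_eq)
  have ng: "cmod (gaussian x v) \<le> 1" for x v :: "real^'n" by (simp add: gaussian_eq)
  have gauss_cont: "continuous_on UNIV (\<lambda>v. gaussian x v)" for x :: "real^'n" by (intro continuous_intros)
  have regularized: "(\<integral>\<xi>. fourier F \<xi> * modulation \<xi> t * gaussian 0 (e *\<^sub>R \<xi>) \<partial>lborel) =
      ?c * (\<integral>v. F (t + e *\<^sub>R v) * gaussian 0 v \<partial>lborel)" if e: "e > 0" for e
  proof -
    let ?H = "\<lambda>z. F (snd z) * modulation (fst z) (t - snd z) * gaussian 0 (e *\<^sub>R fst z)"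
    have ge: "integrable lborel (\<lambda>\<xi>::real^'n. cmod (gaussian 0 (e *\<^sub>R \<xi>)))"
    proof -
      have "integrable lborel (\<lambda>\<xi>::real^'n. gaussian 0 (e *\<^sub>R \<xi>))"
      \<comment> \<open>A non-integrable function has integral 0 by convention, while the
        substitution formula holds for every measurable function; it would turn the positive
        Gaussian mass into 0.\<close>
      proof (rule ccontr)
        assume n: "\<not> ?thesis"
        have "(\<integral>u. gaussian (0 :: real^'n) u \<partial>lborel) = e ^ DIM(real^'n) *\<^sub>R (\<integral>x. gaussian (0 :: real^'n) (0 + e *\<^sub>R x) \<partial>lborel)"
          by (rule lborel_integral_affine) (use e in \<open>auto intro!: borel_measurable_continuous_onI continuous_intros\<close>)
        then have "(\<integral>u. gaussian (0 :: real^'n) u \<partial>lborel) = 0"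
          using not_integrable_integral_eq[OF n] by simp
        then show False using integral_gaussian(2)[where 'n='n] gauss_mass_pos[of "TYPE('n)"] by simp
      qed
      then show ?thesis by (rule integrable_norm)
    qed
    have H: "integrable lborel ?H"
    proof (rule integrable_pair_bound[OF _ ge _ integrable_norm[OF int]])
      show "?H \<in> borel_measurable borel"
        by (intro borel_measurable_continuous_onI continuous_intros continuous_on_compose2[OF cont]) auto
    qed (auto simp: norm_mult mult.commute)
    have "(\<integral>\<xi>. fourier F \<xi> * modulation \<xi> t * gaussian 0 (e *\<^sub>R \<xi>) \<partial>lborel) =
        (\<integral>\<xi>. (\<integral>s. ?H (\<xi>, s) \<partial>lborel) \<partial>lborel)"
    proof (intro Bochner_Integration.integral_cong refl)
      fix \<xi> :: "real^'n"
      have "fourier F \<xi> * modulation \<xi> t * gaussian 0 (e *\<^sub>R \<xi>) =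
        (\<integral>s. (F s * modulation (- \<xi>) s) * (modulation \<xi> t * gaussian 0 (e *\<^sub>R \<xi>)) \<partial>lborel)"
        unfolding fourier_def Bochner_Integration.integral_mult_left_zero by (simp only: mult.assoc)
      also have "\<dots> = (\<integral>s. ?H (\<xi>, s) \<partial>lborel)"
        by (intro Bochner_Integration.integral_cong refl)
          (simp add: modulation_eq exp_diff exp_minus inner_diff_right right_diff_distrib field_simps)
      finally show "fourier F \<xi> * modulation \<xi> t * gaussian 0 (e *\<^sub>R \<xi>) = (\<integral>s. ?H (\<xi>, s) \<partial>lborel)" .
    qed
    also have "\<dots> = (\<integral>s. (\<integral>\<xi>. ?H (\<xi>, s) \<partial>lborel) \<partial>lborel)" by (rule lborel_Fubini(2)[OF H, symmetric])
    also have "\<dots> = e ^ DIM(real^'n) *\<^sub>R (\<integral>v. (\<integral>\<xi>. ?H (\<xi>, t + e *\<^sub>R v) \<partial>lborel) \<partial>lborel)"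
    proof (rule lborel_integral_affine[OF _ e])
      have "(\<lambda>z. ?H (snd z, fst z)) \<in> borel_measurable borel"
        by (intro borel_measurable_continuous_onI continuous_intros continuous_on_compose2[OF cont]) auto
      from borel_measurable_parametric_integral[OF this]
      show "(\<lambda>s. \<integral>\<xi>. ?H (\<xi>, s) \<partial>lborel) \<in> borel_measurable borel" by simp
    qed
    also have "\<dots> = e ^ DIM(real^'n) *\<^sub>R (\<integral>v. F (t + e *\<^sub>R v) * ((1 / e ^ DIM(real^'n)) *\<^sub>R (?c * gaussian 0 v)) \<partial>lborel)"
    proof (intro arg_cong2[where f=scaleR] Bochner_Integration.integral_cong refl)
      fix v :: "real^'n"
      \<comment> \<open>Rescaling the frequency by e produces the factor e^(-N), which cancels the
        e^N from the substitution s = t + e v.\<close>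
      have "(\<integral>\<eta>. modulation \<eta> (- v) * gaussian 0 \<eta> \<partial>lborel) =
          e ^ DIM(real^'n) *\<^sub>R (\<integral>\<xi>. modulation (0 + e *\<^sub>R \<xi>) (- v) * gaussian 0 (0 + e *\<^sub>R \<xi>) \<partial>lborel)"
        by (rule lborel_integral_affine[OF _ e])
          (auto intro!: borel_measurable_continuous_onI continuous_intros)
      also have "(\<integral>\<eta>. modulation \<eta> (- v) * gaussian 0 \<eta> \<partial>lborel) = ?c * gaussian 0 v"
        unfolding integral_modulation_gaussian(2) by (simp add: gaussian_eq)
      finally have *: "(\<integral>\<xi>. modulation (e *\<^sub>R \<xi>) (- v) * gaussian 0 (e *\<^sub>R \<xi>) \<partial>lborel) =
          (1 / e ^ DIM(real^'n)) *\<^sub>R (?c * gaussian 0 v)" using e by simp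
      have "(\<integral>\<xi>. ?H (\<xi>, t + e *\<^sub>R v) \<partial>lborel) =
          (\<integral>\<xi>. F (t + e *\<^sub>R v) * (modulation (e *\<^sub>R \<xi>) (- v) * gaussian 0 (e *\<^sub>R \<xi>)) \<partial>lborel)"
        by (intro Bochner_Integration.integral_cong refl) (simp add: modulation_eq)
      then show "(\<integral>\<xi>. ?H (\<xi>, t + e *\<^sub>R v) \<partial>lborel) =
          F (t + e *\<^sub>R v) * ((1 / e ^ DIM(real^'n)) *\<^sub>R (?c * gaussian 0 v))"
        unfolding *[symmetric] by simp
    qed
    also have "\<dots> = ?c * (\<integral>v. F (t + e *\<^sub>R v) * gaussian 0 v \<partial>lborel)"
    proof -
      have eq: "F (t + e *\<^sub>R v) * ((1 / e ^ DIM(real^'n)) *\<^sub>R (?c * gaussian 0 v)) =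
          (1 / e ^ DIM(real^'n)) *\<^sub>R (?c * (F (t + e *\<^sub>R v) * gaussian 0 v))" for v
        by (simp add: mult_ac)
      show ?thesis
        unfolding eq Bochner_Integration.integral_scaleR_right Bochner_Integration.integral_mult_right_zero
        using e by simp
    qed
    finally show ?thesis .
  qed
  have "(\<lambda>k. \<integral>\<xi>. fourier F \<xi> * modulation \<xi> t * gaussian 0 (\<epsilon> k *\<^sub>R \<xi>) \<partial>lborel)
      \<longlonglongrightarrow> (\<integral>\<xi>. fourier F \<xi> * modulation \<xi> t \<partial>lborel)"
  proof (rule integral_dominated_convergence[OF _ _ integrable_norm[OF int']])
    have mm: "(\<lambda>\<xi>. modulation \<xi> t) \<in> borel_measurable lborel" "(\<lambda>\<xi>. gaussian 0 (\<epsilon> k *\<^sub>R \<xi>)) \<in> borel_measurable lborel" for k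
      by (auto intro!: borel_measurable_continuous_onI continuous_intros)
    show "(\<lambda>\<xi>. fourier F \<xi> * modulation \<xi> t) \<in> borel_measurable lborel"
      "\<And>k. (\<lambda>\<xi>. fourier F \<xi> * modulation \<xi> t * gaussian 0 (\<epsilon> k *\<^sub>R \<xi>)) \<in> borel_measurable lborel"
      by (intro borel_measurable_times borel_measurable_integrable[OF int'] mm)+
    show "AE \<xi> in lborel. (\<lambda>k. fourier F \<xi> * modulation \<xi> t * gaussian 0 (\<epsilon> k *\<^sub>R \<xi>)) \<longlonglongrightarrow> fourier F \<xi> * modulation \<xi> t"
    proof (rule AE_I2)
      fix \<xi> :: "real^'n"
      have "(\<lambda>k. gaussian 0 (\<epsilon> k *\<^sub>R \<xi>)) \<longlonglongrightarrow> gaussian 0 (0 *\<^sub>R \<xi>)"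
        by (rule continuous_on_tendsto_compose[OF gauss_cont tendsto_scaleR[OF \<epsilon>0 tendsto_const]]) simp_all
      from tendsto_mult_left[OF this, of "fourier F \<xi> * modulation \<xi> t"]
      show "(\<lambda>k. fourier F \<xi> * modulation \<xi> t * gaussian 0 (\<epsilon> k *\<^sub>R \<xi>)) \<longlonglongrightarrow> fourier F \<xi> * modulation \<xi> t"
        by (simp add: g0)
    qed
    show "AE \<xi> in lborel. cmod (fourier F \<xi> * modulation \<xi> t * gaussian 0 (\<epsilon> k *\<^sub>R \<xi>)) \<le> cmod (fourier F \<xi>)" for k
      by (intro AE_I2) (use ng in \<open>simp add: norm_mult mult_left_le\<close>)
  qed
  moreover
  have G: "integrable lborel (\<lambda>v::real^'n. D * cmod (gaussian 0 v))"
    using integrable_mult_right[OF integrable_norm[OF integral_gaussian(1)[where 'n='n]], of D] by simp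
  have "(\<lambda>k. \<integral>v. F (t + \<epsilon> k *\<^sub>R v) * gaussian 0 v \<partial>lborel) \<longlonglongrightarrow> (\<integral>v. F t * gaussian (0 :: real^'n) v \<partial>lborel)"
  proof (rule integral_dominated_convergence[OF _ _ G])
    show "(\<lambda>v. F t * gaussian (0 :: real^'n) v) \<in> borel_measurable lborel"
      "\<And>k. (\<lambda>v. F (t + \<epsilon> k *\<^sub>R v) * gaussian 0 v) \<in> borel_measurable lborel"
      by (auto intro!: borel_measurable_continuous_onI continuous_intros continuous_on_compose2[OF cont])
    show "AE v in lborel. (\<lambda>k. F (t + \<epsilon> k *\<^sub>R v) * gaussian 0 v) \<longlonglongrightarrow> F t * gaussian 0 v"
    proof (rule AE_I2)
      fix v :: "real^'n"
      have "(\<lambda>k. F (t + \<epsilon> k *\<^sub>R v)) \<longlonglongrightarrow> F (t + 0 *\<^sub>R v)"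
        by (rule continuous_on_tendsto_compose[OF cont
              tendsto_add[OF tendsto_const tendsto_scaleR[OF \<epsilon>0 tendsto_const]]]) simp_all
      then show "(\<lambda>k. F (t + \<epsilon> k *\<^sub>R v) * gaussian 0 v) \<longlonglongrightarrow> F t * gaussian 0 v"
        by (intro tendsto_mult_right) simp
    qed
    show "AE v in lborel. cmod (F (t + \<epsilon> k *\<^sub>R v) * gaussian 0 v) \<le> D * cmod (gaussian 0 v)" for k
      by (intro AE_I2) (simp add: norm_mult mult_right_mono bdd)
  qed
  then have "(\<lambda>k. ?c * (\<integral>v. F (t + \<epsilon> k *\<^sub>R v) * gaussian 0 v \<partial>lborel)) \<longlonglongrightarrow> ?c * (\<integral>v. F t * gaussian (0 :: real^'n) v \<partial>lborel)"
    by (rule tendsto_mult_left)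
  ultimately have "(\<integral>\<xi>. fourier F \<xi> * modulation \<xi> t \<partial>lborel) = ?c * (\<integral>v. F t * gaussian (0 :: real^'n) v \<partial>lborel)"
    unfolding regularized[OF \<epsilon>(1)] by (rule LIMSEQ_unique)
  then show ?thesis by (simp add: integral_gaussian(2) power2_eq_square)
qed

section \<open>The short-time Fourier transform\<close>

definition stft :: "(real^'n::finite \<Rightarrow> complex) \<Rightarrow> (real^'n) \<times> (real^'n) \<Rightarrow> complex"
  where "stft f y = fourier (f * gaussian (fst y)) (snd y)"

lemma integrable_exp_norm_bound:
  fixes u :: "real^'n::finite \<Rightarrow> complex"
  assumes "continuous_on UNIV u" "\<And>s. cmod (u s) \<le> B * exp (- norm (s - x))"
  shows "integrable lborel u"
proof (rule Bochner_Integration.integrable_bound)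
  show "integrable lborel (\<lambda>s. B * exp (- norm (s - x)))" by (intro integrable_mult_right integrable_exp_norm)
  show "u \<in> borel_measurable lborel" using assms(1) by (simp add: borel_measurable_continuous_onI)
  show "AE s in lborel. norm (u s) \<le> norm (B * exp (- norm (s - x)))"
    using assms(2) by (intro AE_I2) (smt (verit, best) real_norm_def)
qed

text \<open>By translation invariance t \<mapsto> \<integral> w(s + t e_i) ds is constant, and
  differentiation under the integral identifies its derivative at 0.\<close>

lemma integral_partial_deriv_eq_0:
  fixes w :: "real^'n::finite \<Rightarrow> complex"
  assumes w: "smooth w" and B: "\<And>s. cmod (w s) \<le> B * exp (- norm (s - x))"
    and B': "\<And>s. cmod (partial_deriv i w s) \<le> B' * exp (- norm (s - x))"
  shows "(\<integral>s. partial_deriv i w s \<partial>lborel) = 0"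
proof -
  let ?e = "axis i 1 :: real^'n"
  have cont: "continuous_on UNIV w" using w by (rule smooth_continuous)
  have int: "integrable lborel w" by (rule integrable_exp_norm_bound[OF cont B])
  have B'0: "B' \<ge> 0"
    using order_trans[OF norm_ge_zero B'[of x]] by simp
  have "((\<lambda>t. \<integral>s. w (s + t *\<^sub>R ?e) \<partial>lborel) has_vector_derivative
      (\<integral>s. partial_deriv i w (s + 0 *\<^sub>R ?e) \<partial>lborel)) (at 0)"
  proof (rule has_vector_derivative_integral(1))
    show "integrable lborel (\<lambda>s. w (s + t *\<^sub>R ?e))" for t
      using lborel_integrable_translate[OF int, of "t *\<^sub>R ?e"] by (simp add: add.commute)
    show "((\<lambda>t. w (s + t *\<^sub>R ?e)) has_vector_derivative partial_deriv i w (s + t *\<^sub>R ?e)) (at t)" for s t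
      by (rule smooth_has_partial_deriv_at[OF w])
    \<comment> \<open>A shift by less than 1 costs at most the factor \<open>exp 1\<close>, so the
      majorant does not depend on t.\<close>
    show "cmod (partial_deriv i w (s + t *\<^sub>R ?e)) \<le> B' * exp 1 * exp (- norm (s - x))" if "\<bar>t\<bar> < 1" for s t
    proof -
      have "norm (s - x) \<le> norm (s + t *\<^sub>R ?e - x) + norm (t *\<^sub>R ?e)"
        using norm_triangle_ineq4[of "s + t *\<^sub>R ?e - x" "t *\<^sub>R ?e"] by (simp add: algebra_simps)
      then have "- norm (s + t *\<^sub>R ?e - x) \<le> 1 + - norm (s - x)" using that by simp
      then have "B' * exp (- norm (s + t *\<^sub>R ?e - x)) \<le> B' * exp (1 + - norm (s - x))"
        using B'0 by (intro mult_left_mono) auto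
      then show ?thesis using B'[of "s + t *\<^sub>R ?e"] unfolding exp_add by (simp only: mult.assoc)
    qed
    show "integrable lborel (\<lambda>s. B' * exp 1 * exp (- norm (s - x)))" by (intro integrable_mult_right integrable_exp_norm)
  qed
  moreover have "(\<integral>s. w (s + t *\<^sub>R ?e) \<partial>lborel) = (\<integral>s. w s \<partial>lborel)" for t
    using lborel_integral_translate[of w "t *\<^sub>R ?e"] borel_measurable_continuous_onI[OF cont]
    by (simp add: add.commute)
  ultimately have "((\<lambda>_::real. \<integral>s. w s \<partial>lborel) has_vector_derivative (\<integral>s. partial_deriv i w s \<partial>lborel)) (at 0)"
    by simp
  then show ?thesis by (rule vector_derivative_unique_at) simp
qed

lemma partial_deriv_modulation: "partial_deriv i (modulation \<xi>) = fscale (\<i> * of_real (\<xi> $ i)) (modulation \<xi>)"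
proof
  fix t
  have "((\<lambda>z. exp (\<i> * of_real (\<xi> \<bullet> t) + \<i> * of_real (\<xi> $ i) * z)) has_field_derivative
      exp (\<i> * of_real (\<xi> \<bullet> t) + \<i> * of_real (\<xi> $ i) * of_real 0) * (\<i> * of_real (\<xi> $ i))) (at (of_real 0))"
    by (auto intro!: derivative_eq_intros)
  from has_vector_derivative_real_field[OF this]
  show "partial_deriv i (modulation \<xi>) t = fscale (\<i> * of_real (\<xi> $ i)) (modulation \<xi>) t"
    by (intro partial_deriv_eqI)
      (simp add: modulation_eq fscale_def inner_add_right inner_axis algebra_simps)
qed

text \<open>Integration by parts: the partial derivative of \<open>u * modulation (- \<xi>)\<close>
  has integral 0.\<close>

lemma fourier_partial_deriv:
  fixes u :: "real^'n::finite \<Rightarrow> complex"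
  assumes u: "smooth u" and B: "\<And>s. cmod (u s) \<le> B * exp (- norm (s - x))"
    and B': "\<And>s. cmod (partial_deriv i u s) \<le> B * exp (- norm (s - x))"
  shows "fourier (partial_deriv i u) \<xi> = \<i> * of_real (\<xi> $ i) * fourier u \<xi>"
proof -
  let ?w = "u * modulation (- \<xi>)"
  have pd: "partial_deriv i ?w s = partial_deriv i u s * modulation (- \<xi>) s +
      - (\<i> * of_real (\<xi> $ i)) * (u s * modulation (- \<xi>) s)" for s
    unfolding partial_deriv_mult[OF u smooth_modulation] partial_deriv_modulation
    by (simp add: fscale_def algebra_simps)
  have "(\<integral>s. partial_deriv i ?w s \<partial>lborel) = 0"
  proof (rule integral_partial_deriv_eq_0[where B=B and x=x and B'="B + \<bar>\<xi> $ i\<bar> * B"])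
    show "smooth ?w" using u smooth_modulation by (rule smooth_mult)
    show "cmod (?w s) \<le> B * exp (- norm (s - x))" for s using B by (simp add: norm_mult)
    show "cmod (partial_deriv i ?w s) \<le> (B + \<bar>\<xi> $ i\<bar> * B) * exp (- norm (s - x))" for s
    proof -
      have "cmod (partial_deriv i ?w s) \<le> cmod (partial_deriv i u s) + \<bar>\<xi> $ i\<bar> * cmod (u s)"
        unfolding pd by (rule order_trans[OF norm_triangle_ineq]) (simp add: norm_mult)
      also have "\<dots> \<le> B * exp (- norm (s - x)) + \<bar>\<xi> $ i\<bar> * (B * exp (- norm (s - x)))"
        using B B' by (intro add_mono mult_left_mono) auto
      finally show ?thesis by (simp add: algebra_simps)
    qed
  qed
  moreover have i1: "integrable lborel (\<lambda>s. u s * modulation (- \<xi>) s)"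
    by (rule integrable_exp_norm_bound[where B=B and x=x, OF continuous_on_mult])
      (use B in \<open>auto simp: norm_mult intro!: smooth_continuous smooth_modulation u\<close>)
  moreover have i2: "integrable lborel (\<lambda>s. partial_deriv i u s * modulation (- \<xi>) s)"
    by (rule integrable_exp_norm_bound[where B=B and x=x, OF continuous_on_mult])
      (use B' in \<open>auto simp: norm_mult intro!: smooth_continuous smooth_modulation smooth_partial_deriv u\<close>)
  ultimately show ?thesis
    unfolding pd fourier_def Bochner_Integration.integral_add[OF i2 integrable_mult_right[OF i1]]
      Bochner_Integration.integral_mult_right_zero by simp
qed

lemma fourier_iterated_deriv:
  fixes u :: "real^'n::finite \<Rightarrow> complex"
  assumes u: "smooth u"
    and B: "\<And>j s. j \<le> k \<Longrightarrow> cmod (deriv_list (replicate j i) u s) \<le> B * exp (- norm (s - x))"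
  shows "fourier (deriv_list (replicate k i) u) \<xi> = (\<i> * of_real (\<xi> $ i)) ^ k * fourier u \<xi>"
proof -
  have "j \<le> k \<Longrightarrow> fourier (deriv_list (replicate j i) u) \<xi> = (\<i> * of_real (\<xi> $ i)) ^ j * fourier u \<xi>" for j
  proof (induction j)
    case (Suc j)
    have "fourier (partial_deriv i (deriv_list (replicate j i) u)) \<xi> =
        \<i> * of_real (\<xi> $ i) * fourier (deriv_list (replicate j i) u) \<xi>"
      using Suc.prems B[of j] B[of "Suc j"]
      by (intro fourier_partial_deriv[where x=x and B=B] smooth_deriv_list[OF u]) auto
    then show ?case using Suc by simp
  qed simp
  then show ?thesis by simp
qed

lemma norm_fourier_le:
  fixes u :: "real^'n::finite \<Rightarrow> complex"
  assumes "continuous_on UNIV u" "\<And>s. cmod (u s) \<le> B * exp (- norm (s - x))"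
  shows "cmod (fourier u \<xi>) \<le> B * (\<integral>s. exp (- norm (s :: real^'n)) \<partial>lborel)"
proof -
  have "cmod (fourier u \<xi>) \<le> (\<integral>s. B * exp (- norm (s - x)) \<partial>lborel)"
    unfolding fourier_def
  proof (rule Bochner_Integration.integral_norm_bound_integral)
    show "integrable lborel (\<lambda>s. u s * modulation (- \<xi>) s)"
      by (rule integrable_exp_norm_bound[where B=B and x=x])
        (use assms in \<open>auto simp: norm_mult intro!: continuous_intros\<close>)
    show "integrable lborel (\<lambda>s. B * exp (- norm (s - x)))" by (intro integrable_mult_right integrable_exp_norm)
  qed (use assms in \<open>simp add: norm_mult\<close>)
  also have "\<dots> = B * (\<integral>s. exp (- norm (s - x)) \<partial>lborel)" by simp
  also have "(\<integral>s. exp (- norm (s - x)) \<partial>lborel) = (\<integral>s. exp (- norm (s :: real^'n)) \<partial>lborel)"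
  proof -
    have "(\<integral>s. complex_of_real (exp (- norm (- x + s))) \<partial>lborel) = (\<integral>s. complex_of_real (exp (- norm (s :: real^'n))) \<partial>lborel)"
      by (rule lborel_integral_translate[where f="\<lambda>s. complex_of_real (exp (- norm s))"])
        (auto intro!: borel_measurable_continuous_onI continuous_intros)
    then show ?thesis by (simp add: add.commute)
  qed
  finally show ?thesis .
qed

lemma stft_borel_measurable:
  fixes f :: "real^'n::finite \<Rightarrow> complex"
  assumes "continuous_on UNIV f"
  shows "stft f \<in> borel_measurable borel"
proof -
  have "(\<lambda>z. f (snd z) * gaussian (fst (fst z)) (snd z) * modulation (- snd (fst z)) (snd z)) \<in> borel_measurable borel"
    by (intro borel_measurable_continuous_onI continuous_intros continuous_on_compose2[OF assms]) auto
  from borel_measurable_parametric_integral[OF this]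
  have "(\<lambda>y. stft f y) \<in> borel_measurable borel" unfolding stft_def fourier_def by simp
  then show ?thesis by simp
qed

text \<open>(2 pi)^N from Fourier inversion, times the integral of the squared window.\<close>

definition stft_constant :: "'n::finite itself \<Rightarrow> complex"
  where "stft_constant T = of_real ((gauss_mass T)\<^sup>2 * (gauss_mass T / sqrt 2 ^ CARD('n)))"

lemma stft_constant_nonzero: "stft_constant T \<noteq> 0"
  using gauss_mass_pos[of T] by (simp add: stft_constant_def)

lemma integral_gaussian_square:
  "(\<integral>x. gaussian x t * gaussian x t \<partial>lborel) = of_real (gauss_mass TYPE('n) / sqrt 2 ^ CARD('n))"
  for t :: "real^'n::finite"
proof -
  let ?g = "\<lambda>u::real^'n. gaussian 0 (sqrt 2 *\<^sub>R u)"
  have "gaussian x t * gaussian x t = ?g (- t + x)" for x :: "real^'n"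
    by (simp add: gaussian_eq norm_minus_commute power_mult_distrib flip: exp_add of_real_mult)
  then have "(\<integral>x. gaussian x t * gaussian x t \<partial>lborel) = (\<integral>x. ?g (- t + x) \<partial>lborel)" by simp
  also have "\<dots> = (\<integral>x. ?g x \<partial>lborel)"
    by (rule lborel_integral_translate) (auto intro!: borel_measurable_continuous_onI continuous_intros)
  also have "\<dots> = of_real (gauss_mass TYPE('n) / sqrt 2 ^ CARD('n))"
  proof -
    have "of_real (gauss_mass TYPE('n)) = sqrt 2 ^ DIM(real^'n) *\<^sub>R (\<integral>x. gaussian (0 :: real^'n) (0 + sqrt 2 *\<^sub>R x) \<partial>lborel)"
      unfolding integral_gaussian(2)[symmetric]
      by (rule lborel_integral_affine) (auto intro!: borel_measurable_continuous_onI continuous_intros)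
    then show ?thesis by (simp add: scaleR_conv_of_real field_simps)
  qed
  finally show ?thesis .
qed

text \<open>For fixed x, Fourier inversion in \<xi> recovers f times the window at t; the atom
  contributes the window once more, and integration over x leaves the mass of the squared
  window.\<close>

lemma stft_inversion:
  fixes f :: "real^'n::finite \<Rightarrow> complex"
  assumes cont: "continuous_on UNIV f"
    and window: "\<And>x. \<exists>B. \<forall>s. cmod (f s * gaussian x s) \<le> B * exp (- norm (s - x))"
    and int1: "\<And>x. integrable lborel (\<lambda>\<xi>. stft f (x, \<xi>))"
    and int2: "integrable lborel (\<lambda>y. stft f y * atom y t)"
  shows "(\<integral>y. stft f y * atom y t \<partial>lborel) = stft_constant TYPE('n) * f t"
proof -
  have "(\<integral>y. stft f y * atom y t \<partial>lborel) = (\<integral>x. (\<integral>\<xi>. stft f (x, \<xi>) * atom (x, \<xi>) t \<partial>lborel) \<partial>lborel)"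
    by (rule lborel_Fubini(1)[OF int2])
  also have "\<dots> = (\<integral>x. of_real ((gauss_mass TYPE('n))\<^sup>2) * f t * (gaussian x t * gaussian x t) \<partial>lborel)"
  proof (intro Bochner_Integration.integral_cong refl)
    fix x :: "real^'n"
    obtain B where B: "\<And>s. cmod (f s * gaussian x s) \<le> B * exp (- norm (s - x))" using window by blast
    have cx: "continuous_on UNIV (\<lambda>s. f s * gaussian x s)" using cont by (intro continuous_intros)
    have B0: "B \<ge> 0" using order_trans[OF norm_ge_zero B[of x]] by simp
    have "(\<integral>\<xi>. stft f (x, \<xi>) * atom (x, \<xi>) t \<partial>lborel) =
        (\<integral>\<xi>. (fourier (f * gaussian x) \<xi> * modulation \<xi> t) * gaussian x t \<partial>lborel)"
      by (simp add: stft_def atom_def mult.assoc)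
    also have "\<dots> = (\<integral>\<xi>. fourier (f * gaussian x) \<xi> * modulation \<xi> t \<partial>lborel) * gaussian x t"
      by (rule Bochner_Integration.integral_mult_left_zero)
    also have "(\<integral>\<xi>. fourier (f * gaussian x) \<xi> * modulation \<xi> t \<partial>lborel) =
        of_real ((gauss_mass TYPE('n))\<^sup>2) * (f * gaussian x) t"
    proof (rule fourier_inversion)
      show "continuous_on UNIV (f * gaussian x)" using cx by (simp add: times_fun_def)
      show "integrable lborel (f * gaussian x)"
        using integrable_exp_norm_bound[OF cx B] by (simp add: times_fun_def)
      show "cmod ((f * gaussian x) s) \<le> B" for s
      proof -
        have "B * exp (- norm (s - x)) \<le> B * 1" using B0 by (intro mult_left_mono) auto
        then show ?thesis using B[of s] by simp
      qed
      show "integrable lborel (fourier (f * gaussian x))" using int1[of x] by (simp add: stft_def)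
    qed
    finally show "(\<integral>\<xi>. stft f (x, \<xi>) * atom (x, \<xi>) t \<partial>lborel) =
        of_real ((gauss_mass TYPE('n))\<^sup>2) * f t * (gaussian x t * gaussian x t)" by (simp add: mult_ac)
  qed
  also have "\<dots> = stft_constant TYPE('n) * f t"
    unfolding Bochner_Integration.integral_mult_right_zero integral_gaussian_square
    by (simp add: stft_constant_def)
  finally show ?thesis .
qed

context weight_function
begin

lemma exp_weight_decay: "\<exists>L\<ge>1. \<exists>C\<ge>0. \<forall>r\<ge>0. exp (- (real L * \<omega> r)) \<le> C / (1 + r) ^ k"
proof -
  obtain a b where b: "b > 0" and ab: "\<And>t. t \<ge> 0 \<Longrightarrow> \<omega> t \<ge> a + b * ln (1 + t)"
    using weight_log_growth by blast
  \<comment> \<open>By condition (\<gamma>), L b \<ge> k makes exp (- L \<omega>) decay at least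
    like (1 + r)^(-k).\<close>
  define L where "L = max 1 (nat \<lceil>real k / b\<rceil>)"
  have "real k / b \<le> real (nat \<lceil>real k / b\<rceil>)" by (rule real_nat_ceiling_ge)
  also have "\<dots> \<le> real L" unfolding L_def of_nat_le_iff by simp
  finally have L: "real k \<le> real L * b" using b by (simp add: field_simps)
  have "exp (- (real L * \<omega> r)) \<le> exp (- (real L * a)) / (1 + r) ^ k" if r: "r \<ge> 0" for r
  proof -
    have "real k * ln (1 + r) \<le> real L * b * ln (1 + r)" using L r by (intro mult_right_mono) auto
    moreover have "real L * (a + b * ln (1 + r)) \<le> real L * \<omega> r" using ab[OF r] by (intro mult_left_mono) auto
    ultimately have "- (real L * \<omega> r) \<le> - (real L * a) - real k * ln (1 + r)" by (simp add: algebra_simps)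
    then have "exp (- (real L * \<omega> r)) \<le> exp (- (real L * a) - real k * ln (1 + r))" by simp
    also have "\<dots> = exp (- (real L * a)) / (1 + r) ^ k" using r by (simp add: exp_diff exp_of_nat_mult)
    finally show ?thesis .
  qed
  then show ?thesis by (intro exI[of _ L] conjI exI[of _ "exp (- (real L * a))"]) (auto simp: L_def)
qed

lemma infnorm_attained: "\<exists>i. infnorm x = \<bar>x $ i\<bar>" for x :: "real^'n::finite"
proof -
  have "{\<bar>x $ i\<bar> | i. i \<in> UNIV} = range (\<lambda>i. \<bar>x $ i\<bar>)" by auto
  then have "infnorm x = Max (range (\<lambda>i. \<bar>x $ i\<bar>))" unfolding infnorm_cart by (simp add: cSup_eq_Max)
  moreover have "Max (range (\<lambda>i. \<bar>x $ i\<bar>)) \<in> range (\<lambda>i. \<bar>x $ i\<bar>)" by (rule Max_in) auto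
  ultimately have "infnorm x \<in> range (\<lambda>i. \<bar>x $ i\<bar>)" by (simp only:)
  then show ?thesis by (rule rangeE) blast
qed

text \<open>Integration by parts k times in the coordinate where \<open>infnorm \<xi>\<close> is
  attained divides by R^k and costs 1 / v m k. The best k makes this about exp (- m \<omega>(R)), so
  smoothness of f becomes decay in frequency.\<close>

lemma stft_bound:
  "\<exists>C\<ge>0. \<forall>f A (x :: real^'n::finite) \<xi>. smooth f \<longrightarrow> bound (doubling * m) n A f \<longrightarrow>
    cmod (stft f (x, \<xi>)) \<le> C * A * exp (real (n * doubling) * \<omega> (norm x)) *
      ((1 + infnorm \<xi>) * exp (- (real m * \<omega> (infnorm \<xi>))))"
proof -
  define I where "I = (\<integral>s. exp (- norm (s :: real^'n)) \<partial>lborel)"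
  have I0: "I \<ge> 0" unfolding I_def by (rule Bochner_Integration.integral_nonneg) simp
  obtain C where C: "C \<ge> 0" "\<And>f A (x :: real^'n) s js. smooth f \<Longrightarrow> bound (doubling * m) n A f \<Longrightarrow> ordered_list js \<Longrightarrow>
    cmod (deriv_list js (f * gaussian x) s) * v m (length js) \<le>
    C * A * exp (real (n * doubling) * \<omega> (norm x)) * exp (- norm (s - x))"
    using windowed_bound[of m n] by blast
  have "cmod (stft f (x, \<xi>)) \<le> C * I * A * exp (real (n * doubling) * \<omega> (norm x)) *
      ((1 + infnorm \<xi>) * exp (- (real m * \<omega> (infnorm \<xi>))))"
    if f: "smooth f" "bound (doubling * m) n A f" for f A and x \<xi> :: "real^'n"
  proof -
    define R where "R = infnorm \<xi>"
    define D where "D = C * A * exp (real (n * doubling) * \<omega> (norm x))"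
    have D0: "D \<ge> 0" using C(1) deriv_bound_nonneg[OF f(2)] by (simp add: D_def)
    let ?h = "f * gaussian x"
    have h: "smooth ?h" using f(1) smooth_gaussian by (rule smooth_mult)
    obtain i where i: "R = \<bar>\<xi> $ i\<bar>" using infnorm_attained[of \<xi>] by (auto simp: R_def)
    have Cf: "cmod (deriv_list (replicate j i) ?h s) * v m j \<le> D * exp (- norm (s - x))" for j s
      using C(2)[OF f ordered_list_replicate, of j i x s] by (simp add: D_def)
    \<comment> \<open>For R \<ge> 1 the order k comes from \<open>weight_coeff_attained\<close>,
      whose extra factor R is the origin of \<open>1 + infnorm \<xi>\<close> in the claim. For R < 1
      the weight vanishes and order 0 is enough.\<close>
    have key: "\<exists>k. v m k > 0 \<and> 1 / (v m k * R ^ k) \<le> (1 + R) * exp (- (real m * \<omega> R)) \<and> R ^ k > 0"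
    proof (cases "1 \<le> R")
      case True
      obtain k where k: "exp (real m * \<omega> R) \<le> v m k * R ^ Suc k"
        using weight_coeff_attained[OF True] by blast
      have "v m k * R ^ Suc k > 0" using k exp_gt_zero less_le_trans by blast
      then have pos: "v m k > 0" using weight_coeff_nonneg[of m k] by (cases "v m k = 0") auto
      have "1 / (v m k * R ^ k) \<le> R * exp (- (real m * \<omega> R))"
        using k pos True by (simp add: exp_minus field_simps)
      also have "\<dots> \<le> (1 + R) * exp (- (real m * \<omega> R))" by (intro mult_right_mono) auto
      finally show ?thesis using pos True by (intro exI[of _ k]) auto
    next
      case False
      then have "\<omega> R = 0" using weight_zero[of R] i by simp
      then show ?thesis using i by (intro exI[of _ 0]) (simp add: weight_coeff_0)
    qed
    then obtain k where k: "v m k > 0" "1 / (v m k * R ^ k) \<le> (1 + R) * exp (- (real m * \<omega> R))" "R ^ k > 0" by blast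
    \<comment> \<open>Coefficients are submultiplicative and at most 1, hence decreasing in the
      order. So one constant bounds all intermediate derivatives that
      \<open>fourier_iterated_deriv\<close> needs.\<close>
    have Bj: "cmod (deriv_list (replicate j i) ?h s) \<le> D / v m k * exp (- norm (s - x))" if j: "j \<le> k" for j s
    proof -
      have "v m k \<le> v m j * v m (k - j)" using weight_coeff_submult[of m j "k - j"] j by simp
      also have "\<dots> \<le> v m j" using weight_coeff_le_one weight_coeff_nonneg by (simp add: mult_left_le)
      finally have "cmod (deriv_list (replicate j i) ?h s) * v m k \<le> D * exp (- norm (s - x))"
        using Cf[of j s] by (meson mult_left_mono norm_ge_zero order_trans)
      then show ?thesis using k(1) by (simp add: field_simps)
    qed
    have "R ^ k * cmod (fourier ?h \<xi>) = cmod (fourier (deriv_list (replicate k i) ?h) \<xi>)"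
      using fourier_iterated_deriv[OF h Bj] by (simp add: norm_mult norm_power i)
    also have "\<dots> \<le> D / v m k * I"
      unfolding I_def using h by (intro norm_fourier_le[OF _ Bj[OF order_refl]] smooth_continuous smooth_deriv_list)
    finally have "cmod (fourier ?h \<xi>) \<le> D * I * (1 / (v m k * R ^ k))"
      using k by (simp add: field_simps)
    also have "\<dots> \<le> D * I * ((1 + R) * exp (- (real m * \<omega> R)))"
      using k(2) D0 I0 by (intro mult_left_mono) auto
    finally show ?thesis by (simp add: stft_def D_def R_def mult_ac)
  qed
  then show ?thesis using C(1) I0 by (intro exI[of _ "C * I"]) auto
qed

text \<open>L additional multiples of \<omega> in frequency and in position buy the integrable
  factors: the level is m0 + L and the growth index n * doubling + L. The level does not depend on
  n.\<close>

lemma stft_decay: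
  "\<exists>m\<ge>1. \<forall>n. \<exists>n' C. C \<ge> 0 \<and> (\<forall>f A (x :: real^'n::finite) \<xi>. smooth f \<longrightarrow> bound (doubling * m) n A f \<longrightarrow>
    cmod (stft f (x, \<xi>)) * exp (real m0 * \<omega> (infnorm \<xi>) - real n' * \<omega> (norm x)) \<le> C * A * (decay x * decay \<xi>))"
proof -
  let ?N = "2 * CARD('n)"
  \<comment> \<open>One power more than \<open>decay\<close> needs, to absorb the factor
    \<open>1 + infnorm \<xi>\<close> of \<open>stft_bound\<close>.\<close>
  obtain L C0 where L: "L \<ge> 1" "C0 \<ge> 0" "\<And>r. r \<ge> 0 \<Longrightarrow> exp (- (real L * \<omega> r)) \<le> C0 / (1 + r) ^ Suc ?N"
    using exp_weight_decay[of "Suc ?N"] by blast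
  have Lx: "exp (- (real L * \<omega> r)) * (1 + r) \<le> C0 * decay x" if "\<And>i. \<bar>x $ i\<bar> \<le> r" "r \<ge> 0" for r and x :: "real^'n"
  proof -
    have "exp (- (real L * \<omega> r)) * (1 + r) \<le> C0 / (1 + r) ^ Suc ?N * (1 + r)"
      using L(3)[OF that(2)] that(2) by (intro mult_right_mono) auto
    also have "\<dots> = C0 * (1 / (1 + r) ^ ?N)" using that(2) by simp
    also have "\<dots> \<le> C0 * decay x" using decay_lower_bound[OF that(1)] L(2) by (intro mult_left_mono)
    finally show ?thesis .
  qed
  show ?thesis
  proof (rule exI[of _ "m0 + L"], rule conjI, rule_tac [2] allI)
    show "m0 + L \<ge> 1" using L(1) by simp
    fix n
    obtain C where C: "C \<ge> 0" "\<And>f A (x :: real^'n) \<xi>. smooth f \<Longrightarrow> bound (doubling * (m0 + L)) n A f \<Longrightarrow>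
      cmod (stft f (x, \<xi>)) \<le> C * A * exp (real (n * doubling) * \<omega> (norm x)) *
        ((1 + infnorm \<xi>) * exp (- (real (m0 + L) * \<omega> (infnorm \<xi>))))"
      using stft_bound[of "m0 + L" n] by blast
    let ?n = "n * doubling + L"
    have "cmod (stft f (x, \<xi>)) * exp (real m0 * \<omega> (infnorm \<xi>) - real ?n * \<omega> (norm x)) \<le>
      C * C0 * C0 * A * (decay x * decay \<xi>)"
      if f: "smooth f" "bound (doubling * (m0 + L)) n A f" for f A and x \<xi> :: "real^'n"
    proof -
      have A: "A \<ge> 0" using f(2) by (rule deriv_bound_nonneg)
      let ?R = "infnorm \<xi>" and ?r = "norm x"
      have "cmod (stft f (x, \<xi>)) * exp (real m0 * \<omega> ?R - real ?n * \<omega> ?r) \<le>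
          C * A * exp (real (n * doubling) * \<omega> ?r) * ((1 + ?R) * exp (- (real (m0 + L) * \<omega> ?R))) *
          exp (real m0 * \<omega> ?R - real ?n * \<omega> ?r)"
        using C(2)[OF f] by (intro mult_right_mono) auto
      also have "\<dots> = C * A * ((1 + ?R) * (exp (real (n * doubling) * \<omega> ?r) * exp (- (real (m0 + L) * \<omega> ?R)) *
          exp (real m0 * \<omega> ?R - real ?n * \<omega> ?r)))" by (simp add: mult_ac)
      also have "exp (real (n * doubling) * \<omega> ?r) * exp (- (real (m0 + L) * \<omega> ?R)) *
          exp (real m0 * \<omega> ?R - real ?n * \<omega> ?r) = exp (- (real L * \<omega> ?R)) * exp (- (real L * \<omega> ?r))"
        by (simp add: algebra_simps flip: exp_add)
      also have "C * A * ((1 + ?R) * (exp (- (real L * \<omega> ?R)) * exp (- (real L * \<omega> ?r)))) \<le>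
          C * A * ((C0 * decay \<xi>) * (C0 * decay x))"
      proof -
        have 1: "exp (- (real L * \<omega> ?R)) * (1 + ?R) \<le> C0 * decay \<xi>"
          by (intro Lx component_le_infnorm_cart infnorm_pos_le)
        have "exp (- (real L * \<omega> ?r)) * 1 \<le> exp (- (real L * \<omega> ?r)) * (1 + ?r)" by (intro mult_left_mono) auto
        also have "\<dots> \<le> C0 * decay x" by (intro Lx component_le_norm_cart norm_ge_zero)
        finally have 2: "exp (- (real L * \<omega> ?r)) \<le> C0 * decay x" by simp
        have "(exp (- (real L * \<omega> ?R)) * (1 + ?R)) * exp (- (real L * \<omega> ?r)) \<le> (C0 * decay \<xi>) * (C0 * decay x)"
          by (rule mult_mono[OF 1 2]) (use L(2) decay_nonneg[of \<xi>] in simp_all)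
        then show ?thesis using C(1) A by (intro mult_left_mono) (auto simp: mult_ac)
      qed
      finally show ?thesis by (simp add: mult_ac)
    qed
    then show "\<exists>n' C. C \<ge> 0 \<and> (\<forall>f A (x :: real^'n) \<xi>. smooth f \<longrightarrow> bound (doubling * (m0 + L)) n A f \<longrightarrow>
      cmod (stft f (x, \<xi>)) * exp (real m0 * \<omega> (infnorm \<xi>) - real n' * \<omega> (norm x)) \<le> C * A * (decay x * decay \<xi>))"
      using C(1) L(2) by (intro exI[of _ ?n] exI[of _ "C * C0 * C0"]) auto
  qed
qed

end

section \<open>Functionals and the reconstruction formula\<close>

text \<open>Rounds points to nearby net points by a measurable map of finite range; composing an
  integrand with this map turns the integral into a finite sum.\<close>

lemma finite_net_selection:
  fixes Z :: "'a::euclidean_space set"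
  assumes "finite Z"
  shows "\<exists>s. s \<in> borel_measurable borel \<and> finite (range s) \<and>
    (\<forall>y\<in>(\<Union>z\<in>Z. ball z \<delta>). s y \<in> Z \<and> dist y (s y) < \<delta>)"
  using assms
proof (induction Z rule: finite_induct)
  case empty
  show ?case by (intro exI[of _ "\<lambda>_. 0"]) (auto simp: range_constant)
next
  case (insert z Z)
  then obtain s where s: "s \<in> borel_measurable borel" "finite (range s)"
    "\<And>y. y \<in> (\<Union>z\<in>Z. ball z \<delta>) \<Longrightarrow> s y \<in> Z \<and> dist y (s y) < \<delta>" by blast
  let ?s = "\<lambda>y. if y \<in> ball z \<delta> then z else s y"
  have "?s \<in> borel_measurable borel" by (rule measurable_If_set) (use s(1) in auto)
  moreover have "finite (range ?s)" by (rule finite_subset[of _ "insert z (range s)"]) (use s(2) in auto)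
  moreover have "\<forall>y\<in>(\<Union>z\<in>insert z Z. ball z \<delta>). ?s y \<in> insert z Z \<and> dist y (?s y) < \<delta>"
  proof
    fix y assume y: "y \<in> (\<Union>z\<in>insert z Z. ball z \<delta>)"
    show "?s y \<in> insert z Z \<and> dist y (?s y) < \<delta>"
    proof (cases "y \<in> ball z \<delta>")
      case True
      then show ?thesis by (simp add: dist_commute)
    next
      case False
      then have "y \<in> (\<Union>z\<in>Z. ball z \<delta>)" using y by blast
      from s(3)[OF this] show ?thesis using False by auto
    qed
  qed
  ultimately show ?case by blast
qed

lemma integral_simple_composition:
  fixes V \<phi> :: "'a::euclidean_space \<Rightarrow> complex"
  assumes V: "integrable lborel V" and s: "s \<in> borel_measurable borel" "finite (range s)"
  shows "integrable lborel (\<lambda>y. V y * \<phi> (s y))"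
    and "(\<integral>y. V y * \<phi> (s y) \<partial>lborel) = (\<Sum>z\<in>range s. (\<integral>y. V y * indicator (s -` {z}) y \<partial>lborel) * \<phi> z)"
proof -
  have eq: "V y * \<phi> (s y) = (\<Sum>z\<in>range s. V y * indicator (s -` {z}) y * \<phi> z)" for y
  proof -
    have "(\<Sum>z\<in>range s. V y * indicator (s -` {z}) y * \<phi> z) = (\<Sum>z\<in>range s. if z = s y then V y * \<phi> z else 0)"
      by (intro sum.cong refl) (auto simp: indicator_def)
    also have "\<dots> = V y * \<phi> (s y)" using s(2) by (simp add: sum.delta)
    finally show ?thesis by simp
  qed
  have int: "integrable lborel (\<lambda>y. V y * indicator (s -` {z}) y)" for z
  proof (rule Bochner_Integration.integrable_bound[OF V])
    have [measurable]: "s -` {z} \<in> sets borel" using measurable_sets[OF s(1), of "{z}"] by simp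
    have [measurable]: "V \<in> borel_measurable borel" using borel_measurable_integrable[OF V] by simp
    show "(\<lambda>y. V y * indicator (s -` {z}) y) \<in> borel_measurable lborel" by measurable
  qed (auto simp: indicator_def)
  show "integrable lborel (\<lambda>y. V y * \<phi> (s y))"
    unfolding eq by (intro Bochner_Integration.integrable_sum integrable_mult_left int)
  show "(\<integral>y. V y * \<phi> (s y) \<partial>lborel) = (\<Sum>z\<in>range s. (\<integral>y. V y * indicator (s -` {z}) y \<partial>lborel) * \<phi> z)"
    unfolding eq by (subst Bochner_Integration.integral_sum) (auto intro: integrable_mult_left int)
qed

lemma integral_tail_small:
  fixes G :: "'a::euclidean_space \<Rightarrow> real"
  assumes G: "integrable lborel G" and e: "e > 0"
  shows "\<exists>R. \<bar>\<integral>y. indicator (- cball 0 R) y * G y \<partial>lborel\<bar> < e"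
proof -
  have [measurable]: "G \<in> borel_measurable borel" using borel_measurable_integrable[OF G] by simp
  have "(\<lambda>k. \<integral>y. indicator (- cball 0 (real k)) y * G y \<partial>lborel) \<longlonglongrightarrow> (\<integral>y. 0 \<partial>(lborel :: 'a measure))"
  proof (rule integral_dominated_convergence[OF _ _ integrable_norm[OF G]])
    show "AE y in lborel. (\<lambda>k. indicator (- cball 0 (real k)) y * G y) \<longlonglongrightarrow> 0"
    proof (rule AE_I2)
      fix y :: 'a
      obtain N where N: "norm y \<le> real N" using real_arch_simple by blast
      have "\<forall>\<^sub>F k in sequentially. indicator (- cball 0 (real k)) y * G y = 0"
        using eventually_ge_at_top[of N] by eventually_elim (use N in \<open>auto simp: indicator_def\<close>)
      then show "(\<lambda>k. indicator (- cball 0 (real k)) y * G y) \<longlonglongrightarrow> 0"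
        by (rule tendsto_eventually)
    qed
  qed (auto simp: indicator_def)
  then have "(\<lambda>k. \<integral>y. indicator (- cball 0 (real k)) y * G y \<partial>lborel) \<longlonglongrightarrow> 0" by simp
  from LIMSEQ_D[OF this e] show ?thesis by auto
qed

context weight_function
begin

lemma deriv_bound_diff:
  assumes "smooth f" "smooth g" "bound m n A f" "bound m n B g"
  shows "bound m n (A + B) (f - g)"
proof -
  have "bound m n (A + cmod (-1) * B) (f + fscale (-1) g)"
    using assms by (intro deriv_bound_add deriv_bound_fscale smooth_fscale)
  then show ?thesis unfolding fscale_minus_one by simp
qed

lemma weight_unbounded: "\<exists>R. \<forall>r\<ge>R. \<omega> r \<ge> c"
proof -
  obtain a b where b: "b > 0" and ab: "\<And>t. t \<ge> 0 \<Longrightarrow> \<omega> t \<ge> a + b * ln (1 + t)"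
    using weight_log_growth by blast
  have "\<omega> r \<ge> c" if r: "r \<ge> exp ((c - a) / b)" for r
  proof -
    have r0: "r > 0" using r exp_gt_zero less_le_trans by blast
    have "(c - a) / b \<le> ln r" using r r0 by (simp add: ln_ge_iff)
    also have "\<dots> \<le> ln (1 + r)" using r0 by simp
    finally have "c \<le> a + b * ln (1 + r)" using b by (simp add: field_simps)
    then show ?thesis using ab[of r] r0 by simp
  qed
  then show ?thesis by blast
qed

lemma atom_in_O_M: "atom y \<in> topspace (O_M \<omega>)"
  unfolding topspace_O_M_iff using smooth_atom atom_bound[of _ 0] by (metis prod.collapse)

text \<open>
  High derivatives and large arguments are controlled by the gap between the two bounds; what
  remains is a finite number of derivatives on a compact set.
\<close>

lemma atom_uniformly_continuous:
  assumes e: "e > 0"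
  shows "\<exists>\<delta>>0. \<forall>y z :: (real^'n::finite) \<times> (real^'n). norm y \<le> R \<longrightarrow> norm z \<le> R \<longrightarrow> dist y z < \<delta> \<longrightarrow>
    bound m (n * doubling + 1) e (atom y - atom z)"
proof -
  \<comment> \<open>Both atoms are bounded with the better indices \<open>M\<close> and
    \<open>N\<close>. Passing from \<open>M\<close> to \<open>m\<close> gains 2^(-k) for k
    derivatives, passing from \<open>N\<close> to \<open>N + 1\<close> gains exp (-
    \<omega>(t)).\<close>
  define M where "M = doubling * m"
  define N where "N = n * doubling"
  obtain C where C: "C \<ge> 0" "\<And>x \<xi> :: real^'n. bound M N
    (C * exp (real (doubling * M) * \<omega> (infnorm \<xi>) - real n * \<omega> (norm x))) (atom (x, \<xi>))"
    using atom_bound[of M n] unfolding N_def by blast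
  define C1 where "C1 = C * exp (real (doubling * M) * \<omega> (max R 0))"
  have bnd: "bound M N C1 (atom y)" if y: "norm y \<le> R" for y :: "(real^'n) \<times> (real^'n)"
  proof -
    have "infnorm (snd y) \<le> norm (snd y)" by (rule infnorm_le_norm)
    also have "\<dots> \<le> max R 0" using norm_snd_le[of "snd y" "fst y"] y by simp
    finally have "\<omega> (infnorm (snd y)) \<le> \<omega> (max R 0)" by (intro weight_mono infnorm_pos_le)
    then have "real (doubling * M) * \<omega> (infnorm (snd y)) - real n * \<omega> (norm (fst y)) \<le> real (doubling * M) * \<omega> (max R 0)"
      using weight_nonneg[of "norm (fst y)"] by (smt (verit) mult_left_mono mult_nonneg_nonneg norm_ge_zero of_nat_0_le_iff)
    then have "C * exp (real (doubling * M) * \<omega> (infnorm (snd y)) - real n * \<omega> (norm (fst y))) \<le> C1"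
      unfolding C1_def using C(1) by (intro mult_left_mono) auto
    then show ?thesis using C(2)[of "snd y" "fst y"] deriv_bound_mono by fastforce
  qed
  define B where "B = exp (real M) * (C1 + C1)"
  \<comment> \<open>Beyond radius \<open>R1\<close> the gain in growth alone, and beyond order
    \<open>J\<close> the gain in derivatives alone, brings the constant \<open>B\<close> below
    \<open>e\<close>.\<close>
  obtain R1 where R1: "\<And>r. r \<ge> R1 \<Longrightarrow> \<omega> r \<ge> ln ((B + 1) / e)" using weight_unbounded by blast
  obtain J where J: "B / e < 2 ^ J" using real_arch_pow[of 2 "B / e"] by auto
  define L where "L = {js :: 'n list. length js \<le> J}"
  have finL: "finite L" "[] \<in> L" using finite_lists_length_le[of "UNIV :: 'n set" J] by (auto simp: L_def)
  define Q where "Q js d \<longleftrightarrow> d > 0 \<and> (\<forall>(y :: (real^'n) \<times> (real^'n)) z t. norm y \<le> R \<longrightarrow> norm z \<le> R \<longrightarrow> norm t \<le> R1 \<longrightarrow>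
      dist y z < d \<longrightarrow> dist (deriv_list js (atom y) t) (deriv_list js (atom z) t) < e)" for js d
  have "\<exists>d. Q js d" for js
  proof -
    have "compact (cball (0 :: (real^'n) \<times> (real^'n)) R \<times> cball (0 :: real^'n) R1)"
      by (intro compact_Times compact_cball)
    then have "uniformly_continuous_on (cball 0 R \<times> cball 0 R1)
        (\<lambda>z. deriv_list js (atom (fst z)) (snd z))"
      using continuous_on_subset[OF continuous_on_deriv_list_atom] by (intro compact_uniformly_continuous) auto
    then obtain d where d: "d > 0" "\<And>p q. p \<in> cball 0 R \<times> cball 0 R1 \<Longrightarrow> q \<in> cball 0 R \<times> cball 0 R1 \<Longrightarrow>
        dist q p < d \<Longrightarrow> dist (deriv_list js (atom (fst q)) (snd q)) (deriv_list js (atom (fst p)) (snd p)) < e"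
      unfolding uniformly_continuous_on_def using e by meson
    have "dist (deriv_list js (atom y) t) (deriv_list js (atom z) t) < e"
      if "norm y \<le> R" "norm z \<le> R" "norm t \<le> R1" "dist y z < d" for y z t
      using d(2)[of "(z, t)" "(y, t)"] that by (simp add: dist_Pair_Pair)
    then have "Q js d" using d(1) by (simp add: Q_def)
    then show ?thesis ..
  qed
  then have "\<forall>js. \<exists>d. Q js d" ..
  then have "\<exists>d. \<forall>js. Q js (d js)" by (rule choice)
  then obtain d where d: "\<And>js :: 'n list. d js > 0" "\<And>(js :: 'n list) y z t. norm y \<le> R \<Longrightarrow> norm z \<le> R \<Longrightarrow> norm t \<le> R1 \<Longrightarrow>
      dist y z < d js \<Longrightarrow> dist (deriv_list js (atom y) t) (deriv_list js (atom z) t) < e"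
    unfolding Q_def by blast
  define \<delta> where "\<delta> = Min (d ` L)"
  have \<delta>: "\<delta> > 0" "\<And>js. js \<in> L \<Longrightarrow> \<delta> \<le> d js"
  proof -
    have "L \<noteq> {}" using finL by blast
    then show "\<delta> > 0" "\<And>js. js \<in> L \<Longrightarrow> \<delta> \<le> d js"
      using finL(1) d(1) by (simp_all add: \<delta>_def)
  qed
  have "bound m (N + 1) e (atom y - atom z)"
    if y: "norm y \<le> R" and z: "norm z \<le> R" and yz: "dist y z < \<delta>" for y z :: "(real^'n) \<times> (real^'n)"
    unfolding deriv_bound_def
  proof (intro allI impI)
    fix js :: "'n list" and t :: "real^'n" assume js: "ordered_list js"
    let ?c = "cmod (deriv_list js (atom y - atom z) t)" and ?k = "length js"
    have E1: "1 \<le> exp (real k * \<omega> (norm t))" for k using weight_nonneg[of "norm t"] by simp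
    have "?c * v M ?k \<le> (C1 + C1) * exp (real N * \<omega> (norm t))"
      by (rule deriv_boundD[OF deriv_bound_diff[OF smooth_atom smooth_atom bnd[OF y] bnd[OF z]] js])
    then have *: "exp (real M) * (?c * v M ?k) \<le> exp (real M) * ((C1 + C1) * exp (real N * \<omega> (norm t)))"
      by (intro mult_left_mono) auto
    have "2 ^ ?k * (?c * v m ?k) = ?c * (2 ^ ?k * v m ?k)" by simp
    also have "\<dots> \<le> ?c * (exp (real M) * v M ?k)"
      unfolding M_def by (intro mult_left_mono weight_coeff_doubling) auto
    also have "\<dots> = exp (real M) * (?c * v M ?k)" by simp
    also note *
    also have "exp (real M) * ((C1 + C1) * exp (real N * \<omega> (norm t))) = B * exp (real N * \<omega> (norm t))"
      by (simp only: B_def mult.assoc)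
    finally have key: "2 ^ ?k * (?c * v m ?k) \<le> B * exp (real N * \<omega> (norm t))" .
    have B0: "B \<ge> 0" using deriv_bound_nonneg[OF bnd[OF y]] by (simp add: B_def)
    have expN: "exp (real (N + 1) * \<omega> (norm t)) = exp (real N * \<omega> (norm t)) * exp (\<omega> (norm t))"
      by (simp add: algebra_simps flip: exp_add)
    consider "?k > J" | "norm t > R1" | "?k \<le> J" "norm t \<le> R1" by linarith
    then show "?c * v m ?k \<le> e * exp (real (N + 1) * \<omega> (norm t))"
    proof cases
      case 1
      have "(2::real) ^ J \<le> 2 ^ ?k" using 1 by (intro power_increasing) auto
      then have "B / e \<le> 2 ^ ?k" using J by linarith
      then have "B \<le> e * 2 ^ ?k" using e by (simp add: divide_le_eq mult.commute)
      then have "B * exp (real N * \<omega> (norm t)) \<le> e * 2 ^ ?k * exp (real N * \<omega> (norm t))" by (intro mult_right_mono) auto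
      also have "\<dots> = 2 ^ ?k * (e * exp (real N * \<omega> (norm t)))" by simp
      finally have "2 ^ ?k * (?c * v m ?k) \<le> 2 ^ ?k * (e * exp (real N * \<omega> (norm t)))" using key by linarith
      then have "?c * v m ?k \<le> e * exp (real N * \<omega> (norm t))" by simp
      also have "\<dots> \<le> e * (exp (real N * \<omega> (norm t)) * exp (\<omega> (norm t)))"
        using E1[of 1] e by (intro mult_left_mono) auto
      finally show ?thesis unfolding expN .
    next
      case 2
      have "(B + 1) / e > 0" using B0 e by simp
      then have "(B + 1) / e \<le> exp (\<omega> (norm t))" using R1[of "norm t"] 2 by (metis exp_le_cancel_iff exp_ln less_imp_le)
      then have "B \<le> e * exp (\<omega> (norm t))" using e by (simp add: field_simps)
      have "1 * (?c * v m ?k) \<le> 2 ^ ?k * (?c * v m ?k)"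
        using weight_coeff_nonneg by (intro mult_right_mono) auto
      also have "\<dots> \<le> B * exp (real N * \<omega> (norm t))" by (rule key)
      also have "\<dots> \<le> e * exp (\<omega> (norm t)) * exp (real N * \<omega> (norm t))"
        using \<open>B \<le> e * exp (\<omega> (norm t))\<close> by (intro mult_right_mono) auto
      finally show ?thesis unfolding expN by (simp add: mult_ac)
    next
      case 3
      then have "js \<in> L" by (simp add: L_def)
      then have "dist (deriv_list js (atom y) t) (deriv_list js (atom z) t) < e"
        using d(2)[OF y z 3(2)] yz \<delta>(2) by fastforce
      then have "?c \<le> e"
        unfolding deriv_list_diff(2)[OF smooth_atom smooth_atom] by (simp add: dist_norm)
      then have "?c * v m ?k \<le> e * 1"
        using weight_coeff_le_one weight_coeff_nonneg e by (intro mult_mono) auto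
      also have "\<dots> \<le> e * exp (real (N + 1) * \<omega> (norm t))" using e by (intro mult_left_mono E1) auto
      finally show ?thesis .
    qed
  qed
  then show ?thesis using \<delta>(1) unfolding N_def by blast
qed

text \<open>In the application \<open>V\<close> is a short-time Fourier transform,
  \<open>\<rho>\<close> the size of the atoms and \<open>G\<close> an integrable majorant of their
  product. A vanishing coefficient would make the bound on the atoms empty, hence
  \<open>pos\<close>.\<close>

lemma deriv_list_reconstruction_integrable:
  fixes V :: "(real^'n::finite) \<times> (real^'n) \<Rightarrow> complex"
  assumes V: "V \<in> borel_measurable borel" and G: "integrable lborel G"
    and atom: "\<And>y :: (real^'n) \<times> (real^'n). bound M N (C1 * \<rho> y) (atom y)" and C1: "C1 \<ge> 0"
    and \<rho>: "\<And>y. 0 \<le> \<rho> y" and VG: "\<And>y. cmod (V y) * \<rho> y \<le> G y"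
    and js: "ordered_list js" and pos: "v M (length js) > 0"
  shows "integrable lborel (\<lambda>y. V y * deriv_list js (atom y) t)"
    and "cmod (V y * deriv_list js (atom y) t) \<le> C1 * exp (real N * \<omega> (norm t)) / v M (length js) * G y"
proof -
  have le: "cmod (V y * deriv_list js (atom y) t) \<le> C1 * exp (real N * \<omega> (norm t)) / v M (length js) * G y" for y t
  proof -
    have "cmod (deriv_list js (atom y) t) \<le> C1 * \<rho> y * exp (real N * \<omega> (norm t)) / v M (length js)"
      using deriv_boundD[OF atom js] pos by (simp add: field_simps)
    then have "cmod (V y * deriv_list js (atom y) t) \<le> cmod (V y) * (C1 * \<rho> y * exp (real N * \<omega> (norm t)) / v M (length js))"
      unfolding norm_mult by (rule mult_left_mono) simp
    also have "\<dots> = C1 * exp (real N * \<omega> (norm t)) / v M (length js) * (cmod (V y) * \<rho> y)" by simp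
    also have "\<dots> \<le> C1 * exp (real N * \<omega> (norm t)) / v M (length js) * G y"
      using VG C1 pos by (intro mult_left_mono) auto
    finally show ?thesis .
  qed
  have meas: "(\<lambda>y. V y * deriv_list js (atom y) t) \<in> borel_measurable lborel" for t
  proof -
    have "continuous_on UNIV (\<lambda>y. deriv_list js (atom y) t)"
      using continuous_on_compose2[OF continuous_on_deriv_list_atom, of UNIV "\<lambda>y. (y, t)" js]
      by (simp add: continuous_intros)
    from borel_measurable_continuous_onI[OF this] show ?thesis using V by simp
  qed
  show "integrable lborel (\<lambda>y. V y * deriv_list js (atom y) t)"
  proof (rule Bochner_Integration.integrable_bound[OF _ meas])
    let ?K = "C1 * exp (real N * \<omega> (norm t)) / v M (length js)"
    show "integrable lborel (\<lambda>y. ?K * G y)" using G by (rule integrable_mult_right)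
    show "AE y in lborel. norm (V y * deriv_list js (atom y) t) \<le> norm (?K * G y)"
      unfolding real_norm_def by (intro AE_I2 order_trans[OF le abs_ge_self])
  qed
  show "cmod (V y * deriv_list js (atom y) t) \<le> C1 * exp (real N * \<omega> (norm t)) / v M (length js) * G y"
    by (rule le)
qed

text \<open>Differentiation under the integral, adding one outermost derivative at a time. The
  induction can descend because suffixes of ordered lists are ordered and positivity of a
  coefficient passes to lower orders.\<close>

lemma deriv_list_reconstruction:
  fixes V :: "(real^'n::finite) \<times> (real^'n) \<Rightarrow> complex" and f :: "real^'n \<Rightarrow> complex"
  assumes V: "V \<in> borel_measurable borel" and G: "integrable lborel G"
    and atom: "\<And>y :: (real^'n) \<times> (real^'n). bound M N (C1 * \<rho> y) (atom y)" and C1: "C1 \<ge> 0"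
    and \<rho>: "\<And>y. 0 \<le> \<rho> y" and VG: "\<And>y. cmod (V y) * \<rho> y \<le> G y"
    and f: "smooth f" and rec: "\<And>t. (\<integral>y. V y * atom y t \<partial>lborel) = c * f t"
    and js: "ordered_list js" and pos: "v M (length js) > 0"
  shows "(\<integral>y. V y * deriv_list js (atom y) t \<partial>lborel) = c * deriv_list js f t"
proof -
  note int = deriv_list_reconstruction_integrable(1)[OF V G atom C1 \<rho> VG]
  note le = deriv_list_reconstruction_integrable(2)[OF V G atom C1 \<rho> VG]
  have "(\<integral>y. V y * deriv_list js (atom y) t \<partial>lborel) = c * deriv_list js f t" for t
    using js pos
  proof (induction js arbitrary: t)
    case Nil
    show ?case using rec by simp
  next
    case (Cons i js)
    have js: "ordered_list js" using Cons.prems(1) ordered_list_suffix[of "[i]"] by simp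
    have pos: "v M (length js) > 0" using Cons.prems(2) by (rule weight_coeff_pos_mono) simp
    let ?e = "axis i 1 :: real^'n"
    \<comment> \<open>A majorant valid for |h| < 1, where the argument has norm at most
      \<open>norm t + 1\<close>. It carries the coefficient of the longer list, since it has to
      dominate the differentiated integrand.\<close>
    define K where "K = C1 * exp (real N * \<omega> (norm t + 1)) / v M (length (i # js))"
    have "((\<lambda>h. \<integral>y. V y * deriv_list js (atom y) (t + h *\<^sub>R ?e) \<partial>lborel) has_vector_derivative
        (\<integral>y. V y * deriv_list (i # js) (atom y) (t + 0 *\<^sub>R ?e) \<partial>lborel)) (at 0)"
    proof (rule has_vector_derivative_integral(1)[where G="\<lambda>y. K * G y"])
      show "integrable lborel (\<lambda>y. V y * deriv_list js (atom y) (t + h *\<^sub>R ?e))" for h by (rule int[OF js pos])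
      show "((\<lambda>h. V y * deriv_list js (atom y) (t + h *\<^sub>R ?e)) has_vector_derivative
          V y * deriv_list (i # js) (atom y) (t + h *\<^sub>R ?e)) (at h)" for y h
        unfolding deriv_list_simps
        by (intro has_vector_derivative_mult_right smooth_has_partial_deriv_at smooth_deriv_list smooth_atom)
      show "integrable lborel (\<lambda>y. K * G y)" using G by simp
      fix y and h :: real assume h: "\<bar>h\<bar> < 1"
      have "norm (t + h *\<^sub>R ?e) \<le> norm t + 1"
        using norm_triangle_ineq[of t "h *\<^sub>R ?e"] h by simp
      then have "exp (real N * \<omega> (norm (t + h *\<^sub>R ?e))) \<le> exp (real N * \<omega> (norm t + 1))"
        using weight_mono[OF norm_ge_zero, of "t + h *\<^sub>R ?e" "norm t + 1"] by (simp add: mult_left_mono)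
      then have "C1 * exp (real N * \<omega> (norm (t + h *\<^sub>R ?e))) / v M (length (i # js)) \<le> K"
        unfolding K_def using C1 Cons.prems(2) by (intro divide_right_mono mult_left_mono) auto
      moreover have "0 \<le> G y" using VG[of y] \<rho>[of y] by (meson mult_nonneg_nonneg norm_ge_zero order_trans)
      ultimately show "cmod (V y * deriv_list (i # js) (atom y) (t + h *\<^sub>R ?e)) \<le> K * G y"
        using le[OF Cons.prems, where y=y and t="t + h *\<^sub>R ?e"] by (meson mult_right_mono order_trans)
    qed
    then have "((\<lambda>h. c * deriv_list js f (t + h *\<^sub>R ?e)) has_vector_derivative
        (\<integral>y. V y * deriv_list (i # js) (atom y) t \<partial>lborel)) (at 0)"
      unfolding Cons.IH[OF js pos] by simp
    moreover have "((\<lambda>h. c * deriv_list js f (t + h *\<^sub>R ?e)) has_vector_derivative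
        c * partial_deriv i (deriv_list js f) t) (at 0)"
      by (intro has_vector_derivative_mult_right smooth_has_partial_deriv smooth_deriv_list f)
    ultimately show ?case unfolding deriv_list_simps by (rule vector_derivative_unique_at)
  qed
  then show "(\<integral>y. V y * deriv_list js (atom y) t \<partial>lborel) = c * deriv_list js f t" .
qed

lemma atom_combination:
  fixes T :: "(real^'n::finite \<Rightarrow> complex) \<Rightarrow> complex"
  assumes T: "T \<in> dual_space (O_M \<omega>)" and Z: "finite Z"
  shows "(\<Sum>z\<in>Z. fscale (w z) (atom z)) \<in> topspace (O_M \<omega>)"
    and "T (\<Sum>z\<in>Z. fscale (w z) (atom z)) = (\<Sum>z\<in>Z. w z * T (atom z))"
    and "deriv_list js (\<Sum>z\<in>Z. fscale (w z) (atom z)) t = (\<Sum>z\<in>Z. w z * deriv_list js (atom z) t)"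
proof -
  note sub = subspace_rules[OF subspace_O_M]
  let ?h = "\<lambda>Z. \<Sum>z\<in>Z. fscale (w z) (atom z)"
  have "?h Z \<in> topspace (O_M \<omega>) \<and> T (?h Z) = (\<Sum>z\<in>Z. w z * T (atom z)) \<and>
    deriv_list js (?h Z) t = (\<Sum>z\<in>Z. w z * deriv_list js (atom z) t)"
    using Z
  proof (induction Z rule: finite_induct)
    case empty
    have "T (fscale 0 0) = 0 * T 0" using sub(1) by (rule dual_spaceD(3)[OF T])
    then show ?case using sub(1) by (simp add: deriv_list_zero del: zero_fun_apply) (simp add: fscale_def zero_fun_def)
  next
    case (insert z Z)
    have a: "fscale (w z) (atom z) \<in> topspace (O_M \<omega>)" by (intro sub(3) atom_in_O_M)
    have h: "?h (insert z Z) = fscale (w z) (atom z) + ?h Z" using insert by simp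
    have sm: "smooth (?h Z)" using insert.IH topspace_O_M_iff by blast
    have "T (?h (insert z Z)) = w z * T (atom z) + T (?h Z)"
      unfolding h using dual_spaceD(2)[OF T a] dual_spaceD(3)[OF T atom_in_O_M] insert.IH by simp
    moreover have "deriv_list js (?h (insert z Z)) t = w z * deriv_list js (atom z) t + deriv_list js (?h Z) t"
      unfolding h deriv_list_add[OF smooth_fscale[OF smooth_atom] sm] deriv_list_fscale[OF smooth_atom]
      by (simp add: fscale_def)
    ultimately show ?case using insert sub(2)[OF a] unfolding h by (simp del: plus_fun_apply)
  qed
  then show "?h Z \<in> topspace (O_M \<omega>)" "T (?h Z) = (\<Sum>z\<in>Z. w z * T (atom z))"
    "deriv_list js (?h Z) t = (\<Sum>z\<in>Z. w z * deriv_list js (atom z) t)" by blast+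
qed

lemma dual_atom_continuous:
  fixes T :: "(real^'n::finite \<Rightarrow> complex) \<Rightarrow> complex"
  assumes T: "T \<in> dual_space (O_M \<omega>)"
  shows "continuous_on UNIV (\<lambda>y. T (atom y))"
proof -
  note sub = subspace_rules[OF subspace_O_M]
  obtain m where m: "m \<ge> 1" "\<And>n. \<exists>C\<ge>0. \<forall>f A. f \<in> topspace (O_M \<omega>) \<longrightarrow> bound m n A f \<longrightarrow> cmod (T f) \<le> C * A"
    using dual_O_M_bound[OF T] by blast
  \<comment> \<open>With n = 0, \<open>atom_uniformly_continuous\<close> measures differences of
    atoms in the step of index 1, on which \<open>T\<close> is bounded by \<open>C\<close>.\<close>
  obtain C where C: "C \<ge> 0" "\<And>f A. f \<in> topspace (O_M \<omega>) \<Longrightarrow> bound m (0 * doubling + 1) A f \<Longrightarrow> cmod (T f) \<le> C * A"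
    using m(2) by blast
  show ?thesis
    unfolding continuous_on_iff
  proof (intro ballI allI impI)
    fix y :: "(real^'n) \<times> (real^'n)" and e :: real assume e: "e > 0"
    define e' where "e' = e / (C + 1) / 2"
    have e': "e' > 0" "C * e' < e" using e C(1) mult_nonneg_nonneg[OF C(1) less_imp_le[OF e]]
      by (auto simp: e'_def field_simps intro!: add_nonneg_pos)
    obtain d where d: "d > 0" "\<And>z z'. norm z \<le> norm y + 1 \<Longrightarrow> norm z' \<le> norm y + 1 \<Longrightarrow> dist z z' < d \<Longrightarrow>
      bound m (0 * doubling + 1) e' (atom z - atom z' :: real^'n \<Rightarrow> complex)"
      using atom_uniformly_continuous[OF e'(1)] by blast
    have "dist (T (atom z)) (T (atom y)) < e" if z: "dist z y < min d 1" for z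
    proof -
      have "norm z \<le> norm y + 1" using z norm_triangle_ineq2[of z y] by (simp add: dist_norm)
      then have "bound m (0 * doubling + 1) e' (atom z - atom y)" using d(2)[of z y] z by simp
      then have "cmod (T (atom z - atom y)) \<le> C * e'" by (intro C(2) sub(4) atom_in_O_M)
      also have "T (atom z - atom y) = T (atom z) - T (atom y)"
      proof -
        have "T (atom z - atom y + atom y) = T (atom z - atom y) + T (atom y)"
          by (intro dual_spaceD(2)[OF T] sub(4) atom_in_O_M)
        then show ?thesis by simp
      qed
      finally show ?thesis using e' by (simp add: dist_norm)
    qed
    then show "\<exists>d>0. \<forall>z\<in>UNIV. dist z y < d \<longrightarrow> dist (T (atom z)) (T (atom y)) < e"
      using d(1) by (intro exI[of _ "min d 1"]) auto
  qed
qed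

text \<open>
  The functional passes under the integral: the reconstruction of \<open>f\<close> is approximated by finite
  combinations of atoms in a single step norm on which the functional is bounded.
\<close>

lemma dual_reconstruction:
  fixes V :: "(real^'n::finite) \<times> (real^'n) \<Rightarrow> complex" and f :: "real^'n \<Rightarrow> complex"
  assumes T: "T \<in> dual_space (O_M \<omega>)"
    and Tm: "\<And>n. \<exists>C\<ge>0. \<forall>f A. f \<in> topspace (O_M \<omega>) \<longrightarrow> bound m n A f \<longrightarrow> cmod (T f) \<le> C * A"
    and V: "V \<in> borel_measurable borel" and G: "integrable lborel G"
    and atom: "\<And>y :: (real^'n) \<times> (real^'n). bound (doubling * m) (n * doubling) (C1 * \<rho> y) (atom y)" and C1: "C1 \<ge> 0"
    and VG: "\<And>y. cmod (V y) * \<rho> y \<le> G y"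
    and \<rho>: "\<And>R. \<exists>r>0. \<forall>y. norm y \<le> R \<longrightarrow> r \<le> \<rho> y"
    and f: "f \<in> topspace (O_M \<omega>)" and rec: "\<And>t. (\<integral>y. V y * atom y t \<partial>lborel) = c * f t"
  shows "integrable lborel (\<lambda>y. V y * T (atom y))"
    and "(\<integral>y. V y * T (atom y) \<partial>lborel) = c * T f"
proof -
  note sub = subspace_rules[OF subspace_O_M]
  have smf: "smooth f" using f topspace_O_M_iff by blast
  define N where "N = n * doubling"
  have mM: "m \<le> doubling * m" using doubling_ge_one by simp
  obtain C where C: "C \<ge> 0" "\<And>f A. f \<in> topspace (O_M \<omega>) \<Longrightarrow> bound m (N + 1) A f \<Longrightarrow> cmod (T f) \<le> C * A"
    using Tm by blast
  have \<rho>0: "\<rho> y \<ge> 0" for y using \<rho>[of "norm y"] by (meson less_imp_le order_trans order_refl)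
  have G0: "G y \<ge> 0" for y using VG[of y] \<rho>0[of y] by (meson mult_nonneg_nonneg norm_ge_zero order_trans)
  have Tatom: "cmod (T (atom y)) \<le> C * (C1 * \<rho> y)" for y
    using atom[of y] mM by (intro C(2) atom_in_O_M) (auto simp: N_def intro: deriv_bound_mono)
  have VT: "cmod (V y) * cmod (T (atom y)) \<le> C * (C1 * G y)" for y
  proof -
    have "cmod (V y) * cmod (T (atom y)) \<le> cmod (V y) * (C * (C1 * \<rho> y))" using Tatom by (intro mult_left_mono) auto
    also have "\<dots> = C * (C1 * (cmod (V y) * \<rho> y))" by simp
    also have "\<dots> \<le> C * (C1 * G y)" using VG C C1 by (intro mult_left_mono) auto
    finally show ?thesis .
  qed
  have Tcont: "continuous_on UNIV (\<lambda>y. T (atom y))" by (rule dual_atom_continuous[OF T])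
  show intT: "integrable lborel (\<lambda>y. V y * T (atom y))"
  proof (rule Bochner_Integration.integrable_bound)
    show "integrable lborel (\<lambda>y. C * (C1 * G y))" using G by simp
    show "(\<lambda>y. V y * T (atom y)) \<in> borel_measurable lborel"
      using V borel_measurable_continuous_onI[OF Tcont] by simp
    show "AE y in lborel. norm (V y * T (atom y)) \<le> norm (C * (C1 * G y))"
      using VT C(1) C1 G0 by (intro AE_I2) (simp add: norm_mult)
  qed
  have approx: "cmod ((\<integral>y. V y * T (atom y) \<partial>lborel) - c * T f) \<le> 2 * C * ((1 + C1) * e)" if e: "e > 0" for e
  proof -
    obtain R where R: "\<bar>\<integral>y. indicator (- cball 0 R) y * G y \<partial>lborel\<bar> < e"
      using integral_tail_small[OF G e] by blast
    let ?K = "cball (0 :: (real^'n) \<times> (real^'n)) R"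
    \<comment> \<open>A positive lower bound of \<open>\<rho>\<close> on the ball turns the majorant
      of |V| \<rho> into integrability of \<open>V\<close> itself there.\<close>
    obtain r where r: "r > 0" "\<And>y. norm y \<le> R \<Longrightarrow> r \<le> \<rho> y" using \<rho> by blast
    let ?V = "\<lambda>y. V y * indicator ?K y"
    have VK: "cmod (?V y) \<le> G y / r" for y
    proof (cases "y \<in> ?K")
      case True
      then have "cmod (V y) * r \<le> G y" using r(2)[of y] VG[of y] by (meson mem_cball_0 mult_left_mono norm_ge_zero order_trans)
      then show ?thesis using True r(1) by (simp add: field_simps)
    qed (use G0 r in simp)
    have Vm: "?V \<in> borel_measurable lborel"
      by (intro borel_measurable_times borel_measurable_indicator) (use V in auto)
    have Vint: "integrable lborel ?V"
    proof (rule Bochner_Integration.integrable_bound[OF _ Vm])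
      show "integrable lborel (\<lambda>y. G y / r)" using G by simp
      show "AE y in lborel. norm (?V y) \<le> norm (G y / r)"
        using VK G0 r(1) by (intro AE_I2) (auto intro: order_trans[OF _ abs_ge_self])
    qed
    define I where "I = (\<integral>y. cmod (?V y) \<partial>lborel)"
    have I0: "I \<ge> 0" by (simp add: I_def)
    \<comment> \<open>The mesh error is integrated against |V| on the ball, so it stays below
      \<open>e\<close>; the 1 covers I = 0.\<close>
    define \<epsilon> where "\<epsilon> = e / (I + 1)"
    have \<epsilon>: "\<epsilon> > 0" "\<epsilon> * I \<le> e" using e I0 by (auto simp: \<epsilon>_def field_simps add_pos_nonneg)
    obtain \<delta> where \<delta>: "\<delta> > 0" "\<And>y z :: (real^'n) \<times> (real^'n). norm y \<le> R \<Longrightarrow> norm z \<le> R \<Longrightarrow> dist y z < \<delta> \<Longrightarrow>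
      bound m (N + 1) \<epsilon> (atom y - atom z)"
      using atom_uniformly_continuous[OF \<epsilon>(1), of R m n] unfolding N_def by blast
    have "\<exists>Z. finite Z \<and> Z \<subseteq> ?K \<and> ?K \<subseteq> (\<Union>z\<in>Z. ball z \<delta>)"
      by (rule seq_compact_imp_totally_bounded[OF compact_imp_seq_compact[OF compact_cball], rule_format, OF \<delta>(1)])
    then obtain Z where Z: "finite Z" "Z \<subseteq> ?K" "?K \<subseteq> (\<Union>z\<in>Z. ball z \<delta>)" by blast
    obtain s where s12: "s \<in> borel_measurable borel" "finite (range s)"
      and s3: "\<forall>y\<in>(\<Union>z\<in>Z. ball z \<delta>). s y \<in> Z \<and> dist y (s y) < \<delta>"
      using finite_net_selection[OF Z(1), of \<delta>] by blast
    have "s y \<in> ?K \<and> dist y (s y) < \<delta>" if "y \<in> ?K" for y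
      using bspec[OF s3 subsetD[OF Z(3) that]] subsetD[OF Z(2)] by blast
    note s = s12 this
    define w where "w z = (\<integral>y. ?V y * indicator (s -` {z}) y \<partial>lborel)" for z
    let ?g = "\<Sum>z\<in>range s. fscale (w z) (atom z)"
    \<comment> \<open>The pointwise error of rounding to net points, up to a factor: the mesh error
      on the ball and the whole integrand outside it.\<close>
    define H where "H y = \<epsilon> * cmod (?V y) + C1 * (indicator (- ?K) y * G y)" for y
    have tail: "integrable lborel (\<lambda>y. indicator (- ?K) y * G y)"
      by (rule Bochner_Integration.integrable_bound[OF G])
        (use borel_measurable_integrable[OF G] in \<open>auto simp: indicator_def\<close>)
    have Hint: "integrable lborel H"
      unfolding H_def using tail integrable_norm[OF Vint] by simp
    have Hle: "(\<integral>y. H y \<partial>lborel) \<le> (1 + C1) * e"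
    proof -
      have "(\<integral>y. H y \<partial>lborel) = \<epsilon> * I + C1 * (\<integral>y. indicator (- ?K) y * G y \<partial>lborel)"
        unfolding H_def I_def using tail integrable_norm[OF Vint] by simp
      also have "\<dots> \<le> e + C1 * e" using \<epsilon> R C1 by (intro add_mono mult_left_mono) auto
      finally show ?thesis by (simp add: algebra_simps)
    qed
    \<comment> \<open>Applied to two integrands with the same weights \<open>w\<close>: derivatives
      of atoms at t, which puts the remainder into one step norm, and the values
      \<open>T (atom y)\<close>.\<close>
    have est: "cmod ((\<integral>y. V y * a y \<partial>lborel) - (\<Sum>z\<in>range s. w z * a z)) \<le> X * ((1 + C1) * e)"
      if a: "integrable lborel (\<lambda>y. V y * a y)" and X: "X \<ge> 0"
        and near: "\<And>y. y \<in> ?K \<Longrightarrow> cmod (a y - a (s y)) \<le> X * \<epsilon>"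
        and far: "\<And>y. cmod (V y) * cmod (a y) \<le> X * (C1 * G y)" for a X
    proof -
      note simple = integral_simple_composition[OF Vint s(1,2), of a]
      have "(\<integral>y. V y * a y \<partial>lborel) - (\<Sum>z\<in>range s. w z * a z) = (\<integral>y. V y * a y - ?V y * a (s y) \<partial>lborel)"
        unfolding w_def simple(2)[symmetric] by (rule Bochner_Integration.integral_diff[OF a simple(1), symmetric])
      also have "cmod \<dots> \<le> (\<integral>y. X * H y \<partial>lborel)"
      proof (rule Bochner_Integration.integral_norm_bound_integral)
        show "integrable lborel (\<lambda>y. V y * a y - ?V y * a (s y))"
          by (rule Bochner_Integration.integrable_diff[OF a simple(1)])
        show "integrable lborel (\<lambda>y. X * H y)" using Hint by simp
        show "cmod (V y * a y - ?V y * a (s y)) \<le> X * H y" for y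
        proof (cases "y \<in> ?K")
          case True
          then have "cmod (V y * a y - ?V y * a (s y)) = cmod (V y) * cmod (a y - a (s y))"
            by (simp add: right_diff_distrib flip: norm_mult)
          also have "\<dots> \<le> cmod (V y) * (X * \<epsilon>)" using near[OF True] by (intro mult_left_mono) auto
          finally show ?thesis using True by (simp add: H_def mult_ac)
        next
          case False
          then show ?thesis using far[of y] by (simp add: H_def norm_mult)
        qed
      qed
      also have "\<dots> = X * (\<integral>y. H y \<partial>lborel)" by simp
      also have "\<dots> \<le> X * ((1 + C1) * e)" using Hle X by (intro mult_left_mono)
      finally show ?thesis .
    qed
    note comb = atom_combination[OF T s(2), where w=w]
    have gM: "smooth ?g" using comb(1) topspace_O_M_iff by blast
    have "bound m (N + 1) ((1 + C1) * e) (fscale c f - ?g)"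
      unfolding deriv_bound_def
    proof (intro allI impI)
      fix js :: "'n list" and t :: "real^'n" assume js: "ordered_list js"
      let ?v = "v m (length js)" and ?E = "exp (real (N + 1) * \<omega> (norm t))"
      show "cmod (deriv_list js (fscale c f - ?g) t) * ?v \<le> (1 + C1) * e * ?E"
      \<comment> \<open>A vanishing coefficient makes the left side 0; otherwise the reconstruction
        may be differentiated along \<open>js\<close>.\<close>
      proof (cases "?v = 0")
        case True
        then show ?thesis using C1 e by simp
      next
        case False
        then have pos: "?v > 0" using weight_coeff_nonneg[of m "length js"] by simp
        have vM: "?v \<le> v (doubling * m) (length js)" using mM by (rule weight_coeff_mono)
        have pos': "v (doubling * m) (length js) > 0" using pos vM by simp
        note repr = deriv_list_reconstruction_integrable(1)[OF V G atom C1 \<rho>0 VG js pos', of t]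
          deriv_list_reconstruction[OF V G atom C1 \<rho>0 VG smf rec js pos', of t]
        have "deriv_list js (fscale c f - ?g) t = (\<integral>y. V y * deriv_list js (atom y) t \<partial>lborel) -
            (\<Sum>z\<in>range s. w z * deriv_list js (atom z) t)"
          unfolding deriv_list_diff(2)[OF smooth_fscale[OF smf] gM] deriv_list_fscale[OF smf] repr(2)
          using comb(3)[of js t] by (simp add: fscale_def)
        also have "cmod \<dots> \<le> ?E / ?v * ((1 + C1) * e)"
        proof (rule est[OF repr(1)])
          show "?E / ?v \<ge> 0" using pos by simp
          fix y
          show "cmod (deriv_list js (atom y) t - deriv_list js (atom (s y)) t) \<le> ?E / ?v * \<epsilon>" if "y \<in> ?K"
          proof -
            have "bound m (N + 1) \<epsilon> (atom y - atom (s y))" using \<delta>(2)[of y "s y"] s(3)[OF that] that by simp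
            from deriv_boundD[OF this js, of t] show ?thesis
              unfolding deriv_list_diff(2)[OF smooth_atom smooth_atom] using pos by (simp add: field_simps)
          qed
          have "cmod (deriv_list js (atom y) t) * ?v \<le> cmod (deriv_list js (atom y) t) * v (doubling * m) (length js)"
            using vM by (intro mult_left_mono) auto
          also have "\<dots> \<le> C1 * \<rho> y * exp (real N * \<omega> (norm t))" using deriv_boundD[OF atom js] by (simp add: N_def)
          also have "\<dots> \<le> C1 * \<rho> y * ?E"
            using C1 \<rho>0[of y] weight_nonneg[of "norm t"] by (intro mult_left_mono) (auto intro!: mult_right_mono)
          finally have "cmod (deriv_list js (atom y) t) \<le> ?E / ?v * (C1 * \<rho> y)" using pos by (simp add: field_simps)
          then have "cmod (V y) * cmod (deriv_list js (atom y) t) \<le> cmod (V y) * (?E / ?v * (C1 * \<rho> y))"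
            by (intro mult_left_mono) auto
          also have "\<dots> = ?E / ?v * (C1 * (cmod (V y) * \<rho> y))" by simp
          also have "\<dots> \<le> ?E / ?v * (C1 * G y)" using VG C1 pos by (intro mult_left_mono) auto
          finally show "cmod (V y) * cmod (deriv_list js (atom y) t) \<le> ?E / ?v * (C1 * G y)" .
        qed
        finally show ?thesis using pos by (simp add: field_simps)
      qed
    qed
    then have 1: "cmod (T (fscale c f - ?g)) \<le> C * ((1 + C1) * e)"
      by (intro C(2) sub(4) sub(3) f comb(1))
    have diff: "T (h - k) = T h - T k" if "h \<in> topspace (O_M \<omega>)" "k \<in> topspace (O_M \<omega>)" for h k
      using dual_spaceD(2)[OF T sub(4)[OF that] that(2)] by simp
    have 2: "T (fscale c f - ?g) = c * T f - (\<Sum>z\<in>range s. w z * T (atom z))"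
      using diff[OF sub(3)[OF f] comb(1)] dual_spaceD(3)[OF T f] comb(2) by simp
    have 3: "cmod ((\<integral>y. V y * T (atom y) \<partial>lborel) - (\<Sum>z\<in>range s. w z * T (atom z))) \<le> C * ((1 + C1) * e)"
    proof (rule est[OF intT C(1) _ VT])
      fix y assume y: "y \<in> ?K"
      have "bound m (N + 1) \<epsilon> (atom y - atom (s y))" using \<delta>(2)[of y "s y"] s(3)[OF y] y by simp
      then have "cmod (T (atom y - atom (s y))) \<le> C * \<epsilon>" by (intro C(2) sub(4) atom_in_O_M)
      then show "cmod (T (atom y) - T (atom (s y))) \<le> C * \<epsilon>" unfolding diff[OF atom_in_O_M atom_in_O_M] .
    qed
    have "(\<integral>y. V y * T (atom y) \<partial>lborel) - c * T f =
        ((\<integral>y. V y * T (atom y) \<partial>lborel) - (\<Sum>z\<in>range s. w z * T (atom z))) - T (fscale c f - ?g)"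
      unfolding 2 by simp
    also have "cmod \<dots> \<le> C * ((1 + C1) * e) + C * ((1 + C1) * e)"
      by (rule order_trans[OF norm_triangle_ineq4 add_mono[OF 3 1]])
    finally show ?thesis by (simp only: mult_2 distrib_right)
  qed
  have "cmod ((\<integral>y. V y * T (atom y) \<partial>lborel) - c * T f) \<le> 0"
  proof (rule field_le_epsilon)
    fix e :: real assume e: "e > 0"
    define K where "K = 2 * C * (1 + C1)"
    have K: "K \<ge> 0" using C(1) C1 by (simp add: K_def)
    have "cmod ((\<integral>y. V y * T (atom y) \<partial>lborel) - c * T f) \<le> K * (e / (K + 1))"
      using approx[of "e / (K + 1)"] e K by (simp add: K_def mult.assoc)
    also have "\<dots> \<le> 0 + e" using e K by (simp add: field_simps)
    finally show "cmod ((\<integral>y. V y * T (atom y) \<partial>lborel) - c * T f) \<le> 0 + e" .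
  qed
  then show "(\<integral>y. V y * T (atom y) \<partial>lborel) = c * T f" by simp
qed

end

section \<open>Strongly bounded sets of functionals are equicontinuous\<close>

lemma integrable_decay_pair:
  "integrable lborel (\<lambda>y :: (real^'n::finite) \<times> (real^'n). decay (fst y) * decay (snd y))"
proof -
  have [measurable]: "decay \<in> borel_measurable borel"
    using borel_measurable_integrable[OF integrable_decay] by simp
  have "integrable lborel (\<lambda>y :: (real^'n) \<times> (real^'n). complex_of_real (decay (fst y) * decay (snd y)))"
  proof (rule integrable_pair_bound[OF _ integrable_decay decay_nonneg integrable_decay decay_nonneg])
    show "(\<lambda>y :: (real^'n) \<times> (real^'n). complex_of_real (decay (fst y) * decay (snd y))) \<in> borel_measurable borel"
      unfolding borel_prod[symmetric] by measurable
  qed (simp add: norm_mult decay_nonneg abs_of_nonneg)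
  from integrable_Re[OF this] show ?thesis by simp
qed

lemma stft_fscale: "stft (fscale c f) y = c * stft f y"
proof -
  have "stft (fscale c f) y = (\<integral>s. c * ((f * gaussian (fst y)) s * modulation (- snd y) s) \<partial>lborel)"
    unfolding stft_def fourier_def by (simp add: fscale_def mult.assoc)
  then show ?thesis unfolding stft_def fourier_def by (simp only: Bochner_Integration.integral_mult_right_zero)
qed

context weight_function
begin

lemma windowed_decay:
  fixes f :: "real^'n::finite \<Rightarrow> complex"
  assumes "f \<in> level (doubling * m)"
  shows "\<exists>B. \<forall>s. cmod (f s * gaussian x s) \<le> B * exp (- norm (s - x))"
proof -
  obtain n A where f: "smooth f" "bound (doubling * m) n A f" using assms by (rule levelE)
  obtain C where "\<And>f A (x :: real^'n) s js. smooth f \<Longrightarrow> bound (doubling * m) n A f \<Longrightarrow> ordered_list js \<Longrightarrow>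
    cmod (deriv_list js (f * gaussian x) s) * v m (length js) \<le>
    C * A * exp (real (n * doubling) * \<omega> (norm x)) * exp (- norm (s - x))"
    using windowed_bound[of m n] by blast
  from this[OF f ordered_list_Nil, of x] show ?thesis by (auto simp: weight_coeff_0)
qed

lemma stft_add:
  assumes f: "f \<in> level (doubling * m)" and g: "g \<in> level (doubling * m)"
  shows "stft (f + g) y = stft f y + stft g y"
proof -
  have int: "integrable lborel (\<lambda>s. (h * gaussian (fst y)) s * modulation (- snd y) s)"
    if h: "h \<in> level (doubling * m)" for h
  proof -
    obtain B where B: "\<And>s. cmod (h s * gaussian (fst y) s) \<le> B * exp (- norm (s - fst y))"
      using windowed_decay[OF h] by blast
    have "continuous_on UNIV h" using h by (elim levelE) (rule smooth_continuous)
    then show ?thesis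
      unfolding times_fun_apply using B
      by (intro integrable_exp_norm_bound[where B=B and x="fst y"] continuous_intros) (simp_all add: norm_mult)
  qed
  have "stft (f + g) y = (\<integral>s. (f * gaussian (fst y)) s * modulation (- snd y) s +
      (g * gaussian (fst y)) s * modulation (- snd y) s \<partial>lborel)"
    unfolding stft_def fourier_def by (simp add: algebra_simps)
  then show ?thesis unfolding stft_def fourier_def
    by (simp only: Bochner_Integration.integral_add[OF int[OF f] int[OF g]])
qed

text \<open>All constants may depend on \<open>T\<close> and \<open>f\<close>, because only the
  identity is wanted; bounds uniform over a bounded set of functionals come separately, from their
  values on atoms.\<close>

lemma stft_reconstruction:
  fixes f :: "real^'n::finite \<Rightarrow> complex"
  assumes T: "T \<in> dual_space (O_M \<omega>)" and f: "f \<in> topspace (O_M \<omega>)"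
  shows "(\<integral>y. stft f y * T (atom y) \<partial>lborel) = stft_constant TYPE('n) * T f"
proof -
  obtain m where m: "m \<ge> 1" and Tm: "\<And>n. \<exists>C\<ge>0. \<forall>f A. f \<in> topspace (O_M \<omega>) \<longrightarrow> bound m n A f \<longrightarrow> cmod (T f) \<le> C * A"
    using dual_O_M_bound[OF T] by blast
  \<comment> \<open>The exponent of \<omega>(\<xi>) in \<open>atom_bound\<close> at index
    \<open>doubling * m\<close>, which is the index that \<open>dual_reconstruction\<close> asks of
    the atoms.\<close>
  define m0 where "m0 = doubling * (doubling * m)"
  obtain m' where m': "m' \<ge> 1" and dec: "\<And>n. \<exists>n' C. C \<ge> 0 \<and> (\<forall>f A (x :: real^'n) \<xi>. smooth f \<longrightarrow> bound (doubling * m') n A f \<longrightarrow>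
    cmod (stft f (x, \<xi>)) * exp (real m0 * \<omega> (infnorm \<xi>) - real n' * \<omega> (norm x)) \<le> C * A * (decay x * decay \<xi>))"
    using stft_decay[of m0] by blast
  have smf: "smooth f" using f topspace_O_M_iff by blast
  have cont: "continuous_on UNIV f" using smf by (rule smooth_continuous)
  obtain nf A where bf: "bound (doubling * m') nf A f"
    using f doubling_mult_ge[OF m'] unfolding topspace_O_M_iff by blast
  obtain n C where C: "C \<ge> 0" "\<And>x \<xi>. cmod (stft f (x, \<xi>)) * exp (real m0 * \<omega> (infnorm \<xi>) - real n * \<omega> (norm x)) \<le>
      C * A * (decay x * decay \<xi>)"
    using dec[of nf] smf bf by blast
  have A: "A \<ge> 0" using bf by (rule deriv_bound_nonneg)
  define \<rho> where "\<rho> y = exp (real m0 * \<omega> (infnorm (snd y)) - real n * \<omega> (norm (fst y)))" for y :: "(real^'n) \<times> (real^'n)"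
  define G where "G y = C * A * (decay (fst y) * decay (snd y))" for y :: "(real^'n) \<times> (real^'n)"
  have VG: "cmod (stft f y) * \<rho> y \<le> G y" for y
    using C(2)[of "fst y" "snd y"] by (simp add: \<rho>_def G_def)
  have G: "integrable lborel G"
    unfolding G_def using integrable_decay_pair by (rule integrable_mult_right)
  have G0: "G y \<ge> 0" for y unfolding G_def by (intro mult_nonneg_nonneg C(1) A decay_nonneg)
  obtain C1 where C1: "C1 \<ge> 0" "\<And>x \<xi> :: real^'n. bound (doubling * m) (n * doubling)
    (C1 * exp (real (doubling * (doubling * m)) * \<omega> (infnorm \<xi>) - real n * \<omega> (norm x))) (atom (x, \<xi>))"
    using atom_bound[of "doubling * m" n] by blast
  have at: "bound (doubling * m) (n * doubling) (C1 * \<rho> y) (atom y)" for y :: "(real^'n) \<times> (real^'n)"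
    using C1(2)[of "snd y" "fst y"] by (simp add: \<rho>_def m0_def)
  \<comment> \<open>The frequency part of the exponent is nonnegative and may be dropped; the
    position part is bounded on balls.\<close>
  have \<rho>: "\<exists>r>0. \<forall>y. norm y \<le> R \<longrightarrow> r \<le> \<rho> y" for R
  proof (intro exI[of _ "exp (- (real n * \<omega> (max R 0)))"] conjI allI impI)
    fix y :: "(real^'n) \<times> (real^'n)" assume y: "norm y \<le> R"
    have "norm (fst y) \<le> max R 0" using norm_fst_le[of "fst y" "snd y"] y by simp
    then have "real n * \<omega> (norm (fst y)) \<le> real n * \<omega> (max R 0)" by (intro mult_left_mono weight_mono) auto
    moreover have "0 \<le> real m0 * \<omega> (infnorm (snd y))" by (intro mult_nonneg_nonneg weight_nonneg infnorm_pos_le of_nat_0_le_iff)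
    ultimately show "exp (- (real n * \<omega> (max R 0))) \<le> \<rho> y" by (simp add: \<rho>_def)
  qed simp
  have V: "stft f \<in> borel_measurable borel" using cont by (rule stft_borel_measurable)
  have rec: "(\<integral>y. stft f y * atom y t \<partial>lborel) = stft_constant TYPE('n) * f t" for t
  proof (rule stft_inversion[OF cont])
    show "\<exists>B. \<forall>s. cmod (f s * gaussian x s) \<le> B * exp (- norm (s - x))" for x
      using levelI[OF smf bf] by (rule windowed_decay)
    show "integrable lborel (\<lambda>\<xi>. stft f (x, \<xi>))" for x
    proof (rule Bochner_Integration.integrable_bound)
      show "integrable lborel (\<lambda>\<xi>. C * A * decay x * exp (real n * \<omega> (norm x)) * decay \<xi>)"
        using integrable_decay by (rule integrable_mult_right)
      show "(\<lambda>\<xi>. stft f (x, \<xi>)) \<in> borel_measurable lborel"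
        using measurable_compose[OF _ V, of "Pair x" lborel] by simp
      show "AE \<xi> in lborel. norm (stft f (x, \<xi>)) \<le> norm (C * A * decay x * exp (real n * \<omega> (norm x)) * decay \<xi>)"
      proof (rule AE_I2)
        fix \<xi> :: "real^'n"
        have "cmod (stft f (x, \<xi>)) * exp (- (real n * \<omega> (norm x))) \<le>
            cmod (stft f (x, \<xi>)) * exp (real m0 * \<omega> (infnorm \<xi>) - real n * \<omega> (norm x))"
          using weight_nonneg[OF infnorm_pos_le, of \<xi>] by (intro mult_left_mono) auto
        also have "\<dots> \<le> C * A * (decay x * decay \<xi>)" by (rule C(2))
        finally have "cmod (stft f (x, \<xi>)) \<le> C * A * decay x * exp (real n * \<omega> (norm x)) * decay \<xi>"
          by (simp add: exp_minus field_simps)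
        then show "norm (stft f (x, \<xi>)) \<le> norm (C * A * decay x * exp (real n * \<omega> (norm x)) * decay \<xi>)"
          unfolding real_norm_def by (rule order_trans[OF _ abs_ge_self])
      qed
    qed
    show "integrable lborel (\<lambda>y. stft f y * atom y t)"
      using deriv_list_reconstruction_integrable(1)[OF V G at C1(1) _ VG ordered_list_Nil, where t=t]
      by (simp add: \<rho>_def weight_coeff_0)
  qed
  show ?thesis by (rule dual_reconstruction(2)[OF T Tm V G at C1(1) VG \<rho> f rec])
qed

section \<open>Uniform estimates for a strongly bounded set of functionals\<close>

context
  fixes B :: "((real^'n::finite \<Rightarrow> complex) \<Rightarrow> complex) set"
  assumes B: "bounded_in (O_M_dual \<omega>) B"
begin

lemma strongly_bounded_on:
  assumes "\<And>f. f \<in> D \<Longrightarrow> smooth f" "\<And>m. m \<ge> 1 \<Longrightarrow> \<exists>n A. \<forall>f\<in>D. bound m n A f"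
  shows "\<exists>c\<ge>0. \<forall>T\<in>B. \<forall>f\<in>D. cmod (T f) \<le> c"
proof -
  obtain c where c: "\<And>T f. T \<in> B \<Longrightarrow> f \<in> D \<Longrightarrow> cmod (T f) \<le> c"
    using bounded_in_strong_dualD[OF B[unfolded O_M_dual_def] bounded_in_O_M_I[OF assms]] by blast
  have "cmod (T f) \<le> max c 0" if "T \<in> B" "f \<in> D" for T f using c[OF that] by simp
  then show ?thesis by (intro exI[of _ "max c 0"]) auto
qed

lemma strongly_bounded_dual: "T \<in> B \<Longrightarrow> T \<in> dual_space (O_M \<omega>)"
  using B by (auto simp: bounded_in_def O_M_dual_def)

lemma strongly_bounded_fscale_atom: "T \<in> B \<Longrightarrow> T (fscale c (atom y)) = c * T (atom y)"
  by (rule dual_spaceD(3)[OF strongly_bounded_dual atom_in_O_M])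

lemma strongly_bounded_atoms_frequency:
  "\<exists>m0. \<exists>C\<ge>0. \<forall>T\<in>B. \<forall>x \<xi>. cmod (T (atom (x, \<xi>))) \<le> C * exp (real m0 * \<omega> (infnorm \<xi>))"
proof (rule ccontr)
  assume contr: "\<not> ?thesis"
  \<comment> \<open>The negated claim is used with \<open>m0\<close> and \<open>C\<close> both equal
    to k. Functional and point are paired so that one choice yields both sequences.\<close>
  have "\<exists>z. fst z \<in> B \<and> cmod (fst z (atom (snd z))) > real k * exp (real k * \<omega> (infnorm (snd (snd z))))" for k
  proof (rule ccontr)
    assume "\<not> ?thesis"
    then have "\<forall>T\<in>B. \<forall>x \<xi>. cmod (T (atom (x, \<xi>))) \<le> real k * exp (real k * \<omega> (infnorm \<xi>))"
      by (auto simp: not_less)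
    then show False using contr of_nat_0_le_iff by blast
  qed
  then have "\<exists>z. \<forall>k. fst (z k) \<in> B \<and>
      cmod (fst (z k) (atom (snd (z k)))) > real k * exp (real k * \<omega> (infnorm (snd (snd (z k)))))"
    by (intro choice allI)
  then obtain z where z: "\<And>k. fst (z k) \<in> B"
    "\<And>k. cmod (fst (z k) (atom (snd (z k)))) > real k * exp (real k * \<omega> (infnorm (snd (snd (z k)))))" by blast
  define T where "T k = fst (z k)" for k
  define y where "y k = snd (z k)" for k
  define W where "W k = \<omega> (infnorm (snd (y k)))" for k
  have T: "T k \<in> B" and Ty: "cmod (T k (atom (y k))) > real k * exp (real k * W k)" for k
    using z unfolding T_def y_def W_def by blast+
  have W0: "W k \<ge> 0" for k by (simp add: W_def weight_nonneg infnorm_pos_le)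
  \<comment> \<open>The normalizing exponent k grows with the sequence and so eventually exceeds the
    exponent \<open>doubling * m\<close> of the atoms, for every fixed m.\<close>
  define h where "h k = fscale (of_real (exp (- (real k * W k)))) (atom (y k))" for k
  have "\<exists>c\<ge>0. \<forall>T\<in>B. \<forall>f\<in>range h. cmod (T f) \<le> c"
  proof (rule strongly_bounded_on)
    show "smooth f" if "f \<in> range h" for f using that by (auto simp: h_def intro!: smooth_fscale smooth_atom)
    fix m :: nat
    obtain C where C: "C \<ge> 0" "\<And>x \<xi> :: real^'n. bound m (0 * doubling)
      (C * exp (real (doubling * m) * \<omega> (infnorm \<xi>) - real 0 * \<omega> (norm x))) (atom (x, \<xi>))"
      using atom_bound[of m 0] by blast
    \<comment> \<open>For k \<ge> \<open>doubling * m\<close> the normalization wins and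
      \<open>C\<close> is enough; the sum covers the finitely many smaller k.\<close>
    define A where "A = C * (1 + (\<Sum>k<doubling * m. exp (real (doubling * m) * W k)))"
    have "bound m 0 A (h k)" for k
    proof -
      have "bound m 0 (C * exp (real (doubling * m) * W k)) (atom (y k))"
        using C(2)[of "snd (y k)" "fst (y k)"] by (simp add: W_def)
      then have "bound m 0 (cmod (of_real (exp (- (real k * W k)))) * (C * exp (real (doubling * m) * W k))) (h k)"
        unfolding h_def by (rule deriv_bound_fscale[OF smooth_atom])
      moreover have "cmod (of_real (exp (- (real k * W k)))) * (C * exp (real (doubling * m) * W k)) \<le> A"
      proof -
        have S: "0 \<le> (\<Sum>k<doubling * m. exp (real (doubling * m) * W k))" by (intro sum_nonneg) simp
        have "exp (real (doubling * m) * W k - real k * W k) \<le> 1 + (\<Sum>k<doubling * m. exp (real (doubling * m) * W k))"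
        proof (cases "k < doubling * m")
          case True
          have "exp (real (doubling * m) * W k - real k * W k) \<le> exp (real (doubling * m) * W k)" using W0[of k] by simp
          also have "\<dots> \<le> (\<Sum>k<doubling * m. exp (real (doubling * m) * W k))"
            using True by (intro member_le_sum[of k _ "\<lambda>k. exp (real (doubling * m) * W k)"]) auto
          finally show ?thesis by simp
        next
          case False
          then have "real (doubling * m) \<le> real k" by (simp only: of_nat_le_iff not_less)
          then have "real (doubling * m) * W k \<le> real k * W k" using W0 by (rule mult_right_mono)
          then have "exp (real (doubling * m) * W k - real k * W k) \<le> 1" by simp
          then show ?thesis using S by linarith
        qed
        then have "C * exp (real (doubling * m) * W k - real k * W k) \<le> A"
          unfolding A_def using C(1) by (intro mult_left_mono)
        moreover have "exp (real (doubling * m) * W k - real k * W k) = exp (- (real k * W k)) * exp (real (doubling * m) * W k)"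
          by (simp flip: exp_add)
        moreover have "cmod (of_real (exp (- (real k * W k)))) = exp (- (real k * W k))" unfolding norm_of_real by (rule abs_exp_cancel)
        ultimately show ?thesis by (simp only: mult_ac)
      qed
      ultimately show ?thesis using deriv_bound_mono by blast
    qed
    then show "\<exists>n A. \<forall>f\<in>range h. bound m n A f" by blast
  qed
  then obtain c where c: "\<And>T f. T \<in> B \<Longrightarrow> f \<in> range h \<Longrightarrow> cmod (T f) \<le> c" by blast
  obtain k :: nat where k: "real k > c" using reals_Archimedean2 by blast
  \<comment> \<open>The normalization cancels the exponential in the lower bound for
    \<open>T k\<close>, so the values on \<open>h k\<close> exceed every constant.\<close>
  have "real k = exp (- (real k * W k)) * (real k * exp (real k * W k))" by (simp flip: exp_add)
  also have "\<dots> \<le> exp (- (real k * W k)) * cmod (T k (atom (y k)))" using Ty[of k] by (intro mult_left_mono) auto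
  also have "\<dots> = cmod (T k (h k))" unfolding h_def strongly_bounded_fscale_atom[OF T] by (simp add: norm_mult)
  also have "\<dots> \<le> c" by (intro c T) simp
  finally show False using k by simp
qed

lemma strongly_bounded_atoms:
  "\<exists>m0. \<forall>n. \<exists>C\<ge>0. \<forall>T\<in>B. \<forall>x \<xi>. cmod (T (atom (x, \<xi>))) \<le>
    C * exp (real m0 * \<omega> (infnorm \<xi>) - real n * \<omega> (norm x))"
proof -
  obtain m0 C0 where C0: "C0 \<ge> 0" "\<And>T x \<xi>. T \<in> B \<Longrightarrow> cmod (T (atom (x, \<xi>))) \<le> C0 * exp (real m0 * \<omega> (infnorm \<xi>))"
    using strongly_bounded_atoms_frequency by blast
  \<comment> \<open>Where \<omega>(\<xi>) exceeds n \<omega>(x), one additional \<omega>(\<xi>) pays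
    for the factor exp (- n \<omega>(x)); hence \<open>Suc m0\<close>, for every n alike.\<close>
  have "\<exists>C\<ge>0. \<forall>T\<in>B. \<forall>x \<xi>. cmod (T (atom (x, \<xi>))) \<le>
    C * exp (real (Suc m0) * \<omega> (infnorm \<xi>) - real n * \<omega> (norm x))" for n
  proof -
    define D where "D = {fscale (of_real (exp (real n * \<omega> (norm x)))) (atom (x, \<xi> :: real^'n)) | x \<xi>.
      \<omega> (infnorm \<xi>) \<le> real n * \<omega> (norm x)}"
    have "\<exists>c\<ge>0. \<forall>T\<in>B. \<forall>f\<in>D. cmod (T f) \<le> c"
    proof (rule strongly_bounded_on)
      show "smooth f" if "f \<in> D" for f using that by (auto simp: D_def intro!: smooth_fscale smooth_atom)
      fix m :: nat
      \<comment> \<open>The summand n compensates the multiple exp (n \<omega>(x)); the other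
        compensates the frequency factor, because \<omega>(\<xi>) \<le> n \<omega>(x) on this
        set.\<close>
      define n' where "n' = n + doubling * m * n"
      obtain C where C: "C \<ge> 0" "\<And>x \<xi> :: real^'n. bound m (n' * doubling)
        (C * exp (real (doubling * m) * \<omega> (infnorm \<xi>) - real n' * \<omega> (norm x))) (atom (x, \<xi>))"
        using atom_bound[of m n'] by blast
      have "bound m (n' * doubling) C f" if fD: "f \<in> D" for f
      proof -
        obtain x \<xi> where f: "f = fscale (of_real (exp (real n * \<omega> (norm x)))) (atom (x, \<xi>))"
          "\<omega> (infnorm \<xi>) \<le> real n * \<omega> (norm x)" using fD by (auto simp: D_def)
        have "bound m (n' * doubling) (cmod (of_real (exp (real n * \<omega> (norm x)))) *
            (C * exp (real (doubling * m) * \<omega> (infnorm \<xi>) - real n' * \<omega> (norm x)))) f"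
          unfolding f(1) by (rule deriv_bound_fscale[OF smooth_atom C(2)])
        moreover have "cmod (of_real (exp (real n * \<omega> (norm x)))) *
            (C * exp (real (doubling * m) * \<omega> (infnorm \<xi>) - real n' * \<omega> (norm x))) \<le> C"
        proof -
          have "real (doubling * m) * \<omega> (infnorm \<xi>) \<le> real (doubling * m) * (real n * \<omega> (norm x))"
            using f(2) by (intro mult_left_mono) auto
          then have "real n * \<omega> (norm x) + (real (doubling * m) * \<omega> (infnorm \<xi>) - real n' * \<omega> (norm x)) \<le> 0"
            by (simp add: n'_def algebra_simps)
          then have "C * exp (real n * \<omega> (norm x) + (real (doubling * m) * \<omega> (infnorm \<xi>) - real n' * \<omega> (norm x))) \<le> C * 1"
            using C(1) by (intro mult_left_mono) auto
          then show ?thesis unfolding exp_add norm_of_real by (simp add: mult_ac)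
        qed
        ultimately show ?thesis using deriv_bound_mono by blast
      qed
      then show "\<exists>n A. \<forall>f\<in>D. bound m n A f" by blast
    qed
    then obtain c where c: "c \<ge> 0" "\<And>T f. T \<in> B \<Longrightarrow> f \<in> D \<Longrightarrow> cmod (T f) \<le> c" by blast
    have "cmod (T (atom (x, \<xi>))) \<le> (C0 + c) * exp (real (Suc m0) * \<omega> (infnorm \<xi>) - real n * \<omega> (norm x))"
      (is "_ \<le> _ * ?E") if T: "T \<in> B" for T x \<xi>
    proof (cases "\<omega> (infnorm \<xi>) \<le> real n * \<omega> (norm x)")
      case True
      then have "fscale (of_real (exp (real n * \<omega> (norm x)))) (atom (x, \<xi>)) \<in> D" by (auto simp: D_def)
      from c(2)[OF T this] have "exp (real n * \<omega> (norm x)) * cmod (T (atom (x, \<xi>))) \<le> c"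
        unfolding strongly_bounded_fscale_atom[OF T] by (simp add: norm_mult)
      then have "cmod (T (atom (x, \<xi>))) \<le> c * exp (- (real n * \<omega> (norm x)))" by (simp add: exp_minus field_simps)
      also have "\<dots> \<le> (C0 + c) * ?E"
        using c(1) C0(1) weight_nonneg[OF infnorm_pos_le, of \<xi>] by (intro mult_mono) auto
      finally show ?thesis .
    next
      case False
      then have "exp (real m0 * \<omega> (infnorm \<xi>)) \<le> ?E" by (simp add: algebra_simps)
      then have "C0 * exp (real m0 * \<omega> (infnorm \<xi>)) \<le> (C0 + c) * ?E" using c(1) C0(1) by (intro mult_mono) auto
      then show ?thesis using C0(2)[OF T, of x \<xi>] by linarith
    qed
    then show ?thesis using C0(1) c(1) by (intro exI[of _ "C0 + c"]) auto
  qed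
  then show ?thesis by blast
qed

text \<open>Decay of the transform with exponent \<open>m0\<close> and the values on atoms with the
  same \<open>m0\<close> multiply to the integrable weight \<open>decay\<close>. Since
  \<open>m0\<close> is fixed for the whole set, so is the level of the dominating seminorm.\<close>

lemma strongly_bounded_equicontinuous:
  "\<exists>q\<in>(\<Union>m\<in>{1..}. level_seminorms m). \<forall>T\<in>B. \<forall>f\<in>topspace (O_M \<omega>). cmod (T f) \<le> q f"
proof (cases "B = {}")
  case True
  then show ?thesis using seminorm_base_nonempty[OF seminorm_base_O_M(2)[where 'n='n]] by blast
next
  case False
  let ?c = "stft_constant TYPE('n)"
  obtain m0 where atoms: "\<And>n. \<exists>C\<ge>0. \<forall>T\<in>B. \<forall>x \<xi>. cmod (T (atom (x, \<xi>))) \<le>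
    C * exp (real m0 * \<omega> (infnorm \<xi>) - real n * \<omega> (norm x))" using strongly_bounded_atoms by blast
  obtain m where m: "m \<ge> 1" and dec: "\<And>n. \<exists>n' C. C \<ge> 0 \<and> (\<forall>f A (x :: real^'n) \<xi>. smooth f \<longrightarrow> bound (doubling * m) n A f \<longrightarrow>
    cmod (stft f (x, \<xi>)) * exp (real m0 * \<omega> (infnorm \<xi>) - real n' * \<omega> (norm x)) \<le> C * A * (decay x * decay \<xi>))"
    using stft_decay[of m0] by blast
  define M where "M = doubling * m"
  have M: "M \<ge> 1" using doubling_mult_ge[OF m] by (simp add: M_def)
  \<comment> \<open>Functionals are 0 outside the carrier of \<open>O_M\<close>, so
    \<open>cmod (T f)\<close> need not be a seminorm on the larger space \<open>level M\<close>; the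
    integral extends it there.\<close>
  define p where "p T f = cmod ((\<integral>y. stft f y * T (atom y) \<partial>lborel) / ?c)" for T and f :: "real^'n \<Rightarrow> complex"
  have step: "\<exists>C\<ge>0. \<forall>f A. smooth f \<longrightarrow> bound M n A f \<longrightarrow> (\<forall>T\<in>B. integrable lborel (\<lambda>y. stft f y * T (atom y)) \<and> p T f \<le> C * A)" for n
  proof -
    obtain n' C where C: "C \<ge> 0" "\<And>f A (x :: real^'n) \<xi>. smooth f \<Longrightarrow> bound M n A f \<Longrightarrow>
      cmod (stft f (x, \<xi>)) * exp (real m0 * \<omega> (infnorm \<xi>) - real n' * \<omega> (norm x)) \<le> C * A * (decay x * decay \<xi>)"
      using dec[of n] unfolding M_def by blast
    \<comment> \<open>The growth index \<open>n'\<close> is dictated by the transform, and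
      \<open>atoms\<close> accepts every n, so both estimates carry the same exponential.\<close>
    obtain C' where C': "C' \<ge> 0" "\<And>T x \<xi>. T \<in> B \<Longrightarrow> cmod (T (atom (x, \<xi>))) \<le>
      C' * exp (real m0 * \<omega> (infnorm \<xi>) - real n' * \<omega> (norm x))" using atoms[of n'] by blast
    define I where "I = (\<integral>y. decay (fst y) * decay (snd y) \<partial>(lborel :: ((real^'n) \<times> (real^'n)) measure))"
    have I0: "I \<ge> 0" unfolding I_def by (rule Bochner_Integration.integral_nonneg) (simp add: decay_nonneg)
    have "integrable lborel (\<lambda>y. stft f y * T (atom y)) \<and> p T f \<le> C' * C * I / cmod ?c * A"
      if f: "smooth f" "bound M n A f" and T: "T \<in> B" for f A T
    proof -
      have A: "A \<ge> 0" using f(2) by (rule deriv_bound_nonneg)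
      let ?D = "\<lambda>y :: (real^'n) \<times> (real^'n). C' * C * A * (decay (fst y) * decay (snd y))"
      have le: "cmod (stft f y * T (atom y)) \<le> ?D y" for y
      proof (cases y)
        case (Pair x \<xi>)
        have "cmod (stft f y * T (atom y)) \<le> cmod (stft f (x, \<xi>)) *
            (C' * exp (real m0 * \<omega> (infnorm \<xi>) - real n' * \<omega> (norm x)))"
          unfolding Pair norm_mult using C'(2)[OF T] by (intro mult_left_mono) auto
        also have "\<dots> = C' * (cmod (stft f (x, \<xi>)) * exp (real m0 * \<omega> (infnorm \<xi>) - real n' * \<omega> (norm x)))" by simp
        also have "\<dots> \<le> C' * (C * A * (decay x * decay \<xi>))" using C(2)[OF f] C'(1) by (intro mult_left_mono)
        finally show ?thesis by (simp add: Pair mult_ac)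
      qed
      have D: "integrable lborel ?D" using integrable_decay_pair by (rule integrable_mult_right)
      have int: "integrable lborel (\<lambda>y. stft f y * T (atom y))"
      proof (rule Bochner_Integration.integrable_bound[OF D])
        show "(\<lambda>y. stft f y * T (atom y)) \<in> borel_measurable lborel"
          using stft_borel_measurable[OF smooth_continuous[OF f(1)]]
            borel_measurable_continuous_onI[OF dual_atom_continuous[OF strongly_bounded_dual[OF T]]] by simp
        show "AE y in lborel. norm (stft f y * T (atom y)) \<le> norm (?D y)"
          unfolding real_norm_def by (intro AE_I2 order_trans[OF le abs_ge_self])
      qed
      have "cmod (\<integral>y. stft f y * T (atom y) \<partial>lborel) \<le> (\<integral>y. ?D y \<partial>lborel)"
        by (rule Bochner_Integration.integral_norm_bound_integral[OF int D le])
      also have "\<dots> = C' * C * A * I" by (simp add: I_def)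
      finally have "p T f \<le> C' * C * A * I / cmod ?c"
        unfolding p_def norm_divide by (rule divide_right_mono) simp
      then show ?thesis using int by (simp add: mult_ac)
    qed
    then show ?thesis using C(1) C'(1) I0 by (intro exI[of _ "C' * C * I / cmod ?c"]) auto
  qed
  have ps: "seminorm_on (level M) (p T)" if T: "T \<in> B" for T
  proof (rule seminorm_onI)
    have int: "integrable lborel (\<lambda>y. stft f y * T (atom y))" if "f \<in> level M" for f
      using that step T by (elim levelE) blast
    fix f g :: "real^'n \<Rightarrow> complex" and c assume f: "f \<in> level M"
    show "0 \<le> p T f" by (simp add: p_def)
    show "p T (fscale c f) = cmod c * p T f"
      unfolding p_def stft_fscale mult.assoc Bochner_Integration.integral_mult_right_zero
      by (simp add: norm_mult norm_divide)
    assume g: "g \<in> level M"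
    have "(\<integral>y. stft (f + g) y * T (atom y) \<partial>lborel) =
        (\<integral>y. stft f y * T (atom y) \<partial>lborel) + (\<integral>y. stft g y * T (atom y) \<partial>lborel)"
      unfolding stft_add[OF f[unfolded M_def] g[unfolded M_def]] distrib_right
      by (rule Bochner_Integration.integral_add[OF int[OF f] int[OF g]])
    then show "p T (f + g) \<le> p T f + p T g"
      unfolding p_def by (simp only: add_divide_distrib norm_triangle_ineq)
  qed
  have bdd: "bdd_above ((\<lambda>T. p T f) ` B)" if f: "f \<in> level M" for f
  proof -
    obtain n A where "smooth f" "bound M n A f" using f by (rule levelE)
    then have "\<exists>c. \<forall>T\<in>B. p T f \<le> c" using step[of n] by blast
    then show ?thesis unfolding bdd_above_def by blast
  qed
  define q where "q f = (SUP T\<in>B. p T f)" for f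
  have "q \<in> level_seminorms M"
  proof (rule level_seminormsI[OF M])
    show "seminorm_on (level M) q"
      unfolding q_def using False ps subspace_level bdd by (rule seminorm_on_SUP)
    show "\<exists>C\<ge>0. \<forall>f A. smooth f \<longrightarrow> bound M n A f \<longrightarrow> 0 < A \<longrightarrow> q f \<le> C * A" for n
      using step[of n] False unfolding q_def by (meson cSUP_least)
  qed
  moreover have "cmod (T f) \<le> q f" if T: "T \<in> B" and f: "f \<in> topspace (O_M \<omega>)" for T f
  proof -
    have "T f = (\<integral>y. stft f y * T (atom y) \<partial>lborel) / ?c"
      unfolding stft_reconstruction[OF strongly_bounded_dual[OF T] f] using stft_constant_nonzero[of "TYPE('n)"] by simp
    then have "cmod (T f) = p T f" by (simp add: p_def)
    also have "\<dots> \<le> q f"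
      unfolding q_def using f M T by (intro cSUP_upper bdd) (auto simp: topspace_O_M)
    finally show ?thesis .
  qed
  ultimately show ?thesis using M by (intro bexI[of _ q] UN_I[of M]) auto
qed

end

lemma multiplication_hypocontinuous:
  shows "bilinear_map (O_M \<omega> :: (real^'n \<Rightarrow> complex) topology) (O_M_dual \<omega>) (O_M_dual \<omega>) (multiplication \<omega>)"
    and "separately_continuous (O_M \<omega> :: (real^'n \<Rightarrow> complex) topology) (O_M_dual \<omega>) (O_M_dual \<omega>) (multiplication \<omega>)"
    and "hypocontinuous (O_M \<omega> :: (real^'n \<Rightarrow> complex) topology) (O_M_dual \<omega>) (O_M_dual \<omega>) (multiplication \<omega>)"
proof -
  let ?X = "O_M \<omega> :: (real^'n \<Rightarrow> complex) topology" and ?Q = "\<Union>m\<in>{1..}. level_seminorms m"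
  have equi: "\<exists>p\<in>?Q. \<forall>f\<in>topspace ?X. \<forall>g\<in>C. q (f * g) \<le> p f"
    if q: "q \<in> ?Q" and C: "bounded_in ?X C" for q C
  proof -
    obtain m where m: "m \<ge> 1" "q \<in> level_seminorms m" using q by auto
    obtain p where p: "p \<in> level_seminorms (doubling * m)" "\<forall>f\<in>level (doubling * m). \<forall>g\<in>C. q (f * g) \<le> p f"
      using mult_bounded_equicontinuous[OF m C] by blast
    have M: "doubling * m \<in> {1..}" using doubling_mult_ge[OF m(1)] by simp
    have "topspace ?X \<subseteq> level (doubling * m)" unfolding topspace_O_M using M by (rule INF_lower)
    then show ?thesis using p M by (intro bexI[of _ p] UN_I[of "doubling * m"]) auto
  qed
  have barrel: "\<exists>q\<in>?Q. \<forall>T\<in>B. \<forall>f\<in>topspace ?X. cmod (T f) \<le> q f" if "bounded_in (strong_dual ?X) B" for B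
    by (rule strongly_bounded_equicontinuous) (use that in \<open>simp add: O_M_dual_def\<close>)
  have b: "multiplication \<omega> = (\<lambda>f T g. if g \<in> topspace ?X then T (f * g) else 0)"
    by (simp add: fun_eq_iff multiplication_def)
  note hyps = seminorm_base_O_M(2) topspace_O_M_mult equi barrel
  show "bilinear_map ?X (O_M_dual \<omega>) (O_M_dual \<omega>) (multiplication \<omega>)"
    unfolding O_M_dual_def b by (rule bilinear_transpose[OF hyps])
  show "separately_continuous ?X (O_M_dual \<omega>) (O_M_dual \<omega>) (multiplication \<omega>)"
    unfolding O_M_dual_def b by (rule separately_continuous_transpose[OF hyps])
  show "hypocontinuous ?X (O_M_dual \<omega>) (O_M_dual \<omega>) (multiplication \<omega>)"
    unfolding O_M_dual_def b by (rule hypocontinuous_transpose[OF hyps])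
qed

end

theorem proposition4p5:
  fixes \<omega> :: "real \<Rightarrow> real"
  assumes "nonquasianalytic_weight \<omega>"
  shows "bilinear_map (O_M \<omega> :: (real^'n \<Rightarrow> complex) topology)
           (O_M_dual \<omega>) (O_M_dual \<omega>) (multiplication \<omega>) \<and>
         separately_continuous (O_M \<omega> :: (real^'n \<Rightarrow> complex) topology)
           (O_M_dual \<omega>) (O_M_dual \<omega>) (multiplication \<omega>) \<and>
         hypocontinuous (O_M \<omega> :: (real^'n \<Rightarrow> complex) topology)
           (O_M_dual \<omega>) (O_M_dual \<omega>) (multiplication \<omega>)"
proof -
  interpret weight_function \<omega> by (rule weight_function.intro[OF assms])
  show ?thesis using multiplication_hypocontinuous by blast
qed

end
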